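(* Let $n\in\mathbb{N}$, $0<\sigma_1^2<\sigma_2^2$, and assume Assumption (A) stated in the context. If $0\le \mathsf{R} \le \bar{\mathsf{R}}_n(\sigma_1^2,\sigma_2^2)$, then \[ C_s(\sigma_1^2, \sigma_2^2, \mathsf{R}, n)= \frac{1}{2} \int_{\sigma_1^2}^{\sigma_2^2} \frac{\mathsf{R}^2 -\mathsf{R}^2\,\mathbb{E} \left[ \mathsf{h}_{\frac{n}{2}}^2\left( \frac{\| \mathsf{R}\mathbf{e}_1+\sqrt{s}\mathbf{Z}\| \mathsf{R}}{s} \right) \right] }{s^2}\, \mathrm{d} s, \] where $\mathbf{Z}\sim\mathcal{N}(\mathbf{0}_n,\mathbf{I}_n)$ and $\mathbf{e}_1=(1,0,\dots,0)\in\mathbb{R}^n$.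
   Context: Vector Gaussian wiretap channel: $\mathbf{Y}_1=\mathbf{X}+\mathbf{N}_1$, $\mathbf{Y}_2=\mathbf{X}+\mathbf{N}_2$, with $\mathbf{X}\in\mathbb{R}^n$, $\mathbf{N}_1\sim\mathcal{N}(\mathbf{0}_n,\sigma_1^2\mathbf{I}_n)$, $\mathbf{N}_2\sim\mathcal{N}(\mathbf{0}_n,\sigma_2^2\mathbf{I}_n)$, mutually independent with $\mathbf{X}$. $C_s(\sigma_1^2,\sigma_2^2,\mathsf{R},n)=\max I(\mathbf{X};\mathbf{Y}_1)-I(\mathbf{X};\mathbf{Y}_2)$ over distributions of $\mathbf{X}$ supported in $\{\|\mathbf{x}\|\le\mathsf{R}\}$. $P_{\mathbf{X}_{\mathsf{R}}}$ is the uniform distribution on $\{\|\mathbf{x}\|=\mathsf{R}\}$, and $\bar{\mathsf{R}}_n(\sigma_1^2,\sigma_2^2)=\max\{\mathsf{R}: P_{\mathbf{X}_{\mathsf{R}}}\text{ attains }C_s(\sigma_1^2,\sigma_2^2,\mathsf{R},n)\}$ ($0$ if empty). $\mathsf{h}_v(x)=\mathsf{I}_v(x)/\mathsf{I}_{v-1}(x)$ with $\mathsf{I}_v$ the modified Bessel function of the first kind. Assumption (A): for all $\mathsf{R}\ge0$, $0\le\sigma_1\le\sigma_2$, $n\in\mathbb{N}$, the function $y\mapsto \frac{1}{\sigma_2^2}\mathbb{E}\left[\frac{\mathsf{R}}{\|y\mathbf{e}_1'+\mathbf{W}\|}\mathsf{h}_{\frac{n}{2}}\left(\frac{\mathsf{R}}{\sigma_2^2}\|y\mathbf{e}_1'+\mathbf{W}\|\right)-1\right]-\frac{1}{\sigma_1^2}\left(\frac{\mathsf{R}}{y}\mathsf{h}_{\frac{n}{2}}\left(\frac{\mathsf{R}}{\sigma_1^2}y\right)-1\right)$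 has at most one sign change on $y>0$, where $\mathbf{W}\sim\mathcal{N}(\mathbf{0}_{n+2},(\sigma_2^2-\sigma_1^2)\mathbf{I}_{n+2})$ and $\mathbf{e}_1'$ is the first unit vector of $\mathbb{R}^{n+2}$. *)

theory Defs
  imports "HOL-Probability.Probability"
begin

text \<open>Series definition I_v(x) = sum_k (x/2)^(2k+v) / (k! Gamma(k+v+1)),
  written with the reciprocal Gamma function (so the poles of Gamma give 0).\<close>
definition besselI :: "real \<Rightarrow> real \<Rightarrow> real" where
  "besselI v x = (\<Sum>k. (x / 2) powr (2 * real k + v) * rGamma (real k + v + 1) / fact k)"

definition hfun :: "real \<Rightarrow> real \<Rightarrow> real" where
  "hfun v x = besselI v x / besselI (v - 1) x"

abbreviation Rn :: "nat \<Rightarrow> (nat \<Rightarrow> real) measure" where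
  "Rn m \<equiv> PiM {..<m} (\<lambda>_. lborel)"

definition vnorm :: "nat \<Rightarrow> (nat \<Rightarrow> real) \<Rightarrow> real" where
  "vnorm m x = sqrt (\<Sum>i<m. (x i)\<^sup>2)"

definition vadd :: "nat \<Rightarrow> (nat \<Rightarrow> real) \<Rightarrow> (nat \<Rightarrow> real) \<Rightarrow> (nat \<Rightarrow> real)" where
  "vadd m x y = restrict (\<lambda>i. x i + y i) {..<m}"

definition vscale :: "nat \<Rightarrow> real \<Rightarrow> (nat \<Rightarrow> real) \<Rightarrow> (nat \<Rightarrow> real)" where
  "vscale m c x = restrict (\<lambda>i. c * x i) {..<m}"

definition ve1 :: "nat \<Rightarrow> real \<Rightarrow> (nat \<Rightarrow> real)" where
  "ve1 m y = restrict (\<lambda>i. if i = 0 then y else 0) {..<m}"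

definition std_gauss :: "nat \<Rightarrow> (nat \<Rightarrow> real) measure" where
  "std_gauss m = PiM {..<m} (\<lambda>_. density lborel std_normal_density)"

text \<open>Gaussian vector N(0, s I_m) (s \<ge> 0), the law of sqrt s * Z; for s = 0 it is the point mass at 0.\<close>
definition gauss :: "nat \<Rightarrow> real \<Rightarrow> (nat \<Rightarrow> real) measure" where
  "gauss m s = distr (std_gauss m) (Rn m) (vscale m (sqrt s))"

definition admissible :: "nat \<Rightarrow> real \<Rightarrow> (nat \<Rightarrow> real) measure \<Rightarrow> bool" where
  "admissible n R P \<longleftrightarrow> prob_space P \<and> sets P = sets (Rn n) \<and> (AE x in P. vnorm n x \<le> R)"

text \<open>I(X;Y) for Y = X + N, X ~ P, N ~ N(0, s I_n) independent of X (in nats).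
  The underlying probability space is P \<times> N(0,sI), with X = fst and Y = fst + snd.\<close>
definition MI :: "nat \<Rightarrow> (nat \<Rightarrow> real) measure \<Rightarrow> real \<Rightarrow> real" where
  "MI n P s = prob_space.mutual_information (P \<Otimes>\<^sub>M gauss n s) (exp 1) (Rn n) (Rn n)
      fst (\<lambda>(x, z). vadd n x z)"

definition secrecy_rate :: "nat \<Rightarrow> (nat \<Rightarrow> real) measure \<Rightarrow> real \<Rightarrow> real \<Rightarrow> real" where
  "secrecy_rate n P s1 s2 = MI n P s1 - MI n P s2"

text \<open>Secrecy capacity C_s(s1, s2, R, n), s_i = sigma_i^2 (the maximum, written as a supremum).\<close>
definition Cs :: "real \<Rightarrow> real \<Rightarrow> real \<Rightarrow> nat \<Rightarrow> real" where
  "Cs s1 s2 R n = (SUP P \<in> {P. admissible n R P}. secrecy_rate n P s1 s2)"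

text \<open>Uniform distribution on the sphere of radius R in R^n: normalized surface (cone) measure,
  i.e. the image of the uniform distribution on the unit ball under x \<mapsto> R x / ||x||.\<close>
definition unif_sphere :: "nat \<Rightarrow> real \<Rightarrow> (nat \<Rightarrow> real) measure" where
  "unif_sphere n R = distr (uniform_measure (Rn n) {x \<in> space (Rn n). vnorm n x \<le> 1}) (Rn n)
      (\<lambda>x. vscale n (R / vnorm n x) x)"

definition attains_Cs :: "real \<Rightarrow> real \<Rightarrow> real \<Rightarrow> nat \<Rightarrow> bool" where
  "attains_Cs s1 s2 R n \<longleftrightarrow> secrecy_rate n (unif_sphere n R) s1 s2 = Cs s1 s2 R n"

definition Rbar :: "nat \<Rightarrow> real \<Rightarrow> real \<Rightarrow> real" where
  "Rbar n s1 s2 = (if {R. 0 \<le> R \<and> attains_Cs s1 s2 R n} = {} then 0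
                   else (GREATEST R. 0 \<le> R \<and> attains_Cs s1 s2 R n))"

definition at_most_one_sign_change :: "(real \<Rightarrow> real) \<Rightarrow> bool" where
  "at_most_one_sign_change f \<longleftrightarrow>
     \<not> (\<exists>a b c. 0 < a \<and> a < b \<and> b < c \<and>
          ((f a > 0 \<and> f b < 0 \<and> f c > 0) \<or> (f a < 0 \<and> f b > 0 \<and> f c < 0)))"

text \<open>The function in Assumption (A), with variances t1 = sigma_1^2, t2 = sigma_2^2;
  W ~ N(0,(t2 - t1) I_(n+2)).\<close>
definition gA :: "nat \<Rightarrow> real \<Rightarrow> real \<Rightarrow> real \<Rightarrow> real \<Rightarrow> real" where
  "gA n R t1 t2 y =
     (1 / t2) * (\<integral>w. (R / vnorm (n+2) (vadd (n+2) (ve1 (n+2) y) w))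
                     * hfun (real n / 2) (R / t2 * vnorm (n+2) (vadd (n+2) (ve1 (n+2) y) w)) - 1
                  \<partial>gauss (n+2) (t2 - t1))
     - (1 / t1) * ((R / y) * hfun (real n / 2) (R / t1 * y) - 1)"

definition assumption_A :: bool where
  "assumption_A \<longleftrightarrow> (\<forall>R t1 t2 n. 0 \<le> R \<and> 0 < t1 \<and> t1 \<le> t2 \<and> 1 \<le> n \<longrightarrow>
                        at_most_one_sign_change (gA n R t1 t2))"

end

theory Submission
  imports Defs "HOL-Real_Asymp.Real_Asymp"
begin

text \<open>Write \<open>Q\<close> for the uniform distribution on the sphere of radius \<open>R\<close>. Comparing output laws with those of
  \<open>Q\<close>, the secrecy rate of \<open>P\<close> is \<open>E_P (\<Xi> |X|) - (KL_s1 - KL_s2)\<close>, where \<open>KL_s\<close> is the divergence between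
  the outputs of \<open>P\<close> and \<open>Q\<close> at noise variance \<open>s\<close>; by data processing the bracket is nonnegative, and it
  vanishes for \<open>Q\<close>. So \<open>Q\<close> is optimal once \<open>\<Xi> \<le> \<Xi> R\<close> on \<open>[0, R]\<close>, and then the capacity is \<open>\<Xi> R\<close>.
  The derivative of \<open>\<Xi>\<close> at \<open>r\<close> is \<open>r\<close> times the mean of the function of Assumption (A) under a noncentral chi
  law in dimension \<open>n + 2\<close>; as these laws have monotone likelihood ratio, \<open>\<Xi>\<close> can only decrease
  and then increase, so the condition reduces to \<open>\<Xi> 0 \<le> \<Xi> R\<close>. It is also necessary, as
  seen by moving a mass \<open>e\<close> of \<open>Q\<close> to the origin, which costs a divergence of order \<open>e\<^sup>2\<close> only.
  Differentiating in the noise variance turns \<open>\<Xi> R\<close> into the stated integral and \<open>\<Xi> 0\<close> into a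
  similar one; these show that the set of radii satisfying the condition is downward closed, and it is
  closed by continuity. Hence it contains every \<open>R\<close> up to its greatest element; were it unbounded,
  \<open>Rbar\<close> would be an unspecified number, but then every radius satisfies the condition.\<close>

text \<open>The kernel \<open>K n s r p\<close> obeys transport equations: in \<open>r\<close> its
  mass moves with velocity \<open>H n (r * p) / s\<close>, in \<open>s\<close> with velocity
  \<open>- (s * p + r * H n (r * p)) / (2 * s^2)\<close>. Both follow from the Riccati equation
  \<open>H_has_deriv\<close>. Integration by parts in \<open>p\<close> therefore turns the
  derivatives of \<open>T\<close> in the two parameters into means of bounded functions. They are
  used in integrated form, as increments of \<open>T\<close>, so pointwise differentiability of
  \<open>Xi\<close> never has to be established. The passage from dimension \<open>n\<close> to
  \<open>n + 2\<close> in Assumption (A) comes from \<open>K_times_H\<close>, where a factor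
  \<open>H n\<close> turns the \<open>n\<close>-dimensional kernel into the
  \<open>(n + 2)\<close>-dimensional one. Assumption (A) leaves the direction of the sign change
  open; it is fixed because the function is positive far out. Geometry enters through maps built
  from shears and sign changes: these suffice to rotate any vector to the first axis, so spherical
  means reduce to one coordinate, and their constants come from computing Gaussian moments in two
  ways.\<close>

declare add_2_eq_Suc [simp del] add_2_eq_Suc' [simp del]

section \<open>The normalised Bessel series: coefficients, recurrences, derivatives\<close>

text \<open>\<open>Phi n (|x|)\<close> is the mean of \<open>exp (x \<bullet> u)\<close> over the unit sphere of \<open>\<real>\<^sup>n\<close>, the normalisation of the
  Bessel function of index \<open>n / 2 - 1\<close> with value 1 at 0; \<open>H n\<close> is its logarithmic derivative, which is
  \<open>hfun (n / 2)\<close> on \<open>[0, \<infinity>)\<close>.\<close>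

definition bc :: "nat \<Rightarrow> nat \<Rightarrow> real" where
  "bc n k = 1 / (4 ^ k * fact k * pochhammer (real n / 2) k)"

definition Phi :: "nat \<Rightarrow> real \<Rightarrow> real" where
  "Phi n t = (\<Sum>k. bc n k * (t\<^sup>2) ^ k)"

definition H :: "nat \<Rightarrow> real \<Rightarrow> real" where
  "H n t = t / real n * Phi (n + 2) t / Phi n t"

lemma pochhammer_half_ge:
  assumes "a \<ge> 1/2"
  shows "pochhammer (a::real) k \<ge> (1/2) ^ k"
proof (induction k)
  case (Suc k)
  have "(1/2) ^ k * (1/2) \<le> pochhammer a k * (a + real k)"
    using Suc assms pochhammer_pos[of a k] by (intro mult_mono) auto
  then show ?case by (simp add: pochhammer_Suc)
qed simp

lemma pochhammer_half_pos: "n \<ge> 1 \<Longrightarrow> pochhammer (real n / 2) k > 0"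
  by (intro pochhammer_pos) auto

lemma bc_pos: "n \<ge> 1 \<Longrightarrow> bc n k > 0"
  using pochhammer_half_pos[of n k] by (auto simp: bc_def)

text \<open>Comparison with the exponential series of \<open>u / 2\<close>: every factor of the
  Pochhammer symbol is at least 1/2 because \<open>n / 2\<close> is. Convergence at every argument
  follows.\<close>

lemma bc_le: assumes "n \<ge> 1" shows "bc n k \<le> (1/2) ^ k / fact k"
proof -
  have "(4::real) ^ k * fact k * pochhammer (real n / 2) k \<ge> 4 ^ k * fact k * (1/2) ^ k"
    using pochhammer_half_ge[of "real n / 2" k] assms by (intro mult_left_mono) auto
  moreover have "(4::real) ^ k * fact k * (1/2) ^ k = 2 ^ k * fact k"
  proof -
    have "(4::real) ^ k * (1/2) ^ k = 2 ^ k" by (simp add: power_mult_distrib[symmetric])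
    then have "(4::real) ^ k * (1/2) ^ k * fact k = 2 ^ k * fact k" by (rule arg_cong)
    then show ?thesis by (metis mult.assoc mult.commute)
  qed
  ultimately have "(4::real) ^ k * fact k * pochhammer (real n / 2) k \<ge> 2 ^ k * fact k" by simp
  then have "1 / (4 ^ k * fact k * pochhammer (real n / 2) k) \<le> 1 / (2 ^ k * fact k :: real)"
    by (intro divide_left_mono mult_pos_pos pochhammer_half_pos assms) auto
  then show ?thesis by (simp add: bc_def power_divide)
qed

lemma summable_bc: assumes "n \<ge> 1" shows "summable (\<lambda>k. bc n k * u ^ k)"
proof (rule summable_comparison_test')
  show "summable (\<lambda>k. (\<bar>u\<bar> / 2) ^ k / fact k)"
    using summable_exp[of "\<bar>u\<bar>/2"] by (simp add: field_simps)
  show "norm (bc n k * u ^ k) \<le> (\<bar>u\<bar> / 2) ^ k / fact k" for k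
    using mult_right_mono[OF bc_le[OF assms, of k], of "\<bar>u\<bar> ^ k"] bc_pos[OF assms, of k]
    by (simp add: abs_mult power_abs power_divide)
qed

text \<open>Termwise differentiation in \<open>t^2\<close> shifts the Pochhammer base from
  \<open>n / 2\<close> to \<open>n / 2 + 1\<close>, that is, the dimension from \<open>n\<close> to
  \<open>n + 2\<close>. This is the content of \<open>Phi_has_deriv\<close>.\<close>

lemma bc_Suc:
  assumes "n \<ge> 1"
  shows "real (Suc k) * bc n (Suc k) = bc (n + 2) k / (2 * real n)"
proof -
  define q where "q = pochhammer (real n / 2 + 1) k"
  have q: "pochhammer (real n / 2) (Suc k) = real n / 2 * q" "pochhammer (real (n + 2) / 2) k = q"
    by (simp_all add: pochhammer_rec q_def add_divide_distrib)
  have "q > 0" unfolding q_def by (intro pochhammer_pos) simp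
  have f: "fact (Suc k) = real (Suc k) * fact k" by simp
  have "real (Suc k) * bc n (Suc k) = real (Suc k) / (real (Suc k) * (4 * 4 ^ k * fact k * (real n / 2 * q)))"
    unfolding bc_def q f power_Suc by (simp only: ac_simps times_divide_eq_right mult_1_right)
  also have "\<dots> = 1 / (4 * 4 ^ k * fact k * (real n / 2 * q))" by (rule nonzero_divide_mult_cancel_left) simp
  also have "\<dots> = bc (n + 2) k / (2 * real n)"
    unfolding bc_def q by (simp add: ac_simps)
  finally show ?thesis .
qed

text \<open>Coefficient form of the Bessel recurrence
  \<open>I_(v-1)(x) - I_(v+1)(x) = (2 v / x) I_v(x)\<close> at \<open>v = n / 2\<close>. It closes
  the system: the second derivative of \<open>Phi n\<close> involves \<open>Phi (n + 4)\<close>,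
  which the recurrence eliminates.\<close>

lemma bc_recurrence:
  assumes "n \<ge> 1"
  shows "bc n (Suc k) = bc (n + 2) (Suc k) + bc (n + 4) k / (real n * (real n + 2))"
proof -
  define a where "a = real n / 2"
  have a: "a > 0" "real n = 2 * a" using assms by (auto simp: a_def)
  have p: "pochhammer (a + 2) k > 0" using a by (intro pochhammer_pos) auto
  have 1: "pochhammer a (Suc k) = a * (a + 1) * pochhammer (a + 2) k / (a + 1 + k)"
  proof -
    have "pochhammer a (Suc (Suc k)) = a * (a + 1) * pochhammer (a + 2) k"
      by (simp add: pochhammer_rec add.assoc)
    then show ?thesis using a by (simp add: pochhammer_Suc field_simps)
  qed
  have 2: "pochhammer (a + 1) (Suc k) = (a + 1) * pochhammer (a + 2) k"
    by (simp add: pochhammer_rec add.assoc)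
  have h: "real (n + 2) / 2 = a + 1" "real (n + 4) / 2 = a + 2" using a by auto
  have 3: "bc n (Suc k) = (a + 1 + k) / (4 ^ Suc k * fact (Suc k) * (a * (a + 1) * pochhammer (a + 2) k))"
    unfolding bc_def a_def[symmetric] 1 by simp
  have 4: "bc (n + 2) (Suc k) = 1 / (4 ^ Suc k * fact (Suc k) * ((a + 1) * pochhammer (a + 2) k))"
    unfolding bc_def h 2 by simp
  have 5: "bc (n + 4) k = 1 / (4 ^ k * fact k * pochhammer (a + 2) k)"
    unfolding bc_def h by simp
  \<comment> \<open>With \<open>x = n / 2\<close> and \<open>j = k + 1\<close> this is
    \<open>(x + j) / (j x (x + 1)) = 1 / (j (x + 1)) + 1 / (x (x + 1))\<close>, up to the common
    factor \<open>1 / (4 F)\<close>.\<close>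
  have key: "(x + j) / (4 * F * j * (x * (x + 1))) = 1 / (4 * F * j * (x + 1)) + 1 / F / (4 * x * (x + 1))"
    if "F > 0" "j > 0" "x > 0" for F j x :: real
  proof -
    have "1 / (4 * F * j * (x + 1)) = x / (4 * F * j * (x * (x + 1)))" using that by simp
    moreover have "1 / F / (4 * x * (x + 1)) = j / (4 * F * j * (x * (x + 1)))" using that by simp
    ultimately show ?thesis by (simp only: add_divide_distrib)
  qed
  define F where "F = 4 ^ k * fact k * pochhammer (a + 2) k"
  have F: "F > 0" using p by (simp add: F_def)
  have "bc n (Suc k) = (a + real (Suc k)) / (4 * F * real (Suc k) * (a * (a + 1)))"
    unfolding 3 F_def by (simp add: ac_simps)
  moreover have "bc (n + 2) (Suc k) = 1 / (4 * F * real (Suc k) * (a + 1))"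
    unfolding 4 F_def by (simp add: ac_simps)
  moreover have "bc (n + 4) k / (real n * (real n + 2)) = 1 / F / (4 * a * (a + 1))"
    unfolding 5 F_def a(2) by (simp add: algebra_simps)
  ultimately show ?thesis using key[OF F _ a(1), of "real (Suc k)"] by simp
qed

lemma Phi_0 [simp]: "Phi n 0 = 1"
proof -
  have "Phi n 0 = (\<Sum>k. bc n k * 0 ^ k)" by (simp add: Phi_def)
  then show ?thesis by (simp only: powser_zero) (simp add: bc_def)
qed

lemma Phi_ge_1: assumes "n \<ge> 1" shows "Phi n t \<ge> 1"
proof -
  have "(\<Sum>k<1. bc n k * (t\<^sup>2) ^ k) \<le> Phi n t"
    unfolding Phi_def
    by (intro sum_le_suminf summable_bc assms ballI mult_nonneg_nonneg less_imp_le[OF bc_pos]) auto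
  then show ?thesis by (simp add: bc_def)
qed

lemma Phi_pos: "n \<ge> 1 \<Longrightarrow> Phi n t > 0"
  using Phi_ge_1[of n t] by simp

lemma Phi_has_deriv:
  assumes "n \<ge> 1"
  shows "(Phi n has_real_derivative t / real n * Phi (n + 2) t) (at t)"
proof -
  have 1: "((\<lambda>x. \<Sum>k. bc n k * x ^ k) has_real_derivative (\<Sum>k. diffs (bc n) k * (t\<^sup>2) ^ k)) (at (t\<^sup>2))"
    by (intro termdiffs_strong_converges_everywhere summable_bc assms)
  have d: "diffs (bc n) k = bc (n + 2) k / (2 * real n)" for k
    unfolding diffs_def using bc_Suc[OF assms, of k] by simp
  have 2: "(\<Sum>k. diffs (bc n) k * (t\<^sup>2) ^ k) = Phi (n + 2) t / (2 * real n)"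
    unfolding d Phi_def using suminf_divide[OF summable_bc[of "n + 2" "t\<^sup>2"], of "2 * real n"]
    by simp
  show ?thesis unfolding Phi_def[of n, abs_def]
    by (rule DERIV_cong[OF DERIV_chain2[where f = "\<lambda>x. \<Sum>k. bc n k * x ^ k" and g = "\<lambda>t. t\<^sup>2", OF 1[unfolded 2]]])
       (auto intro!: derivative_eq_intros simp: Phi_def)
qed

lemma Phi_recurrence:
  assumes "n \<ge> 1"
  shows "Phi n t = Phi (n + 2) t + t\<^sup>2 / (real n * (real n + 2)) * Phi (n + 4) t"
proof -
  let ?c = "1 / (real n * (real n + 2))"
  have s: "summable (\<lambda>k. bc m k * (t\<^sup>2) ^ k)" if "m \<ge> 1" for m using summable_bc[OF that] .
  have "Phi n t = (\<Sum>k. bc n (Suc k) * (t\<^sup>2) ^ Suc k) + 1"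
    unfolding Phi_def using suminf_split_head[OF s[OF assms]] by (simp add: bc_def)
  also have "(\<Sum>k. bc n (Suc k) * (t\<^sup>2) ^ Suc k)
     = (\<Sum>k. bc (n + 2) (Suc k) * (t\<^sup>2) ^ Suc k + (t\<^sup>2 * ?c) * (bc (n + 4) k * (t\<^sup>2) ^ k))"
    by (intro suminf_cong) (simp add: bc_recurrence[OF assms] algebra_simps)
  also have "\<dots> = (\<Sum>k. bc (n + 2) (Suc k) * (t\<^sup>2) ^ Suc k) + (\<Sum>k. (t\<^sup>2 * ?c) * (bc (n + 4) k * (t\<^sup>2) ^ k))"
    using s[of "n + 2"] s[of "n + 4"]
    by (intro suminf_add[symmetric] summable_mult)
       (simp_all add: summable_Suc_iff[where f = "\<lambda>k. bc (n + 2) k * (t\<^sup>2) ^ k"] del: power_Suc)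
  also have "(\<Sum>k. (t\<^sup>2 * ?c) * (bc (n + 4) k * (t\<^sup>2) ^ k)) = (t\<^sup>2 * ?c) * Phi (n + 4) t"
    unfolding Phi_def by (intro suminf_mult s) auto
  also have "(\<Sum>k. bc (n + 2) (Suc k) * (t\<^sup>2) ^ Suc k) + (t\<^sup>2 * ?c) * Phi (n + 4) t + 1
     = Phi (n + 2) t + t\<^sup>2 * ?c * Phi (n + 4) t"
    unfolding Phi_def[of "n + 2"] using suminf_split_head[OF s[of "n + 2"]] by (simp add: bc_def)
  finally show ?thesis by simp
qed

lemma Phi_add2_le: "n \<ge> 1 \<Longrightarrow> Phi (n + 2) t \<le> Phi n t"
  using Phi_recurrence[of n t] Phi_pos[of "n + 4" t] by simp

lemma isCont_Phi: "n \<ge> 1 \<Longrightarrow> isCont (Phi n) t"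
  using Phi_has_deriv by (rule DERIV_isCont)

lemma continuous_on_Phi [continuous_intros]:
  "n \<ge> 1 \<Longrightarrow> continuous_on S f \<Longrightarrow> continuous_on S (\<lambda>x. Phi n (f x))"
  by (rule continuous_on_compose2[of UNIV "Phi n"])
     (auto intro!: continuous_at_imp_continuous_on isCont_Phi)

lemma borel_measurable_Phi [measurable]: "Phi n \<in> borel_measurable borel"
  unfolding Phi_def[abs_def] by measurable

section \<open>The logarithmic derivative: Riccati equation, monotonicity, bounds\<close>

lemma borel_measurable_H [measurable]: "H n \<in> borel_measurable borel"
  unfolding H_def[abs_def] by measurable

lemma H_0 [simp]: "H n 0 = 0" by (simp add: H_def)

lemma H_nonneg: "n \<ge> 1 \<Longrightarrow> t \<ge> 0 \<Longrightarrow> H n t \<ge> 0"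
  unfolding H_def by (intro divide_nonneg_nonneg mult_nonneg_nonneg less_imp_le[OF Phi_pos]) auto

lemma H_le_div: assumes "n \<ge> 1" "t \<ge> 0" shows "H n t \<le> t / real n"
proof -
  have "Phi (n + 2) t / Phi n t \<le> 1"
    using Phi_add2_le[OF assms(1)] Phi_pos[OF assms(1)] by simp
  from mult_left_mono[OF this, of "t / real n"] assms(2) show ?thesis by (simp add: H_def)
qed

lemma isCont_H: "n \<ge> 1 \<Longrightarrow> isCont (H n) t"
  unfolding H_def[abs_def]
  by (intro continuous_intros isCont_Phi) (use Phi_pos[of n] in \<open>auto simp: less_imp_neq[symmetric]\<close>)

lemma ln_Phi_has_deriv:
  assumes "n \<ge> 1"
  shows "((\<lambda>t. ln (Phi n t)) has_real_derivative H n t) (at t)"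
  using DERIV_chain2[OF DERIV_ln[OF Phi_pos[OF assms, of t]] Phi_has_deriv[OF assms]]
  by (simp add: H_def divide_inverse mult.commute)

text \<open>Riccati equation of a Bessel quotient: the recurrence rewrites
  \<open>Phi (n + 4)\<close> in terms of \<open>Phi n\<close> and \<open>Phi (n + 2)\<close>, hence
  of \<open>H n\<close>. At \<open>t = 0\<close> division by 0 would make the formula give 1 instead
  of the true slope \<open>1 / n\<close>.\<close>

lemma H_has_deriv:
  assumes "n \<ge> 1" "t \<noteq> 0"
  shows "(H n has_real_derivative 1 - (H n t)\<^sup>2 - (real n - 1) / t * H n t) (at t)"
proof -
  have p: "Phi n t > 0" by (rule Phi_pos[OF assms(1)])
  have r: "t\<^sup>2 * Phi (n + 4) t = (Phi n t - Phi (n + 2) t) * (real n * (real n + 2))"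
  proof -
    have "Phi n t - Phi (n + 2) t = t\<^sup>2 / (real n * (real n + 2)) * Phi (n + 4) t"
      using Phi_recurrence[OF assms(1), of t] by linarith
    moreover have "real n * (real n + 2) \<noteq> 0" using assms(1) by simp
    ultimately show ?thesis by (metis nonzero_mult_div_cancel_right times_divide_eq_left times_divide_eq_right mult.commute)
  qed
  have Phi2: "(Phi (n + 2) has_real_derivative t / real (n + 2) * Phi (n + 4) t) (at t)"
    using Phi_has_deriv[of "n + 2" t] by (simp add: add.assoc)
  have "(H n has_real_derivative
     ((1 / real n * Phi (n + 2) t + t / real n * (t / real (n + 2) * Phi (n + 4) t)) * Phi n t
       - t / real n * Phi (n + 2) t * (t / real n * Phi (n + 2) t)) / (Phi n t * Phi n t)) (at t)"
    unfolding H_def[abs_def]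
    using DERIV_divide[OF DERIV_mult[OF DERIV_cdivide[OF DERIV_ident, of "real n"] Phi2] Phi_has_deriv[OF assms(1)]] p
    by (simp add: ac_simps)
  also have "t / real n * (t / real (n + 2) * Phi (n + 4) t) = Phi n t - Phi (n + 2) t"
  proof -
    have "t / real n * (t / real (n + 2) * Phi (n + 4) t) = t\<^sup>2 * Phi (n + 4) t / (real n * (real n + 2))"
      by (simp add: power2_eq_square)
    moreover have "real n * (real n + 2) \<noteq> 0" using assms(1) by simp
    ultimately show ?thesis unfolding r by (metis nonzero_mult_div_cancel_right)
  qed
  also have "((1 / real n * Phi (n + 2) t + (Phi n t - Phi (n + 2) t)) * Phi n t
       - t / real n * Phi (n + 2) t * (t / real n * Phi (n + 2) t)) / (Phi n t * Phi n t)
     = 1 - (H n t)\<^sup>2 - (real n - 1) / t * H n t"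
  proof -
    define q where "q = Phi (n + 2) t / Phi n t"
    define h where "h = t / real n * q"
    have h: "H n t = h" by (simp add: H_def h_def q_def)
    have *: "((1 / N * Q + (P - Q)) * P - t / N * Q * (t / N * Q)) / (P * P)
      = 1 / N * (Q / P) + 1 - Q / P - (t / N * (Q / P))\<^sup>2" if "P \<noteq> 0" for N P Q :: real
      using that by (simp add: power2_eq_square add_divide_distrib diff_divide_distrib algebra_simps)
    have "(real n - 1) / t * h = q - 1 / real n * q"
      using assms by (simp add: h_def diff_divide_distrib left_diff_distrib)
    then show ?thesis unfolding h using *[of "Phi n t" "real n" "Phi (n + 2) t"] p
      by (simp add: q_def[symmetric]) (simp add: h_def)
  qed
  finally show ?thesis .
qed


text \<open>An integrating factor: multiplying the Riccati right-hand side \<open>N\<close> by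
  \<open>x ^ (n - 1) * (Phi n x)^2\<close> gives a function \<open>E\<close> whose derivative is a
  nonnegative multiple of \<open>H n x * (Phi n x)^2\<close>. As \<open>E\<close> starts at a
  nonnegative value, \<open>N\<close> cannot become negative.\<close>

lemma H_deriv_nonneg:
  assumes n: "n \<ge> 1" and t: "t > 0"
  shows "1 - (H n t)\<^sup>2 - (real n - 1) / t * H n t \<ge> 0"
proof -
  define N where "N = (\<lambda>x. 1 - (H n x)\<^sup>2 - (real n - 1) / x * H n x)"
  define g where "g = (\<lambda>x. Phi (n + 2) x / real n)"
  \<comment> \<open>Written with \<open>g = H * Phi / x\<close> instead of \<open>N\<close>, so that
    there is no pole and \<open>E\<close> is continuous up to 0.\<close>
  define E where "E = (\<lambda>x. x ^ (n - 1) * ((Phi n x)\<^sup>2 - (real n - 1) * g x * Phi n x - (x * g x)\<^sup>2))"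
  have Hg: "H n x * Phi n x = x * g x" for x
    using Phi_pos[OF n, of x] by (simp add: H_def g_def)
  have E: "E x = x ^ (n - 1) * (Phi n x)\<^sup>2 * N x" if "x > 0" for x
  proof -
    have "(Phi n x)\<^sup>2 * N x = (Phi n x)\<^sup>2 - (H n x * Phi n x)\<^sup>2 - (real n - 1) * (H n x * Phi n x) / x * Phi n x"
      by (simp add: N_def power2_eq_square algebra_simps)
    also have "\<dots> = (Phi n x)\<^sup>2 - (real n - 1) * g x * Phi n x - (x * g x)\<^sup>2"
      using that by (simp add: Hg)
    finally show ?thesis by (simp add: E_def)
  qed
  have cE: "continuous_on {0..t} E"
    unfolding E_def g_def by (intro continuous_intros) (use n in auto)
  have dH: "(H n has_real_derivative N x) (at x)" if "x > 0" for x
    unfolding N_def using H_has_deriv[OF n, of x] that by simp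
  have dPhi: "(Phi n has_real_derivative H n x * Phi n x) (at x)" for x
    using Phi_has_deriv[OF n, of x] Phi_pos[OF n, of x] by (simp add: H_def)
  have dE: "(E has_real_derivative (real n - 1) * x ^ (n - 1) / x\<^sup>2 * (H n x * (Phi n x)\<^sup>2)) (at x)"
    if x: "x > 0" for x
  proof -
    have pw: "((\<lambda>x. x ^ (n - 1)) has_real_derivative (real n - 1) * x ^ (n - 1) / x) (at x)"
    proof -
      have "((\<lambda>x. x ^ (n - 1)) has_real_derivative real (n - 1) * x ^ (n - 1 - 1)) (at x)"
        by (auto intro!: derivative_eq_intros)
      moreover have "real (n - 1) * x ^ (n - 1 - 1) = (real n - 1) * x ^ (n - 1) / x"
        using x n by (cases "n - 1") auto
      ultimately show ?thesis by simp
    qed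
    \<comment> \<open>Opaque names keep the truncated subtraction \<open>n - 1\<close> out of the
      algebra that follows.\<close>
    define q where "q = (\<lambda>x::real. x ^ (n - 1))"
    define k where "k = real n - 1"
    have pwq: "(q has_real_derivative k * q x / x) (at x)"
      using pw by (simp add: q_def k_def)
    have "((\<lambda>x. q x * ((Phi n x)\<^sup>2 * (1 - (H n x)\<^sup>2 - k * H n x / x))) has_real_derivative
       k * q x / x * ((Phi n x)\<^sup>2 * (1 - (H n x)\<^sup>2 - k * H n x / x))
       + (2 * Phi n x * (H n x * Phi n x) * (1 - (H n x)\<^sup>2 - k * H n x / x)
        + (- (2 * H n x * N x) - (k * N x * x - k * H n x) / (x * x)) * (Phi n x)\<^sup>2) * q x) (at x)"
      using x dPhi[of x] dH[OF x] pwq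
      by (auto intro!: derivative_eq_intros simp: ac_simps)
    also have "k * q x / x * ((Phi n x)\<^sup>2 * (1 - (H n x)\<^sup>2 - k * H n x / x))
       + (2 * Phi n x * (H n x * Phi n x) * (1 - (H n x)\<^sup>2 - k * H n x / x)
        + (- (2 * H n x * N x) - (k * N x * x - k * H n x) / (x * x)) * (Phi n x)\<^sup>2) * q x
      = k * q x / x\<^sup>2 * (H n x * (Phi n x)\<^sup>2)"
    proof -
      have N: "1 - (H n x)\<^sup>2 - k * H n x / x = N x" by (simp add: N_def k_def)
      have *: "(k * N x * x - k * H n x) / (x * x) = k * N x / x - k * H n x / x\<^sup>2"
        using x by (simp add: diff_divide_distrib power2_eq_square)
      show ?thesis unfolding N unfolding * unfolding divide_inverse by algebra
    qed
    finally show ?thesis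
      by (rule DERIV_cong_ev[THEN iffD1, rotated -1])
         (auto intro!: eventually_mono[OF eventually_nhds_in_open[of "{0<..}"]] simp: E N_def q_def k_def x)
  qed
  have "E 0 \<le> E t"
  proof (rule DERIV_nonneg_imp_increasing_open[OF less_imp_le[OF t] _ cE])
    fix x assume x: "0 < x" "x < t"
    show "\<exists>y. (E has_real_derivative y) (at x) \<and> 0 \<le> y"
      using dE[OF x(1)] H_nonneg[OF n, of x] x n
      by (intro exI[of _ "(real n - 1) * x ^ (n - 1) / x\<^sup>2 * (H n x * (Phi n x)\<^sup>2)"]) auto
  qed
  \<comment> \<open>For \<open>n = 1\<close> the power is \<open>0 ^ 0 = 1\<close> and
    \<open>E 0 = 1\<close>; for larger \<open>n\<close> it makes \<open>E 0 = 0\<close>.\<close>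
  moreover have "E 0 \<ge> 0"
    using n by (cases "n = 1") (auto simp: E_def g_def)
  ultimately have "0 \<le> t ^ (n - 1) * (Phi n t)\<^sup>2 * N t" using E[OF t] by simp
  moreover have "t ^ (n - 1) * (Phi n t)\<^sup>2 > 0" using t Phi_pos[OF n, of t] by simp
  ultimately show ?thesis unfolding N_def by (simp add: zero_le_mult_iff)
qed

lemma H_mono:
  assumes n: "n \<ge> 1" and "0 \<le> s" "s \<le> t"
  shows "H n s \<le> H n t"
proof (rule DERIV_nonneg_imp_increasing_open[OF assms(3)])
  show "continuous_on {s..t} (H n)"
    by (intro continuous_at_imp_continuous_on ballI isCont_H n)
  fix x :: real assume x: "s < x" "x < t"
  then have "x > 0" using assms by simp
  then show "\<exists>y. (H n has_real_derivative y) (at x) \<and> 0 \<le> y"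
    using H_has_deriv[OF n, of x] H_deriv_nonneg[OF n, of x] by auto
qed

text \<open>In the Riccati right-hand side the term \<open>(n - 1) / t * H n t\<close> is subtracted
  and nonnegative, so nonnegativity of the whole already forces \<open>(H n t)^2\<close> to be at
  most 1.\<close>

lemma H_le_1: assumes n: "n \<ge> 1" and t: "t \<ge> 0" shows "H n t \<le> 1"
proof (cases "t = 0")
  case False
  with t have t: "t > 0" by simp
  have "(real n - 1) / t * H n t \<ge> 0"
    using H_nonneg[OF n, of t] n t by simp
  with H_deriv_nonneg[OF n t] have "(H n t)\<^sup>2 \<le> 1" by simp
  then show ?thesis using power2_le_imp_le[of "H n t" 1] by simp
qed simp

lemma ln_Phi_nonneg: "n \<ge> 1 \<Longrightarrow> 0 \<le> ln (Phi n t)"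
  using Phi_ge_1[of n t] by simp

lemma ln_Phi_le:
  assumes n: "n \<ge> 1" and t: "t \<ge> 0" shows "ln (Phi n t) \<le> t"
proof -
  have "0 - ln (Phi n 0) \<le> t - ln (Phi n t)"
  proof (rule DERIV_nonneg_imp_nondecreasing[OF t])
    fix x :: real assume x: "0 \<le> x"
    show "\<exists>y. ((\<lambda>x. x - ln (Phi n x)) has_real_derivative y) (at x) \<and> 0 \<le> y"
      using H_le_1[OF n x] ln_Phi_has_deriv[OF n, of x]
      by (intro exI[of _ "1 - H n x"]) (auto intro!: derivative_intros)
  qed
  then show ?thesis by simp
qed

lemma Phi_le_exp: "n \<ge> 1 \<Longrightarrow> t \<ge> 0 \<Longrightarrow> Phi n t \<le> exp t"
  using ln_Phi_le[of n t] Phi_pos[of n t] by (metis exp_le_cancel_iff exp_ln)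

text \<open>The logarithm of the ratio has \<open>p\<close>-derivative
  \<open>r' * H n (r' * p) - r * H n (r * p)\<close>, which is nonnegative because
  \<open>H n\<close> is monotone. This is the source of the monotone likelihood ratio of the laws
  \<open>kap n s r\<close>.\<close>

lemma Phi_ratio_mono:
  assumes n: "n \<ge> 1" and r: "0 \<le> r" "r \<le> r'" and p: "0 \<le> p" "p \<le> p'"
  shows "Phi n (r' * p) / Phi n (r * p) \<le> Phi n (r' * p') / Phi n (r * p')"
proof -
  have "ln (Phi n (r' * p)) - ln (Phi n (r * p)) \<le> ln (Phi n (r' * p')) - ln (Phi n (r * p'))"
  proof (rule DERIV_nonneg_imp_nondecreasing[OF p(2)])
    fix x :: real assume x: "p \<le> x"
    have "r * H n (r * x) \<le> r' * H n (r' * x)"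
      using x p r by (intro mult_mono H_mono[OF n] mult_right_mono H_nonneg[OF n]) auto
    then show "\<exists>y. ((\<lambda>x. ln (Phi n (r' * x)) - ln (Phi n (r * x))) has_real_derivative y) (at x) \<and> 0 \<le> y"
      using DERIV_diff[OF DERIV_chain2[OF ln_Phi_has_deriv[OF n] DERIV_cmult[OF DERIV_ident, of r']]
                          DERIV_chain2[OF ln_Phi_has_deriv[OF n] DERIV_cmult[OF DERIV_ident, of r]], of x]
      by (intro exI[of _ "r' * H n (r' * x) - r * H n (r * x)"]) (simp add: mult.commute)
  qed
  then have "ln (Phi n (r' * p) / Phi n (r * p)) \<le> ln (Phi n (r' * p') / Phi n (r * p'))"
    by (simp add: ln_divide_pos Phi_pos[OF n])
  then show ?thesis using Phi_pos[OF n] by simp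
qed

section \<open>Identification with the modified Bessel functions\<close>

lemma rGamma_add_nat:
  assumes "x > 0" shows "rGamma (real k + x) = rGamma x / pochhammer x k"
  using pochhammer_rGamma[of x k] assms pochhammer_pos[OF assms, of k]
  by (simp add: add.commute)

lemma besselI_eq_Phi:
  assumes x: "x > 0" and m: "m \<ge> 1"
  shows "besselI (real m / 2 - 1) x = (x / 2) powr (real m / 2 - 1) * rGamma (real m / 2) * Phi m x"
    (is "_ = ?c * _")
proof -
  have "(x / 2) powr (2 * real k + (real m / 2 - 1)) * rGamma (real k + (real m / 2 - 1) + 1) / fact k
      = ?c * (bc m k * (x\<^sup>2) ^ k)" for k
  proof -
    have "(x / 2) powr (2 * real k) = (x / 2) ^ (2 * k)"
      using x by (simp add: powr_realpow[symmetric])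
    also have "\<dots> = (x\<^sup>2) ^ k / 4 ^ k"
      by (simp add: power_mult power_divide)
    finally have "(x / 2) powr (2 * real k + (real m / 2 - 1)) = (x\<^sup>2) ^ k / 4 ^ k * (x / 2) powr (real m / 2 - 1)"
      by (simp add: powr_add)
    moreover have "rGamma (real k + (real m / 2 - 1) + 1) = rGamma (real m / 2) / pochhammer (real m / 2) k"
      using rGamma_add_nat[of "real m / 2" k] m by simp
    ultimately show ?thesis by (simp add: bc_def ac_simps)
  qed
  then have "besselI (real m / 2 - 1) x = (\<Sum>k. ?c * (bc m k * (x\<^sup>2) ^ k))"
    by (simp add: besselI_def)
  then show ?thesis using suminf_mult[OF summable_bc[OF m]] by (simp add: Phi_def)
qed

lemma hfun_eq_H:
  assumes n: "n \<ge> 1" and t: "t \<ge> 0"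
  shows "hfun (real n / 2) t = H n t"
proof (cases "t = 0")
  \<comment> \<open>Since \<open>0 powr v = 0\<close>, both series vanish and \<open>hfun\<close> is
    \<open>0 / 0 = 0\<close>, in agreement with \<open>H n 0\<close>.\<close>
  case True
  then show ?thesis by (simp add: hfun_def besselI_def)
next
  case False
  with t have t: "t > 0" by simp
  have 1: "besselI (real n / 2) t = (t / 2) powr (real n / 2) * rGamma (real n / 2 + 1) * Phi (n + 2) t"
    using besselI_eq_Phi[OF t, of "n + 2"] by (simp add: add_divide_distrib)
  have 2: "(t / 2) powr (real n / 2) = (t / 2) powr (real n / 2 - 1) * (t / 2)"
    using t powr_add[of "t / 2" "real n / 2 - 1" 1] by simp
  have 3: "rGamma (real n / 2 + 1) = rGamma (real n / 2) / (real n / 2)"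
    using rGamma_add_nat[of "real n / 2" 1] n by (simp add: add.commute)
  have 4: "rGamma (real n / 2) \<noteq> 0"
    using n Gamma_real_pos[of "real n / 2"] by (simp add: Gamma_def)
  show ?thesis unfolding hfun_def 1 besselI_eq_Phi[OF t n] 2 3 H_def using t 4 n Phi_pos[OF n, of t]
    by simp
qed

section \<open>Euclidean structure of the product space \<open>Rn n\<close>\<close>

interpretation lebesgue_pm: product_sigma_finite "\<lambda>_::nat. lborel :: real measure"
  by standard

lemma sigma_finite_Rn [simp, intro]: "sigma_finite_measure (Rn n)"
  by (rule lebesgue_pm.sigma_finite) simp

definition vdot :: "nat \<Rightarrow> (nat \<Rightarrow> real) \<Rightarrow> (nat \<Rightarrow> real) \<Rightarrow> real" where
  "vdot n x y = (\<Sum>i<n. x i * y i)"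

lemma space_Rn: "space (Rn n) = extensional {..<n}"
  by (simp add: space_PiM PiE_def)

lemma measurable_coord: "i < n \<Longrightarrow> (\<lambda>x. x i) \<in> borel_measurable (Rn n)"
  using measurable_component_singleton[of i "{..<n}" "\<lambda>_. lborel"] by simp

lemma measurable_coord_comp:
  "f \<in> measurable M (Rn n) \<Longrightarrow> i < n \<Longrightarrow> (\<lambda>x. f x i) \<in> borel_measurable M"
  by (rule measurable_compose[OF _ measurable_coord])

lemma measurable_RnI:
  assumes "\<And>i. i < n \<Longrightarrow> (\<lambda>x. f x i) \<in> borel_measurable M"
    and "\<And>x. x \<in> space M \<Longrightarrow> f x \<in> extensional {..<n}"
  shows "f \<in> measurable M (Rn n)"
  using assms by (intro measurable_PiM_single') (auto simp: PiE_def)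

lemma measurable_vdot:
  "f \<in> measurable M (Rn n) \<Longrightarrow> g \<in> measurable M (Rn n) \<Longrightarrow> (\<lambda>x. vdot n (f x) (g x)) \<in> borel_measurable M"
  unfolding vdot_def by (intro borel_measurable_sum borel_measurable_times measurable_coord_comp) auto

lemma vnorm_eq_vdot: "vnorm n x = sqrt (vdot n x x)"
  by (simp add: vnorm_def vdot_def power2_eq_square)

lemma measurable_vnorm':
  "f \<in> measurable M (Rn n) \<Longrightarrow> (\<lambda>x. vnorm n (f x)) \<in> borel_measurable M"
  unfolding vnorm_eq_vdot by (rule measurable_compose[OF measurable_vdot borel_measurable_sqrt])

lemma measurable_vnorm [measurable]: "vnorm n \<in> borel_measurable (Rn n)"
  by (rule measurable_vnorm'[OF measurable_ident_sets[OF refl]])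

lemma measurable_vdot2 [measurable]: "x \<in> space (Rn n) \<Longrightarrow> vdot n x \<in> borel_measurable (Rn n)"
  by (rule measurable_vdot[OF measurable_const measurable_ident_sets[OF refl]])

lemma vdot_commute: "vdot n x y = vdot n y x"
  by (simp add: vdot_def mult.commute)

lemma vdot_self_nonneg [simp]: "0 \<le> vdot n x x"
  by (simp add: vdot_def sum_nonneg)

lemma vnorm_nonneg [simp]: "0 \<le> vnorm n x"
  by (simp add: vnorm_eq_vdot)

lemma vnorm_power2: "(vnorm n x)\<^sup>2 = vdot n x x"
  by (simp add: vnorm_eq_vdot)

lemma vdot_vscale: "vdot n (vscale n a x) (vscale n b y) = a * b * vdot n x y"
  by (simp add: vdot_def vscale_def sum_distrib_left ac_simps)

lemma vdot_vscale_left: "vdot n (vscale n a x) y = a * vdot n x y"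
  by (simp add: vdot_def vscale_def sum_distrib_left ac_simps)

lemma vnorm_vscale: "vnorm n (vscale n a x) = \<bar>a\<bar> * vnorm n x"
  by (simp add: vnorm_eq_vdot vdot_vscale real_sqrt_mult)

lemma vdot_ve1: "1 \<le> n \<Longrightarrow> vdot n (ve1 n r) y = r * y 0"
proof -
  assume "1 \<le> n"
  then have "{..<n} = insert 0 {0<..<n}" by auto
  then show ?thesis by (simp add: vdot_def ve1_def)
qed

lemma vnorm_ve1: "1 \<le> n \<Longrightarrow> vnorm n (ve1 n r) = \<bar>r\<bar>"
  by (simp add: vnorm_eq_vdot vdot_ve1) (simp add: ve1_def)

lemma ve1_in_space [simp, intro]: "ve1 n r \<in> space (Rn n)"
  by (simp add: space_Rn ve1_def)

lemma vscale_in_space [simp, intro]: "vscale n a x \<in> space (Rn n)"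
  by (simp add: space_Rn vscale_def)

lemma measurable_vscale:
  "c \<in> borel_measurable M \<Longrightarrow> f \<in> measurable M (Rn n) \<Longrightarrow> (\<lambda>x. vscale n (c x) (f x)) \<in> measurable M (Rn n)"
  by (intro measurable_RnI)
     (simp_all add: vscale_def borel_measurable_times measurable_coord_comp)

lemma measurable_vscale1 [measurable]: "vscale n c \<in> measurable (Rn n) (Rn n)"
  by (rule measurable_vscale[OF _ measurable_ident_sets[OF refl]]) simp

lemma measurable_vadd:
  "f \<in> measurable M (Rn n) \<Longrightarrow> g \<in> measurable M (Rn n) \<Longrightarrow> (\<lambda>x. vadd n (f x) (g x)) \<in> measurable M (Rn n)"
  by (intro measurable_RnI)
     (simp_all add: vadd_def borel_measurable_add measurable_coord_comp)

lemma measurable_vadd1 [measurable]: "x \<in> space (Rn n) \<Longrightarrow> vadd n x \<in> measurable (Rn n) (Rn n)"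
  by (rule measurable_vadd[OF measurable_const measurable_ident_sets[OF refl]])

subsection \<open>Orthogonal maps preserving Lebesgue measure\<close>

definition mp :: "nat \<Rightarrow> ((nat \<Rightarrow> real) \<Rightarrow> (nat \<Rightarrow> real)) \<Rightarrow> bool" where
  "mp n T \<longleftrightarrow> T \<in> measurable (Rn n) (Rn n) \<and> distr (Rn n) (Rn n) T = Rn n"

lemma mp_comp:
  assumes "mp n S" "mp n T"
  shows "mp n (\<lambda>x. S (T x))"
proof -
  have S: "S \<in> measurable (Rn n) (Rn n)" "distr (Rn n) (Rn n) S = Rn n"
    and T: "T \<in> measurable (Rn n) (Rn n)" "distr (Rn n) (Rn n) T = Rn n"
    using assms by (auto simp: mp_def)
  have "distr (Rn n) (Rn n) (S \<circ> T) = Rn n"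
    using distr_distr[OF S(1) T(1)] by (simp add: S(2) T(2))
  then show ?thesis using measurable_compose[OF T(1) S(1)] by (simp add: mp_def comp_def)
qed

text \<open>Integrate the changed coordinate first: with the others fixed, \<open>b\<close> is a
  constant, and a translation or reflection of the line preserves one-dimensional Lebesgue
  measure.\<close>

lemma mp_coord_op:
  assumes i: "i < n" and a: "\<bar>a\<bar> = 1"
    and b [measurable]: "b \<in> borel_measurable (Rn n)" and bi: "\<And>x t. b (x(i := t)) = b x"
  shows "mp n (\<lambda>x. x(i := a * x i + b x))"
proof -
  let ?T = "\<lambda>x. x(i := a * x i + b x)"
  have I: "{..<n} = insert i ({..<n} - {i})" using i by auto
  have T [measurable]: "?T \<in> measurable (Rn n) (Rn n)"
  proof (rule measurable_RnI)
    fix j assume j: "j < n"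
    note [measurable] = measurable_coord[OF i] measurable_coord[OF j]
    show "(\<lambda>x. ?T x j) \<in> borel_measurable (Rn n)"
      by (cases "j = i") simp_all
  qed (auto simp: space_Rn extensional_def i)
  have "distr (Rn n) (Rn n) ?T = Rn n"
  proof (rule measure_eqI)
    fix A assume "A \<in> sets (distr (Rn n) (Rn n) ?T)"
    then have A [measurable]: "A \<in> sets (Rn n)" by simp
    let ?J = "{..<n} - {i}"
    have J: "finite ?J" "i \<notin> ?J" by auto
    have "emeasure (distr (Rn n) (Rn n) ?T) A = (\<integral>\<^sup>+x. indicator A (?T x) \<partial>Rn n)"
      using nn_integral_distr[OF T, of "indicator A"] A by simp
    also have "\<dots> = (\<integral>\<^sup>+x. \<integral>\<^sup>+y. indicator A (?T (x(i := y))) \<partial>lborel \<partial>PiM ?J (\<lambda>_. lborel))"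
      by (subst I, rule lebesgue_pm.product_nn_integral_insert[OF J]) (use i in \<open>simp add: insert_absorb\<close>)
    also have "\<dots> = (\<integral>\<^sup>+x. \<integral>\<^sup>+y. indicator A (x(i := y)) \<partial>lborel \<partial>PiM ?J (\<lambda>_. lborel))"
    proof (rule nn_integral_cong)
      fix x assume x: "x \<in> space (PiM ?J (\<lambda>_. lborel :: real measure))"
      have m: "(\<lambda>y. x(i := y)) \<in> measurable lborel (Rn n)"
        using measurable_component_update[OF x J(2)] I by simp
      have "(\<integral>\<^sup>+y. indicator A (x(i := y)) \<partial>lborel)
          = ennreal \<bar>a\<bar> * (\<integral>\<^sup>+y. indicator A (x(i := b x + a * y)) \<partial>lborel)"
        using a by (intro nn_integral_real_affine) (use measurable_compose[OF m borel_measurable_indicator[OF A]] in auto)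
      then show "(\<integral>\<^sup>+y. indicator A (?T (x(i := y))) \<partial>lborel) = (\<integral>\<^sup>+y. indicator A (x(i := y)) \<partial>lborel)"
        using a by (simp add: bi add.commute)
    qed
    also have "\<dots> = (\<integral>\<^sup>+x. indicator A x \<partial>Rn n)"
      by (subst I, rule lebesgue_pm.product_nn_integral_insert[OF J, symmetric]) (use i in \<open>simp add: insert_absorb\<close>)
    also have "\<dots> = emeasure (Rn n) A" by simp
    finally show "emeasure (distr (Rn n) (Rn n) ?T) A = emeasure (Rn n) A" .
  qed simp
  with T show ?thesis by (simp add: mp_def)
qed

text \<open>Orthogonal linear maps, recorded without matrices through the properties that later
  proofs use. Homogeneity makes such a map commute with the radial projection onto a sphere.\<close>

definition orth :: "nat \<Rightarrow> ((nat \<Rightarrow> real) \<Rightarrow> (nat \<Rightarrow> real)) \<Rightarrow> bool" where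
  "orth n T \<longleftrightarrow> mp n T \<and> (\<forall>x\<in>space (Rn n). \<forall>y\<in>space (Rn n). vdot n (T x) (T y) = vdot n x y)
     \<and> (\<forall>x\<in>space (Rn n). \<forall>k. T (vscale n k x) = vscale n k (T x))"

lemma orth_measurable: "orth n T \<Longrightarrow> T \<in> measurable (Rn n) (Rn n)"
  by (simp add: orth_def mp_def)

lemma orth_space: "orth n T \<Longrightarrow> x \<in> space (Rn n) \<Longrightarrow> T x \<in> space (Rn n)"
  using orth_measurable by (rule measurable_space)

lemma orth_vdot: "orth n T \<Longrightarrow> x \<in> space (Rn n) \<Longrightarrow> y \<in> space (Rn n) \<Longrightarrow> vdot n (T x) (T y) = vdot n x y"
  by (simp add: orth_def)

lemma orth_vnorm: "orth n T \<Longrightarrow> x \<in> space (Rn n) \<Longrightarrow> vnorm n (T x) = vnorm n x"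
  by (simp add: vnorm_eq_vdot orth_vdot)

lemma orth_comp: "orth n S \<Longrightarrow> orth n T \<Longrightarrow> orth n (\<lambda>x. S (T x))"
  using orth_space[of n T] unfolding orth_def by (auto intro: mp_comp)

lemma orth_id: "orth n (\<lambda>x. x)"
  by (simp add: orth_def mp_def distr_id)

lemma orth_reflect: assumes "1 \<le> n" shows "orth n (\<lambda>x. x(0 := - x 0))"
proof -
  have "mp n (\<lambda>x. x(0 := (-1) * x 0 + 0))"
    using assms by (intro mp_coord_op) auto
  moreover have "vdot n (x(0 := - x 0)) (y(0 := - y 0)) = vdot n x y" for x y
    unfolding vdot_def by (intro sum.cong) auto
  moreover have "(vscale n k x)(0 := - (vscale n k x 0)) = vscale n k (x(0 := - x 0))" for x k
    using assms by (auto simp: vscale_def fun_eq_iff)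
  ultimately show ?thesis by (simp add: orth_def)
qed

text \<open>A plane rotation is a product of three shears, each of which preserves Lebesgue measure
  by \<open>mp_coord_op\<close>. What remains is the invariance of the inner product, a computation
  in two coordinates.\<close>

lemma orth_rotation:
  assumes j: "0 < j" "j < n" and cs: "c\<^sup>2 + s\<^sup>2 = 1" and c: "c > - 1"
  shows "orth n (\<lambda>x. x(0 := c * x 0 + s * x j, j := - s * x 0 + c * x j))" (is "orth n ?R")
proof -
  \<comment> \<open>The tangent of half the rotation angle, the shear coefficient of the first and
    third factor. The half turn \<open>c = - 1\<close> is the one angle at which it does not
    exist.\<close>
  define t where "t = s / (1 + c)"
  have ts: "t * s = 1 - c" "t * (1 + c) = s"
  proof -
    show t: "t * (1 + c) = s" using c by (simp add: t_def)
    have "(t * s) * (1 + c) = (1 - c) * (1 + c)"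
      using cs t by algebra
    then show "t * s = 1 - c" using c by simp
  qed
  have jm [measurable]: "(\<lambda>x. x j) \<in> borel_measurable (Rn n)" "(\<lambda>x. x 0) \<in> borel_measurable (Rn n)"
    using j by (auto intro: measurable_coord)
  have A: "mp n (\<lambda>x. x(0 := 1 * x 0 + t * x j))"
    using j by (intro mp_coord_op) auto
  have B: "mp n (\<lambda>x. x(j := 1 * x j + (- s) * x 0))"
    using j by (intro mp_coord_op) auto
  have "mp n (\<lambda>x. (\<lambda>x. x(0 := 1 * x 0 + t * x j)) ((\<lambda>x. (\<lambda>x. x(j := 1 * x j + (- s) * x 0)) ((\<lambda>x. x(0 := 1 * x 0 + t * x j)) x)) x))"
    by (rule mp_comp[OF A mp_comp[OF B A]])
  also have "(\<lambda>x. (\<lambda>x. x(0 := 1 * x 0 + t * x j)) ((\<lambda>x. (\<lambda>x. x(j := 1 * x j + (- s) * x 0)) ((\<lambda>x. x(0 := 1 * x 0 + t * x j)) x)) x)) = ?R"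
  proof
    fix x :: "nat \<Rightarrow> real"
    have e1: "x j + - s * (x 0 + t * x j) = - s * x 0 + c * x j"
      using ts(1) by algebra
    have e2: "x 0 + t * x j + t * (- s * x 0 + c * x j) = c * x 0 + s * x j"
      using ts by algebra
    show "(\<lambda>x. x(0 := 1 * x 0 + t * x j)) ((\<lambda>x. (\<lambda>x. x(j := 1 * x j + (- s) * x 0)) ((\<lambda>x. x(0 := 1 * x 0 + t * x j)) x)) x) = ?R x"
      using j e1 e2 by (auto simp: fun_eq_iff)
  qed
  finally have mp: "mp n ?R" .
  have vd: "vdot n (?R x) (?R y) = vdot n x y" for x y
  proof -
    have I: "{..<n} = insert 0 (insert j ({..<n} - {0, j}))" using j by auto
    have "(\<Sum>i\<in>{..<n} - {0, j}. ?R x i * ?R y i) = (\<Sum>i\<in>{..<n} - {0, j}. x i * y i)"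
      by (intro sum.cong) auto
    moreover have "(c * x 0 + s * x j) * (c * y 0 + s * y j) + (- s * x 0 + c * x j) * (- s * y 0 + c * y j)
       = x 0 * y 0 + x j * y j"
      using cs by algebra
    ultimately show ?thesis
      unfolding vdot_def using j by (subst (1 2) I) simp
  qed
  have "?R (vscale n k x) = vscale n k (?R x)" for k x
    using j by (auto simp: vscale_def fun_eq_iff algebra_simps)
  with mp vd show ?thesis by (simp add: orth_def)
qed

text \<open>Induction on the last coordinate that may be nonzero: a rotation in the plane of
  coordinates \<open>0\<close> and \<open>Suc k\<close> moves its content into coordinate 0. Finally
  a multiple of the first unit vector is left, and a reflection corrects its sign if
  necessary.\<close>

lemma orth_to_ve1_aux:
  assumes "k < n" "x \<in> space (Rn n)" "\<And>j. k < j \<Longrightarrow> j < n \<Longrightarrow> x j = 0"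
  shows "\<exists>T. orth n T \<and> T x = ve1 n (vnorm n x)"
  using assms
proof (induction k arbitrary: x)
  case 0
  define a where "a = x 0"
  have x: "x = ve1 n a"
    using 0 by (auto simp: ve1_def space_Rn extensional_def fun_eq_iff a_def)
  have nx: "vnorm n x = \<bar>a\<bar>" using 0(1) unfolding x by (intro vnorm_ve1) simp
  show ?case
  proof (cases "a \<ge> 0")
    case True
    then show ?thesis using x nx orth_id by (intro exI[of _ "\<lambda>x. x"]) auto
  next
    case False
    have "x(0 := - x 0) = ve1 n (- a)"
      unfolding x using 0(1) by (auto simp: ve1_def fun_eq_iff)
    moreover have "orth n (\<lambda>x. x(0 := - x 0))" using 0(1) by (intro orth_reflect) simp
    moreover have "vnorm n x = - a" using nx False by simp
    ultimately show ?thesis by (intro exI[of _ "\<lambda>x. x(0 := - x 0)"] conjI) (assumption, simp only:)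
  qed
next
  case (Suc k)
  show ?case
  proof (cases "x (Suc k) = 0")
    case True
    then have "x j = 0" if "k < j" "j < n" for j
      using Suc.prems(3)[of j] that by (cases "j = Suc k") auto
    then show ?thesis using Suc.IH[of x] Suc.prems by auto
  next
    case False
    define m where "m = sqrt ((x 0)\<^sup>2 + (x (Suc k))\<^sup>2)"
    have m2: "m\<^sup>2 = (x 0)\<^sup>2 + (x (Suc k))\<^sup>2" by (simp add: m_def)
    have m: "m > 0" unfolding m_def using False by (simp add: sum_power2_gt_zero_iff)
    define c s where "c = x 0 / m" and "s = x (Suc k) / m"
    have cs: "c\<^sup>2 + s\<^sup>2 = 1"
      unfolding c_def s_def power_divide add_divide_distrib[symmetric] m2[symmetric] using m by simp
    \<comment> \<open>\<open>s\<close> is nonzero because coordinate \<open>Suc k\<close> is, so the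
      half turn excluded in \<open>orth_rotation\<close> does not occur.\<close>
    have "s\<^sup>2 > 0" using False m by (simp add: s_def)
    with cs have "c\<^sup>2 < 1" by linarith
    then have c: "c > -1" by (simp add: abs_square_less_1)
    let ?R = "\<lambda>x. x(0 := c * x 0 + s * x (Suc k), Suc k := - s * x 0 + c * x (Suc k))"
    have R: "orth n ?R" using Suc.prems cs c by (intro orth_rotation) auto
    have "- s * x 0 + c * x (Suc k) = 0" by (simp add: c_def s_def)
    then have "?R x j = 0" if "k < j" "j < n" for j
      using Suc.prems(3)[of j] that by (cases "j = Suc k") auto
    moreover have "k < n" using Suc.prems(1) by simp
    ultimately obtain T where T: "orth n T" "T (?R x) = ve1 n (vnorm n (?R x))"
      using Suc.IH[OF _ orth_space[OF R Suc.prems(2)]] by blast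
    have "vnorm n (?R x) = vnorm n x" by (rule orth_vnorm[OF R Suc.prems(2)])
    then show ?thesis
      using T(2) by (intro exI[of _ "\<lambda>x. T (?R x)"] conjI orth_comp[OF T(1) R]) simp
  qed
qed

lemma orth_to_ve1:
  assumes "1 \<le> n" "x \<in> space (Rn n)"
  obtains T where "orth n T" "T x = ve1 n (vnorm n x)"
proof -
  have "\<exists>T. orth n T \<and> T x = ve1 n (vnorm n x)"
    using assms by (intro orth_to_ve1_aux[of "n - 1"]) auto
  then show ?thesis using that by blast
qed

section \<open>Rotation-invariant measures\<close>

definition rotinv :: "nat \<Rightarrow> (nat \<Rightarrow> real) measure \<Rightarrow> bool" where
  "rotinv n M \<longleftrightarrow> sets M = sets (Rn n) \<and> (\<forall>T. orth n T \<longrightarrow> distr M (Rn n) T = M)"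

lemma rotinv_Rn: "rotinv n (Rn n)"
  by (simp add: rotinv_def orth_def mp_def)

lemma rotinv_density_vnorm:
  assumes [measurable]: "g \<in> borel_measurable borel"
  shows "rotinv n (density (Rn n) (\<lambda>x. g (vnorm n x)))"
  unfolding rotinv_def
proof (intro conjI allI impI)
  fix T assume T: "orth n T"
  note [measurable] = orth_measurable[OF T]
  have "distr (density (Rn n) (\<lambda>x. g (vnorm n x))) (Rn n) T
      = distr (density (Rn n) (\<lambda>x. g (vnorm n (T x)))) (Rn n) T"
    by (intro arg_cong[where f = "\<lambda>M. distr M (Rn n) T"] density_cong) (auto simp: orth_vnorm[OF T])
  also have "\<dots> = density (distr (Rn n) (Rn n) T) (\<lambda>x. g (vnorm n x))"
    by (intro density_distr[symmetric]) auto
  also have "distr (Rn n) (Rn n) T = Rn n" using T by (simp add: orth_def mp_def)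
  finally show "distr (density (Rn n) (\<lambda>x. g (vnorm n x))) (Rn n) T = density (Rn n) (\<lambda>x. g (vnorm n x))" .
qed simp

text \<open>Rotate \<open>x\<close> to the first axis and change variables by the same map; inner
  products and norms stay the same. In this way an integral involving a direction is reduced to a
  single coordinate.\<close>

lemma rotinv_nn_integral:
  assumes M: "rotinv n M" and n: "1 \<le> n" and x: "x \<in> space (Rn n)"
    and f [measurable]: "case_prod f \<in> borel_measurable (borel \<Otimes>\<^sub>M borel)"
  shows "(\<integral>\<^sup>+y. f (vdot n x y) (vnorm n y) \<partial>M) = (\<integral>\<^sup>+y. f (vnorm n x * y 0) (vnorm n y) \<partial>M)"
proof -
  obtain T where T: "orth n T" "T x = ve1 n (vnorm n x)" using orth_to_ve1[OF n x] by blast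
  have sM [measurable_cong]: "sets M = sets (Rn n)" using M by (simp add: rotinv_def)
  then have sp: "space M = space (Rn n)" by (rule sets_eq_imp_space_eq)
  note [measurable] = orth_measurable[OF T(1)]
  have f2: "(\<lambda>y. f (vdot n z y) (vnorm n y)) \<in> borel_measurable (Rn n)" if [measurable]: "z \<in> space (Rn n)" for z
  proof -
    have "(\<lambda>y. (vdot n z y, vnorm n y)) \<in> measurable (Rn n) (borel \<Otimes>\<^sub>M borel)" by measurable
    from measurable_compose[OF this f] show ?thesis by simp
  qed
  have "(\<integral>\<^sup>+y. f (vdot n x y) (vnorm n y) \<partial>M) = (\<integral>\<^sup>+y. f (vdot n (T x) (T y)) (vnorm n (T y)) \<partial>M)"
    by (intro nn_integral_cong) (simp add: orth_vdot[OF T(1) x] orth_vnorm[OF T(1)] sp)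
  also have "\<dots> = (\<integral>\<^sup>+y. f (vdot n (T x) y) (vnorm n y) \<partial>distr M (Rn n) T)"
    using f2[OF orth_space[OF T(1) x]] by (subst nn_integral_distr) auto
  also have "distr M (Rn n) T = M" using M T by (simp add: rotinv_def)
  finally show ?thesis by (simp add: T(2) vdot_ve1[OF n])
qed

section \<open>Gaussian transition densities; \<open>gd n s x\<close> is the density of
  \<open>N(x, s I)\<close>\<close>

definition gd :: "nat \<Rightarrow> real \<Rightarrow> (nat \<Rightarrow> real) \<Rightarrow> (nat \<Rightarrow> real) \<Rightarrow> real" where
  "gd n s x y = (\<Prod>i<n. normal_density (x i) (sqrt s) (y i))"

lemma gd_eq:
  assumes "s > 0"
  shows "gd n s x y = (1 / sqrt (2 * pi * s)) ^ n * exp (- (vdot n y y - 2 * vdot n x y + vdot n x x) / (2 * s))"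
proof -
  have "gd n s x y = (\<Prod>i<n. 1 / sqrt (2 * pi * s) * exp (- (y i - x i)\<^sup>2 / (2 * s)))"
    using assms by (simp add: gd_def normal_density_def)
  also have "\<dots> = (1 / sqrt (2 * pi * s)) ^ n * (\<Prod>i<n. exp (- (y i - x i)\<^sup>2 / (2 * s)))"
    by (simp only: prod.distrib prod_constant card_lessThan)
  also have "(\<Prod>i<n. exp (- (y i - x i)\<^sup>2 / (2 * s))) = exp (\<Sum>i<n. - (y i - x i)\<^sup>2 / (2 * s))"
    by (rule exp_sum[symmetric]) simp
  also have "(\<Sum>i<n. - (y i - x i)\<^sup>2 / (2 * s)) = - (vdot n y y - 2 * vdot n x y + vdot n x x) / (2 * s)"
    unfolding sum_divide_distrib[symmetric] vdot_def sum_distrib_left sum_subtractf[symmetric] sum.distrib[symmetric] sum_negf[symmetric]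
    by (intro arg_cong2[where f = "(/)"] sum.cong refl) (simp add: power2_eq_square algebra_simps)
  finally show ?thesis .
qed

lemma gd_pos: "s > 0 \<Longrightarrow> gd n s x y > 0"
  by (simp add: gd_eq)

lemma gd_nonneg [simp]: "0 \<le> gd n s x y"
  unfolding gd_def by (intro prod_nonneg) simp

lemma measurable_gd:
  assumes "f \<in> measurable M (Rn n)" "g \<in> measurable M (Rn n)"
  shows "(\<lambda>w. gd n s (f w) (g w)) \<in> borel_measurable M"
proof -
  have [measurable]: "(\<lambda>w. f w i) \<in> borel_measurable M" "(\<lambda>w. g w i) \<in> borel_measurable M" if "i < n" for i
    using assms that by (auto intro: measurable_coord_comp)
  show ?thesis unfolding gd_def normal_density_def by (intro borel_measurable_prod) auto
qed

lemma measurable_gd1 [measurable]: "x \<in> space (Rn n) \<Longrightarrow> gd n s x \<in> borel_measurable (Rn n)"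
  by (rule measurable_gd[OF measurable_const measurable_ident_sets[OF refl]])

lemma emeasure_indicator_PiE:
  "y \<in> space (Rn n) \<Longrightarrow> indicator (Pi\<^sub>E {..<n} A) y = (\<Prod>i<n. indicator (A i) (y i) :: ennreal)"
proof (cases "\<forall>i<n. y i \<in> A i")
  case True
  then show "y \<in> space (Rn n) \<Longrightarrow> ?thesis" by (auto simp: space_Rn PiE_def intro!: prod.neutral[symmetric])
next
  case False
  then obtain i where "i < n" "y i \<notin> A i" by auto
  then have "(\<Prod>i<n. indicator (A i) (y i) :: ennreal) = 0" by (intro prod_zero) (auto intro!: bexI[of _ i])
  moreover have "y \<notin> Pi\<^sub>E {..<n} A" using \<open>i < n\<close> \<open>y i \<notin> A i\<close> by auto
  ultimately show ?thesis by (simp add: indicator_def del: PiE_iff)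
qed

lemma product_sigma_finite_normal:
  assumes "\<sigma> > 0"
  shows "product_sigma_finite (\<lambda>i::nat. density lborel (\<lambda>t. ennreal (normal_density (m i) \<sigma> t)))"
  by (intro product_sigma_finite.intro prob_space_imp_sigma_finite prob_space_normal_density assms)

text \<open>It suffices to compare on boxes, where the integral of a product of one-coordinate
  densities factorises.\<close>

lemma density_gd:
  assumes s: "s > 0" and x: "x \<in> space (Rn n)"
  shows "density (Rn n) (\<lambda>y. ennreal (gd n s x y)) = PiM {..<n} (\<lambda>i. density lborel (\<lambda>t. ennreal (normal_density (x i) (sqrt s) t)))"
proof -
  interpret P: product_sigma_finite "\<lambda>i. density lborel (\<lambda>t. ennreal (normal_density (x i) (sqrt s) t))"
    by (rule product_sigma_finite_normal) (use s in simp)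
  show ?thesis
  proof (rule P.PiM_eqI)
    show "sets (density (Rn n) (\<lambda>y. ennreal (gd n s x y))) = sets (PiM {..<n} (\<lambda>i. density lborel (\<lambda>t. ennreal (normal_density (x i) (sqrt s) t))))"
      unfolding sets_density by (rule sets_PiM_cong) auto
    fix A assume A: "\<And>i. i \<in> {..<n} \<Longrightarrow> A i \<in> sets (density lborel (\<lambda>t. ennreal (normal_density (x i) (sqrt s) t)))"
    then have [measurable]: "A i \<in> sets borel" if "i < n" for i using that by auto
    have B: "Pi\<^sub>E {..<n} A \<in> sets (Rn n)" by (rule sets_PiM_I_finite) auto
    have m: "(\<lambda>y. ennreal (gd n s x y)) \<in> borel_measurable (Rn n)" using x by measurable
    have "emeasure (density (Rn n) (\<lambda>y. ennreal (gd n s x y))) (Pi\<^sub>E {..<n} A)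
       = (\<integral>\<^sup>+y. ennreal (gd n s x y) * indicator (Pi\<^sub>E {..<n} A) y \<partial>Rn n)"
      by (rule emeasure_density[OF m B])
    also have "\<dots> = (\<integral>\<^sup>+y. (\<Prod>i<n. ennreal (normal_density (x i) (sqrt s) (y i)) * indicator (A i) (y i)) \<partial>Rn n)"
      by (intro nn_integral_cong) (simp add: emeasure_indicator_PiE gd_def prod_ennreal[symmetric] prod.distrib)
    also have "\<dots> = (\<Prod>i<n. \<integral>\<^sup>+t. ennreal (normal_density (x i) (sqrt s) t) * indicator (A i) t \<partial>lborel)"
      by (rule lebesgue_pm.product_nn_integral_prod) auto
    also have "\<dots> = (\<Prod>i<n. emeasure (density lborel (\<lambda>t. ennreal (normal_density (x i) (sqrt s) t))) (A i))"
      by (intro prod.cong refl emeasure_density[symmetric]) auto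
    finally show "emeasure (density (Rn n) (\<lambda>y. ennreal (gd n s x y))) (Pi\<^sub>E {..<n} A) = \<dots>" .
  qed simp
qed

lemma prob_space_gd:
  assumes s: "s > 0" and x: "x \<in> space (Rn n)"
  shows "prob_space (density (Rn n) (\<lambda>y. ennreal (gd n s x y)))"
  unfolding density_gd[OF assms] by (intro prob_space_PiM prob_space_normal_density) (use s in simp)

lemma nn_integral_gd:
  assumes s: "s > 0" and x: "x \<in> space (Rn n)"
  shows "(\<integral>\<^sup>+y. ennreal (gd n s x y) \<partial>Rn n) = 1"
  using prob_space.emeasure_space_1[OF prob_space_gd[OF assms]] x
  by (simp add: emeasure_density cong: nn_integral_cong)

lemma std_gauss_eq: "std_gauss n = density (Rn n) (\<lambda>y. ennreal (gd n 1 (ve1 n 0) y))"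
  unfolding std_gauss_def density_gd[OF zero_less_one ve1_in_space]
  by (rule PiM_cong) (auto simp: ve1_def)

lemma sets_std_gauss [measurable_cong]: "sets (std_gauss n) = sets (Rn n)"
  by (simp add: std_gauss_eq)

lemma space_std_gauss: "space (std_gauss n) = space (Rn n)"
  by (simp add: std_gauss_eq)

lemma prob_space_std_gauss: "prob_space (std_gauss n)"
  unfolding std_gauss_eq by (rule prob_space_gd) auto

lemma distr_std_normal_affine:
  assumes "\<sigma> > 0"
  shows "distr (density lborel (\<lambda>t. ennreal (std_normal_density t))) lborel (\<lambda>t. m + \<sigma> * t)
       = density lborel (\<lambda>t. ennreal (normal_density m \<sigma> t))"
proof -
  let ?S = "density lborel (\<lambda>t. ennreal (std_normal_density t))"
  interpret prob_space ?S by (rule prob_space_normal_density) simp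
  have "distributed ?S lborel (\<lambda>t. t) (\<lambda>t. ennreal (normal_density 0 1 t))"
    unfolding distributed_def using distr_id2[of lborel ?S] by auto
  from normal_density_affine[OF this, of \<sigma> m] assms
  have "distributed ?S lborel (\<lambda>t. m + \<sigma> * t) (\<lambda>t. ennreal (normal_density m \<sigma> t))" by simp
  then show ?thesis by (rule distributed_distr_eq_density)
qed

text \<open>The preimage of a box is a box with affinely transformed sides, so the claim is the
  one-dimensional affine rule in each factor.\<close>

lemma distr_std_gauss:
  assumes s: "s > 0" and x: "x \<in> space (Rn n)"
  shows "distr (std_gauss n) (Rn n) (\<lambda>z. vadd n x (vscale n (sqrt s) z)) = density (Rn n) (\<lambda>y. ennreal (gd n s x y))"
    (is "distr _ _ ?T = _")
proof -
  interpret P: product_sigma_finite "\<lambda>i. density lborel (\<lambda>t. ennreal (normal_density (x i) (sqrt s) t))"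
    by (rule product_sigma_finite_normal) (use s in simp)
  interpret S: product_sigma_finite "\<lambda>i::nat. density lborel (\<lambda>t. ennreal (std_normal_density t))"
    by (rule product_sigma_finite_normal) simp
  have T [measurable]: "?T \<in> measurable (std_gauss n) (Rn n)"
    using x by measurable
  show ?thesis unfolding density_gd[OF assms]
  proof (rule P.PiM_eqI)
    show "sets (distr (std_gauss n) (Rn n) ?T) = sets (PiM {..<n} (\<lambda>i. density lborel (\<lambda>t. ennreal (normal_density (x i) (sqrt s) t))))"
      unfolding sets_distr by (rule sets_PiM_cong) auto
    fix A assume A: "\<And>i. i \<in> {..<n} \<Longrightarrow> A i \<in> sets (density lborel (\<lambda>t. ennreal (normal_density (x i) (sqrt s) t)))"
    then have Ab [measurable]: "A i \<in> sets borel" if "i < n" for i using that by auto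
    have B: "Pi\<^sub>E {..<n} A \<in> sets (Rn n)" by (rule sets_PiM_I_finite) auto
    define A' where "A' = (\<lambda>i. (\<lambda>t. x i + sqrt s * t) -` A i)"
    have A': "A' i \<in> sets borel" if "i < n" for i
    proof -
      have "(\<lambda>t. x i + sqrt s * t) -` A i \<inter> space borel \<in> sets borel"
        by (rule measurable_sets[OF _ Ab[OF that]]) measurable
      then show ?thesis by (simp add: A'_def)
    qed
    have pre: "?T -` Pi\<^sub>E {..<n} A \<inter> space (std_gauss n) = Pi\<^sub>E {..<n} A'"
      unfolding space_std_gauss space_Rn by (auto simp: A'_def PiE_def vadd_def vscale_def Pi_iff)
    have "emeasure (distr (std_gauss n) (Rn n) ?T) (Pi\<^sub>E {..<n} A) = emeasure (std_gauss n) (Pi\<^sub>E {..<n} A')"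
      unfolding pre[symmetric] by (rule emeasure_distr[OF T B])
    also have "\<dots> = (\<Prod>i<n. emeasure (density lborel (\<lambda>t. ennreal (std_normal_density t))) (A' i))"
      unfolding std_gauss_def by (rule S.emeasure_PiM) (use A' in auto)
    also have "\<dots> = (\<Prod>i<n. emeasure (density lborel (\<lambda>t. ennreal (normal_density (x i) (sqrt s) t))) (A i))"
    proof (intro prod.cong refl)
      fix i assume i: "i \<in> {..<n}"
      have "emeasure (density lborel (\<lambda>t. ennreal (normal_density (x i) (sqrt s) t))) (A i)
          = emeasure (distr (density lborel (\<lambda>t. ennreal (std_normal_density t))) lborel (\<lambda>t. x i + sqrt s * t)) (A i)"
        using distr_std_normal_affine[of "sqrt s" "x i"] s by simp
      also have "\<dots> = emeasure (density lborel (\<lambda>t. ennreal (std_normal_density t))) (A' i)"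
        using i by (subst emeasure_distr) (auto simp: A'_def)
      finally show "emeasure (density lborel (\<lambda>t. ennreal (std_normal_density t))) (A' i)
         = emeasure (density lborel (\<lambda>t. ennreal (normal_density (x i) (sqrt s) t))) (A i)" by simp
    qed
    finally show "emeasure (distr (std_gauss n) (Rn n) ?T) (Pi\<^sub>E {..<n} A) = \<dots>" .
  qed simp
qed

lemma sets_gauss [measurable_cong]: "sets (gauss n s) = sets (Rn n)"
  by (simp add: gauss_def)

lemma measurable_vscale_std_gauss [measurable]: "vscale n c \<in> measurable (std_gauss n) (Rn n)"
  using measurable_vscale1[of n c] by (simp cong: measurable_cong_sets add: sets_std_gauss)

lemma prob_space_gauss: "prob_space (gauss n s)"
  unfolding gauss_def by (rule prob_space.prob_space_distr[OF prob_space_std_gauss]) measurable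

lemma distr_gauss:
  assumes s: "s > 0" and x: "x \<in> space (Rn n)"
  shows "distr (gauss n s) (Rn n) (vadd n x) = density (Rn n) (\<lambda>y. ennreal (gd n s x y))"
proof -
  have "distr (gauss n s) (Rn n) (vadd n x) = distr (std_gauss n) (Rn n) (vadd n x \<circ> vscale n (sqrt s))"
    unfolding gauss_def by (rule distr_distr) (use x in measurable)
  then show ?thesis using distr_std_gauss[OF assms] by (simp add: comp_def)
qed

lemma conv_normal_density:
  assumes "0 < s" "0 < t"
  shows "(\<integral>\<^sup>+u. ennreal (normal_density a (sqrt s) u) * ennreal (normal_density u (sqrt t) b) \<partial>lborel)
       = ennreal (normal_density a (sqrt (s + t)) b)"
proof -
  have nd: "normal_density m \<sigma> x = normal_density 0 \<sigma> (x - m)" for m \<sigma> x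
    by (simp add: normal_density_def)
  have "(\<integral>\<^sup>+u. ennreal (normal_density a (sqrt s) u) * ennreal (normal_density u (sqrt t) b) \<partial>lborel)
      = (\<integral>\<^sup>+u. ennreal (normal_density 0 (sqrt t) (b - a - u) * normal_density 0 (sqrt s) u) \<partial>lborel)"
  proof -
    have m: "(\<lambda>u. ennreal (normal_density a (sqrt s) u) * ennreal (normal_density u (sqrt t) b)) \<in> borel_measurable borel"
      unfolding normal_density_def by measurable
    show ?thesis
      unfolding nn_integral_real_affine[OF m, of 1 a, simplified]
      by (intro nn_integral_cong)
         (simp add: nd[of a] nd[of "a + _"] ennreal_mult[symmetric] mult.commute diff_diff_eq)
  qed
  also have "\<dots> = ennreal (normal_density 0 (sqrt ((sqrt t)\<^sup>2 + (sqrt s)\<^sup>2)) (b - a))"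
    using fun_cong[OF conv_normal_density_zero_mean[of "sqrt t" "sqrt s"], of "b - a"] assms by simp
  finally show ?thesis using assms by (simp add: nd[of a] add.commute)
qed

text \<open>The Chapman-Kolmogorov equation of the heat semigroup. Both the data processing
  inequality and the link with Assumption (A) view noise of variance \<open>s + t\<close> as noise
  \<open>s\<close> followed by independent noise \<open>t\<close>.\<close>

lemma conv_gd:
  assumes "0 < s" "0 < t"
  shows "(\<integral>\<^sup>+u. ennreal (gd n s x u) * ennreal (gd n t u y) \<partial>Rn n) = ennreal (gd n (s + t) x y)"
proof -
  have "(\<integral>\<^sup>+u. ennreal (gd n s x u) * ennreal (gd n t u y) \<partial>Rn n)
     = (\<integral>\<^sup>+u. (\<Prod>i<n. ennreal (normal_density (x i) (sqrt s) (u i)) * ennreal (normal_density (u i) (sqrt t) (y i))) \<partial>Rn n)"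
    by (intro nn_integral_cong) (simp add: gd_def prod_ennreal[symmetric] prod.distrib)
  also have "\<dots> = (\<Prod>i<n. \<integral>\<^sup>+u. ennreal (normal_density (x i) (sqrt s) u) * ennreal (normal_density u (sqrt t) (y i)) \<partial>lborel)"
    by (rule lebesgue_pm.product_nn_integral_prod) (auto simp: normal_density_def)
  also have "\<dots> = ennreal (gd n (s + t) x y)"
    using assms by (simp add: conv_normal_density gd_def prod_ennreal)
  finally show ?thesis .
qed

subsection \<open>Moments\<close>

lemma distr_gd_coord:
  assumes s: "s > 0" and x: "x \<in> space (Rn n)" and i: "i < n"
  shows "distr (density (Rn n) (\<lambda>y. ennreal (gd n s x y))) lborel (\<lambda>y. y i)
       = density lborel (\<lambda>t. ennreal (normal_density (x i) (sqrt s) t))"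
proof -
  let ?M = "\<lambda>i. density lborel (\<lambda>t. ennreal (normal_density (x i) (sqrt s) t))"
  have "distr (PiM {..<n} ?M) (?M i) (\<lambda>y. y i) = ?M i"
    by (rule distr_PiM_component) (use s i in \<open>auto intro: prob_space_normal_density\<close>)
  moreover have "distr (PiM {..<n} ?M) (?M i) (\<lambda>y. y i) = distr (PiM {..<n} ?M) lborel (\<lambda>y. y i)"
    by (rule distr_cong) auto
  ultimately show ?thesis unfolding density_gd[OF s x] by simp
qed

lemma gd_coord_moments:
  assumes s: "s > 0" and x: "x \<in> space (Rn n)" and i: "i < n"
  shows "has_bochner_integral (density (Rn n) (\<lambda>y. ennreal (gd n s x y))) (\<lambda>y. y i) (x i)"
    and "has_bochner_integral (density (Rn n) (\<lambda>y. ennreal (gd n s x y))) (\<lambda>y. (y i)\<^sup>2) ((x i)\<^sup>2 + s)"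
proof -
  let ?G = "density (Rn n) (\<lambda>y. ennreal (gd n s x y))"
  let ?N = "density lborel (\<lambda>t. ennreal (normal_density (x i) (sqrt s) t))"
  have m [measurable]: "(\<lambda>y. y i) \<in> measurable ?G lborel" using measurable_coord[OF i] by simp
  have ss: "sqrt s > 0" using s by simp
  have 1: "has_bochner_integral lborel (\<lambda>t. normal_density (x i) (sqrt s) t * t) (x i)"
    by (rule normal_moment_nz_1[OF ss])
  have 0: "has_bochner_integral lborel (\<lambda>t. normal_density (x i) (sqrt s) t) 1"
    using normal_moment_even[OF ss, of "x i" 0] by simp
  have 2: "has_bochner_integral lborel (\<lambda>t. normal_density (x i) (sqrt s) t * (t - x i)\<^sup>2) s"
    using normal_moment_even[OF ss, of "x i" 1] s by (simp add: numeral_2_eq_2)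
  have 3: "has_bochner_integral lborel (\<lambda>t. normal_density (x i) (sqrt s) t * t\<^sup>2) ((x i)\<^sup>2 + s)"
  proof -
    have "has_bochner_integral lborel
      (\<lambda>t. normal_density (x i) (sqrt s) t * (t - x i)\<^sup>2 + 2 * x i * (normal_density (x i) (sqrt s) t * t)
          - (x i)\<^sup>2 * normal_density (x i) (sqrt s) t) (s + 2 * x i * x i - (x i)\<^sup>2 * 1)"
      by (intro has_bochner_integral_add has_bochner_integral_diff has_bochner_integral_mult_right 0 1 2)
    also have "(\<lambda>t. normal_density (x i) (sqrt s) t * (t - x i)\<^sup>2 + 2 * x i * (normal_density (x i) (sqrt s) t * t)
          - (x i)\<^sup>2 * normal_density (x i) (sqrt s) t) = (\<lambda>t. normal_density (x i) (sqrt s) t * t\<^sup>2)"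
      by (auto simp: fun_eq_iff power2_eq_square algebra_simps)
    also have "s + 2 * x i * x i - (x i)\<^sup>2 * 1 = (x i)\<^sup>2 + s" by (simp add: power2_eq_square)
    finally show ?thesis .
  qed
  have tr: "has_bochner_integral ?G (\<lambda>y. f (y i)) v"
    if [measurable]: "f \<in> borel_measurable borel"
      and h: "has_bochner_integral lborel (\<lambda>t. normal_density (x i) (sqrt s) t * f t) v" for f v
  proof -
    have "has_bochner_integral ?N f v"
      using h by (intro has_bochner_integral_density) auto
    then have "has_bochner_integral (distr ?G lborel (\<lambda>y. y i)) f v"
      unfolding distr_gd_coord[OF assms] .
    then show ?thesis by (simp add: has_bochner_integral_iff integrable_distr_eq[OF m] integral_distr[OF m])
  qed
  show "has_bochner_integral ?G (\<lambda>y. y i) (x i)" by (rule tr[OF _ 1]) simp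
  show "has_bochner_integral ?G (\<lambda>y. (y i)\<^sup>2) ((x i)\<^sup>2 + s)" by (rule tr[OF _ 3]) simp
qed

lemma gd_vdot_moment:
  assumes s: "s > 0" and x: "x \<in> space (Rn n)"
  shows "has_bochner_integral (density (Rn n) (\<lambda>y. ennreal (gd n s x y))) (\<lambda>y. vdot n a y) (vdot n a x)"
  unfolding vdot_def
  by (intro has_bochner_integral_sum has_bochner_integral_mult_right gd_coord_moments(1)[OF assms]) auto

lemma gd_vdot_self_moment:
  assumes s: "s > 0" and x: "x \<in> space (Rn n)"
  shows "has_bochner_integral (density (Rn n) (\<lambda>y. ennreal (gd n s x y))) (\<lambda>y. vdot n y y) (vdot n x x + real n * s)"
proof -
  have "has_bochner_integral (density (Rn n) (\<lambda>y. ennreal (gd n s x y))) (\<lambda>y. \<Sum>i<n. (y i)\<^sup>2) (\<Sum>i<n. (x i)\<^sup>2 + s)"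
    by (intro has_bochner_integral_sum gd_coord_moments(2)[OF assms]) auto
  then show ?thesis by (simp add: vdot_def power2_eq_square sum.distrib)
qed

subsection \<open>The law of the norm\<close>

text \<open>Checked on boxes. It yields the factor \<open>r ^ n\<close> in the volume of a ball of
  radius \<open>r\<close>, the input to polar coordinates.\<close>

lemma scale_measure_distr_vscale:
  assumes c: "c > 0"
  shows "scale_measure (ennreal (c ^ n)) (distr (Rn n) (Rn n) (vscale n c)) = Rn n"
proof (rule lebesgue_pm.PiM_eqI)
  fix A :: "nat \<Rightarrow> real set" assume A: "\<And>i. i \<in> {..<n} \<Longrightarrow> A i \<in> sets lborel"
  then have Ab [measurable]: "A i \<in> sets borel" if "i < n" for i using that by auto
  have B: "Pi\<^sub>E {..<n} A \<in> sets (Rn n)" by (rule sets_PiM_I_finite) auto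
  define A' where "A' = (\<lambda>i. (\<lambda>t. c * t) -` A i)"
  have A': "A' i \<in> sets borel" if "i < n" for i
  proof -
    have "(\<lambda>t. c * t) -` A i \<inter> space borel \<in> sets borel"
      by (rule measurable_sets[OF _ Ab[OF that]]) measurable
    then show ?thesis by (simp add: A'_def)
  qed
  have pre: "vscale n c -` Pi\<^sub>E {..<n} A \<inter> space (Rn n) = Pi\<^sub>E {..<n} A'"
    unfolding space_Rn by (auto simp: A'_def PiE_def vscale_def Pi_iff)
  have sc: "ennreal c * emeasure lborel (A' i) = emeasure lborel (A i)" if i: "i < n" for i
  proof -
    have "emeasure lborel (A i) = (\<integral>\<^sup>+t. indicator (A i) t \<partial>lborel)" using i by simp
    also have "\<dots> = ennreal \<bar>c\<bar> * (\<integral>\<^sup>+t. indicator (A i) (0 + c * t) \<partial>lborel)"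
      by (rule nn_integral_real_affine) (use c i in auto)
    also have "(\<integral>\<^sup>+t. indicator (A i) (0 + c * t) \<partial>lborel) = (\<integral>\<^sup>+t. indicator (A' i) t \<partial>lborel)"
      by (intro nn_integral_cong) (auto simp: A'_def indicator_def)
    finally show ?thesis using c A'[OF i] by simp
  qed
  have "emeasure (distr (Rn n) (Rn n) (vscale n c)) (Pi\<^sub>E {..<n} A) = emeasure (Rn n) (Pi\<^sub>E {..<n} A')"
    unfolding pre[symmetric] by (rule emeasure_distr[OF measurable_vscale1 B])
  also have "\<dots> = (\<Prod>i<n. emeasure lborel (A' i))"
    by (rule lebesgue_pm.emeasure_PiM) (use A' in auto)
  finally have "emeasure (scale_measure (ennreal (c ^ n)) (distr (Rn n) (Rn n) (vscale n c))) (Pi\<^sub>E {..<n} A)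
     = ennreal (c ^ n) * (\<Prod>i<n. emeasure lborel (A' i))" by simp
  also have "\<dots> = (\<Prod>i<n. ennreal c * emeasure lborel (A' i))"
    using c by (simp add: prod.distrib ennreal_power)
  also have "\<dots> = (\<Prod>i<n. emeasure lborel (A i))" by (intro prod.cong refl sc) simp
  finally show "emeasure (scale_measure (ennreal (c ^ n)) (distr (Rn n) (Rn n) (vscale n c))) (Pi\<^sub>E {..<n} A) = \<dots>" .
qed simp_all

lemma abs_coord_le_vnorm: "i < n \<Longrightarrow> \<bar>y i\<bar> \<le> vnorm n y"
  unfolding vnorm_def
  by (rule real_le_rsqrt) (use member_le_sum[of i "{..<n}" "\<lambda>i. (y i)\<^sup>2"] in auto)

definition Vb :: "nat \<Rightarrow> real" where
  "Vb n = measure (Rn n) {y \<in> space (Rn n). vnorm n y < 1}"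

lemma emeasure_ball_finite: "emeasure (Rn n) {y \<in> space (Rn n). vnorm n y \<le> 1} < \<infinity>"
proof -
  have "emeasure (Rn n) {y \<in> space (Rn n). vnorm n y \<le> 1} \<le> emeasure (Rn n) (Pi\<^sub>E {..<n} (\<lambda>_. {-1..1}))"
  proof (rule emeasure_mono)
    show "{y \<in> space (Rn n). vnorm n y \<le> 1} \<subseteq> Pi\<^sub>E {..<n} (\<lambda>_. {-1..1})"
    proof
      fix y assume "y \<in> {y \<in> space (Rn n). vnorm n y \<le> 1}"
      then have y: "y \<in> space (Rn n)" "vnorm n y \<le> 1" by auto
      have "y i \<in> {-1..1}" if "i < n" for i
        using abs_coord_le_vnorm[OF that, of y] y(2) by auto
      with y(1) show "y \<in> Pi\<^sub>E {..<n} (\<lambda>_. {-1..1})" by (auto simp: space_Rn PiE_def)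
    qed
  qed (auto intro: sets_PiM_I_finite)
  also have "\<dots> = (\<Prod>i<n. emeasure lborel {-1..1::real})"
    by (rule lebesgue_pm.emeasure_PiM) auto
  also have "\<dots> = (\<Prod>i<n. ennreal 2)" by simp
  also have "\<dots> = ennreal (2 ^ n)" by (simp only: prod_constant card_lessThan ennreal_power)
  also have "\<dots> < \<infinity>" by simp
  finally show ?thesis .
qed

lemma emeasure_ball:
  assumes r: "r > 0"
  shows "emeasure (Rn n) {y \<in> space (Rn n). vnorm n y < r} = ennreal (r ^ n * Vb n)"
proof -
  let ?A = "{y \<in> space (Rn n). vnorm n y < r}" and ?B = "{y \<in> space (Rn n). vnorm n y < 1}"
  have A: "?A \<in> sets (Rn n)" by measurable
  have pre: "vscale n r -` ?A \<inter> space (Rn n) = ?B"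
    using r by (auto simp: vnorm_vscale)
  have "emeasure (Rn n) ?B \<le> emeasure (Rn n) {y \<in> space (Rn n). vnorm n y \<le> 1}"
    by (rule emeasure_mono) (auto, measurable)
  also note emeasure_ball_finite
  finally have B: "emeasure (Rn n) ?B = ennreal (Vb n)"
    unfolding Vb_def by (simp add: emeasure_eq_ennreal_measure)
  have "emeasure (Rn n) ?A = emeasure (scale_measure (ennreal (r ^ n)) (distr (Rn n) (Rn n) (vscale n r))) ?A"
    by (simp only: scale_measure_distr_vscale[OF r])
  also have "\<dots> = ennreal (r ^ n) * emeasure (Rn n) ?B"
    using emeasure_distr[OF measurable_vscale1 A, of r] by (simp only: emeasure_scale_measure pre)
  finally show ?thesis using r by (simp add: B ennreal_mult' Vb_def)
qed

lemma Vb_nonneg [simp]: "0 \<le> Vb n" by (simp add: Vb_def)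

text \<open>Polar coordinates, by comparing the law of the norm with a density on the half line:
  both give the ball of radius \<open>r\<close> the mass \<open>Vb n * r ^ n\<close>.\<close>

lemma nn_integral_radial:
  assumes n: "1 \<le> n" and g [measurable]: "g \<in> borel_measurable borel"
  shows "(\<integral>\<^sup>+y. g (vnorm n y) \<partial>Rn n)
    = (\<integral>\<^sup>+p. ennreal (real n * Vb n * p ^ (n - 1)) * indicator {0<..} p * g p \<partial>lborel)"
proof -
  define D where "D = (\<lambda>p::real. ennreal (real n * Vb n * p ^ (n - 1)) * indicator {0<..} p)"
  have D [measurable]: "D \<in> borel_measurable borel" unfolding D_def by measurable
  \<comment> \<open>The sign is reversed because measures are compared on the half lines
    \<open>{x<..}\<close>; these then correspond to balls, which have finite measure, and not to
    their complements.\<close>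
  let ?M = "distr (Rn n) borel (\<lambda>y. - vnorm n y)"
  let ?N = "distr (density lborel D) borel (\<lambda>p. - p)"
  have M: "emeasure ?M {x<..} = emeasure (Rn n) {y \<in> space (Rn n). vnorm n y < - x}" for x
    by (subst emeasure_distr) (auto intro!: arg_cong[where f = "emeasure (Rn n)"])
  have N: "emeasure ?N {x<..} = (\<integral>\<^sup>+p. D p * indicator {..<- x} p \<partial>lborel)" for x
  proof -
    have "emeasure ?N {x<..} = emeasure (density lborel D) {..<- x}"
      by (subst emeasure_distr) (auto intro!: arg_cong[where f = "emeasure (density lborel D)"])
    then show ?thesis by (simp add: emeasure_density)
  qed
  have eq: "emeasure ?M {x<..} = emeasure ?N {x<..} \<and> emeasure ?M {x<..} < \<infinity>" for x
  proof (cases "x < 0")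
    case False
    have e: "{y \<in> space (Rn n). vnorm n y < - x} = {}"
      using False by (auto simp: not_less intro: order_trans[OF _ vnorm_nonneg])
    have "D p * indicator {..<- x} p = 0" for p
      using False by (auto simp: D_def indicator_def)
    then have "(\<integral>\<^sup>+p. D p * indicator {..<- x} p \<partial>lborel) = 0" by (simp only: nn_integral_const) simp
    then show ?thesis unfolding M N e by simp
  next
    case True
    define r where "r = - x"
    have r: "r > 0" using True by (simp add: r_def)
    \<comment> \<open>Up to the null set of the two endpoints the domain is \<open>[0, r]\<close>,
      where the density is the derivative of \<open>Vb n * p ^ n\<close>.\<close>
    have "(\<integral>\<^sup>+p. D p * indicator {..<r} p \<partial>lborel)
       = (\<integral>\<^sup>+p. ennreal (real n * Vb n * p ^ (n - 1)) * indicator {0..r} p \<partial>lborel)"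
    proof (rule nn_integral_cong_AE)
      have "AE p in lborel. p \<noteq> 0 \<and> p \<noteq> r"
        using AE_lborel_singleton[of "0::real"] AE_lborel_singleton[of r] by eventually_elim auto
      then show "AE p in lborel. D p * indicator {..<r} p = ennreal (real n * Vb n * p ^ (n - 1)) * indicator {0..r} p"
        by eventually_elim (auto simp: D_def indicator_def)
    qed
    also have "\<dots> = ennreal (Vb n * r ^ n - Vb n * 0 ^ n)"
    proof (rule nn_integral_FTC_Icc[where F = "\<lambda>p. Vb n * p ^ n"])
      fix p :: real assume "p \<in> {0..r}"
      show "((\<lambda>p. Vb n * p ^ n) has_real_derivative real n * Vb n * p ^ (n - 1)) (at p)"
        by (auto intro!: derivative_eq_intros)
      show "0 \<le> real n * Vb n * p ^ (n - 1)" using \<open>p \<in> {0..r}\<close> by simp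
    qed (use r in auto)
    also have "\<dots> = ennreal (r ^ n * Vb n)" using n by (simp add: mult.commute power_0_left)
    finally show ?thesis
      unfolding M N r_def[symmetric] by (simp add: emeasure_ball[OF r])
  qed
  have MN: "?M = ?N"
    using eq[THEN conjunct1] eq[THEN conjunct2] by (intro measure_eqI_lessThan) simp_all
  have "(\<integral>\<^sup>+y. g (vnorm n y) \<partial>Rn n) = (\<integral>\<^sup>+t. g (- t) \<partial>?M)"
    by (subst nn_integral_distr) auto
  also have "\<dots> = (\<integral>\<^sup>+p. g p \<partial>density lborel D)"
    unfolding MN by (subst nn_integral_distr) auto
  also have "\<dots> = (\<integral>\<^sup>+p. D p * g p \<partial>lborel)"
    by (rule nn_integral_density) auto
  finally show ?thesis by (simp add: D_def)
qed

text \<open>The normalising constant of the chi law of a standard Gaussian norm: the area of the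
  unit sphere divided by \<open>sqrt (2 * pi) ^ n\<close>.\<close>

definition cn :: "nat \<Rightarrow> real" where
  "cn n = real n * Vb n * (1 / sqrt (2 * pi)) ^ n"

lemma nn_integral_std_gauss_radial:
  assumes n: "1 \<le> n" and g [measurable]: "g \<in> borel_measurable borel"
  shows "(\<integral>\<^sup>+z. g (vnorm n z) \<partial>std_gauss n)
    = (\<integral>\<^sup>+p. ennreal (cn n * p ^ (n - 1) * exp (- p\<^sup>2 / 2)) * indicator {0<..} p * g p \<partial>lborel)"
proof -
  let ?c = "(1 / sqrt (2 * pi)) ^ n"
  have gd1: "gd n 1 (ve1 n 0) y = ?c * exp (- (vnorm n y)\<^sup>2 / 2)" for y
    using n by (simp add: gd_eq vdot_ve1 vnorm_power2)
  have "(\<integral>\<^sup>+z. g (vnorm n z) \<partial>std_gauss n) = (\<integral>\<^sup>+y. ennreal (gd n 1 (ve1 n 0) y) * g (vnorm n y) \<partial>Rn n)"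
    unfolding std_gauss_eq by (rule nn_integral_density) measurable
  also have "\<dots> = (\<integral>\<^sup>+y. ennreal (?c * exp (- (vnorm n y)\<^sup>2 / 2)) * g (vnorm n y) \<partial>Rn n)"
    by (simp only: gd1)
  also have "\<dots> = (\<integral>\<^sup>+p. ennreal (real n * Vb n * p ^ (n - 1)) * indicator {0<..} p * (ennreal (?c * exp (- p\<^sup>2 / 2)) * g p) \<partial>lborel)"
    by (rule nn_integral_radial[OF n]) measurable
  also have "\<dots> = (\<integral>\<^sup>+p. ennreal (cn n * p ^ (n - 1) * exp (- p\<^sup>2 / 2)) * indicator {0<..} p * g p \<partial>lborel)"
  proof (intro nn_integral_cong)
    fix p :: real
    show "ennreal (real n * Vb n * p ^ (n - 1)) * indicator {0<..} p * (ennreal (?c * exp (- p\<^sup>2 / 2)) * g p)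
       = ennreal (cn n * p ^ (n - 1) * exp (- p\<^sup>2 / 2)) * indicator {0<..} p * g p"
    proof (cases "p > 0")
      case True
      then have "cn n * p ^ (n - 1) * exp (- p\<^sup>2 / 2) = (real n * Vb n * p ^ (n - 1)) * (?c * exp (- p\<^sup>2 / 2))"
        by (simp only: cn_def ac_simps)
      then have "ennreal (cn n * p ^ (n - 1) * exp (- p\<^sup>2 / 2)) = ennreal (real n * Vb n * p ^ (n - 1)) * ennreal (?c * exp (- p\<^sup>2 / 2))"
        using True by (simp only: ennreal_mult) (intro ennreal_mult; simp)
      then show ?thesis using True by (simp add: mult.assoc)
    qed simp
  qed
  finally show ?thesis .
qed

lemma nn_integral_std_gauss_norm2: "(\<integral>\<^sup>+z. ennreal ((vnorm n z)\<^sup>2) \<partial>std_gauss n) = ennreal (real n)"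
proof -
  have "has_bochner_integral (std_gauss n) (\<lambda>y. vdot n y y) (vdot n (ve1 n 0) (ve1 n 0) + real n * 1)"
    unfolding std_gauss_eq by (rule gd_vdot_self_moment) auto
  moreover have "vdot n (ve1 n 0) (ve1 n 0) = 0" by (simp add: vdot_def ve1_def)
  ultimately have "has_bochner_integral (std_gauss n) (\<lambda>y. vdot n y y) (real n)" by simp
  then show ?thesis
    by (simp add: vnorm_power2 has_bochner_integral_iff nn_integral_eq_integral)
qed

text \<open>Up to the constants \<open>cn n\<close> and \<open>cn (n + 2)\<close>, one and the same
  radial integral \<open>J\<close> is the second moment of the Gaussian norm in dimension
  \<open>n\<close> and the total mass in dimension \<open>n + 2\<close>. Hence
  \<open>cn n * J = n\<close> and \<open>cn (n + 2) * J = 1\<close>, from which the ratio and the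
  positivity follow without a closed form for the ball volume.\<close>

lemma cn_add2:
  assumes n: "1 \<le> n"
  shows "cn n = real n * cn (n + 2)"
    and "cn n > 0"
proof -
  define J where "J = (\<integral>\<^sup>+p. ennreal (p ^ (n + 1) * exp (- p\<^sup>2 / 2)) * indicator {0<..} p \<partial>lborel)"
  have cnn: "cn m \<ge> 0" for m by (simp add: cn_def)
  have 1: "ennreal (cn n) * J = ennreal (real n)"
  proof -
    have "ennreal (real n) = (\<integral>\<^sup>+p. ennreal (cn n * p ^ (n - 1) * exp (- p\<^sup>2 / 2)) * indicator {0<..} p * ennreal (p\<^sup>2) \<partial>lborel)"
      using nn_integral_std_gauss_radial[OF n, of "\<lambda>p. ennreal (p\<^sup>2)"] nn_integral_std_gauss_norm2[of n] by simp
    also have "\<dots> = (\<integral>\<^sup>+p. ennreal (cn n) * (ennreal (p ^ (n + 1) * exp (- p\<^sup>2 / 2)) * indicator {0<..} p) \<partial>lborel)"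
    proof (intro nn_integral_cong)
      fix p :: real
      have "p ^ (n + 1) = p ^ (n - 1) * p\<^sup>2"
        using n by (simp add: power_add[symmetric])
      then have *: "cn n * (p ^ (n + 1) * exp (- p\<^sup>2 / 2)) = cn n * p ^ (n - 1) * exp (- p\<^sup>2 / 2) * p\<^sup>2" by simp
      show "ennreal (cn n * p ^ (n - 1) * exp (- p\<^sup>2 / 2)) * indicator {0<..} p * ennreal (p\<^sup>2)
        = ennreal (cn n) * (ennreal (p ^ (n + 1) * exp (- p\<^sup>2 / 2)) * indicator {0<..} p)"
      proof (cases "p > 0")
        case True
        have "ennreal (cn n * p ^ (n - 1) * exp (- p\<^sup>2 / 2)) * ennreal (p\<^sup>2)
            = ennreal (cn n * p ^ (n - 1) * exp (- p\<^sup>2 / 2) * p\<^sup>2)"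
          using True cnn[of n] by (intro ennreal_mult[symmetric]) auto
        moreover have "ennreal (cn n) * ennreal (p ^ (n + 1) * exp (- p\<^sup>2 / 2))
            = ennreal (cn n * (p ^ (n + 1) * exp (- p\<^sup>2 / 2)))"
          using True cnn[of n] by (intro ennreal_mult[symmetric]) auto
        ultimately show ?thesis using True by (simp only: *) simp
      qed simp
    qed
    also have "\<dots> = ennreal (cn n) * J" unfolding J_def by (rule nn_integral_cmult) measurable
    finally show ?thesis by simp
  qed
  have 2: "ennreal (cn (n + 2)) * J = 1"
  proof -
    have "1 = (\<integral>\<^sup>+p. ennreal (cn (n + 2) * p ^ (n + 2 - 1) * exp (- p\<^sup>2 / 2)) * indicator {0<..} p \<partial>lborel)"
      using nn_integral_std_gauss_radial[of "n + 2" "\<lambda>p. 1"] prob_space.emeasure_space_1[OF prob_space_std_gauss[of "n + 2"]]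
      by simp
    also have "\<dots> = (\<integral>\<^sup>+p. ennreal (cn (n + 2)) * (ennreal (p ^ (n + 1) * exp (- p\<^sup>2 / 2)) * indicator {0<..} p) \<partial>lborel)"
    proof (intro nn_integral_cong)
      fix p :: real
      have "n + 2 - 1 = n + 1" by simp
      then show "ennreal (cn (n + 2) * p ^ (n + 2 - 1) * exp (- p\<^sup>2 / 2)) * indicator {0<..} p
        = ennreal (cn (n + 2)) * (ennreal (p ^ (n + 1) * exp (- p\<^sup>2 / 2)) * indicator {0<..} p)"
        using cnn[of "n + 2"] by (cases "p > 0") (simp_all add: ennreal_mult[symmetric] mult.assoc)
    qed
    also have "\<dots> = ennreal (cn (n + 2)) * J" unfolding J_def by (rule nn_integral_cmult) measurable
    finally show ?thesis by simp
  qed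
  have J: "J \<noteq> \<infinity>" "J \<noteq> 0"
  proof -
    show "J \<noteq> 0" using 2 by auto
    show "J \<noteq> \<infinity>" using 2 by (auto simp: ennreal_mult_top split: if_splits)
  qed
  then obtain j where j: "J = ennreal j" "j > 0"
    by (cases J) auto
  have "cn n * j = real n" using 1 cnn[of n] j by (simp add: ennreal_mult[symmetric])
  moreover have "cn (n + 2) * j = 1" using 2 cnn[of "n + 2"] j by (simp add: ennreal_mult[symmetric] ennreal_eq_1)
  ultimately show "cn n = real n * cn (n + 2)" "cn n > 0"
    using j n cnn[of n] by (auto simp: less_le)
       (metis (no_types, opaque_lifting) mult.assoc mult.right_neutral mult_cancel_right less_irrefl)
qed

text \<open>Multiplying the chi density of dimension \<open>n\<close> by \<open>p ^ (2 * k)\<close>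
  gives a multiple of the chi density of dimension \<open>n + 2 * k\<close>. Iterating
  \<open>cn_add2\<close> identifies the multiple as
  \<open>n (n + 2) ... (n + 2 k - 2)\<close>.\<close>

lemma nn_integral_std_gauss_norm_power:
  assumes n: "1 \<le> n"
  shows "(\<integral>\<^sup>+z. ennreal ((vnorm n z) ^ (2 * k)) \<partial>std_gauss n) = ennreal (2 ^ k * pochhammer (real n / 2) k)"
proof -
  have c: "cn n = 2 ^ k * pochhammer (real n / 2) k * cn (n + 2 * k)"
  proof (induction k)
    case (Suc k)
    have "cn (n + 2 * k) = real (n + 2 * k) * cn (n + 2 * Suc k)"
      using cn_add2(1)[of "n + 2 * k"] n by (simp add: ac_simps)
    then show ?case using Suc by (simp add: pochhammer_Suc algebra_simps)
  qed simp
  let ?q = "2 ^ k * pochhammer (real n / 2) k"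
  have q: "?q \<ge> 0" using pochhammer_half_pos[OF n, of k] by simp
  have cpos: "cn (n + 2 * k) \<ge> 0" by (simp add: cn_def)
  have "(\<integral>\<^sup>+z. ennreal ((vnorm n z) ^ (2 * k)) \<partial>std_gauss n)
     = (\<integral>\<^sup>+p. ennreal (cn n * p ^ (n - 1) * exp (- p\<^sup>2 / 2)) * indicator {0<..} p * ennreal (p ^ (2 * k)) \<partial>lborel)"
    by (rule nn_integral_std_gauss_radial[OF n]) measurable
  also have "\<dots> = (\<integral>\<^sup>+p. ennreal ?q * (ennreal (cn (n + 2 * k) * p ^ (n + 2 * k - 1) * exp (- p\<^sup>2 / 2)) * indicator {0<..} p) \<partial>lborel)"
  proof (intro nn_integral_cong)
    fix p :: real
    have "p ^ (n + 2 * k - 1) = p ^ (n - 1) * p ^ (2 * k)"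
      using n by (simp add: power_add[symmetric])
    then have *: "?q * (cn (n + 2 * k) * p ^ (n + 2 * k - 1) * exp (- p\<^sup>2 / 2)) = cn n * p ^ (n - 1) * exp (- p\<^sup>2 / 2) * p ^ (2 * k)"
      unfolding c by (simp add: ac_simps)
    show "ennreal (cn n * p ^ (n - 1) * exp (- p\<^sup>2 / 2)) * indicator {0<..} p * ennreal (p ^ (2 * k))
       = ennreal ?q * (ennreal (cn (n + 2 * k) * p ^ (n + 2 * k - 1) * exp (- p\<^sup>2 / 2)) * indicator {0<..} p)"
    proof (cases "p > 0")
      case True
      have "ennreal ?q * ennreal (cn (n + 2 * k) * p ^ (n + 2 * k - 1) * exp (- p\<^sup>2 / 2))
          = ennreal (?q * (cn (n + 2 * k) * p ^ (n + 2 * k - 1) * exp (- p\<^sup>2 / 2)))"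
        using True q cpos by (intro ennreal_mult[symmetric]) auto
      moreover have "ennreal (cn n * p ^ (n - 1) * exp (- p\<^sup>2 / 2)) * ennreal (p ^ (2 * k)) = ennreal (cn n * p ^ (n - 1) * exp (- p\<^sup>2 / 2) * p ^ (2 * k))"
        using True cn_add2(2)[OF n] by (intro ennreal_mult[symmetric]) auto
      ultimately show ?thesis using True by (simp only: *) simp
    qed simp
  qed
  also have "\<dots> = ennreal ?q * (\<integral>\<^sup>+p. ennreal (cn (n + 2 * k) * p ^ (n + 2 * k - 1) * exp (- p\<^sup>2 / 2)) * indicator {0<..} p \<partial>lborel)"
    by (rule nn_integral_cmult) measurable
  also have "(\<integral>\<^sup>+p. ennreal (cn (n + 2 * k) * p ^ (n + 2 * k - 1) * exp (- p\<^sup>2 / 2)) * indicator {0<..} p \<partial>lborel) = 1"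
    using nn_integral_std_gauss_radial[of "n + 2 * k" "\<lambda>p. 1"] prob_space.emeasure_space_1[OF prob_space_std_gauss[of "n + 2 * k"]] n
    by simp
  finally show ?thesis by simp
qed

lemma AE_vnorm_pos:
  assumes n: "1 \<le> n"
  shows "AE y in Rn n. vnorm n y > 0"
proof -
  have "(\<integral>\<^sup>+y. indicator {0} (vnorm n y) \<partial>Rn n)
     = (\<integral>\<^sup>+p. ennreal (real n * Vb n * p ^ (n - 1)) * indicator {0<..} p * indicator {0} p \<partial>lborel)"
    by (rule nn_integral_radial[OF n]) measurable
  also have "\<dots> = (\<integral>\<^sup>+p. 0 \<partial>(lborel :: real measure))"
    by (intro nn_integral_cong) (auto simp: indicator_def)
  finally have "(\<integral>\<^sup>+y. indicator {0} (vnorm n y) \<partial>Rn n) = 0" by simp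
  then have "AE y in Rn n. indicator {0} (vnorm n y) = (0::ennreal)"
    by (subst (asm) nn_integral_0_iff_AE) measurable
  then show ?thesis
    by eventually_elim (use vnorm_nonneg[of n] in \<open>auto simp: indicator_def less_le split: if_splits\<close>)
qed

subsection \<open>The uniform distribution on the sphere\<close>

lemma prob_space_unif_sphere_aux:
  assumes n: "1 \<le> n"
  shows "prob_space (uniform_measure (Rn n) {x \<in> space (Rn n). vnorm n x \<le> 1})"
proof (rule prob_space_uniform_measure)
  let ?B = "{x \<in> space (Rn n). vnorm n x \<le> 1}"
  show "emeasure (Rn n) ?B \<noteq> \<infinity>" using emeasure_ball_finite[of n] by simp
  have "Vb n \<noteq> 0" using cn_add2(2)[OF n] by (auto simp: cn_def)
  then have "0 < ennreal (1 ^ n * Vb n)" using Vb_nonneg[of n] by (simp add: less_le)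
  also have "\<dots> = emeasure (Rn n) {x \<in> space (Rn n). vnorm n x < 1}"
    by (rule emeasure_ball[symmetric]) simp
  also have "\<dots> \<le> emeasure (Rn n) ?B" by (rule emeasure_mono) (auto, measurable)
  finally show "emeasure (Rn n) ?B \<noteq> 0" by simp
qed

lemma measurable_sphere_proj [measurable]: "(\<lambda>x. vscale n (R / vnorm n x) x) \<in> measurable (Rn n) (Rn n)"
  by (rule measurable_vscale[OF _ measurable_ident_sets[OF refl]]) measurable

lemma sets_unif_sphere [measurable_cong]: "sets (unif_sphere n R) = sets (Rn n)"
  by (simp add: unif_sphere_def)

lemma prob_space_unif_sphere: "1 \<le> n \<Longrightarrow> prob_space (unif_sphere n R)"
  unfolding unif_sphere_def
  by (rule prob_space.prob_space_distr[OF prob_space_unif_sphere_aux]) simp_all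

lemma AE_unif_sphere:
  assumes n: "1 \<le> n" and R: "0 \<le> R"
  shows "AE x in unif_sphere n R. vnorm n x = R"
proof -
  have "AE x in Rn n. vnorm n (vscale n (R / vnorm n x) x) = R"
    using AE_vnorm_pos[OF n] by eventually_elim (use R in \<open>simp add: vnorm_vscale\<close>)
  then have "AE x in uniform_measure (Rn n) {x \<in> space (Rn n). vnorm n x \<le> 1}. vnorm n (vscale n (R / vnorm n x) x) = R"
    by (intro AE_uniform_measureI) auto
  moreover have "{x \<in> space (Rn n). vnorm n x = R} \<in> sets (Rn n)" by measurable
  ultimately show ?thesis unfolding unif_sphere_def by (subst AE_distr_iff) simp_all
qed

text \<open>The uniform law on the ball has a radial density and is therefore invariant; homogeneity
  of the orthogonal map carries the invariance through the radial projection.\<close>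

lemma rotinv_unif_sphere: "rotinv n (unif_sphere n R)"
  unfolding rotinv_def
proof (intro conjI allI impI)
  fix T assume T: "orth n T"
  note Tm [measurable] = orth_measurable[OF T]
  let ?B = "{x \<in> space (Rn n). vnorm n x \<le> 1}"
  let ?U = "uniform_measure (Rn n) ?B"
  let ?p = "\<lambda>x. vscale n (R / vnorm n x) x"
  have U: "?U = density (Rn n) (\<lambda>x. indicator {..1} (vnorm n x) / emeasure (Rn n) ?B)"
    unfolding uniform_measure_def by (intro density_cong) (auto simp: indicator_def, measurable)
  have rU: "rotinv n ?U" unfolding U by (rule rotinv_density_vnorm) measurable
  have pm: "?p \<in> measurable ?U (Rn n)" "T \<in> measurable ?U (Rn n)" by (simp_all add: Tm)
  have "distr (unif_sphere n R) (Rn n) T = distr ?U (Rn n) (T \<circ> ?p)"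
    unfolding unif_sphere_def by (rule distr_distr[OF Tm pm(1)])
  also have "\<dots> = distr ?U (Rn n) (?p \<circ> T)"
  proof (rule distr_cong[OF refl refl])
    fix x assume "x \<in> space ?U"
    then have x: "x \<in> space (Rn n)" by simp
    have "T (?p x) = vscale n (R / vnorm n x) (T x)" using T x by (simp add: orth_def)
    then show "(T \<circ> ?p) x = (?p \<circ> T) x" by (simp add: orth_vnorm[OF T x])
  qed
  also have "\<dots> = distr (distr ?U (Rn n) T) (Rn n) ?p"
    by (rule distr_distr[OF _ pm(2), symmetric]) measurable
  also have "distr ?U (Rn n) T = ?U" using rU T by (simp add: rotinv_def)
  finally show "distr (unif_sphere n R) (Rn n) T = unif_sphere n R" by (simp add: unif_sphere_def)
qed (simp add: sets_unif_sphere)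

lemma rotinv_std_gauss: assumes n: "1 \<le> n" shows "rotinv n (std_gauss n)"
proof -
  have "gd n 1 (ve1 n 0) y = (1 / sqrt (2 * pi)) ^ n * exp (- (vnorm n y)\<^sup>2 / 2)" for y
    using n by (simp add: gd_eq vdot_ve1 vnorm_power2)
  then show ?thesis
    unfolding std_gauss_eq by (simp only:) (rule rotinv_density_vnorm, measurable)
qed

lemma std_gauss_coord_moment:
  assumes n: "1 \<le> n"
  shows "(\<integral>\<^sup>+z. ennreal ((z 0) ^ (2 * k)) \<partial>std_gauss n) = ennreal (fact (2 * k) / (2 ^ k * fact k))"
proof -
  have d: "distr (std_gauss n) lborel (\<lambda>y. y 0) = density lborel (\<lambda>t. ennreal (std_normal_density t))"
    using distr_gd_coord[of 1 "ve1 n 0" n 0] n by (simp add: std_gauss_eq) (simp add: ve1_def)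
  have m: "(\<lambda>y. y 0) \<in> measurable (std_gauss n) lborel"
    using measurable_coord[of 0 n] n by (simp cong: measurable_cong_sets add: sets_std_gauss)
  have "(\<integral>\<^sup>+z. ennreal ((z 0) ^ (2 * k)) \<partial>std_gauss n) = (\<integral>\<^sup>+t. ennreal (t ^ (2 * k)) \<partial>distr (std_gauss n) lborel (\<lambda>y. y 0))"
    by (subst nn_integral_distr[OF m]) auto
  also have "\<dots> = (\<integral>\<^sup>+t. ennreal (std_normal_density t * t ^ (2 * k)) \<partial>lborel)"
    unfolding d by (subst nn_integral_density) (auto simp: ennreal_mult)
  also have "\<dots> = ennreal (fact (2 * k) / (2 ^ k * fact k))"
    using std_normal_moment_even[of k] by (simp add: has_bochner_integral_iff nn_integral_eq_integral)
  finally show ?thesis .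
qed

text \<open>Compute the mean of \<open>(vdot n x z) ^ (2 * k)\<close> for \<open>x\<close> on the
  sphere and a Gaussian \<open>z\<close> in two ways. For fixed \<open>x\<close>, invariance of the
  law of \<open>z\<close> leaves a one-dimensional Gaussian moment; for fixed \<open>z\<close>,
  invariance of the law of \<open>x\<close> leaves the wanted moment times a moment of the norm of
  \<open>z\<close>.\<close>

lemma unif_sphere_coord_moment:
  assumes n: "1 \<le> n" and R: "0 \<le> R"
  shows "(\<integral>\<^sup>+x. ennreal ((x 0) ^ (2 * k)) \<partial>unif_sphere n R) = ennreal (R ^ (2 * k) * fact (2 * k) * bc n k)"
proof -
  let ?Q = "unif_sphere n R"
  define m where "m = (\<integral>\<^sup>+x. ennreal ((x 0) ^ (2 * k)) \<partial>?Q)"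
  interpret Q: prob_space ?Q by (rule prob_space_unif_sphere[OF n])
  interpret G: prob_space "std_gauss n" by (rule prob_space_std_gauss)
  interpret QG: pair_sigma_finite ?Q "std_gauss n"
    by (intro pair_sigma_finite.intro Q.sigma_finite_measure_axioms G.sigma_finite_measure_axioms)
  have fm: "case_prod (\<lambda>a b. ennreal (a ^ (2 * k))) \<in> borel_measurable (borel \<Otimes>\<^sub>M (borel :: real measure))"
    by measurable
  have sQ: "space ?Q = space (Rn n)" by (rule sets_eq_imp_space_eq[OF sets_unif_sphere])
  have [measurable]: "(\<lambda>x. x 0) \<in> borel_measurable (Rn n)"
    using measurable_coord[of 0 n] n by simp
  have x0: "(\<lambda>x. ennreal ((x 0) ^ (2 * k))) \<in> borel_measurable (Rn n)" by measurable
  have dm: "(\<lambda>(x, z). ennreal ((vdot n x z) ^ (2 * k))) \<in> borel_measurable (?Q \<Otimes>\<^sub>M std_gauss n)"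
  proof -
    have [measurable]: "(\<lambda>p. vdot n (fst p) (snd p)) \<in> borel_measurable (?Q \<Otimes>\<^sub>M std_gauss n)"
      by (rule measurable_vdot) (simp_all cong: measurable_cong_sets add: sets_unif_sphere sets_std_gauss)
    show ?thesis unfolding case_prod_beta by measurable
  qed
  have pw: "ennreal ((a * b) ^ (2 * k)) = ennreal (a ^ (2 * k)) * ennreal (b ^ (2 * k))" for a b :: real
    by (simp add: power_mult_distrib ennreal_mult)
  have A: "(\<integral>\<^sup>+z. ennreal ((vdot n x z) ^ (2 * k)) \<partial>std_gauss n) = ennreal ((vnorm n x) ^ (2 * k)) * ennreal (fact (2 * k) / (2 ^ k * fact k))"
    if x: "x \<in> space (Rn n)" for x
  proof -
    have "(\<integral>\<^sup>+z. ennreal ((vdot n x z) ^ (2 * k)) \<partial>std_gauss n) = (\<integral>\<^sup>+z. ennreal ((vnorm n x * z 0) ^ (2 * k)) \<partial>std_gauss n)"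
      by (rule rotinv_nn_integral[OF rotinv_std_gauss[OF n] n x fm])
    also have "\<dots> = ennreal ((vnorm n x) ^ (2 * k)) * (\<integral>\<^sup>+z. ennreal ((z 0) ^ (2 * k)) \<partial>std_gauss n)"
      unfolding pw by (rule nn_integral_cmult) (use x0 in \<open>simp cong: measurable_cong_sets add: sets_std_gauss\<close>)
    finally show ?thesis by (simp only: std_gauss_coord_moment[OF n])
  qed
  have B: "(\<integral>\<^sup>+x. ennreal ((vdot n x z) ^ (2 * k)) \<partial>?Q) = ennreal ((vnorm n z) ^ (2 * k)) * m"
    if z: "z \<in> space (Rn n)" for z
  proof -
    have "(\<integral>\<^sup>+x. ennreal ((vdot n z x) ^ (2 * k)) \<partial>?Q) = (\<integral>\<^sup>+x. ennreal ((vnorm n z * x 0) ^ (2 * k)) \<partial>?Q)"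
      by (rule rotinv_nn_integral[OF rotinv_unif_sphere n z fm])
    also have "\<dots> = ennreal ((vnorm n z) ^ (2 * k)) * m"
      unfolding pw m_def by (rule nn_integral_cmult) (use x0 in \<open>simp cong: measurable_cong_sets add: sets_unif_sphere\<close>)
    finally show ?thesis by (simp only: vdot_commute)
  qed
  have "(\<integral>\<^sup>+x. \<integral>\<^sup>+z. ennreal ((vdot n x z) ^ (2 * k)) \<partial>std_gauss n \<partial>?Q)
      = (\<integral>\<^sup>+x. ennreal (R ^ (2 * k)) * ennreal (fact (2 * k) / (2 ^ k * fact k)) \<partial>?Q)"
  proof (rule nn_integral_cong_AE)
    show "AE x in ?Q. (\<integral>\<^sup>+z. ennreal ((vdot n x z) ^ (2 * k)) \<partial>std_gauss n) = ennreal (R ^ (2 * k)) * ennreal (fact (2 * k) / (2 ^ k * fact k))"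
      using AE_unif_sphere[OF n R] AE_space[of ?Q] by eventually_elim (simp add: A sQ)
  qed
  also have "\<dots> = ennreal (R ^ (2 * k)) * ennreal (fact (2 * k) / (2 ^ k * fact k))"
    by (simp add: Q.emeasure_space_1)
  finally have 1: "(\<integral>\<^sup>+x. \<integral>\<^sup>+z. ennreal ((vdot n x z) ^ (2 * k)) \<partial>std_gauss n \<partial>?Q)
      = ennreal (R ^ (2 * k)) * ennreal (fact (2 * k) / (2 ^ k * fact k))" .
  have "(\<integral>\<^sup>+x. \<integral>\<^sup>+z. ennreal ((vdot n x z) ^ (2 * k)) \<partial>std_gauss n \<partial>?Q)
      = (\<integral>\<^sup>+z. \<integral>\<^sup>+x. ennreal ((vdot n x z) ^ (2 * k)) \<partial>?Q \<partial>std_gauss n)"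
    by (rule QG.Fubini'[OF dm, symmetric])
  also have "\<dots> = (\<integral>\<^sup>+z. ennreal ((vnorm n z) ^ (2 * k)) * m \<partial>std_gauss n)"
    by (intro nn_integral_cong B) (simp add: space_std_gauss)
  also have "\<dots> = (\<integral>\<^sup>+z. ennreal ((vnorm n z) ^ (2 * k)) \<partial>std_gauss n) * m"
    by (rule nn_integral_multc) measurable
  also have "\<dots> = ennreal (2 ^ k * pochhammer (real n / 2) k) * m"
    by (simp only: nn_integral_std_gauss_norm_power[OF n])
  finally have 2: "ennreal (2 ^ k * pochhammer (real n / 2) k) * m = ennreal (R ^ (2 * k)) * ennreal (fact (2 * k) / (2 ^ k * fact k))"
    using 1 by simp
  let ?p = "2 ^ k * pochhammer (real n / 2) k"
  have p: "?p > 0" using pochhammer_half_pos[OF n, of k] by simp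
  \<comment> \<open>Equation \<open>2\<close> makes a positive multiple of \<open>m\<close>
    finite.\<close>
  have "m \<noteq> \<infinity>" using 2 p by (auto simp: ennreal_mult_top ennreal_mult[symmetric] split: if_splits)
  then obtain j where j: "m = ennreal j" "j \<ge> 0" by (cases m) auto
  have gen: "a * b = c \<Longrightarrow> a > 0 \<Longrightarrow> b = c / a" for a b c :: real by auto
  have "?p * j = R ^ (2 * k) * (fact (2 * k) / (2 ^ k * fact k))"
  proof -
    have "ennreal (?p * j) = ennreal ?p * ennreal j"
      by (rule ennreal_mult) (use p j in auto)
    moreover have "ennreal (R ^ (2 * k) * (fact (2 * k) / (2 ^ k * fact k))) = ennreal (R ^ (2 * k)) * ennreal (fact (2 * k) / (2 ^ k * fact k))"
      by (rule ennreal_mult) (use R in auto)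
    ultimately have "ennreal (?p * j) = ennreal (R ^ (2 * k) * (fact (2 * k) / (2 ^ k * fact k)))"
      using 2 j(1) by simp
    then show ?thesis using p j R by (subst (asm) ennreal_inj) auto
  qed
  then have "j = R ^ (2 * k) * (fact (2 * k) / (2 ^ k * fact k)) / ?p" 
    by (rule gen) (rule p)
  also have "\<dots> = R ^ (2 * k) * fact (2 * k) * (1 / (2 ^ k * 2 ^ k * fact k * pochhammer (real n / 2) k))"
    by simp
  also have "(2::real) ^ k * 2 ^ k = 4 ^ k" by (simp add: power_mult_distrib[symmetric])
  finally have "j = R ^ (2 * k) * fact (2 * k) * bc n k" by (simp add: bc_def)
  then show ?thesis using j by (simp add: m_def)
qed

lemma cosh_sums: "(\<lambda>k. x ^ (2 * k) / fact (2 * k)) sums cosh (x::real)"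
proof -
  have "(\<lambda>k. (\<lambda>n. if even n then x ^ n / fact n else 0) (2 * k)) sums cosh x
    \<longleftrightarrow> (\<lambda>n. if even n then x ^ n / fact n else 0) sums cosh x"
    by (rule sums_mono_reindex) (auto simp: strict_mono_def elim!: evenE)
  moreover have "(\<lambda>n. if even n then x ^ n / fact n else 0) sums cosh x"
    using cosh_converges[of x] by (simp add: divide_inverse mult.commute scaleR_conv_of_real cong: if_cong)
  ultimately show ?thesis by simp
qed

text \<open>Averaging over opposite points replaces \<open>exp\<close> by \<open>cosh\<close>, a
  series of nonnegative terms, so it may be integrated termwise without a convergence argument. The
  even coordinate moments then produce the coefficients \<open>bc n k\<close>.\<close>

lemma unif_sphere_exp:
  assumes n: "1 \<le> n" and R: "0 \<le> R" and y: "y \<in> space (Rn n)"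
  shows "(\<integral>\<^sup>+x. ennreal (exp (vdot n y x)) \<partial>unif_sphere n R) = ennreal (Phi n (R * vnorm n y))"
proof -
  let ?Q = "unif_sphere n R"
  let ?t = "vnorm n y"
  let ?f = "\<lambda>a b :: real. ennreal (exp a)"
  have fm: "case_prod ?f \<in> borel_measurable (borel \<Otimes>\<^sub>M borel)" by measurable
  have [measurable]: "(\<lambda>x. x 0) \<in> borel_measurable ?Q"
    using measurable_coord[of 0 n] n by (simp cong: measurable_cong_sets add: sets_unif_sphere)
  have 1: "(\<integral>\<^sup>+x. ennreal (exp (vdot n y x)) \<partial>?Q) = (\<integral>\<^sup>+x. ennreal (exp (?t * x 0)) \<partial>?Q)"
    by (rule rotinv_nn_integral[OF rotinv_unif_sphere n y fm])
  \<comment> \<open>The vector \<open>ve1 n (- ?t)\<close> has norm \<open>?t\<close> as well;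
    invariance applied to it is the symmetry under reflection.\<close>
  have 2: "(\<integral>\<^sup>+x. ennreal (exp (- ?t * x 0)) \<partial>?Q) = (\<integral>\<^sup>+x. ennreal (exp (?t * x 0)) \<partial>?Q)"
    using rotinv_nn_integral[OF rotinv_unif_sphere n ve1_in_space[of n "- ?t"] fm, of R]
    by (simp add: vdot_ve1[OF n] vnorm_ve1[OF n])
  have "2 * (\<integral>\<^sup>+x. ennreal (exp (vdot n y x)) \<partial>?Q)
      = (\<integral>\<^sup>+x. ennreal (exp (?t * x 0)) \<partial>?Q) + (\<integral>\<^sup>+x. ennreal (exp (- ?t * x 0)) \<partial>?Q)"
    unfolding 1 2 by (simp add: mult_2)
  also have "\<dots> = (\<integral>\<^sup>+x. ennreal (exp (?t * x 0)) + ennreal (exp (- ?t * x 0)) \<partial>?Q)"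
    by (rule nn_integral_add[symmetric]) measurable
  also have "\<dots> = (\<integral>\<^sup>+x. 2 * (\<Sum>k. ennreal ((?t * x 0) ^ (2 * k) / fact (2 * k))) \<partial>?Q)"
  proof (intro nn_integral_cong)
    fix x :: "nat \<Rightarrow> real"
    have "exp (?t * x 0) + exp (- ?t * x 0) = 2 * cosh (?t * x 0)" by (simp add: cosh_def)
    moreover have "ennreal (cosh (?t * x 0)) = (\<Sum>k. ennreal ((?t * x 0) ^ (2 * k) / fact (2 * k)))"
      by (rule suminf_ennreal_eq[OF _ cosh_sums, symmetric]) simp
    moreover have "ennreal (exp (?t * x 0)) + ennreal (exp (- ?t * x 0)) = ennreal (exp (?t * x 0) + exp (- ?t * x 0))"
      by (rule ennreal_plus[symmetric]) simp_all
    moreover have "ennreal (2 * cosh (?t * x 0)) = ennreal 2 * ennreal (cosh (?t * x 0))"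
      by (rule ennreal_mult) (simp_all add: cosh_def)
    ultimately show "ennreal (exp (?t * x 0)) + ennreal (exp (- ?t * x 0)) = 2 * (\<Sum>k. ennreal ((?t * x 0) ^ (2 * k) / fact (2 * k)))"
      by (simp only: ennreal_numeral)
  qed
  also have "\<dots> = 2 * (\<integral>\<^sup>+x. (\<Sum>k. ennreal ((?t * x 0) ^ (2 * k) / fact (2 * k))) \<partial>?Q)"
    by (rule nn_integral_cmult) measurable
  also have "(\<integral>\<^sup>+x. (\<Sum>k. ennreal ((?t * x 0) ^ (2 * k) / fact (2 * k))) \<partial>?Q)
      = (\<Sum>k. \<integral>\<^sup>+x. ennreal ((?t * x 0) ^ (2 * k) / fact (2 * k)) \<partial>?Q)"
    by (rule nn_integral_suminf) measurable
  also have "\<dots> = (\<Sum>k. ennreal (bc n k * ((R * ?t)\<^sup>2) ^ k))"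
  proof (rule suminf_cong)
    fix k
    let ?c = "?t ^ (2 * k) / fact (2 * k)"
    have "(\<integral>\<^sup>+x. ennreal ((?t * x 0) ^ (2 * k) / fact (2 * k)) \<partial>?Q) = (\<integral>\<^sup>+x. ennreal ?c * ennreal ((x 0) ^ (2 * k)) \<partial>?Q)"
      by (intro nn_integral_cong) (simp add: power_mult_distrib ennreal_mult[symmetric])
    also have "\<dots> = ennreal ?c * ennreal (R ^ (2 * k) * fact (2 * k) * bc n k)"
      by (subst nn_integral_cmult) (simp_all only: unif_sphere_coord_moment[OF n R], measurable)
    also have "\<dots> = ennreal (?c * (R ^ (2 * k) * fact (2 * k) * bc n k))"
      using bc_pos[OF n, of k] by (intro ennreal_mult[symmetric]) auto
    also have "?c * (R ^ (2 * k) * fact (2 * k) * bc n k) = bc n k * ((R * ?t)\<^sup>2) ^ k"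
      by (simp add: power_mult power_mult_distrib)
    finally show "(\<integral>\<^sup>+x. ennreal ((?t * x 0) ^ (2 * k) / fact (2 * k)) \<partial>?Q) = ennreal (bc n k * ((R * ?t)\<^sup>2) ^ k)" .
  qed
  also have "\<dots> = ennreal (Phi n (R * ?t))"
    unfolding Phi_def using bc_pos[OF n]
    by (intro suminf_ennreal_eq summable_sums summable_bc n) (simp add: less_imp_le)
  finally show ?thesis by (simp add: ennreal_mult_cancel_left)
qed

text \<open>The output density for the uniform input on the sphere of radius \<open>R\<close>.\<close>

definition qd :: "nat \<Rightarrow> real \<Rightarrow> real \<Rightarrow> (nat \<Rightarrow> real) \<Rightarrow> real" where
  "qd n R s y = (1 / sqrt (2 * pi * s)) ^ n * exp (- ((vnorm n y)\<^sup>2 + R\<^sup>2) / (2 * s)) * Phi n (R * vnorm n y / s)"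

lemma qd_pos: "n \<ge> 1 \<Longrightarrow> s > 0 \<Longrightarrow> qd n R s y > 0"
  by (simp add: qd_def Phi_pos)

lemma measurable_qd [measurable]: "qd n R s \<in> borel_measurable (Rn n)"
  unfolding qd_def by measurable

lemma gd_factor:
  assumes "s > 0"
  shows "gd n s x y = (1 / sqrt (2 * pi * s)) ^ n * exp (- ((vnorm n y)\<^sup>2 + (vnorm n x)\<^sup>2) / (2 * s)) * exp (vdot n y x / s)"
proof -
  have "- (vdot n y y - 2 * vdot n x y + vdot n x x) / (2 * s) = - ((vnorm n y)\<^sup>2 + (vnorm n x)\<^sup>2) / (2 * s) + vdot n y x / s"
    using assms by (simp add: vnorm_power2 vdot_commute[of n y x] diff_divide_distrib add_divide_distrib)
  then show ?thesis unfolding gd_eq[OF assms] by (simp only: exp_add mult.assoc)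
qed

lemma nn_integral_gd_unif_sphere:
  assumes n: "1 \<le> n" and R: "0 \<le> R" and s: "s > 0" and y: "y \<in> space (Rn n)"
  shows "(\<integral>\<^sup>+x. ennreal (gd n s x y) \<partial>unif_sphere n R) = ennreal (qd n R s y)"
proof -
  let ?Q = "unif_sphere n R"
  let ?c = "(1 / sqrt (2 * pi * s)) ^ n * exp (- ((vnorm n y)\<^sup>2 + R\<^sup>2) / (2 * s))"
  have c: "?c \<ge> 0" using s by simp
  have "(\<integral>\<^sup>+x. ennreal (gd n s x y) \<partial>?Q) = (\<integral>\<^sup>+x. ennreal ?c * ennreal (exp (vdot n (vscale n (1 / s) y) x)) \<partial>?Q)"
  proof (rule nn_integral_cong_AE)
    show "AE x in ?Q. ennreal (gd n s x y) = ennreal ?c * ennreal (exp (vdot n (vscale n (1 / s) y) x))"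
      using AE_unif_sphere[OF n R]
    proof eventually_elim
      fix x assume "vnorm n x = R"
      then have "gd n s x y = ?c * exp (vdot n (vscale n (1 / s) y) x)"
        by (simp only: gd_factor[OF s] vdot_vscale_left) simp
      then show "ennreal (gd n s x y) = ennreal ?c * ennreal (exp (vdot n (vscale n (1 / s) y) x))"
        using c by (simp only: ennreal_mult exp_ge_zero)
    qed
  qed
  also have "\<dots> = ennreal ?c * (\<integral>\<^sup>+x. ennreal (exp (vdot n (vscale n (1 / s) y) x)) \<partial>?Q)"
    by (rule nn_integral_cmult) measurable
  also have "\<dots> = ennreal ?c * ennreal (Phi n (R * vnorm n (vscale n (1 / s) y)))"
    by (simp only: unif_sphere_exp[OF n R vscale_in_space])
  also have "R * vnorm n (vscale n (1 / s) y) = R * vnorm n y / s"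
    using s by (simp add: vnorm_vscale)
  also have "ennreal ?c * ennreal (Phi n (R * vnorm n y / s)) = ennreal (qd n R s y)"
    unfolding qd_def using c Phi_pos[OF n] by (intro ennreal_mult[symmetric]) (auto intro: less_imp_le)
  finally show ?thesis .
qed

subsection \<open>The law of the norm of a shifted Gaussian vector\<close>

text \<open>The density of \<open>|Y| / s\<close> for \<open>Y \<sim> N(x, s I)\<close> and \<open>|x| = r\<close>. With this scaling the
  likelihood ratio in \<open>r\<close> does not involve \<open>s\<close>, apart from a constant factor.\<close>

definition K :: "nat \<Rightarrow> real \<Rightarrow> real \<Rightarrow> real \<Rightarrow> real" where
  "K n s r p = cn n * p ^ (n - 1) * sqrt s ^ n * exp (- s * p\<^sup>2 / 2 - r\<^sup>2 / (2 * s)) * Phi n (r * p)"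

lemma measurable_K [measurable]: "K n s r \<in> borel_measurable borel"
  unfolding K_def by measurable

text \<open>The left side depends on \<open>x\<close> through its norm alone, so it equals its
  average over the sphere of radius \<open>r\<close>. Fubini replaces \<open>gd n s x\<close> by the
  radial density \<open>qd n r s\<close>; polar coordinates and the substitution
  \<open>p = vnorm n y / s\<close> finish.\<close>

lemma nn_integral_gd_radial:
  assumes n: "1 \<le> n" and s: "s > 0" and x: "x \<in> space (Rn n)" and r: "vnorm n x = r"
    and g [measurable]: "g \<in> borel_measurable borel"
  shows "(\<integral>\<^sup>+y. ennreal (gd n s x y) * g (vnorm n y / s) \<partial>Rn n)
    = (\<integral>\<^sup>+p. ennreal (K n s r p) * indicator {0<..} p * g p \<partial>lborel)"
proof -
  have r0: "r \<ge> 0" using r vnorm_nonneg by auto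
  let ?Q = "unif_sphere n r"
  interpret Q: prob_space ?Q by (rule prob_space_unif_sphere[OF n])
  interpret L: sigma_finite_measure "Rn n" by simp
  interpret QL: pair_sigma_finite ?Q "Rn n"
    by (intro pair_sigma_finite.intro Q.sigma_finite_measure_axioms L.sigma_finite_measure_axioms)
  have sQ: "space ?Q = space (Rn n)" by (rule sets_eq_imp_space_eq[OF sets_unif_sphere])
  define I where "I = (\<lambda>x. \<integral>\<^sup>+y. ennreal (gd n s x y) * g (vnorm n y / s) \<partial>Rn n)"
  define f where "f = (\<lambda>a b. ennreal ((1 / sqrt (2 * pi * s)) ^ n * exp (- (b\<^sup>2 + r\<^sup>2) / (2 * s)) * exp (a / s)) * g (b / s))"
  have fm: "case_prod f \<in> borel_measurable (borel \<Otimes>\<^sub>M borel)" unfolding f_def by measurable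
  have I: "I x' = (\<integral>\<^sup>+y. f (r * y 0) (vnorm n y) \<partial>Rn n)" if x': "x' \<in> space (Rn n)" "vnorm n x' = r" for x'
  proof -
    have "I x' = (\<integral>\<^sup>+y. f (vdot n x' y) (vnorm n y) \<partial>Rn n)"
      unfolding I_def f_def by (simp only: gd_factor[OF s] x'(2) vdot_commute[of n x'])
    also have "\<dots> = (\<integral>\<^sup>+y. f (vnorm n x' * y 0) (vnorm n y) \<partial>Rn n)"
      by (rule rotinv_nn_integral[OF rotinv_Rn n x'(1) fm])
    finally show ?thesis by (simp only: x'(2))
  qed
  have gm: "(\<lambda>(x, y). ennreal (gd n s x y) * g (vnorm n y / s)) \<in> borel_measurable (?Q \<Otimes>\<^sub>M Rn n)"
  proof -
    have [measurable]: "(\<lambda>p. gd n s (fst p) (snd p)) \<in> borel_measurable (?Q \<Otimes>\<^sub>M Rn n)"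
      by (rule measurable_gd) (simp_all cong: measurable_cong_sets add: sets_unif_sphere)
    show ?thesis unfolding case_prod_beta by measurable
  qed
  have "I x = (\<integral>\<^sup>+x'. I x \<partial>?Q)" by (simp add: Q.emeasure_space_1)
  also have "\<dots> = (\<integral>\<^sup>+x'. I x' \<partial>?Q)"
    by (rule nn_integral_cong_AE) (use AE_unif_sphere[OF n r0] AE_space[of ?Q] in \<open>eventually_elim, simp add: I x r sQ\<close>)
  also have "\<dots> = (\<integral>\<^sup>+y. \<integral>\<^sup>+x'. ennreal (gd n s x' y) * g (vnorm n y / s) \<partial>?Q \<partial>Rn n)"
    unfolding I_def by (rule QL.Fubini'[OF gm, symmetric])
  also have "\<dots> = (\<integral>\<^sup>+y. ennreal (qd n r s y) * g (vnorm n y / s) \<partial>Rn n)"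
  proof (intro nn_integral_cong)
    fix y assume y: "y \<in> space (Rn n)"
    have "(\<lambda>x. gd n s x y) \<in> borel_measurable ?Q"
      by (rule measurable_gd) (simp_all add: y cong: measurable_cong_sets add: sets_unif_sphere)
    then have "(\<integral>\<^sup>+x'. ennreal (gd n s x' y) * g (vnorm n y / s) \<partial>?Q) = (\<integral>\<^sup>+x'. ennreal (gd n s x' y) \<partial>?Q) * g (vnorm n y / s)"
      by (intro nn_integral_multc measurable_compose[OF _ measurable_ennreal])
    then show "(\<integral>\<^sup>+x'. ennreal (gd n s x' y) * g (vnorm n y / s) \<partial>?Q) = ennreal (qd n r s y) * g (vnorm n y / s)"
      by (simp only: nn_integral_gd_unif_sphere[OF n r0 s y])
  qed
  also have "\<dots> = (\<integral>\<^sup>+p. ennreal (real n * Vb n * p ^ (n - 1)) * indicator {0<..} p *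
      (ennreal ((1 / sqrt (2 * pi * s)) ^ n * exp (- (p\<^sup>2 + r\<^sup>2) / (2 * s)) * Phi n (r * p / s)) * g (p / s)) \<partial>lborel)"
    unfolding qd_def by (rule nn_integral_radial[OF n]) measurable
  also have "\<dots> = ennreal \<bar>s\<bar> * (\<integral>\<^sup>+p. ennreal (real n * Vb n * (0 + s * p) ^ (n - 1)) * indicator {0<..} (0 + s * p) *
      (ennreal ((1 / sqrt (2 * pi * s)) ^ n * exp (- ((0 + s * p)\<^sup>2 + r\<^sup>2) / (2 * s)) * Phi n (r * (0 + s * p) / s)) * g ((0 + s * p) / s)) \<partial>lborel)"
    by (rule nn_integral_real_affine) (use s in \<open>auto intro!: borel_measurable_times_ennreal\<close>)
  also have "\<dots> = (\<integral>\<^sup>+p. ennreal s * (ennreal (real n * Vb n * (s * p) ^ (n - 1)) * indicator {0<..} (s * p) *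
      (ennreal ((1 / sqrt (2 * pi * s)) ^ n * exp (- ((s * p)\<^sup>2 + r\<^sup>2) / (2 * s)) * Phi n (r * (s * p) / s)) * g (s * p / s))) \<partial>lborel)"
    using s by (subst nn_integral_cmult) (auto intro!: borel_measurable_times_ennreal)
  also have "\<dots> = (\<integral>\<^sup>+p. ennreal (K n s r p) * indicator {0<..} p * g p \<partial>lborel)"
  proof (intro nn_integral_cong)
    fix p :: real
    show "ennreal s * (ennreal (real n * Vb n * (s * p) ^ (n - 1)) * indicator {0<..} (s * p) *
      (ennreal ((1 / sqrt (2 * pi * s)) ^ n * exp (- ((s * p)\<^sup>2 + r\<^sup>2) / (2 * s)) * Phi n (r * (s * p) / s)) * g (s * p / s)))
      = ennreal (K n s r p) * indicator {0<..} p * g p"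
    proof (cases "p > 0")
      case True
      have e1: "r * (s * p) / s = r * p" using s by simp
      have e2: "- ((s * p)\<^sup>2 + r\<^sup>2) / (2 * s) = - s * p\<^sup>2 / 2 - r\<^sup>2 / (2 * s)"
        using s by (simp add: add_divide_distrib power2_eq_square diff_divide_distrib)
      have e3: "s * (s * p) ^ (n - 1) * (1 / sqrt (2 * pi * s)) ^ n = p ^ (n - 1) * (1 / sqrt (2 * pi)) ^ n * sqrt s ^ n"
      proof -
        obtain m where m: "n = Suc m" using n by (cases n) auto
        have "s * (s * p) ^ (n - 1) = s ^ n * p ^ (n - 1)"
          by (simp add: m power_mult_distrib)
        then have "s * (s * p) ^ (n - 1) * (1 / sqrt (2 * pi * s)) ^ n = p ^ (n - 1) * (s * (1 / sqrt (2 * pi * s))) ^ n"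
          by (simp only: power_mult_distrib ac_simps)
        also have "s * (1 / sqrt (2 * pi * s)) = 1 / sqrt (2 * pi) * sqrt s"
        proof -
          have "s / sqrt s = sqrt s" using s by (simp add: real_div_sqrt)
          moreover have "s * (1 / (a * b)) = 1 / a * (s / b)" for a b :: real by simp
          ultimately show ?thesis by (simp only: real_sqrt_mult[of "2 * pi" s])
        qed
        finally show ?thesis by (simp only: power_mult_distrib mult.assoc)
      qed
      have *: "K n s r p = s * ((real n * Vb n * (s * p) ^ (n - 1)) * ((1 / sqrt (2 * pi * s)) ^ n * exp (- ((s * p)\<^sup>2 + r\<^sup>2) / (2 * s)) * Phi n (r * (s * p) / s)))"
      proof -
        have gen: "N * C2 * P * Q * E * F = s * (N * A * (C * E * F))" if "s * A * C = P * C2 * Q" for N C2 P Q E F A C :: real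
          using that by algebra
        show ?thesis unfolding K_def cn_def e1 e2 by (rule gen[OF e3])
      qed
      have "ennreal (K n s r p) = ennreal s * (ennreal (real n * Vb n * (s * p) ^ (n - 1)) *
          ennreal ((1 / sqrt (2 * pi * s)) ^ n * exp (- ((s * p)\<^sup>2 + r\<^sup>2) / (2 * s)) * Phi n (r * (s * p) / s)))"
        unfolding * using s True Phi_pos[OF n, of "r * (s * p) / s"]
        by (subst ennreal_mult, simp, simp, subst ennreal_mult) simp_all
      then show ?thesis using True s by (simp add: mult.assoc)
    next
      case False
      then show ?thesis using s by (simp add: zero_less_mult_iff)
    qed
  qed
  finally show ?thesis by (simp only: I_def)
qed

definition kap :: "nat \<Rightarrow> real \<Rightarrow> real \<Rightarrow> real measure" where
  "kap n s r = density lborel (\<lambda>p. ennreal (indicator {0<..} p * K n s r p))"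

lemma sets_kap [measurable_cong, simp]: "sets (kap n s r) = sets borel"
  by (simp add: kap_def)

lemma cn_pos: "n \<ge> 1 \<Longrightarrow> cn n > 0" by (rule cn_add2(2))

lemma K_pos: "n \<ge> 1 \<Longrightarrow> s > 0 \<Longrightarrow> p > 0 \<Longrightarrow> K n s r p > 0"
  unfolding K_def by (intro mult_pos_pos cn_pos Phi_pos) auto

lemma indicator_K_nonneg: "n \<ge> 1 \<Longrightarrow> s > 0 \<Longrightarrow> 0 \<le> indicator {0<..} p * K n s r p"
  using K_pos[of n s p r] by (auto simp: indicator_def)

lemma law_gd:
  assumes n: "1 \<le> n" and s: "s > 0" and x: "x \<in> space (Rn n)"
  shows "distr (density (Rn n) (\<lambda>y. ennreal (gd n s x y))) borel (\<lambda>y. vnorm n y / s) = kap n s (vnorm n x)"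
proof (rule measure_eqI)
  fix A assume "A \<in> sets (distr (density (Rn n) (\<lambda>y. ennreal (gd n s x y))) borel (\<lambda>y. vnorm n y / s))"
  then have A [measurable]: "A \<in> sets borel" by simp
  have gm: "(\<lambda>y. ennreal (gd n s x y)) \<in> borel_measurable (Rn n)" using x by measurable
  have "emeasure (distr (density (Rn n) (\<lambda>y. ennreal (gd n s x y))) borel (\<lambda>y. vnorm n y / s)) A
     = (\<integral>\<^sup>+t. indicator A t \<partial>distr (density (Rn n) (\<lambda>y. ennreal (gd n s x y))) borel (\<lambda>y. vnorm n y / s))" by simp
  also have "\<dots> = (\<integral>\<^sup>+y. indicator A (vnorm n y / s) \<partial>density (Rn n) (\<lambda>y. ennreal (gd n s x y)))"
    by (rule nn_integral_distr) simp_all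
  also have "\<dots> = (\<integral>\<^sup>+y. ennreal (gd n s x y) * indicator A (vnorm n y / s) \<partial>Rn n)"
    by (rule nn_integral_density[OF gm]) measurable
  also have "\<dots> = (\<integral>\<^sup>+p. ennreal (K n s (vnorm n x) p) * indicator {0<..} p * indicator A p \<partial>lborel)"
    by (rule nn_integral_gd_radial[OF n s x refl]) measurable
  also have "\<dots> = (\<integral>\<^sup>+p. ennreal (indicator {0<..} p * K n s (vnorm n x) p) * indicator A p \<partial>lborel)"
    by (intro nn_integral_cong) (simp add: indicator_def)
  also have "\<dots> = emeasure (kap n s (vnorm n x)) A"
    unfolding kap_def by (subst emeasure_density) simp_all
  finally show "emeasure (distr (density (Rn n) (\<lambda>y. ennreal (gd n s x y))) borel (\<lambda>y. vnorm n y / s)) A = \<dots>" .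
qed simp

lemma prob_space_kap:
  assumes "1 \<le> n" "s > 0" "r \<ge> 0"
  shows "prob_space (kap n s r)"
proof -
  have "prob_space (distr (density (Rn n) (\<lambda>y. ennreal (gd n s (ve1 n r) y))) borel (\<lambda>y. vnorm n y / s))"
    by (rule prob_space.prob_space_distr[OF prob_space_gd]) (use assms in simp_all)
  then show ?thesis using law_gd[of n s "ve1 n r"] assms by (simp add: vnorm_ve1)
qed

lemma integral_gd_radial:
  fixes g :: "real \<Rightarrow> real"
  assumes n: "1 \<le> n" and s: "s > 0" and x: "x \<in> space (Rn n)" and g: "g \<in> borel_measurable borel"
  shows "(\<integral>y. g (vnorm n y / s) \<partial>density (Rn n) (\<lambda>y. ennreal (gd n s x y))) = (\<integral>p. g p \<partial>kap n s (vnorm n x))"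
    and "integrable (density (Rn n) (\<lambda>y. ennreal (gd n s x y))) (\<lambda>y. g (vnorm n y / s)) \<longleftrightarrow> integrable (kap n s (vnorm n x)) g"
proof -
  have m: "(\<lambda>y. vnorm n y / s) \<in> measurable (density (Rn n) (\<lambda>y. ennreal (gd n s x y))) borel" by simp
  show "(\<integral>y. g (vnorm n y / s) \<partial>density (Rn n) (\<lambda>y. ennreal (gd n s x y))) = (\<integral>p. g p \<partial>kap n s (vnorm n x))"
    unfolding law_gd[OF n s x, symmetric] by (rule integral_distr[OF m g, symmetric])
  show "integrable (density (Rn n) (\<lambda>y. ennreal (gd n s x y))) (\<lambda>y. g (vnorm n y / s)) \<longleftrightarrow> integrable (kap n s (vnorm n x)) g"
    unfolding law_gd[OF n s x, symmetric] by (rule integrable_distr_eq[OF m g, symmetric])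
qed

lemma integral_kap:
  fixes g :: "real \<Rightarrow> real"
  assumes n: "1 \<le> n" and s: "s > 0" and g [measurable]: "g \<in> borel_measurable borel"
  shows "(\<integral>p. g p \<partial>kap n s r) = (LINT p:{0<..}|lborel. K n s r p * g p)"
    and "integrable (kap n s r) g \<longleftrightarrow> set_integrable lborel {0<..} (\<lambda>p. K n s r p * g p)"
proof -
  show "(\<integral>p. g p \<partial>kap n s r) = (LINT p:{0<..}|lborel. K n s r p * g p)"
    unfolding kap_def set_lebesgue_integral_def
    by (subst integral_real_density) (auto intro!: AE_I2 indicator_K_nonneg n s simp: mult.assoc)
  show "integrable (kap n s r) g \<longleftrightarrow> set_integrable lborel {0<..} (\<lambda>p. K n s r p * g p)"
    unfolding kap_def set_integrable_def
    by (subst integrable_real_density) (auto intro!: AE_I2 indicator_K_nonneg n s simp: mult.assoc)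
qed

subsection \<open>Domination\<close>

text \<open>The Gaussian factor beats polynomial and exponential growth: multiplied by
  \<open>exp p\<close>, the left side is continuous and tends to 0, hence is bounded on the half
  line.\<close>

lemma gauss_poly_bound:
  assumes a: "a > 0"
  shows "\<exists>C\<ge>0. \<forall>p\<ge>0. (1 + p) ^ m * exp (- a * p\<^sup>2 / 2 + \<rho> * p) \<le> C * exp (- p :: real)"
proof -
  define f where "f = (\<lambda>p::real. (1 + p) ^ m * exp (- a * p\<^sup>2 / 2 + (\<rho> + 1) * p))"
  have "(f \<longlongrightarrow> 0) at_top"
  proof -
    have "((\<lambda>p::real. (1 + p) ^ m * exp (- a * p\<^sup>2 / 2 + (\<rho> + 1) * p)) \<longlongrightarrow> 0) at_top"
      using a by real_asymp
    then show ?thesis by (simp add: f_def)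
  qed
  then have "eventually (\<lambda>p. f p < 1) at_top"
    by (rule order_tendstoD) simp
  then obtain N where N: "\<And>p. p \<ge> N \<Longrightarrow> f p < 1" by (auto simp: eventually_at_top_linorder)
  have "\<exists>x\<in>{0..max N 0}. \<forall>y\<in>{0..max N 0}. f y \<le> f x"
    by (rule continuous_attains_sup) (auto simp: f_def intro!: continuous_intros)
  then obtain B where B: "\<And>p. p \<in> {0..max N 0} \<Longrightarrow> f p \<le> B" by blast
  have "f p \<le> max 1 B" if "p \<ge> 0" for p
    using N[of p] B[of p] that by (cases "p \<le> N") auto
  moreover have "f p = (1 + p) ^ m * exp (- a * p\<^sup>2 / 2 + \<rho> * p) * exp p" for p
    by (simp add: f_def exp_add[symmetric] distrib_right add.assoc mult.assoc)
  ultimately have key: "(1 + p) ^ m * exp (- a * p\<^sup>2 / 2 + \<rho> * p) * exp p \<le> max 1 B" if "p \<ge> 0" for p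
    using that by metis
  have "(1 + p) ^ m * exp (- a * p\<^sup>2 / 2 + \<rho> * p) \<le> max 1 B * exp (- p)" if "p \<ge> 0" for p
  proof -
    let ?X = "(1 + p) ^ m * exp (- a * p\<^sup>2 / 2 + \<rho> * p)"
    have "?X * exp p * exp (- p) \<le> max 1 B * exp (- p)"
      using key[OF that] by (intro mult_right_mono) auto
    moreover have "?X * exp p * exp (- p) = ?X"
      by (simp only: mult.assoc exp_add[symmetric]) simp
    ultimately show ?thesis by (simp only:)
  qed
  then show ?thesis by (intro exI[of _ "max 1 B"]) auto
qed

text \<open>One integrable majorant serves all variances in \<open>[a, b]\<close> and all radii in
  \<open>[0, \<rho>]\<close>, with room for a factor of polynomial growth. The increments of
  \<open>T\<close> and its continuity rest on it. The Gaussian factor absorbs the growth of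
  \<open>Phi n (r * p)\<close>, which is at most \<open>exp (\<rho> * p)\<close>.\<close>

lemma K_dom:
  assumes n: "n \<ge> 1" and a: "a > 0" and \<rho>: "\<rho> \<ge> 0"
  obtains C where "C \<ge> 0"
    "\<And>s r p. a \<le> s \<Longrightarrow> s \<le> b \<Longrightarrow> 0 \<le> r \<Longrightarrow> r \<le> \<rho> \<Longrightarrow> 0 \<le> p \<Longrightarrow> \<bar>K n s r p\<bar> * (1 + p) ^ m \<le> C * exp (- p)"
proof -
  obtain C where C: "C \<ge> 0" "\<And>p. p \<ge> 0 \<Longrightarrow> (1 + p) ^ (n - 1 + m) * exp (- a * p\<^sup>2 / 2 + \<rho> * p) \<le> C * exp (- p)"
    using gauss_poly_bound[OF a] by blast
  define c where "c = cn n * sqrt b ^ n"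
  have "\<bar>K n s r p\<bar> * (1 + p) ^ m \<le> (\<bar>c\<bar> * C) * exp (- p)"
    if h: "a \<le> s" "s \<le> b" "0 \<le> r" "r \<le> \<rho>" "0 \<le> p" for s r p
  proof -
    have s: "s > 0" using a h by simp
    have 1: "sqrt s ^ n \<le> sqrt b ^ n" using h s by (intro power_mono) auto
    have 2: "p ^ (n - 1) \<le> (1 + p) ^ (n - 1)" using h by (intro power_mono) auto
    have "- s * p\<^sup>2 / 2 - r\<^sup>2 / (2 * s) \<le> - a * p\<^sup>2 / 2"
    proof -
      have "a * p\<^sup>2 \<le> s * p\<^sup>2" using h by (intro mult_right_mono) auto
      moreover have "0 \<le> r\<^sup>2 / (2 * s)" using s by simp
      ultimately show ?thesis by simp
    qed
    then have 3: "exp (- s * p\<^sup>2 / 2 - r\<^sup>2 / (2 * s)) \<le> exp (- a * p\<^sup>2 / 2)" by simp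
    have "Phi n (r * p) \<le> exp (r * p)" using h by (intro Phi_le_exp n) auto
    also have "\<dots> \<le> exp (\<rho> * p)" using h by (simp add: mult_right_mono)
    finally have 4: "Phi n (r * p) \<le> exp (\<rho> * p)" .
    have c0: "c \<ge> 0" using cn_pos[OF n] h s by (simp add: c_def)
    have b0: "b \<ge> 0" using h s by simp
    have "\<bar>K n s r p\<bar> = K n s r p"
      unfolding K_def using cn_pos[OF n] h s Phi_pos[OF n, of "r * p"] by (intro abs_of_nonneg) (simp add: less_imp_le)
    also have "\<dots> \<le> cn n * (1 + p) ^ (n - 1) * sqrt b ^ n * exp (- a * p\<^sup>2 / 2) * exp (\<rho> * p)"
      unfolding K_def using cn_pos[OF n] h s Phi_pos[OF n, of "r * p"] b0
      by (intro mult_mono 1 2 3 4) (auto simp: less_imp_le)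
    also have "\<dots> = c * ((1 + p) ^ (n - 1) * exp (- a * p\<^sup>2 / 2 + \<rho> * p))"
      by (simp only: c_def exp_add ac_simps)
    finally have "\<bar>K n s r p\<bar> * (1 + p) ^ m \<le> c * ((1 + p) ^ (n - 1) * exp (- a * p\<^sup>2 / 2 + \<rho> * p)) * (1 + p) ^ m"
      using h by (intro mult_right_mono) auto
    also have "\<dots> = c * ((1 + p) ^ (n - 1 + m) * exp (- a * p\<^sup>2 / 2 + \<rho> * p))"
      by (simp only: power_add ac_simps)
    also have "\<dots> \<le> c * (C * exp (- p))"
      using h c0 by (intro mult_left_mono C(2)) auto
    finally show ?thesis using c0 by (simp add: mult.assoc)
  qed
  then show thesis using C(1) by (intro that[of "\<bar>c\<bar> * C"]) auto
qed

lemma set_integrable_exp_minus: "set_integrable lborel {0<..} (\<lambda>p::real. C * exp (- p))"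
proof -
  have "set_integrable lborel {0<..} (\<lambda>p::real. exp (- p))"
    using has_bochner_integral_I0i_power_exp_m[of 0]
    by (auto simp: set_integrable_def has_bochner_integral_iff mult.commute)
  then show ?thesis by simp
qed

lemma set_integrable_dominated:
  fixes f :: "real \<Rightarrow> real"
  assumes [measurable]: "f \<in> borel_measurable borel" and b: "\<And>p. p > 0 \<Longrightarrow> \<bar>f p\<bar> \<le> C * exp (- p)"
  shows "set_integrable lborel {0<..} f"
proof (rule set_integrable_bound[OF set_integrable_exp_minus[of C]])
  show "set_borel_measurable lborel {0<..} f" unfolding set_borel_measurable_def by measurable
  show "AE p in lborel. p \<in> {0<..} \<longrightarrow> norm (f p) \<le> norm (C * exp (- p))"
  proof (intro AE_I2 impI)
    fix p :: real assume "p \<in> {0<..}"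
    then have "\<bar>f p\<bar> \<le> C * exp (- p)" using b by simp
    then show "norm (f p) \<le> norm (C * exp (- p))" unfolding real_norm_def by linarith
  qed
qed

lemma tendsto_exp_minus_dominated:
  fixes f :: "real \<Rightarrow> real"
  assumes b: "\<And>p. p > 0 \<Longrightarrow> \<bar>f p\<bar> \<le> C * exp (- p)"
  shows "(f \<longlongrightarrow> 0) at_top"
proof (rule Lim_null_comparison)
  show "((\<lambda>p. C * exp (- p)) \<longlongrightarrow> 0) at_top" by real_asymp
  show "eventually (\<lambda>p. norm (f p) \<le> C * exp (- p)) at_top"
    using eventually_gt_at_top[of 0] by eventually_elim (use b in auto)
qed

text \<open>If \<open>\<partial>\<theta> k \<cdot> u\<close> differs from \<open>W\<close> by a \<open>p\<close>-derivative of a function vanishing at both ends,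
  then \<open>W\<close> integrates to the derivative of \<open>\<integral> k u\<close> in the parameter.\<close>

lemma integral_parameter_difference:
  fixes k k' W A :: "real \<Rightarrow> real \<Rightarrow> real" and u :: "real \<Rightarrow> real"
  assumes ab: "a \<le> b"
    and dk: "\<And>\<theta> p. a \<le> \<theta> \<Longrightarrow> \<theta> \<le> b \<Longrightarrow> p > 0 \<Longrightarrow> ((\<lambda>\<theta>. k \<theta> p) has_real_derivative k' \<theta> p) (at \<theta>)"
    and ck': "\<And>\<theta> p. a \<le> \<theta> \<Longrightarrow> \<theta> \<le> b \<Longrightarrow> p > 0 \<Longrightarrow> isCont (\<lambda>\<theta>. k' \<theta> p) \<theta>"
    and dA: "\<And>\<theta> p. a \<le> \<theta> \<Longrightarrow> \<theta> \<le> b \<Longrightarrow> p > 0 \<Longrightarrow> (A \<theta> has_real_derivative k' \<theta> p * u p - W \<theta> p) (at p)"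
    and cp: "\<And>\<theta> p. a \<le> \<theta> \<Longrightarrow> \<theta> \<le> b \<Longrightarrow> p > 0 \<Longrightarrow> isCont (\<lambda>p. k' \<theta> p * u p - W \<theta> p) p"
    and A0: "\<And>\<theta>. a \<le> \<theta> \<Longrightarrow> \<theta> \<le> b \<Longrightarrow> (A \<theta> \<longlongrightarrow> 0) (at_right 0)"
    and Atop: "\<And>\<theta>. a \<le> \<theta> \<Longrightarrow> \<theta> \<le> b \<Longrightarrow> (A \<theta> \<longlongrightarrow> 0) at_top"
    and mk [measurable]: "\<And>\<theta>. k \<theta> \<in> borel_measurable borel"
    and mu [measurable]: "u \<in> borel_measurable borel"
    and mk' [measurable]: "case_prod k' \<in> borel_measurable (borel \<Otimes>\<^sub>M borel)"
    and mW [measurable]: "\<And>\<theta>. W \<theta> \<in> borel_measurable borel"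
    and bk: "\<And>\<theta> p. a \<le> \<theta> \<Longrightarrow> \<theta> \<le> b \<Longrightarrow> p > 0 \<Longrightarrow> \<bar>k \<theta> p * u p\<bar> \<le> C * exp (- p)"
    and bk': "\<And>\<theta> p. a \<le> \<theta> \<Longrightarrow> \<theta> \<le> b \<Longrightarrow> p > 0 \<Longrightarrow> \<bar>k' \<theta> p * u p\<bar> \<le> C * exp (- p)"
    and bW: "\<And>\<theta> p. a \<le> \<theta> \<Longrightarrow> \<theta> \<le> b \<Longrightarrow> p > 0 \<Longrightarrow> \<bar>W \<theta> p\<bar> \<le> C * exp (- p)"
  shows "(LINT p:{0<..}|lborel. k b p * u p) - (LINT p:{0<..}|lborel. k a p * u p)
       = (LINT \<theta>:{a..b}|lborel. (LINT p:{0<..}|lborel. W \<theta> p))" (is ?eq)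
    and "set_integrable lborel {a..b} (\<lambda>\<theta>. LINT p:{0<..}|lborel. W \<theta> p)" (is ?int)
proof -
  have [measurable]: "k' \<theta> \<in> borel_measurable borel" for \<theta>
    using measurable_compose[OF measurable_Pair1'[of \<theta> borel borel] mk'] by simp
  have Wk': "(LINT p:{0<..}|lborel. k' \<theta> p * u p) = (LINT p:{0<..}|lborel. W \<theta> p)" if \<theta>: "a \<le> \<theta>" "\<theta> \<le> b" for \<theta>
  proof -
    have i1: "set_integrable lborel {0<..} (\<lambda>p. k' \<theta> p * u p)"
      by (rule set_integrable_dominated[OF _ bk'[OF \<theta>]]) measurable
    have i2: "set_integrable lborel {0<..} (W \<theta>)"
      by (rule set_integrable_dominated[OF _ bW[OF \<theta>]]) measurable
    have ei: "einterval 0 \<infinity> = {0<..}" by (auto simp: einterval_def)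
    \<comment> \<open>\<open>A \<theta>\<close> vanishes at both ends of the half line, so the
      integral of its derivative is 0.\<close>
    have "(LBINT p=ereal 0..\<infinity>. k' \<theta> p * u p - W \<theta> p) = 0 - 0"
    proof (rule interval_integral_FTC_integrable[where F = "A \<theta>"])
      show "(A \<theta> has_vector_derivative k' \<theta> x * u x - W \<theta> x) (at x)" if "ereal 0 < ereal x" for x
        using dA[OF \<theta>, of x] that by (simp add: has_real_derivative_iff_has_vector_derivative)
      show "isCont (\<lambda>p. k' \<theta> p * u p - W \<theta> p) x" if "ereal 0 < ereal x" for x
        using cp[OF \<theta>, of x] that by simp
      show "set_integrable lborel (einterval (ereal 0) \<infinity>) (\<lambda>p. k' \<theta> p * u p - W \<theta> p)"
        using set_integral_diff(1)[OF i1 i2] ei by (simp add: zero_ereal_def)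
      show "((A \<theta> \<circ> real_of_ereal) \<longlongrightarrow> 0) (at_right (ereal 0))"
        using A0[OF \<theta>] by (simp add: ereal_tendsto_simps)
      show "((A \<theta> \<circ> real_of_ereal) \<longlongrightarrow> 0) (at_left \<infinity>)"
        using Atop[OF \<theta>] by (simp add: ereal_tendsto_simps)
    qed auto
    moreover have "(LBINT p=ereal 0..\<infinity>. k' \<theta> p * u p - W \<theta> p) = (LINT p:{0<..}|lborel. k' \<theta> p * u p - W \<theta> p)"
      using ei by (simp add: interval_lebesgue_integral_def zero_ereal_def)
    ultimately show ?thesis using set_integral_diff(2)[OF i1 i2] by simp
  qed
  \<comment> \<open>Fubini on a strip: integrating \<open>F\<close> in \<open>\<theta>\<close> first
    gives the increment of \<open>k * u\<close>, integrating in \<open>p\<close> first gives the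
    integral of \<open>W\<close>.\<close>
  define F where "F = (\<lambda>p \<theta>. indicator {0<..} p * (indicator {a..b} \<theta> * (k' \<theta> p * u p)))"
  have mF: "case_prod F \<in> borel_measurable (lborel \<Otimes>\<^sub>M lborel)"
  proof -
    have "(\<lambda>z. case_prod k' (snd z, fst z)) \<in> borel_measurable (lborel \<Otimes>\<^sub>M lborel)"
      by (rule measurable_compose[OF _ mk']) simp
    then have [measurable]: "(\<lambda>z. k' (snd z) (fst z)) \<in> borel_measurable (lborel \<Otimes>\<^sub>M lborel)" by simp
    show ?thesis unfolding F_def case_prod_beta by measurable
  qed
  have iF: "integrable (lborel \<Otimes>\<^sub>M lborel) (case_prod F)"
  proof -
    define G where "G = (\<lambda>z::real \<times> real. indicator {0<..} (fst z) * (C * exp (- fst z)) * indicator {a..b} (snd z) :: real)"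
    have i1: "integrable lborel (\<lambda>p. indicator {0<..} p * (C * exp (- p)) :: real)"
      using set_integrable_exp_minus[of C] by (simp add: set_integrable_def)
    have ind: "integrable lborel (indicator {a..b} :: real \<Rightarrow> real)"
      using ab by (intro integrable_real_indicator) auto
    have G: "integrable (lborel \<Otimes>\<^sub>M lborel) G"
    proof (rule lborel_pair.Fubini_integrable)
      show "G \<in> borel_measurable (lborel \<Otimes>\<^sub>M lborel)" unfolding G_def by measurable
      show "AE x in lborel. integrable lborel (\<lambda>y. G (x, y))"
        unfolding G_def fst_conv snd_conv by (intro AE_I2 integrable_mult_right ind)
      have "(\<lambda>x. \<integral>y. norm (G (x, y)) \<partial>lborel) = (\<lambda>x. \<bar>indicator {0<..} x * (C * exp (- x))\<bar> * (\<integral>y. indicator {a..b} y \<partial>lborel))"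
        by (simp add: G_def abs_mult)
      then show "integrable lborel (\<lambda>x. \<integral>y. norm (G (x, y)) \<partial>lborel)"
        using integrable_mult_left[OF integrable_abs[OF i1]] by simp
    qed
    show ?thesis
    proof (rule Bochner_Integration.integrable_bound[OF G mF], intro AE_I2)
      fix z :: "real \<times> real"
      obtain p \<theta> where z: "z = (p, \<theta>)" by (cases z)
      show "norm (case_prod F z) \<le> norm (G z)"
      proof (cases "p > 0 \<and> a \<le> \<theta> \<and> \<theta> \<le> b")
        case True
        then have "\<bar>k' \<theta> p * u p\<bar> \<le> C * exp (- p)" using bk' by blast
        with True show ?thesis by (simp add: z F_def G_def)
      next
        case False
        then have "case_prod F z = 0" by (auto simp: z F_def)
        then show ?thesis by simp
      qed
    qed
  qed
  have in1: "(\<integral>\<theta>. F p \<theta> \<partial>lborel) = indicator {0<..} p * (k b p * u p - k a p * u p)" for p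
  proof (cases "p > 0")
    case True
    have "(\<integral>\<theta>. k' \<theta> p * indicator {a..b} \<theta> \<partial>lborel) = k b p - k a p"
      by (rule integral_FTC_Icc_real[OF ab]) (use dk ck' True in blast)+
    moreover have "(\<integral>\<theta>. F p \<theta> \<partial>lborel) = (\<integral>\<theta>. (k' \<theta> p * indicator {a..b} \<theta>) * u p \<partial>lborel)"
      using True by (intro Bochner_Integration.integral_cong) (simp_all add: F_def)
    ultimately show ?thesis using True by (simp add: left_diff_distrib)
  qed (simp add: F_def)
  have in2: "(\<integral>p. F p \<theta> \<partial>lborel) = indicator {a..b} \<theta> * (LINT p:{0<..}|lborel. W \<theta> p)" for \<theta>
  proof (cases "\<theta> \<in> {a..b}")
    case True
    then have "(\<integral>p. F p \<theta> \<partial>lborel) = (LINT p:{0<..}|lborel. k' \<theta> p * u p)"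
      by (simp add: F_def set_lebesgue_integral_def)
    then show ?thesis using Wk'[of \<theta>] True by simp
  qed (simp add: F_def)
  have j: "set_integrable lborel {0<..} (\<lambda>p. k \<theta> p * u p)" if "a \<le> \<theta>" "\<theta> \<le> b" for \<theta>
    by (rule set_integrable_dominated[OF _ bk[OF that]]) measurable
  have "(LINT p:{0<..}|lborel. k b p * u p) - (LINT p:{0<..}|lborel. k a p * u p)
      = (\<integral>p. (\<integral>\<theta>. F p \<theta> \<partial>lborel) \<partial>lborel)"
    unfolding in1 using set_integral_diff(2)[OF j[of b] j[of a]] ab by (simp add: set_lebesgue_integral_def)
  also have "\<dots> = (\<integral>\<theta>. (\<integral>p. F p \<theta> \<partial>lborel) \<partial>lborel)"
    by (rule lborel_pair.Fubini_integral[OF iF, symmetric])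
  also have "\<dots> = (LINT \<theta>:{a..b}|lborel. (LINT p:{0<..}|lborel. W \<theta> p))"
    unfolding in2 by (simp add: set_lebesgue_integral_def)
  finally show ?eq .
  show ?int
    using lborel_pair.integrable_snd[OF iF] unfolding in2 by (simp add: set_integrable_def)
qed

section \<open>Increments of \<open>T\<close>, the mean log-Bessel term of the output, in radius and
  in noise variance\<close>

definition T :: "nat \<Rightarrow> real \<Rightarrow> real \<Rightarrow> real \<Rightarrow> real" where
  "T n R r s = (\<integral>p. ln (Phi n (R * p)) \<partial>kap n s r)"

lemma isCont_K: "n \<ge> 1 \<Longrightarrow> isCont (K n s r) p"
  unfolding K_def[abs_def]
  by (intro continuous_intros isCont_o2[OF _ isCont_Phi] continuous_ident) auto

lemma K_has_deriv_p:
  assumes n: "n \<ge> 1" and p: "p > 0"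
  shows "(K n s r has_real_derivative K n s r p * ((real n - 1) / p - s * p + r * H n (r * p))) (at p)"
proof -
  have pw: "((\<lambda>p. p ^ (n - 1)) has_real_derivative (real n - 1) / p * p ^ (n - 1)) (at p)"
  proof -
    have "((\<lambda>x. x ^ (n - 1)) has_real_derivative real (n - 1) * p ^ (n - 1 - 1)) (at p)"
      by (auto intro!: derivative_eq_intros)
    moreover have "real (n - 1) * p ^ (n - 1 - 1) = (real n - 1) / p * p ^ (n - 1)"
      using p n by (cases "n - 1") auto
    ultimately show ?thesis by simp
  qed
  have ex: "((\<lambda>p. exp (- s * p\<^sup>2 / 2 - r\<^sup>2 / (2 * s))) has_real_derivative (- s * p) * exp (- s * p\<^sup>2 / 2 - r\<^sup>2 / (2 * s))) (at p)"
    by (auto intro!: derivative_eq_intros)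
  have ph: "((\<lambda>p. Phi n (r * p)) has_real_derivative (r * H n (r * p)) * Phi n (r * p)) (at p)"
    using DERIV_chain2[OF Phi_has_deriv[OF n] DERIV_cmult[OF DERIV_ident, of r], of p] Phi_pos[OF n, of "r * p"]
    by (simp add: H_def ac_simps)
  have 1: "((\<lambda>p. cn n * p ^ (n - 1) * sqrt s ^ n) has_real_derivative (real n - 1) / p * (cn n * p ^ (n - 1) * sqrt s ^ n)) (at p)"
    using DERIV_cmult_right[OF DERIV_cmult[OF pw, of "cn n"], of "sqrt s ^ n"] by (simp add: ac_simps)
  show ?thesis
    unfolding K_def[abs_def]
    by (rule DERIV_cong[OF DERIV_mult[OF DERIV_mult[OF 1 ex] ph]]) algebra
qed

text \<open>The chain rule multiplies the Riccati equation by \<open>r\<close>, which cancels the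
  \<open>r\<close> in \<open>(n - 1) / (r * p)\<close>. In this form the equation includes
  \<open>r = 0\<close>.\<close>

lemma H_has_deriv_scaled:
  assumes n: "n \<ge> 1" and p: "p > 0" and r: "r \<ge> 0"
  shows "((\<lambda>p. H n (r * p)) has_real_derivative r * (1 - (H n (r * p))\<^sup>2) - (real n - 1) / p * H n (r * p)) (at p)"
proof (cases "r = 0")
  case True
  then show ?thesis by simp
next
  case False
  then have "r * p \<noteq> 0" using p by simp
  from DERIV_chain2[OF H_has_deriv[OF n this] DERIV_cmult[OF DERIV_ident, of r]]
  have "((\<lambda>p. H n (r * p)) has_real_derivative (1 - (H n (r * p))\<^sup>2 - (real n - 1) / (r * p) * H n (r * p)) * r) (at p)"
    by simp
  also have "(1 - (H n (r * p))\<^sup>2 - (real n - 1) / (r * p) * H n (r * p)) * r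
     = r * (1 - (H n (r * p))\<^sup>2) - (real n - 1) / p * H n (r * p)"
  proof -
    have "(real n - 1) / (r * p) * H n (r * p) * r = (real n - 1) / p * H n (r * p)" using False by simp
    then show ?thesis by algebra
  qed
  finally show ?thesis .
qed

lemma ln_Phi_has_deriv_scaled:
  assumes n: "n \<ge> 1"
  shows "((\<lambda>p. ln (Phi n (R * p))) has_real_derivative R * H n (R * p)) (at p)"
  using DERIV_chain2[OF ln_Phi_has_deriv[OF n] DERIV_cmult[OF DERIV_ident, of R], of p]
  by (simp add: mult.commute)

lemma K_has_deriv_s:
  assumes n: "n \<ge> 1" and s: "s > 0"
  shows "((\<lambda>s. K n s r p) has_real_derivative K n s r p * (real n / (2 * s) - p\<^sup>2 / 2 + r\<^sup>2 / (2 * s\<^sup>2))) (at s)"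
proof -
  have sq: "((\<lambda>s. sqrt s ^ n) has_real_derivative real n / (2 * s) * sqrt s ^ n) (at s)"
  proof -
    have "((\<lambda>s. sqrt s ^ n) has_real_derivative real n * (inverse (sqrt s) / 2 * sqrt s ^ (n - 1))) (at s)"
      using s by (auto intro!: derivative_eq_intros)
    moreover have "real n * (inverse (sqrt s) / 2 * sqrt s ^ (n - 1)) = real n / (2 * s) * sqrt s ^ n"
    proof -
      have "sqrt s ^ n = sqrt s * sqrt s ^ (n - 1)" using n by (cases n) auto
      moreover have "sqrt s / s = inverse (sqrt s)" using s by (simp add: inverse_eq_divide sqrt_divide_self_eq)
      moreover have "real n / (2 * s) * (sqrt s * y) = real n * ((sqrt s / s) / 2 * y)" for y by simp
      ultimately show ?thesis by (simp only:)
    qed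
    ultimately show ?thesis by (simp only:)
  qed
  have ex: "((\<lambda>s. exp (- s * p\<^sup>2 / 2 - r\<^sup>2 / (2 * s))) has_real_derivative (- p\<^sup>2 / 2 + r\<^sup>2 / (2 * s\<^sup>2)) * exp (- s * p\<^sup>2 / 2 - r\<^sup>2 / (2 * s))) (at s)"
    using s by (auto intro!: derivative_eq_intros simp: power2_eq_square)
  show ?thesis
    unfolding K_def
    by (rule DERIV_cong[OF DERIV_cmult_right[OF DERIV_mult[OF DERIV_cmult[OF sq, of "cn n * p ^ (n - 1)"] ex], of "Phi n (r * p)"]]) algebra
qed

lemma K_has_deriv_r:
  assumes n: "n \<ge> 1" and s: "s > 0"
  shows "((\<lambda>r. K n s r p) has_real_derivative K n s r p * (- r / s + p * H n (r * p))) (at r)"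
proof -
  have ex: "((\<lambda>r. exp (- s * p\<^sup>2 / 2 - r\<^sup>2 / (2 * s))) has_real_derivative (- r / s) * exp (- s * p\<^sup>2 / 2 - r\<^sup>2 / (2 * s))) (at r)"
    using s by (auto intro!: derivative_eq_intros)
  have ph: "((\<lambda>r. Phi n (r * p)) has_real_derivative (p * H n (r * p)) * Phi n (r * p)) (at r)"
    using DERIV_chain2[OF Phi_has_deriv[OF n] DERIV_cmult_right[OF DERIV_ident, of p], of r] Phi_pos[OF n, of "r * p"]
    by (simp add: H_def ac_simps)
  show ?thesis
    unfolding K_def
    by (rule DERIV_cong[OF DERIV_mult[OF DERIV_cmult[OF ex, of "cn n * p ^ (n - 1) * sqrt s ^ n"] ph]]) algebra
qed

lemma H_abs_le_1: "n \<ge> 1 \<Longrightarrow> t \<ge> 0 \<Longrightarrow> \<bar>H n t\<bar> \<le> 1"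
  using H_le_1[of n t] H_nonneg[of n t] by simp

lemma T_eq: "n \<ge> 1 \<Longrightarrow> s > 0 \<Longrightarrow> T n R r s = (LINT p:{0<..}|lborel. K n s r p * ln (Phi n (R * p)))"
  unfolding T_def by (rule integral_kap) simp_all

lemma isCont_H_scaled: "n \<ge> 1 \<Longrightarrow> isCont (\<lambda>p. H n (r * p)) p"
  by (rule isCont_o2[OF _ isCont_H]) (auto intro!: continuous_intros)

lemma isCont_ln_Phi_scaled: "n \<ge> 1 \<Longrightarrow> isCont (\<lambda>p. ln (Phi n (r * p))) p"
  using ln_Phi_has_deriv_scaled by (rule DERIV_isCont)

lemma le_power_one_plus: "0 \<le> p \<Longrightarrow> 1 \<le> k \<Longrightarrow> k \<le> m \<Longrightarrow> p ^ k \<le> (1 + (p::real)) ^ m"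
proof -
  assume "0 \<le> p" "k \<le> m"
  then have "p ^ k \<le> (1 + p) ^ k" by (intro power_mono) auto
  also have "\<dots> \<le> (1 + p) ^ m" using \<open>0 \<le> p\<close> \<open>k \<le> m\<close> by (intro power_increasing) auto
  finally show ?thesis .
qed

lemma K_mult_dom:
  assumes C: "\<bar>K n s r p\<bar> * (1 + p) ^ m \<le> C * exp (- p)" and x: "\<bar>x\<bar> \<le> B * (1 + p) ^ m" and B: "0 \<le> B"
  shows "\<bar>K n s r p * x\<bar> \<le> (B * C) * exp (- p)"
proof -
  have "\<bar>K n s r p * x\<bar> \<le> \<bar>K n s r p\<bar> * (B * (1 + p) ^ m)"
    unfolding abs_mult by (intro mult_left_mono x) simp
  also have "\<dots> = B * (\<bar>K n s r p\<bar> * (1 + p) ^ m)" by simp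
  also have "\<dots> \<le> B * (C * exp (- p))" by (intro mult_left_mono C B)
  finally show ?thesis by simp
qed

text \<open>By the Riccati equation \<open>K\<close> satisfies the continuity equation
  \<open>dK/dr = - (1 / s) d/dp (K * H n (r * p))\<close>: the terms with \<open>(n - 1) / p\<close>
  and with the square of \<open>H n\<close> cancel. Testing against \<open>?u\<close> and
  integrating by parts in \<open>p\<close> leaves \<open>?W\<close>, with flux
  \<open>?A\<close>.\<close>

lemma T_diff_r:
  assumes n: "n \<ge> 1" and s: "s > 0" and R: "R \<ge> 0" and a: "0 \<le> a" and ab: "a \<le> b"
  shows "T n R b s - T n R a s = (LINT r:{a..b}|lborel. 1 / s * (\<integral>p. H n (r * p) * (R * H n (R * p)) \<partial>kap n s r))"
    and "set_integrable lborel {a..b} (\<lambda>r. 1 / s * (\<integral>p. H n (r * p) * (R * H n (R * p)) \<partial>kap n s r))"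
proof -
  \<comment> \<open>The noise is fixed here, so the range of variances is the single point
    \<open>s\<close>; the radii range up to \<open>b\<close>.\<close>
  obtain C where C: "C \<ge> 0"
    "\<And>s' r p. s \<le> s' \<Longrightarrow> s' \<le> s \<Longrightarrow> 0 \<le> r \<Longrightarrow> r \<le> b \<Longrightarrow> 0 \<le> p \<Longrightarrow> \<bar>K n s' r p\<bar> * (1 + p) ^ 3 \<le> C * exp (- p)"
    by (rule K_dom[OF n s order_trans[OF a ab], where b = s and m = 3]) (rule that)
  \<comment> \<open>The summands bound, in units of \<open>(1 + p) ^ 3\<close>, the factors that
    multiply \<open>K\<close> in \<open>?k * ?u\<close>, in \<open>?k' * ?u\<close>, and in both
    \<open>?W\<close> and \<open>?A\<close>.\<close>
  define B where "B = R + (b / s + 1) * R + 1 / s * R"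
  have bs: "0 \<le> b / s" "0 \<le> 1 / s" using a ab s by auto
  have B0: "R \<le> B" "(b / s + 1) * R \<le> B" "1 / s * R \<le> B" "0 \<le> B"
  proof -
    have "0 \<le> (b / s + 1) * R" "0 \<le> 1 / s * R" using R bs by (intro mult_nonneg_nonneg; simp)+
    then show "R \<le> B" "(b / s + 1) * R \<le> B" "1 / s * R \<le> B" "0 \<le> B"
      using R unfolding B_def by linarith+
  qed
  let ?u = "\<lambda>p. ln (Phi n (R * p))"
  let ?k = "\<lambda>r p. K n s r p"
  let ?k' = "\<lambda>r p. K n s r p * (- r / s + p * H n (r * p))"
  let ?W = "\<lambda>r p. 1 / s * (K n s r p * (H n (r * p) * (R * H n (R * p))))"
  let ?A = "\<lambda>r p. - 1 / s * (K n s r p * (H n (r * p) * ?u p))"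
  have u: "\<bar>?u p\<bar> \<le> R * p" if "p > 0" for p
    using ln_Phi_nonneg[OF n, of "R * p"] ln_Phi_le[OF n, of "R * p"] R that by simp
  have P: "1 \<le> (1 + p) ^ 3" "p \<le> (1 + p) ^ 3" "p * p \<le> (1 + p) ^ 3" if "p > 0" for p :: real
    using le_power_one_plus[of p 1 3] le_power_one_plus[of p 2 3] that
    by (auto simp: power2_eq_square intro!: one_le_power)
  have h: "\<bar>H n (r * p)\<bar> \<le> 1" if "r \<ge> 0" "p > 0" for r p
    using that by (intro H_abs_le_1 n) auto
  have ar: "0 \<le> r" if "a \<le> r" for r using that a by simp
  have dA: "(?A r has_real_derivative ?k' r p * ?u p - ?W r p) (at p)"
    if r: "a \<le> r" "r \<le> b" and p: "p > 0" for r p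
  proof -
    have "(?A r has_real_derivative - 1 / s * (
        K n s r p * ((real n - 1) / p - s * p + r * H n (r * p)) * (H n (r * p) * ?u p)
        + ((r * (1 - (H n (r * p))\<^sup>2) - (real n - 1) / p * H n (r * p)) * ?u p + (R * H n (R * p)) * H n (r * p)) * K n s r p)) (at p)"
      by (intro DERIV_cmult DERIV_mult K_has_deriv_p H_has_deriv_scaled ln_Phi_has_deriv_scaled n p ar r)
    also have "- 1 / s * (
        K n s r p * ((real n - 1) / p - s * p + r * H n (r * p)) * (H n (r * p) * ?u p)
        + ((r * (1 - (H n (r * p))\<^sup>2) - (real n - 1) / p * H n (r * p)) * ?u p + (R * H n (R * p)) * H n (r * p)) * K n s r p)
       = ?k' r p * ?u p - ?W r p"
    proof -
      have "- 1 / s * (k * (q - s * p + r * h) * (h * u) + ((r * (1 - h\<^sup>2) - q * h) * u + (R * g) * h) * k)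
         = k * (- r / s + p * h) * u - 1 / s * (k * (h * (R * g)))" for k q h g u :: real
      proof -
        \<comment> \<open>Division by \<open>s\<close> becomes multiplication by some
          \<open>i\<close> with \<open>s * i = 1\<close>, which makes the identity
          polynomial.\<close>
        have "s * i = 1 \<Longrightarrow> - i * (k * (q - s * p + r * h) * (h * u) + ((r * (1 - h\<^sup>2) - q * h) * u + (R * g) * h) * k)
          = k * (- r * i + p * h) * u - i * (k * (h * (R * g)))" for i by algebra
        from this[of "1 / s"] s show ?thesis by simp
      qed
      then show ?thesis .
    qed
    finally show ?thesis .
  qed
  have eq: "(LINT p:{0<..}|lborel. ?k b p * ?u p) - (LINT p:{0<..}|lborel. ?k a p * ?u p)
       = (LINT \<theta>:{a..b}|lborel. (LINT p:{0<..}|lborel. ?W \<theta> p))"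
    and int: "set_integrable lborel {a..b} (\<lambda>\<theta>. LINT p:{0<..}|lborel. ?W \<theta> p)"
  proof -
    note * = integral_parameter_difference[where k = ?k and k' = ?k' and W = ?W and A = ?A and u = ?u and a = a and b = b and C = "B * C"]
    have 1: "\<bar>?k \<theta> p * ?u p\<bar> \<le> B * C * exp (- p)" if "a \<le> \<theta>" "\<theta> \<le> b" "p > 0" for \<theta> p
    proof (rule K_mult_dom[OF C(2) _ B0(4)])
      have "R * p \<le> B * (1 + p) ^ 3" using B0 R P(2)[of p] that by (intro mult_mono) auto
      then show "\<bar>?u p\<bar> \<le> B * (1 + p) ^ 3" using u[OF that(3)] by simp
    qed (use that ar in auto)
    have 2: "\<bar>?k' \<theta> p * ?u p\<bar> \<le> B * C * exp (- p)" if t: "a \<le> \<theta>" "\<theta> \<le> b" "p > 0" for \<theta> p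
      unfolding mult.assoc[of "K n s \<theta> p"]
    proof (rule K_mult_dom[OF C(2) _ B0(4)])
      have "\<bar>- \<theta> / s + p * H n (\<theta> * p)\<bar> \<le> \<theta> / s + p"
      proof -
        have "\<bar>p * H n (\<theta> * p)\<bar> \<le> p * 1"
          unfolding abs_mult using t h[OF ar t(3), of \<theta>] by (intro mult_mono) auto
        moreover have "\<bar>- \<theta> / s\<bar> = \<theta> / s" using ar[OF t(1)] s by simp
        ultimately show ?thesis by linarith
      qed
      also have "\<dots> \<le> b / s + p" using t s by (simp add: divide_right_mono)
      finally have "\<bar>- \<theta> / s + p * H n (\<theta> * p)\<bar> * \<bar>?u p\<bar> \<le> (b / s + p) * (R * p)"
        using u[OF t(3)] bs t by (intro mult_mono) auto
      also have "\<dots> = (b / s) * R * p + R * (p * p)" by (simp add: algebra_simps)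
      also have "\<dots> \<le> (b / s) * R * (1 + p) ^ 3 + R * (1 + p) ^ 3"
        using P[OF t(3)] mult_nonneg_nonneg[OF bs(1) R] R by (intro add_mono mult_left_mono) simp_all
      also have "\<dots> = ((b / s + 1) * R) * (1 + p) ^ 3" by (simp add: algebra_simps)
      also have "\<dots> \<le> B * (1 + p) ^ 3" using B0 t by (intro mult_right_mono) auto
      finally show "\<bar>(- \<theta> / s + p * H n (\<theta> * p)) * ?u p\<bar> \<le> B * (1 + p) ^ 3" by (simp add: abs_mult)
    qed (use that ar in auto)
    have 3: "\<bar>?W \<theta> p\<bar> \<le> B * C * exp (- p)" if t: "a \<le> \<theta>" "\<theta> \<le> b" "p > 0" for \<theta> p
      unfolding mult.left_commute[of "1 / s" "K n s \<theta> p"]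
    proof (rule K_mult_dom[OF C(2) _ B0(4)])
      have "\<bar>H n (\<theta> * p) * (R * H n (R * p))\<bar> \<le> 1 * (R * 1)"
        unfolding abs_mult using h[OF ar[OF t(1)] t(3)] h[OF R t(3)] R by (intro mult_mono) auto
      then have "1 / s * \<bar>H n (\<theta> * p) * (R * H n (R * p))\<bar> \<le> 1 / s * R"
        using bs by (intro mult_left_mono) auto
      also have "\<dots> \<le> B * 1" using B0 by simp
      also have "\<dots> \<le> B * (1 + p) ^ 3" using B0 P(1)[OF t(3)] by (intro mult_left_mono) auto
      finally show "\<bar>1 / s * (H n (\<theta> * p) * (R * H n (R * p)))\<bar> \<le> B * (1 + p) ^ 3"
        using s by (simp add: abs_mult)
    qed (use that ar in auto)
    have 4: "(?A \<theta> \<longlongrightarrow> 0) (at_right 0)" for \<theta>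
    proof -
      have "isCont (?A \<theta>) 0"
        by (intro continuous_intros isCont_K isCont_H_scaled isCont_ln_Phi_scaled n)
      then have "(?A \<theta> \<longlongrightarrow> ?A \<theta> 0) (at_right 0)"
        by (auto simp: isCont_def intro: tendsto_within_subset)
      then show ?thesis by simp
    qed
    have 5: "(?A \<theta> \<longlongrightarrow> 0) at_top" if t: "a \<le> \<theta>" "\<theta> \<le> b" for \<theta>
    proof (rule tendsto_exp_minus_dominated)
      fix p :: real assume p: "p > 0"
      show "\<bar>?A \<theta> p\<bar> \<le> B * C * exp (- p)"
        unfolding mult.left_commute[of "- 1 / s" "K n s \<theta> p"]
      proof (rule K_mult_dom[OF C(2) _ B0(4)])
        have "\<bar>H n (\<theta> * p) * ?u p\<bar> \<le> 1 * (R * p)"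
          unfolding abs_mult using h[OF ar[OF t(1)] p] u[OF p] R p by (intro mult_mono) auto
        then have "1 / s * \<bar>H n (\<theta> * p) * ?u p\<bar> \<le> 1 / s * (R * p)"
          using bs by (intro mult_left_mono) auto
        also have "\<dots> = (1 / s * R) * p" by simp
        also have "\<dots> \<le> B * (1 + p) ^ 3" using B0 P(2)[OF p] p by (intro mult_mono) auto
        finally show "\<bar>- 1 / s * (H n (\<theta> * p) * ?u p)\<bar> \<le> B * (1 + p) ^ 3"
          using s by (simp add: abs_mult)
      qed (use p t ar in auto)
    qed
    have 6: "isCont (\<lambda>p. ?k' \<theta> p * ?u p - ?W \<theta> p) p" for \<theta> p
      by (intro continuous_intros isCont_K isCont_H_scaled isCont_ln_Phi_scaled n)
    have 7: "isCont (\<lambda>\<theta>. ?k' \<theta> p) \<theta>" for \<theta> p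
    proof -
      have "isCont (\<lambda>\<theta>. K n s \<theta> p) \<theta>" using K_has_deriv_r[OF n s] by (rule DERIV_isCont)
      moreover have "isCont (\<lambda>\<theta>. H n (\<theta> * p)) \<theta>"
        by (rule isCont_o2[OF _ isCont_H[OF n]]) (auto intro!: continuous_intros)
      ultimately show ?thesis using s by (intro continuous_intros) auto
    qed
    have 8: "case_prod ?k' \<in> borel_measurable (borel \<Otimes>\<^sub>M borel)"
      unfolding K_def by measurable
    show "(LINT p:{0<..}|lborel. ?k b p * ?u p) - (LINT p:{0<..}|lborel. ?k a p * ?u p)
       = (LINT \<theta>:{a..b}|lborel. (LINT p:{0<..}|lborel. ?W \<theta> p))"
      by (rule *(1)[OF ab K_has_deriv_r[OF n s] 7 dA 6 4 5 _ _ 8 _ 1 2 3]) simp_all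
    show "set_integrable lborel {a..b} (\<lambda>\<theta>. LINT p:{0<..}|lborel. ?W \<theta> p)"
      by (rule *(2)[OF ab K_has_deriv_r[OF n s] 7 dA 6 4 5 _ _ 8 _ 1 2 3]) simp_all
  qed
  have W: "(LINT p:{0<..}|lborel. ?W r p) = 1 / s * (\<integral>p. H n (r * p) * (R * H n (R * p)) \<partial>kap n s r)" for r
    by (subst integral_kap(1)[OF n s]) simp_all
  show "T n R b s - T n R a s = (LINT r:{a..b}|lborel. 1 / s * (\<integral>p. H n (r * p) * (R * H n (R * p)) \<partial>kap n s r))"
    unfolding T_eq[OF n s] eq W ..
  show "set_integrable lborel {a..b} (\<lambda>r. 1 / s * (\<integral>p. H n (r * p) * (R * H n (R * p)) \<partial>kap n s r))"
    using int unfolding W .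
qed

text \<open>Here \<open>dK/ds = (1 / (2 * s^2)) d/dp (K * (s * p + r * H n (r * p)))\<close>.
  Integrating by parts against \<open>?u\<close> leaves an unbounded term
  \<open>s * p * R * H n (R * p)\<close>. The summand \<open>R * H n (R * p)\<close> in
  \<open>?A\<close> removes it by a second integration by parts, in which the Riccati equation at
  \<open>R * p\<close> produces \<open>1 - (H n (R * p))^2\<close>; a bounded integrand
  remains.\<close>

lemma T_diff_s:
  assumes n: "n \<ge> 1" and R: "R \<ge> 0" and r: "0 \<le> r" and a: "0 < a" and ab: "a \<le> b"
  shows "T n R r b - T n R r a = (LINT s:{a..b}|lborel. - 1 / s\<^sup>2 *
      (\<integral>p. R\<^sup>2 / 2 - R\<^sup>2 / 2 * (H n (R * p))\<^sup>2 + r * R * (H n (r * p) * H n (R * p)) \<partial>kap n s r))"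
    and "set_integrable lborel {a..b} (\<lambda>s. - 1 / s\<^sup>2 *
      (\<integral>p. R\<^sup>2 / 2 - R\<^sup>2 / 2 * (H n (R * p))\<^sup>2 + r * R * (H n (r * p) * H n (R * p)) \<partial>kap n s r))"
proof -
  obtain C where C: "C \<ge> 0"
    "\<And>s r' p. a \<le> s \<Longrightarrow> s \<le> b \<Longrightarrow> 0 \<le> r' \<Longrightarrow> r' \<le> r \<Longrightarrow> 0 \<le> p \<Longrightarrow> \<bar>K n s r' p\<bar> * (1 + p) ^ 3 \<le> C * exp (- p)"
    by (rule K_dom[OF n a r, where b = b and m = 3]) (rule that)
  let ?V = "\<lambda>p. R\<^sup>2 / 2 - R\<^sup>2 / 2 * (H n (R * p))\<^sup>2 + r * R * (H n (r * p) * H n (R * p))"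
  let ?u = "\<lambda>p. ln (Phi n (R * p))"
  let ?k = "\<lambda>s p. K n s r p"
  let ?k' = "\<lambda>s p. K n s r p * (real n / (2 * s) - p\<^sup>2 / 2 + r\<^sup>2 / (2 * s\<^sup>2))"
  let ?W = "\<lambda>s p. - 1 / s\<^sup>2 * (K n s r p * ?V p)"
  let ?A = "\<lambda>s p. 1 / (2 * s\<^sup>2) * (K n s r p * ((s * p + r * H n (r * p)) * ?u p + R * H n (R * p)))"
  \<comment> \<open>\<open>B1\<close>, \<open>B2\<close>, \<open>B3\<close> serve
    \<open>?k' * ?u\<close>, \<open>?W\<close> and \<open>?A\<close> in turn. The exponent 3 is that
    of \<open>p^2\<close> from the \<open>s\<close>-derivative of \<open>K\<close> times the linear
    bound \<open>R * p\<close> of \<open>?u\<close>.\<close>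
  define B1 B2 B3 where "B1 = (real n / (2 * a) + 1 + r\<^sup>2 / (2 * a\<^sup>2)) * R"
    and "B2 = 1 / a\<^sup>2 * (2 * R\<^sup>2 + r * R)" and "B3 = 1 / (2 * a\<^sup>2) * ((b + r) * R + R)"
  define B where "B = R + B1 + B2 + B3"
  have b0: "b > 0" using a ab by simp
  have Bn: "0 \<le> B1" "0 \<le> B2" "0 \<le> B3"
    unfolding B1_def B2_def B3_def using R r a b0 by (intro mult_nonneg_nonneg; simp)+
  have B0: "R \<le> B" "B1 \<le> B" "B2 \<le> B" "B3 \<le> B" "0 \<le> B"
    using Bn R unfolding B_def by linarith+
  have u: "\<bar>?u p\<bar> \<le> R * p" if "p > 0" for p
    using ln_Phi_nonneg[OF n, of "R * p"] ln_Phi_le[OF n, of "R * p"] R that by simp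
  have P: "1 \<le> (1 + p) ^ 3" "p \<le> (1 + p) ^ 3" "p * p \<le> (1 + p) ^ 3" "p ^ 3 \<le> (1 + p) ^ 3" if "p > 0" for p :: real
    using le_power_one_plus[of p 1 3] le_power_one_plus[of p 2 3] le_power_one_plus[of p 3 3] that
    by (auto simp: power2_eq_square intro!: one_le_power)
  have h: "\<bar>H n (r * p)\<bar> \<le> 1" if "r \<ge> 0" "p > 0" for r p
    using that by (intro H_abs_le_1 n) auto
  have sp: "0 < s" if "a \<le> s" for s using that a by simp
  have dA: "(?A s has_real_derivative ?k' s p * ?u p - ?W s p) (at p)"
    if s: "a \<le> s" "s \<le> b" and p: "p > 0" for s p
  proof -
    let ?q = "(real n - 1) / p"
    have "(?A s has_real_derivative 1 / (2 * s\<^sup>2) * (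
        K n s r p * (?q - s * p + r * H n (r * p)) * ((s * p + r * H n (r * p)) * ?u p + R * H n (R * p))
        + (((s * 1 + r * (r * (1 - (H n (r * p))\<^sup>2) - ?q * H n (r * p))) * ?u p
              + (R * H n (R * p)) * (s * p + r * H n (r * p)))
           + R * (R * (1 - (H n (R * p))\<^sup>2) - ?q * H n (R * p))) * K n s r p)) (at p)"
      by (intro DERIV_cmult DERIV_mult DERIV_add DERIV_ident K_has_deriv_p H_has_deriv_scaled ln_Phi_has_deriv_scaled n p r R)
    also have "1 / (2 * s\<^sup>2) * (
        K n s r p * (?q - s * p + r * H n (r * p)) * ((s * p + r * H n (r * p)) * ?u p + R * H n (R * p))
        + (((s * 1 + r * (r * (1 - (H n (r * p))\<^sup>2) - ?q * H n (r * p))) * ?u p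
              + (R * H n (R * p)) * (s * p + r * H n (r * p)))
           + R * (R * (1 - (H n (R * p))\<^sup>2) - ?q * H n (R * p))) * K n s r p)
       = ?k' s p * ?u p - ?W s p"
    proof -
      have "?q * p = real n - 1" using p by simp
      moreover have "1 / (2 * s\<^sup>2) * (k * (q - s * p + r * h) * ((s * p + r * h) * u + R * g)
          + (((s * 1 + r * (r * (1 - h\<^sup>2) - q * h)) * u + (R * g) * (s * p + r * h)) + R * (R * (1 - g\<^sup>2) - q * g)) * k)
         = k * (N / (2 * s) - p\<^sup>2 / 2 + r\<^sup>2 / (2 * s\<^sup>2)) * u - - 1 / s\<^sup>2 * (k * (R\<^sup>2 / 2 - R\<^sup>2 / 2 * g\<^sup>2 + r * R * (h * g)))"
        if "q * p = N - 1" for k q h g u N :: real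
      proof -
        have i1: "1 / (2 * s\<^sup>2) = (1 / s) * (1 / s) / 2" by (simp add: power2_eq_square)
        have i2: "N / (2 * s) = N * (1 / s) / 2" by simp
        have i3: "r\<^sup>2 / (2 * s\<^sup>2) = r\<^sup>2 * ((1 / s) * (1 / s)) / 2" by (simp add: power2_eq_square)
        have i4: "- 1 / s\<^sup>2 = - ((1 / s) * (1 / s))" by (simp add: power2_eq_square)
        have i5: "s * (1 / s) = 1" using sp[OF s(1)] by simp
        have "s * i = 1 \<Longrightarrow> i * i / 2 * (k * (q - s * p + r * h) * ((s * p + r * h) * u + R * g)
          + (((s * 1 + r * (r * (1 - h\<^sup>2) - q * h)) * u + (R * g) * (s * p + r * h)) + R * (R * (1 - g\<^sup>2) - q * g)) * k)
         = k * (N * i / 2 - p\<^sup>2 / 2 + r\<^sup>2 * (i * i) / 2) * u - - (i * i) * (k * (R\<^sup>2 / 2 - R\<^sup>2 / 2 * g\<^sup>2 + r * R * (h * g)))" for i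
        proof -
          assume si: "s * i = 1"
          have "2 * (i * i / 2 * (k * (q - s * p + r * h) * ((s * p + r * h) * u + R * g)
          + (((s * 1 + r * (r * (1 - h\<^sup>2) - q * h)) * u + (R * g) * (s * p + r * h)) + R * (R * (1 - g\<^sup>2) - q * g)) * k))
          = i * i * (k * (((q * p) * s + s - s * s * p\<^sup>2 + r\<^sup>2) * u + 2 * r * h * R * g + R\<^sup>2 * (1 - g\<^sup>2)))"
            by (simp add: power2_eq_square algebra_simps)
          also have "\<dots> = k * (((s * i) * i * N - (s * i) * (s * i) * p\<^sup>2 + r\<^sup>2 * (i * i)) * u + i * i * (2 * r * h * R * g + R\<^sup>2 * (1 - g\<^sup>2)))"
            unfolding that by (simp add: algebra_simps)
          also have "\<dots> = 2 * (k * (N * i / 2 - p\<^sup>2 / 2 + r\<^sup>2 * (i * i) / 2) * u - - (i * i) * (k * (R\<^sup>2 / 2 - R\<^sup>2 / 2 * g\<^sup>2 + r * R * (h * g))))"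
            unfolding si by (simp add: algebra_simps)
          finally show ?thesis by simp
        qed
        from this[OF i5] show ?thesis unfolding i1 i2 i3 i4 .
      qed
      ultimately show ?thesis by blast
    qed
    finally show ?thesis .
  qed
  have V: "\<bar>?V p\<bar> \<le> 2 * R\<^sup>2 + r * R" if p: "p > 0" for p
  proof -
    have g: "(H n (R * p))\<^sup>2 \<le> 1" using h[OF R p] by (simp add: abs_square_le_1)
    have "R\<^sup>2 / 2 * (H n (R * p))\<^sup>2 \<le> R\<^sup>2 / 2 * 1" by (intro mult_left_mono g) simp
    moreover have "0 \<le> R\<^sup>2 / 2 * (H n (R * p))\<^sup>2" by simp
    moreover have "\<bar>r * R * (H n (r * p) * H n (R * p))\<bar> \<le> r * R * (1 * 1)"
      unfolding abs_mult using r R h[OF r p] h[OF R p] by (intro mult_mono) auto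
    moreover have "0 \<le> R\<^sup>2" by simp
    ultimately show ?thesis by (simp only: abs_le_iff mult_1_right) linarith
  qed
  have s2: "1 / s\<^sup>2 \<le> 1 / a\<^sup>2" "1 / (2 * s\<^sup>2) \<le> 1 / (2 * a\<^sup>2)" "0 \<le> 1 / s\<^sup>2" if "a \<le> s" for s
    using that a by (auto intro!: divide_left_mono power_mono mult_pos_pos mult_left_mono)
  have 1: "\<bar>?k s p * ?u p\<bar> \<le> B * C * exp (- p)" if "a \<le> s" "s \<le> b" "p > 0" for s p
  proof (rule K_mult_dom[OF C(2) _ B0(5)])
    have "R * p \<le> B * (1 + p) ^ 3" using B0 R P(2)[of p] that by (intro mult_mono) auto
    then show "\<bar>?u p\<bar> \<le> B * (1 + p) ^ 3" using u[OF that(3)] by simp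
  qed (use that r in auto)
  have 2: "\<bar>?k' s p * ?u p\<bar> \<le> B * C * exp (- p)" if t: "a \<le> s" "s \<le> b" "p > 0" for s p
    unfolding mult.assoc[of "K n s r p"]
  proof (rule K_mult_dom[OF C(2) _ B0(5)])
    let ?c = "real n / (2 * a)" and ?d = "r\<^sup>2 / (2 * a\<^sup>2)"
    have c: "0 \<le> ?c" "0 \<le> ?d" using a by auto
    have e1: "real n / (2 * s) \<le> ?c" "0 \<le> real n / (2 * s)"
      using t a by (auto intro!: divide_left_mono)
    have e2: "r\<^sup>2 / (2 * s\<^sup>2) \<le> ?d" "0 \<le> r\<^sup>2 / (2 * s\<^sup>2)"
      using t a by (auto intro!: divide_left_mono power_mono mult_pos_pos)
    have "0 \<le> p\<^sup>2" by simp
    then have "\<bar>real n / (2 * s) - p\<^sup>2 / 2 + r\<^sup>2 / (2 * s\<^sup>2)\<bar> \<le> ?c + p\<^sup>2 + ?d"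
      using e1 e2 unfolding abs_le_iff by linarith
    then have "\<bar>real n / (2 * s) - p\<^sup>2 / 2 + r\<^sup>2 / (2 * s\<^sup>2)\<bar> * \<bar>?u p\<bar> \<le> (?c + p\<^sup>2 + ?d) * (R * p)"
      using u[OF t(3)] c by (intro mult_mono) auto
    also have "\<dots> = (?c * R) * p + R * p ^ 3 + (?d * R) * p" by (simp add: power2_eq_square power3_eq_cube distrib_right)
    also have "\<dots> \<le> (?c * R) * (1 + p) ^ 3 + R * (1 + p) ^ 3 + (?d * R) * (1 + p) ^ 3"
      using P[OF t(3)] mult_nonneg_nonneg[OF c(1) R] mult_nonneg_nonneg[OF c(2) R] R by (intro add_mono mult_left_mono) simp_all
    also have "\<dots> = B1 * (1 + p) ^ 3" by (simp add: B1_def distrib_right)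
    also have "\<dots> \<le> B * (1 + p) ^ 3" using B0 t by (intro mult_right_mono) auto
    finally show "\<bar>(real n / (2 * s) - p\<^sup>2 / 2 + r\<^sup>2 / (2 * s\<^sup>2)) * ?u p\<bar> \<le> B * (1 + p) ^ 3" by (simp only: abs_mult)
  qed (use that r in auto)
  have 3: "\<bar>?W s p\<bar> \<le> B * C * exp (- p)" if t: "a \<le> s" "s \<le> b" "p > 0" for s p
    unfolding mult.left_commute[of "- 1 / s\<^sup>2" "K n s r p"]
  proof (rule K_mult_dom[OF C(2) _ B0(5)])
    have "\<bar>- 1 / s\<^sup>2 * ?V p\<bar> = 1 / s\<^sup>2 * \<bar>?V p\<bar>"
      unfolding abs_mult using s2[OF t(1)] by simp
    also have "\<dots> \<le> B2" unfolding B2_def using s2[OF t(1)] V[OF t(3)] a by (intro mult_mono) auto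
    also have "\<dots> \<le> B * 1" using B0 by simp
    also have "\<dots> \<le> B * (1 + p) ^ 3" using B0 P(1)[OF t(3)] by (intro mult_left_mono) auto
    finally show "\<bar>- 1 / s\<^sup>2 * ?V p\<bar> \<le> B * (1 + p) ^ 3" .
  qed (use that r in auto)
  have 4: "(?A s \<longlongrightarrow> 0) (at_right 0)" if "a \<le> s" for s
  proof -
    have "isCont (?A s) 0"
      using sp[OF that] by (intro continuous_intros isCont_K isCont_H_scaled isCont_ln_Phi_scaled n)
    then have "(?A s \<longlongrightarrow> ?A s 0) (at_right 0)"
      by (auto simp: isCont_def intro: tendsto_within_subset)
    then show ?thesis by simp
  qed
  have 5: "(?A s \<longlongrightarrow> 0) at_top" if t: "a \<le> s" "s \<le> b" for s
  proof (rule tendsto_exp_minus_dominated)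
    fix p :: real assume p: "p > 0"
    show "\<bar>?A s p\<bar> \<le> B * C * exp (- p)"
      unfolding mult.left_commute[of "1 / (2 * s\<^sup>2)" "K n s r p"]
    proof (rule K_mult_dom[OF C(2) _ B0(5)])
      let ?X = "(s * p + r * H n (r * p)) * ?u p + R * H n (R * p)"
      have "\<bar>s * p + r * H n (r * p)\<bar> \<le> b * p + r * 1"
      proof -
        have "\<bar>r * H n (r * p)\<bar> \<le> r * 1" unfolding abs_mult using r h[OF r p] by (intro mult_mono) auto
        moreover have "\<bar>s * p\<bar> \<le> b * p" using sp[OF t(1)] t p by (simp add: abs_mult)
        ultimately show ?thesis by linarith
      qed
      then have "\<bar>s * p + r * H n (r * p)\<bar> * \<bar>?u p\<bar> \<le> (b * p + r * 1) * (R * p)"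
        using u[OF p] b0 r p by (intro mult_mono) auto
      moreover have "\<bar>R * H n (R * p)\<bar> \<le> R * 1" unfolding abs_mult using R h[OF R p] by (intro mult_mono) auto
      ultimately have "\<bar>?X\<bar> \<le> (b * p + r * 1) * (R * p) + R * 1"
        using abs_triangle_ineq[of "(s * p + r * H n (r * p)) * ?u p" "R * H n (R * p)"] by (simp add: abs_mult)
      also have "\<dots> = (b * R) * (p * p) + (r * R) * p + R * 1" by (simp add: algebra_simps)
      also have "\<dots> \<le> (b * R) * (1 + p) ^ 3 + (r * R) * (1 + p) ^ 3 + R * (1 + p) ^ 3"
        using P[OF p] b0 r R by (intro add_mono mult_left_mono) simp_all
      also have "\<dots> = ((b + r) * R + R) * (1 + p) ^ 3" by (simp add: distrib_right)
      finally have X: "\<bar>?X\<bar> \<le> ((b + r) * R + R) * (1 + p) ^ 3" .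
      have "\<bar>1 / (2 * s\<^sup>2) * ?X\<bar> = 1 / (2 * s\<^sup>2) * \<bar>?X\<bar>"
        unfolding abs_mult by simp
      also have "\<dots> \<le> 1 / (2 * a\<^sup>2) * (((b + r) * R + R) * (1 + p) ^ 3)"
        using s2[OF t(1)] X by (intro mult_mono) auto
      also have "\<dots> = B3 * (1 + p) ^ 3" by (simp only: B3_def mult.assoc)
      also have "\<dots> \<le> B * (1 + p) ^ 3" using B0 p by (intro mult_right_mono) auto
      finally show "\<bar>1 / (2 * s\<^sup>2) * ?X\<bar> \<le> B * (1 + p) ^ 3" .
    qed (use p t r in auto)
  qed
  have 6: "isCont (\<lambda>p. ?k' s p * ?u p - ?W s p) p" for s p
    by (intro continuous_intros isCont_K isCont_H_scaled isCont_ln_Phi_scaled n) auto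
  have dk: "((\<lambda>s. ?k s p) has_real_derivative ?k' s p) (at s)" if "a \<le> s" for s p
    by (rule K_has_deriv_s[OF n sp[OF that]])
  have 7: "isCont (\<lambda>s. ?k' s p) s" if "a \<le> s" for s p
  proof -
    have "isCont (\<lambda>s. K n s r p) s" using K_has_deriv_s[OF n sp[OF that]] by (rule DERIV_isCont)
    then show ?thesis using sp[OF that] by (intro continuous_intros) auto
  qed
  have 8: "case_prod ?k' \<in> borel_measurable (borel \<Otimes>\<^sub>M borel)"
    unfolding K_def by measurable
  note * = integral_parameter_difference[where k = ?k and k' = ?k' and W = ?W and A = ?A and u = ?u and a = a and b = b and C = "B * C"]
  have eq: "(LINT p:{0<..}|lborel. ?k b p * ?u p) - (LINT p:{0<..}|lborel. ?k a p * ?u p)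
       = (LINT \<theta>:{a..b}|lborel. (LINT p:{0<..}|lborel. ?W \<theta> p))"
    by (rule *(1)[OF ab dk 7 dA 6 4 5 _ _ 8 _ 1 2 3]) simp_all
  have int: "set_integrable lborel {a..b} (\<lambda>\<theta>. LINT p:{0<..}|lborel. ?W \<theta> p)"
    by (rule *(2)[OF ab dk 7 dA 6 4 5 _ _ 8 _ 1 2 3]) simp_all
  have W: "(LINT p:{0<..}|lborel. ?W s p) = - 1 / s\<^sup>2 * (\<integral>p. ?V p \<partial>kap n s r)" if "a \<le> s" for s
    by (subst integral_kap(1)[OF n sp[OF that]]) (measurable, rule set_integral_mult_right)
  show "T n R r b - T n R r a = (LINT s:{a..b}|lborel. - 1 / s\<^sup>2 * (\<integral>p. ?V p \<partial>kap n s r))"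
    unfolding T_eq[OF n b0] T_eq[OF n a] eq
    by (rule set_lebesgue_integral_cong) (simp, intro allI impI W, simp)
  show "set_integrable lborel {a..b} (\<lambda>s. - 1 / s\<^sup>2 * (\<integral>p. ?V p \<partial>kap n s r))"
    by (rule set_integrable_cong[THEN iffD1, OF refl refl _ int]) (rule W, simp)
qed

section \<open>Likelihood ratios of the radial laws\<close>

lemma AE_kap_pos: "AE p in kap n s r. p > 0"
  unfolding kap_def by (subst AE_density) (auto simp: indicator_def)

lemma integrable_kap_bounded:
  fixes g :: "real \<Rightarrow> real"
  assumes n: "1 \<le> n" and s: "s > 0" and r: "r \<ge> 0" and g [measurable]: "g \<in> borel_measurable borel"
    and b: "\<And>p. p > 0 \<Longrightarrow> \<bar>g p\<bar> \<le> B"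
  shows "integrable (kap n s r) g"
proof -
  interpret prob_space "kap n s r" by (rule prob_space_kap[OF n s r])
  show ?thesis
  proof (rule integrable_const_bound)
    show "AE p in kap n s r. norm (g p) \<le> B"
      using AE_kap_pos[of n s r] by eventually_elim (simp add: b)
  qed simp
qed

text \<open>The likelihood ratio of \<open>kap n s r'\<close> to \<open>kap n s r\<close>: the power
  of \<open>p\<close> and the Gaussian factor in \<open>p\<close> cancel, which leaves a Bessel
  quotient that increases in \<open>p\<close> when \<open>r\<close> is at most
  \<open>r'\<close>.\<close>

definition Lr :: "nat \<Rightarrow> real \<Rightarrow> real \<Rightarrow> real \<Rightarrow> real \<Rightarrow> real" where
  "Lr n s r r' p = exp (r\<^sup>2 / (2 * s) - r'\<^sup>2 / (2 * s)) * (Phi n (r' * p) / Phi n (r * p))"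

lemma Lr_pos: "n \<ge> 1 \<Longrightarrow> Lr n s r r' p > 0"
  by (simp add: Lr_def Phi_pos)

lemma measurable_Lr [measurable]: "Lr n s r r' \<in> borel_measurable borel"
  unfolding Lr_def by measurable

lemma Lr_mono:
  "n \<ge> 1 \<Longrightarrow> 0 \<le> r \<Longrightarrow> r \<le> r' \<Longrightarrow> 0 \<le> p \<Longrightarrow> p \<le> p' \<Longrightarrow> Lr n s r r' p \<le> Lr n s r r' p'"
  unfolding Lr_def by (intro mult_left_mono Phi_ratio_mono) auto

lemma kap_eq_density_Lr:
  assumes n: "1 \<le> n" and s: "s > 0"
  shows "kap n s r' = density (kap n s r) (\<lambda>p. ennreal (Lr n s r r' p))"
proof -
  have "K n s r' p = K n s r p * Lr n s r r' p" for p
  proof -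
    have 1: "exp (- s * p\<^sup>2 / 2 - r'\<^sup>2 / (2 * s)) = exp (- s * p\<^sup>2 / 2 - r\<^sup>2 / (2 * s)) * exp (r\<^sup>2 / (2 * s) - r'\<^sup>2 / (2 * s))"
      by (simp add: exp_add[symmetric])
    have "Phi n (r' * p) = Phi n (r * p) * (Phi n (r' * p) / Phi n (r * p))"
      using Phi_pos[OF n, of "r * p"] by simp
    moreover have "Q = P * q \<Longrightarrow> A * (X * Y) * Q = A * X * P * (Y * q)" for P Q q A X Y :: real by algebra
    ultimately show ?thesis unfolding K_def Lr_def 1 by blast
  qed
  then have "ennreal (indicator {0<..} p * K n s r' p) = ennreal (indicator {0<..} p * K n s r p) * ennreal (Lr n s r r' p)" for p
    using indicator_K_nonneg[OF n s, of p r] Lr_pos[OF n, of s r r' p]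
    by (simp add: ennreal_mult[symmetric] less_imp_le mult.assoc)
  then show ?thesis unfolding kap_def by (subst density_density_eq) simp_all
qed

lemma integral_kap_Lr:
  fixes g :: "real \<Rightarrow> real"
  assumes n: "1 \<le> n" and s: "s > 0" and g [measurable]: "g \<in> borel_measurable borel"
  shows "(\<integral>p. g p \<partial>kap n s r') = (\<integral>p. Lr n s r r' p * g p \<partial>kap n s r)"
    and "integrable (kap n s r') g \<longleftrightarrow> integrable (kap n s r) (\<lambda>p. Lr n s r r' p * g p)"
  unfolding kap_eq_density_Lr[OF n s, of r' r]
  by (subst integral_real_density integrable_real_density;
      auto intro!: AE_I2 less_imp_le[OF Lr_pos[OF n]])+

text \<open>Monotone likelihood ratio: the weights \<open>Lr - L0\<close> and \<open>g\<close> have the same sign.\<close>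

lemma kap_single_crossing:
  fixes g :: "real \<Rightarrow> real"
  assumes n: "1 \<le> n" and s: "s > 0" and r: "0 \<le> r" "r \<le> r'"
    and g [measurable]: "g \<in> borel_measurable borel" and b: "\<And>p. p > 0 \<Longrightarrow> \<bar>g p\<bar> \<le> B"
    and sg: "\<And>p q. 0 < p \<Longrightarrow> p < q \<Longrightarrow> g p > 0 \<Longrightarrow> g q \<ge> 0"
    and pos: "(\<integral>p. g p \<partial>kap n s r) > 0"
  shows "(\<integral>p. g p \<partial>kap n s r') \<ge> 0"
proof -
  have r': "r' \<ge> 0" using r by simp
  have int: "integrable (kap n s r) g" "integrable (kap n s r') g"
    using integrable_kap_bounded[where g = g and B = B] n s r r' b by simp_all
  let ?L = "Lr n s r r'"
  define S where "S = {p. 0 < p \<and> g p < 0}"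
  \<comment> \<open>The level of the ratio at which \<open>g\<close> passes from negative to
    positive values. It is set to 0 when \<open>g\<close> is never negative, since
    \<open>Sup {}\<close> carries no information.\<close>
  define L0 where "L0 = (if S = {} then 0 else Sup (?L ` S))"
  \<comment> \<open>A point where \<open>g\<close> is positive exists because the mean is positive.
    By the crossing hypothesis no point of \<open>S\<close> lies to its right, so the ratio there
    bounds \<open>?L\<close> on \<open>S\<close>.\<close>
  have "\<exists>q>0. g q > 0"
  proof (rule ccontr)
    assume "\<not> ?thesis"
    then have np: "g q \<le> 0" if "q > 0" for q using that by force
    have "(\<integral>p. g p \<partial>kap n s r) \<le> (\<integral>p. 0 \<partial>kap n s r)"
    proof (rule integral_mono_AE[OF int(1)])
      show "AE p in kap n s r. g p \<le> 0" using AE_kap_pos[of n s r] by eventually_elim (rule np)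
    qed simp
    with pos show False by simp
  qed
  then obtain q where q: "q > 0" "g q > 0" by blast
  have le: "p \<le> q'" if "p \<in> S" "q' > 0" "g q' > 0" for p q'
    using sg[OF that(2), of p] that by (force simp: S_def)
  have bdd: "bdd_above (?L ` S)"
  proof (rule bdd_aboveI)
    fix z assume "z \<in> ?L ` S"
    then obtain p where p: "p \<in> S" "z = ?L p" by blast
    have "?L p \<le> ?L q" using p(1) by (intro Lr_mono[OF n r] le[OF p(1) q]) (simp add: S_def)
    then show "z \<le> ?L q" using p by simp
  qed
  have L0: "L0 \<ge> 0"
  proof (cases "S = {}")
    case False
    then obtain p where p: "p \<in> S" by blast
    have "0 \<le> ?L p" using Lr_pos[OF n] by (rule less_imp_le)
    also have "\<dots> \<le> Sup (?L ` S)" by (rule cSup_upper[OF _ bdd]) (use p in auto)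
    finally show ?thesis using False by (simp add: L0_def)
  qed (simp add: L0_def)
  have sgn: "L0 * g p \<le> ?L p * g p" if p: "p > 0" for p
  proof (cases "g p" "0 :: real" rule: linorder_cases)
    case less
    then have "p \<in> S" using p by (simp add: S_def)
    then have "?L p \<le> Sup (?L ` S)" by (intro cSup_upper[OF _ bdd]) auto
    then have "?L p \<le> L0" using \<open>p \<in> S\<close> by (auto simp: L0_def)
    then show ?thesis using less by (intro mult_right_mono_neg) auto
  next
    case greater
    have "L0 \<le> ?L p"
    proof (cases "S = {}")
      case True
      then show ?thesis using Lr_pos[OF n, of s r r' p] by (simp add: L0_def)
    next
      case False
      then have "Sup (?L ` S) \<le> ?L p"
        by (intro cSup_least) (auto intro!: Lr_mono n r le[OF _ p greater] simp: S_def)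
      then show ?thesis using False by (simp add: L0_def)
    qed
    then show ?thesis using greater by (intro mult_right_mono) auto
  qed simp
  have "0 \<le> L0 * (\<integral>p. g p \<partial>kap n s r)" using L0 pos by simp
  also have "\<dots> = (\<integral>p. L0 * g p \<partial>kap n s r)" by simp
  also have "\<dots> \<le> (\<integral>p. ?L p * g p \<partial>kap n s r)"
  proof (rule integral_mono_AE)
    show "integrable (kap n s r) (\<lambda>p. ?L p * g p)"
      using int(2) integral_kap_Lr(2)[OF n s g, of r' r] by simp
    show "AE p in kap n s r. L0 * g p \<le> ?L p * g p"
      using AE_kap_pos[of n s r] by eventually_elim (rule sgn)
  qed (use int in simp)
  also have "\<dots> = (\<integral>p. g p \<partial>kap n s r')" by (rule integral_kap_Lr(1)[OF n s g, symmetric])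
  finally show ?thesis .
qed

text \<open>Apply single crossing to \<open>g - c\<close>, with \<open>c\<close> halfway between the
  two means; by monotonicity \<open>g - c\<close> stays nonnegative once positive. If the means were
  in the wrong order, it would have positive mean at \<open>r\<close> and negative mean at
  \<open>r'\<close>.\<close>

lemma kap_stochastic_mono:
  fixes g :: "real \<Rightarrow> real"
  assumes n: "1 \<le> n" and s: "s > 0" and r: "0 \<le> r" "r \<le> r'"
    and g [measurable]: "g \<in> borel_measurable borel" and b: "\<And>p. p > 0 \<Longrightarrow> 0 \<le> g p" "\<And>p. p > 0 \<Longrightarrow> g p \<le> B"
    and mono: "\<And>p q. 0 < p \<Longrightarrow> p \<le> q \<Longrightarrow> g p \<le> g q"
  shows "(\<integral>p. g p \<partial>kap n s r) \<le> (\<integral>p. g p \<partial>kap n s r')"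
proof (rule ccontr)
  assume "\<not> ?thesis"
  then have less: "(\<integral>p. g p \<partial>kap n s r') < (\<integral>p. g p \<partial>kap n s r)" by simp
  have r': "r' \<ge> 0" using r by simp
  interpret k: prob_space "kap n s r" by (rule prob_space_kap[OF n s r(1)])
  interpret k': prob_space "kap n s r'" by (rule prob_space_kap[OF n s r'])
  define c where "c = ((\<integral>p. g p \<partial>kap n s r) + (\<integral>p. g p \<partial>kap n s r')) / 2"
  have ab: "\<bar>g p\<bar> \<le> B" if "p > 0" for p using b[OF that] by simp
  have int: "integrable (kap n s r) g" "integrable (kap n s r') g"
    using integrable_kap_bounded[where g = g and B = B] n s r r' ab by simp_all
  have "(\<integral>p. g p - c \<partial>kap n s r') \<ge> 0"
  proof (rule kap_single_crossing[OF n s r, where B = "B + \<bar>c\<bar>"])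
    show "\<bar>g p - c\<bar> \<le> B + \<bar>c\<bar>" if "p > 0" for p using b[OF that] by linarith
    show "g q - c \<ge> 0" if "0 < p" "p < q" "g p - c > 0" for p q using mono[of p q] that by simp
    show "(\<integral>p. g p - c \<partial>kap n s r) > 0" using int(1) less k.prob_space by (simp add: c_def)
  qed simp
  then show False
    using int(2) less k'.prob_space by (simp add: c_def)
qed

subsection \<open>The secrecy density on the ray\<close>

text \<open>For an input \<open>x\<close> of norm \<open>r\<close>: the divergence of its output law
  \<open>N(x, s I)\<close> from the sphere output at \<open>s = s1\<close>, minus the same quantity
  at \<open>s = s2\<close>. The divergences are evaluated in \<open>gd_qd_integral\<close>.\<close>

definition Xi :: "nat \<Rightarrow> real \<Rightarrow> real \<Rightarrow> real \<Rightarrow> real \<Rightarrow> real" where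
  "Xi n R s1 s2 r = (r\<^sup>2 + R\<^sup>2) / 2 * (1 / s1 - 1 / s2) - T n R r s1 + T n R r s2"

definition e2 :: "nat \<Rightarrow> real \<Rightarrow> real \<Rightarrow> real \<Rightarrow> real" where
  "e2 n R s r = (\<integral>p. R / p * H n (R * p) \<partial>kap (n + 2) s r)"

lemma ratio_H_bounds:
  assumes n: "1 \<le> n" and R: "R \<ge> 0" and p: "p > 0"
  shows "0 \<le> R / p * H n (R * p)" "R / p * H n (R * p) \<le> R\<^sup>2 / real n"
proof -
  show "0 \<le> R / p * H n (R * p)" using R p H_nonneg[OF n, of "R * p"] by simp
  have "R / p * H n (R * p) \<le> R / p * (R * p / real n)"
    using R p by (intro mult_left_mono H_le_div n) auto
  also have "\<dots> = R\<^sup>2 / real n" using p by (simp add: power2_eq_square)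
  finally show "R / p * H n (R * p) \<le> R\<^sup>2 / real n" .
qed

text \<open>\<open>Phi n * H n\<close> is a multiple of \<open>Phi (n + 2)\<close>, and
  \<open>cn n\<close> one of \<open>cn (n + 2)\<close>, so a factor \<open>H n\<close> lifts the
  kernel by two dimensions. This is where the dimension \<open>n + 2\<close> of Assumption (A)
  originates.\<close>

lemma K_times_H:
  assumes n: "1 \<le> n" and s: "s > 0" and p: "p > 0"
  shows "K n s r p * H n (r * p) = r / (s * p) * K (n + 2) s r p"
proof -
  have c: "cn n = real n * cn (n + 2)" by (rule cn_add2(1)[OF n])
  have ph: "Phi n (r * p) * H n (r * p) = r * p / real n * Phi (n + 2) (r * p)"
    using Phi_pos[OF n, of "r * p"] by (simp add: H_def)
  have s2: "sqrt s ^ (n + 2) = sqrt s ^ n * s" using s by (simp add: power_add power2_eq_square)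
  have p2: "p ^ (n + 2 - 1) = p ^ (n - 1) * p * p" using n by (cases n) (simp_all add: power_add power2_eq_square)
  have "K n s r p * H n (r * p) = cn n * p ^ (n - 1) * sqrt s ^ n * exp (- s * p\<^sup>2 / 2 - r\<^sup>2 / (2 * s)) * (r * p / real n * Phi (n + 2) (r * p))"
    unfolding K_def using ph by (simp only: mult.assoc)
  also have "\<dots> = r / (s * p) * K (n + 2) s r p"
    unfolding K_def s2 p2 c using s p n by (simp add: ac_simps)
  finally show ?thesis .
qed

lemma dT_eq_e2:
  assumes n: "1 \<le> n" and s: "s > 0"
  shows "1 / s * (\<integral>p. H n (r * p) * (R * H n (R * p)) \<partial>kap n s r) = r / s\<^sup>2 * e2 n R s r"
proof -
  have n2: "1 \<le> n + 2" by simp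
  have "(\<integral>p. H n (r * p) * (R * H n (R * p)) \<partial>kap n s r) = (LINT p:{0<..}|lborel. K n s r p * (H n (r * p) * (R * H n (R * p))))"
    by (rule integral_kap(1)[OF n s]) measurable
  also have "\<dots> = (LINT p:{0<..}|lborel. r / s * (K (n + 2) s r p * (R / p * H n (R * p))))"
  proof (rule set_lebesgue_integral_cong)
    have "K n s r p * (H n (r * p) * (R * H n (R * p))) = r / s * (K (n + 2) s r p * (R / p * H n (R * p)))" if "p > 0" for p
    proof -
      have "K n s r p * (H n (r * p) * (R * H n (R * p))) = (K n s r p * H n (r * p)) * (R * H n (R * p))" by simp
      then show ?thesis unfolding K_times_H[OF n s that] by simp
    qed
    then show "\<forall>p. p \<in> {0<..} \<longrightarrow> K n s r p * (H n (r * p) * (R * H n (R * p))) = r / s * (K (n + 2) s r p * (R / p * H n (R * p)))"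
      by simp
  qed simp
  also have "\<dots> = r / s * (LINT p:{0<..}|lborel. K (n + 2) s r p * (R / p * H n (R * p)))"
    by (rule set_integral_mult_right)
  also have "(LINT p:{0<..}|lborel. K (n + 2) s r p * (R / p * H n (R * p))) = e2 n R s r"
    unfolding e2_def by (rule integral_kap(1)[OF n2 s, symmetric]) measurable
  finally show ?thesis by (simp add: power2_eq_square)
qed

text \<open>\<open>r * kk n R s1 s2 r\<close> is the derivative of \<open>Xi\<close> at
  \<open>r\<close> in the integrated sense of \<open>Xi_diff\<close>; by \<open>integral_gA\<close>
  the factor \<open>kk\<close> is a mean of the function in Assumption (A).\<close>

definition kk :: "nat \<Rightarrow> real \<Rightarrow> real \<Rightarrow> real \<Rightarrow> real \<Rightarrow> real" where
  "kk n R s1 s2 r = (1 / s2\<^sup>2 * e2 n R s2 r - 1 / s2) - (1 / s1\<^sup>2 * e2 n R s1 r - 1 / s1)"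

lemma Xi_diff:
  assumes n: "1 \<le> n" and s: "0 < s1" "0 < s2" and R: "R \<ge> 0" and a: "0 \<le> a" and ab: "a \<le> b"
  shows "Xi n R s1 s2 b - Xi n R s1 s2 a = (LINT r:{a..b}|lborel. r * kk n R s1 s2 r)"
    and "set_integrable lborel {a..b} (\<lambda>r. r * kk n R s1 s2 r)"
proof -
  have T: "T n R b s - T n R a s = (LINT r:{a..b}|lborel. r / s\<^sup>2 * e2 n R s r)"
    "set_integrable lborel {a..b} (\<lambda>r. r / s\<^sup>2 * e2 n R s r)" if "s > 0" for s
    using T_diff_r[OF n that R a ab] unfolding dT_eq_e2[OF n that] .
  define c where "c = 1 / s1 - 1 / s2"
  have i0: "set_integrable lborel {a..b} (\<lambda>r. r * c)"
    by (intro borel_integrable_atLeastAtMost') (auto intro!: continuous_intros)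
  have q: "(LINT r:{a..b}|lborel. r * c) = b\<^sup>2 / 2 * c - a\<^sup>2 / 2 * c"
  proof -
    have "(\<integral>r. (r * c) * indicator {a..b} r \<partial>lborel) = b\<^sup>2 / 2 * c - a\<^sup>2 / 2 * c"
      by (rule integral_FTC_Icc_real[OF ab]) (auto intro!: derivative_eq_intros)
    moreover have "(LINT r:{a..b}|lborel. r * c) = (\<integral>r. (r * c) * indicator {a..b} r \<partial>lborel)"
      unfolding set_lebesgue_integral_def by (intro Bochner_Integration.integral_cong refl) simp
    ultimately show ?thesis by simp
  qed
  have eq: "r * kk n R s1 s2 r = r * c - r / s1\<^sup>2 * e2 n R s1 r + r / s2\<^sup>2 * e2 n R s2 r" for r
    by (simp add: kk_def c_def algebra_simps)
  show "set_integrable lborel {a..b} (\<lambda>r. r * kk n R s1 s2 r)"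
    unfolding eq by (intro set_integral_add set_integral_diff i0 T s)
  have "Xi n R s1 s2 b - Xi n R s1 s2 a
     = (b\<^sup>2 / 2 * c - a\<^sup>2 / 2 * c) - (T n R b s1 - T n R a s1) + (T n R b s2 - T n R a s2)"
    by (simp add: Xi_def c_def[symmetric] algebra_simps add_divide_distrib)
  also have "\<dots> = (LINT r:{a..b}|lborel. r * kk n R s1 s2 r)"
    unfolding eq q[symmetric] T(1)[OF s(1)] T(1)[OF s(2)]
    by (subst set_integral_add, intro set_integral_diff i0 T s, intro T s, subst set_integral_diff, intro i0, intro T s, rule refl)
  finally show "Xi n R s1 s2 b - Xi n R s1 s2 a = (LINT r:{a..b}|lborel. r * kk n R s1 s2 r)" .
qed

subsection \<open>Link with Assumption (A)\<close>

text \<open>The expectation inside \<open>gA\<close> without its constant, with \<open>s\<close> for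
  the larger variance and \<open>t\<close> for the difference of variances. The norm of the shifted
  Gaussian vector appears as \<open>t * p\<close> because \<open>kap\<close> divides norms by the
  variance.\<close>

definition J :: "nat \<Rightarrow> real \<Rightarrow> real \<Rightarrow> real \<Rightarrow> real \<Rightarrow> real" where
  "J n R s t y = (\<integral>p. R / (t * p) * H n (R / s * (t * p)) \<partial>kap (n + 2) t y)"

lemma gA_eq:
  assumes n: "1 \<le> n" and R: "R \<ge> 0" and s: "0 < s1" "s1 < s2" and y: "y > 0"
  shows "gA n R s1 s2 y = 1 / s2 * (J n R s2 (s2 - s1) y - 1) - 1 / s1 * (R / y * H n (R / s1 * y) - 1)"
proof -
  let ?m = "n + 2" and ?t = "s2 - s1"
  have m: "1 \<le> ?m" by simp
  have t: "?t > 0" and s20: "s2 > 0" using s by auto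
  let ?f = "\<lambda>v. R / v * H n (R / s2 * v)"
  interpret k: prob_space "kap ?m ?t y" by (rule prob_space_kap[OF m t]) (use y in simp)
  have vm: "vadd ?m (ve1 ?m y) \<in> measurable (gauss ?m ?t) (Rn ?m)"
    using measurable_vadd1[OF ve1_in_space[of ?m y]] by (simp cong: measurable_cong_sets add: sets_gauss)
  have "(\<integral>w. R / vnorm ?m (vadd ?m (ve1 ?m y) w) * hfun (real n / 2) (R / s2 * vnorm ?m (vadd ?m (ve1 ?m y) w)) - 1 \<partial>gauss ?m ?t)
      = (\<integral>w. ?f (vnorm ?m (vadd ?m (ve1 ?m y) w)) - 1 \<partial>gauss ?m ?t)"
    by (intro Bochner_Integration.integral_cong refl) (use R s20 in \<open>simp add: hfun_eq_H[OF n]\<close>)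
  also have "\<dots> = (\<integral>u. ?f (vnorm ?m u) - 1 \<partial>distr (gauss ?m ?t) (Rn ?m) (vadd ?m (ve1 ?m y)))"
    by (rule integral_distr[OF vm, symmetric]) measurable
  also have "\<dots> = (\<integral>u. ?f (?t * (vnorm ?m u / ?t)) - 1 \<partial>density (Rn ?m) (\<lambda>u. ennreal (gd ?m ?t (ve1 ?m y) u)))"
    unfolding distr_gauss[OF t ve1_in_space] using t by simp
  also have "\<dots> = (\<integral>p. ?f (?t * p) - 1 \<partial>kap ?m ?t (vnorm ?m (ve1 ?m y)))"
    by (rule integral_gd_radial(1)[OF m t ve1_in_space]) measurable
  also have "\<dots> = (\<integral>p. ?f (?t * p) - 1 \<partial>kap ?m ?t y)" using y by (simp add: vnorm_ve1)
  also have "\<dots> = J n R s2 ?t y - 1"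
  proof -
    have "integrable (kap ?m ?t y) (\<lambda>p. ?f (?t * p))"
    proof (rule integrable_kap_bounded[OF m t])
      fix p :: real assume p: "p > 0"
      have "0 \<le> ?f (?t * p)" using R p t s20 H_nonneg[OF n, of "R / s2 * (?t * p)"] by simp
      moreover have "?f (?t * p) \<le> R / (?t * p) * (R / s2 * (?t * p) / real n)"
        using R p t s20 by (intro mult_left_mono H_le_div n) auto
      moreover have "R / (?t * p) * (R / s2 * (?t * p) / real n) = R * (R / s2 / real n)" using p t by simp
      ultimately show "\<bar>?f (?t * p)\<bar> \<le> R * (R / s2 / real n)" by (simp only: abs_of_nonneg)
    qed (use y in \<open>simp, measurable\<close>)
    then show ?thesis using k.prob_space by (simp add: J_def)
  qed
  finally show ?thesis
    unfolding gA_def using hfun_eq_H[OF n, of "R / s1 * y"] R s y by simp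
qed

lemma nn_integral_kap:
  assumes n: "1 \<le> n" and s: "s > 0" and x: "x \<in> space (Rn n)" and g: "g \<in> borel_measurable borel"
  shows "(\<integral>\<^sup>+p. g p \<partial>kap n s (vnorm n x)) = (\<integral>\<^sup>+y. ennreal (gd n s x y) * g (vnorm n y / s) \<partial>Rn n)"
proof -
  have m: "(\<lambda>y. vnorm n y / s) \<in> measurable (density (Rn n) (\<lambda>y. ennreal (gd n s x y))) borel" by simp
  have gm: "(\<lambda>y. ennreal (gd n s x y)) \<in> borel_measurable (Rn n)" using x by measurable
  have gv: "(\<lambda>y. g (vnorm n y / s)) \<in> borel_measurable (Rn n)"
    by (rule measurable_compose[OF _ g]) measurable
  show ?thesis
    unfolding law_gd[OF n s x, symmetric]
    using nn_integral_distr[OF m, of g] g nn_integral_density[OF gm gv] by simp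
qed

text \<open>The convolution identity \<open>conv_gd\<close> read through norms, for noise
  \<open>s\<close> followed by independent noise \<open>t\<close>. The factors in
  \<open>s * p\<close> and \<open>t * q\<close> undo the division by the variance that is built into
  \<open>kap\<close>.\<close>

lemma kap_semigroup:
  assumes n: "1 \<le> n" and s: "s > 0" and t: "t > 0" and r: "r \<ge> 0" and g [measurable]: "g \<in> borel_measurable borel"
  shows "(\<integral>\<^sup>+p. (\<integral>\<^sup>+q. g (t * q) \<partial>kap n t (s * p)) \<partial>kap n s r) = (\<integral>\<^sup>+p. g ((s + t) * p) \<partial>kap n (s + t) r)"
proof -
  let ?x = "ve1 n r"
  have vx: "vnorm n ?x = r" using n r by (simp add: vnorm_ve1)
  define F where "F = (\<lambda>a. \<integral>\<^sup>+q. g (t * q) \<partial>kap n t a)"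
  have F [measurable]: "F \<in> borel_measurable borel"
  proof -
    have eq: "F a = (\<integral>\<^sup>+q. ennreal (indicator {0<..} q * K n t a q) * g (t * q) \<partial>lborel)" for a
      unfolding F_def kap_def by (rule nn_integral_density) measurable
    have "(\<lambda>a. \<integral>\<^sup>+q. ennreal (indicator {0<..} q * K n t a q) * g (t * q) \<partial>lborel) \<in> borel_measurable borel"
      unfolding K_def by (intro sigma_finite_measure.borel_measurable_nn_integral lborel.sigma_finite_measure_axioms) measurable
    then show ?thesis by (simp add: eq[abs_def])
  qed
  interpret L: sigma_finite_measure "Rn n" by simp
  interpret LL: pair_sigma_finite "Rn n" "Rn n" ..
  have g1: "(\<lambda>u. g (vnorm n u)) \<in> borel_measurable (Rn n)" by (rule measurable_compose[OF _ g]) measurable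
  have st: "s + t > 0" using s t by simp
  have m2: "(\<lambda>(y, u). ennreal (gd n s ?x y) * ennreal (gd n t y u) * g (vnorm n u)) \<in> borel_measurable (Rn n \<Otimes>\<^sub>M Rn n)"
  proof -
    have [measurable]: "(\<lambda>z. gd n s ?x (fst z)) \<in> borel_measurable (Rn n \<Otimes>\<^sub>M Rn n)"
      "(\<lambda>z. gd n t (fst z) (snd z)) \<in> borel_measurable (Rn n \<Otimes>\<^sub>M Rn n)"
      by (rule measurable_gd; simp)+
    have [measurable]: "(\<lambda>z. g (vnorm n (snd z))) \<in> borel_measurable (Rn n \<Otimes>\<^sub>M Rn n)"
      by (rule measurable_compose[OF _ g]) measurable
    show ?thesis unfolding case_prod_beta by measurable
  qed
  have "(\<integral>\<^sup>+p. F (s * p) \<partial>kap n s r) = (\<integral>\<^sup>+y. ennreal (gd n s ?x y) * F (vnorm n y) \<partial>Rn n)"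
    using nn_integral_kap[OF n s ve1_in_space, of "\<lambda>p. F (s * p)" r] s vx by simp
  also have "\<dots> = (\<integral>\<^sup>+y. (\<integral>\<^sup>+u. ennreal (gd n s ?x y) * ennreal (gd n t y u) * g (vnorm n u) \<partial>Rn n) \<partial>Rn n)"
  proof (intro nn_integral_cong)
    fix y assume y: "y \<in> space (Rn n)"
    have "F (vnorm n y) = (\<integral>\<^sup>+u. ennreal (gd n t y u) * g (vnorm n u) \<partial>Rn n)"
      unfolding F_def using nn_integral_kap[OF n t y, of "\<lambda>q. g (t * q)"] t by simp
    moreover have "(\<lambda>u. ennreal (gd n t y u) * g (vnorm n u)) \<in> borel_measurable (Rn n)"
      using g1 y by measurable
    ultimately show "ennreal (gd n s ?x y) * F (vnorm n y) = (\<integral>\<^sup>+u. ennreal (gd n s ?x y) * ennreal (gd n t y u) * g (vnorm n u) \<partial>Rn n)"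
      by (simp add: nn_integral_cmult[symmetric] mult.assoc)
  qed
  also have "\<dots> = (\<integral>\<^sup>+u. (\<integral>\<^sup>+y. ennreal (gd n s ?x y) * ennreal (gd n t y u) * g (vnorm n u) \<partial>Rn n) \<partial>Rn n)"
    by (rule LL.Fubini'[OF m2, symmetric])
  also have "\<dots> = (\<integral>\<^sup>+u. ennreal (gd n (s + t) ?x u) * g (vnorm n u) \<partial>Rn n)"
  proof (intro nn_integral_cong)
    fix u assume u: "u \<in> space (Rn n)"
    have m: "(\<lambda>y. gd n s ?x y) \<in> borel_measurable (Rn n)" "(\<lambda>y. gd n t y u) \<in> borel_measurable (Rn n)"
      by (rule measurable_gd; simp add: u)+
    have "(\<lambda>y. ennreal (gd n s ?x y) * ennreal (gd n t y u)) \<in> borel_measurable (Rn n)"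
      by (intro borel_measurable_times_ennreal measurable_compose[OF _ measurable_ennreal] m)
    then show "(\<integral>\<^sup>+y. ennreal (gd n s ?x y) * ennreal (gd n t y u) * g (vnorm n u) \<partial>Rn n) = ennreal (gd n (s + t) ?x u) * g (vnorm n u)"
      by (simp add: nn_integral_multc conv_gd[OF s t])
  qed
  also have "\<dots> = (\<integral>\<^sup>+p. g ((s + t) * p) \<partial>kap n (s + t) r)"
    using nn_integral_kap[OF n st ve1_in_space, of "\<lambda>p. g ((s + t) * p)" r] st vx by simp
  finally show ?thesis by (simp only: F_def)
qed

lemma scaled_ratio_H_bounds:
  assumes n: "1 \<le> n" and R: "R \<ge> 0" and s: "s > 0" and v: "v > 0"
  shows "0 \<le> R / v * H n (R / s * v)" "R / v * H n (R / s * v) \<le> R\<^sup>2 / (s * real n)"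
proof -
  show "0 \<le> R / v * H n (R / s * v)" using R s v H_nonneg[OF n, of "R / s * v"] by simp
  have "R / v * H n (R / s * v) \<le> R / v * (R / s * v / real n)"
    using R s v by (intro mult_left_mono H_le_div n) auto
  also have "\<dots> = R\<^sup>2 / (s * real n)" using v by (simp add: power2_eq_square)
  finally show "R / v * H n (R / s * v) \<le> R\<^sup>2 / (s * real n)" .
qed

text \<open>The inequality \<open>H n v <= v / n\<close> cancels the pole of
  \<open>R / (t * p)\<close> at 0, so the integrand is bounded and its mean well behaved.\<close>

lemma
  assumes n: "1 \<le> n" and R: "R \<ge> 0" and s: "s > 0" and t: "t > 0"
  shows J_eq_enn: "y \<ge> 0 \<Longrightarrow> ennreal (J n R s t y) = (\<integral>\<^sup>+p. ennreal (R / (t * p) * H n (R / s * (t * p))) \<partial>kap (n + 2) t y)"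
    and J_nonneg: "J n R s t y \<ge> 0"
    and J_le: "y \<ge> 0 \<Longrightarrow> J n R s t y \<le> R\<^sup>2 / (s * real n)"
    and J_measurable: "J n R s t \<in> borel_measurable borel"
proof -
  let ?m = "n + 2"
  let ?f = "\<lambda>p. R / (t * p) * H n (R / s * (t * p))"
  have m: "1 \<le> ?m" by simp
  have b: "0 \<le> ?f p" "?f p \<le> R\<^sup>2 / (s * real n)" if "p > 0" for p
    using scaled_ratio_H_bounds[OF n R s, of "t * p"] that t by auto
  have i: "integrable (kap ?m t y) ?f" if "y \<ge> 0" for y
    by (rule integrable_kap_bounded[OF m t that, where B = "R\<^sup>2 / (s * real n)"]) (measurable, use b in force)
  have AE1: "AE p in kap ?m t y. 0 \<le> ?f p" for y
    using AE_kap_pos[of ?m t y] by eventually_elim (rule b)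
  have AE2: "AE p in kap ?m t y. ?f p \<le> R\<^sup>2 / (s * real n)" for y
    using AE_kap_pos[of ?m t y] by eventually_elim (rule b)
  show "ennreal (J n R s t y) = (\<integral>\<^sup>+p. ennreal (?f p) \<partial>kap ?m t y)" if "y \<ge> 0"
    unfolding J_def by (rule nn_integral_eq_integral[OF i[OF that] AE1, symmetric])
  show "J n R s t y \<ge> 0" unfolding J_def by (rule integral_nonneg_AE[OF AE1])
  show "J n R s t y \<le> R\<^sup>2 / (s * real n)" if y: "y \<ge> 0"
  proof -
    interpret k: prob_space "kap ?m t y" by (rule prob_space_kap[OF m t y])
    have "J n R s t y \<le> (\<integral>p. R\<^sup>2 / (s * real n) \<partial>kap ?m t y)"
      unfolding J_def by (rule integral_mono_AE[OF i[OF y] _ AE2]) simp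
    then show ?thesis using k.prob_space by simp
  qed
  \<comment> \<open>The measure \<open>kap\<close> varies with \<open>y\<close>; as an integral over
    Lebesgue measure with a parameter, \<open>J\<close> is visibly measurable.\<close>
  have "J n R s t y = (\<integral>p. indicator {0<..} p * (K ?m t y p * ?f p) \<partial>lborel)" for y
    unfolding J_def by (subst integral_kap(1)[OF m t]) (simp_all add: set_lebesgue_integral_def)
  moreover have "(\<lambda>y. \<integral>p. indicator {0<..} p * (K ?m t y p * ?f p) \<partial>lborel) \<in> borel_measurable borel"
    unfolding K_def by (intro lborel.borel_measurable_lebesgue_integral) measurable
  ultimately show "J n R s t \<in> borel_measurable borel" by (simp add: fun_eq_iff[symmetric] cong: measurable_cong)
qed

lemma gA_bound:
  assumes n: "1 \<le> n" and R: "R \<ge> 0" and s: "0 < s1" "s1 < s2" and y: "y > 0"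
  shows "\<bar>gA n R s1 s2 y\<bar> \<le> 1 / s2 * (R\<^sup>2 / (s2 * real n) + 1) + 1 / s1 * (R\<^sup>2 / (s1 * real n) + 1)"
proof -
  have t: "s2 - s1 > 0" and s20: "s2 > 0" using s by auto
  have "\<bar>1 / s2 * (J n R s2 (s2 - s1) y - 1)\<bar> \<le> 1 / s2 * (R\<^sup>2 / (s2 * real n) + 1)"
    unfolding abs_mult using J_nonneg[OF n R s20 t, of y] J_le[OF n R s20 t, of y] y s20
    by (intro mult_mono) auto
  moreover have "\<bar>1 / s1 * (R / y * H n (R / s1 * y) - 1)\<bar> \<le> 1 / s1 * (R\<^sup>2 / (s1 * real n) + 1)"
    unfolding abs_mult using scaled_ratio_H_bounds[OF n R s(1) y] s(1)
    by (intro mult_mono) auto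
  ultimately show ?thesis unfolding gA_eq[OF n R s y] by linarith
qed

text \<open>The constants contribute \<open>1 / s1 - 1 / s2 > 0\<close>, the \<open>s2\<close> term
  is nonnegative, and the remaining term is at most \<open>R / (s1 * y)\<close>. Hence the one sign
  change that Assumption (A) permits can only go from negative to positive.\<close>

lemma gA_eventually_pos:
  assumes n: "1 \<le> n" and R: "R \<ge> 0" and s: "0 < s1" "s1 < s2"
  shows "\<exists>c. \<forall>y>c. gA n R s1 s2 y > 0"
proof -
  have t: "s2 - s1 > 0" and s20: "s2 > 0" using s by auto
  define d where "d = 1 / s1 - 1 / s2"
  have d: "d > 0" using s by (simp add: d_def frac_less2)
  have "gA n R s1 s2 y > 0" if y: "y > max 0 (R / (s1 * d))" for y
  proof -
    have y0: "y > 0" using y by simp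
    have "R / y * H n (R / s1 * y) \<le> R / y * 1"
      using R y0 s by (intro mult_left_mono H_le_1 n) auto
    then have "1 / s1 * (R / y * H n (R / s1 * y)) \<le> 1 / s1 * (R / y * 1)"
      by (rule mult_left_mono) (use s in simp)
    also have "\<dots> < d"
    proof -
      have "R / (s1 * d) < y" using y by simp
      then have "R < y * (s1 * d)" using s d by (simp add: pos_divide_less_eq)
      then have "R / (s1 * y) < d" using s y0 by (simp add: pos_divide_less_eq ac_simps)
      then show ?thesis by simp
    qed
    finally have "1 / s1 * (R / y * H n (R / s1 * y)) < d" .
    moreover have "0 \<le> 1 / s2 * J n R s2 (s2 - s1) y" using J_nonneg[OF n R s20 t, of y] s20 by simp
    moreover have "gA n R s1 s2 y = 1 / s2 * J n R s2 (s2 - s1) y - 1 / s1 * (R / y * H n (R / s1 * y)) + d"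
      unfolding gA_eq[OF n R s y0] d_def by (simp add: right_diff_distrib)
    ultimately show ?thesis by linarith
  qed
  then show ?thesis by blast
qed

text \<open>\<open>gA\<close> on \<open>y > 0\<close>, in a form that is evidently measurable.\<close>

definition gAm :: "nat \<Rightarrow> real \<Rightarrow> real \<Rightarrow> real \<Rightarrow> real \<Rightarrow> real" where
  "gAm n R s1 s2 y = 1 / s2 * (J n R s2 (s2 - s1) y - 1) - 1 / s1 * (R / y * H n (R / s1 * y) - 1)"

text \<open>By the semigroup property, averaging the noise \<open>s2 - s1\<close> inside
  \<open>gA\<close> over a law with noise \<open>s1\<close> gives noise \<open>s2\<close>. Each of
  the two terms becomes \<open>e2\<close> at its own variance.\<close>

lemma integral_gA:
  assumes n: "1 \<le> n" and R: "R \<ge> 0" and s: "0 < s1" "s1 < s2" and r: "r \<ge> 0"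
  shows "(\<integral>p. gAm n R s1 s2 (s1 * p) \<partial>kap (n + 2) s1 r) = kk n R s1 s2 r"
proof -
  let ?m = "n + 2" and ?t = "s2 - s1"
  have m: "1 \<le> ?m" by simp
  have t: "?t > 0" and s20: "s2 > 0" using s by auto
  interpret k: prob_space "kap ?m s1 r" by (rule prob_space_kap[OF m s(1) r])
  note Jm [measurable] = J_measurable[OF n R s20 t]
  have J0: "J n R s2 ?t y \<ge> 0" for y by (rule J_nonneg[OF n R s20 t])
  have iJ: "integrable (kap ?m s1 r) (\<lambda>p. J n R s2 ?t (s1 * p))"
    by (rule integrable_kap_bounded[OF m s(1) r, where B = "R\<^sup>2 / (s2 * real n)"])
       (measurable, use J0 J_le[OF n R s20 t] s in auto)
  have b2: "0 \<le> R / p * H n (R * p)" "R / p * H n (R * p) \<le> R\<^sup>2 / real n" if "p > 0" for p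
    using ratio_H_bounds[OF n R that] by auto
  have iH: "integrable (kap ?m u r) (\<lambda>p. R / p * H n (R * p))" if "u > 0" for u
    by (rule integrable_kap_bounded[OF m that r, where B = "R\<^sup>2 / real n"]) (measurable, use b2 in force)
  have AEH: "AE p in kap ?m u r. 0 \<le> R / p * H n (R * p)" for u
    using AE_kap_pos[of ?m u r] by eventually_elim (rule b2)
  have "ennreal (\<integral>p. J n R s2 ?t (s1 * p) \<partial>kap ?m s1 r) = (\<integral>\<^sup>+p. ennreal (J n R s2 ?t (s1 * p)) \<partial>kap ?m s1 r)"
    by (rule nn_integral_eq_integral[OF iJ, symmetric]) (simp add: J0)
  also have "\<dots> = (\<integral>\<^sup>+p. (\<integral>\<^sup>+q. ennreal (R / (?t * q) * H n (R / s2 * (?t * q))) \<partial>kap ?m ?t (s1 * p)) \<partial>kap ?m s1 r)"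
  proof (rule nn_integral_cong_AE)
    show "AE p in kap ?m s1 r. ennreal (J n R s2 ?t (s1 * p)) = (\<integral>\<^sup>+q. ennreal (R / (?t * q) * H n (R / s2 * (?t * q))) \<partial>kap ?m ?t (s1 * p))"
      using AE_kap_pos[of ?m s1 r] by eventually_elim (rule J_eq_enn[OF n R s20 t], use s in simp)
  qed
  also have "\<dots> = (\<integral>\<^sup>+p. ennreal (R / ((s1 + ?t) * p) * H n (R / s2 * ((s1 + ?t) * p))) \<partial>kap ?m (s1 + ?t) r)"
    by (rule kap_semigroup[OF m s(1) t r, where g = "\<lambda>v. ennreal (R / v * H n (R / s2 * v))"]) measurable
  also have "\<dots> = (\<integral>\<^sup>+p. ennreal (1 / s2 * (R / p * H n (R * p))) \<partial>kap ?m s2 r)"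
    using s20 by simp
  also have "\<dots> = ennreal (\<integral>p. 1 / s2 * (R / p * H n (R * p)) \<partial>kap ?m s2 r)"
  proof (rule nn_integral_eq_integral)
    show "AE p in kap ?m s2 r. 0 \<le> 1 / s2 * (R / p * H n (R * p))"
      using AEH[of s2] by eventually_elim (rule mult_nonneg_nonneg[rotated], assumption, use s20 in simp)
  qed (intro integrable_mult_right iH s20)
  also have "(\<integral>p. 1 / s2 * (R / p * H n (R * p)) \<partial>kap ?m s2 r) = 1 / s2 * e2 n R s2 r"
    unfolding e2_def by (rule integral_mult_right_zero)
  finally have "ennreal (\<integral>p. J n R s2 ?t (s1 * p) \<partial>kap ?m s1 r) = ennreal (1 / s2 * e2 n R s2 r)" .
  moreover have "0 \<le> (\<integral>p. J n R s2 ?t (s1 * p) \<partial>kap ?m s1 r)" by (rule integral_nonneg_AE) (simp add: J0)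
  moreover have "0 \<le> 1 / s2 * e2 n R s2 r" unfolding e2_def using s20 integral_nonneg_AE[OF AEH] by simp
  ultimately have EJ: "(\<integral>p. J n R s2 ?t (s1 * p) \<partial>kap ?m s1 r) = 1 / s2 * e2 n R s2 r" by simp
  have eq: "gAm n R s1 s2 (s1 * p) = 1 / s2 * J n R s2 ?t (s1 * p) - 1 / s1 * (1 / s1 * (R / p * H n (R * p))) + (1 / s1 - 1 / s2)" for p
    using s by (simp add: gAm_def right_diff_distrib)
  have "(\<integral>p. gAm n R s1 s2 (s1 * p) \<partial>kap ?m s1 r)
     = (\<integral>p. 1 / s2 * J n R s2 ?t (s1 * p) \<partial>kap ?m s1 r) - (\<integral>p. 1 / s1 * (1 / s1 * (R / p * H n (R * p))) \<partial>kap ?m s1 r) + (\<integral>p. 1 / s1 - 1 / s2 \<partial>kap ?m s1 r)"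
    unfolding eq
    by (subst Bochner_Integration.integral_add, intro Bochner_Integration.integrable_diff integrable_mult_right iJ iH s, simp,
        subst Bochner_Integration.integral_diff, intro integrable_mult_right iJ, intro integrable_mult_right iH s, rule refl)
  also have "(\<integral>p. 1 / s2 * J n R s2 ?t (s1 * p) \<partial>kap ?m s1 r) = 1 / s2 * (1 / s2 * e2 n R s2 r)"
    unfolding EJ[symmetric] by (rule integral_mult_right_zero)
  also have "(\<integral>p. 1 / s1 * (1 / s1 * (R / p * H n (R * p))) \<partial>kap ?m s1 r) = 1 / s1 * (1 / s1 * e2 n R s1 r)"
    unfolding e2_def by (simp only: integral_mult_right_zero)
  also have "(\<integral>p. 1 / s1 - 1 / s2 \<partial>kap ?m s1 r) = 1 / s1 - 1 / s2" using k.prob_space by simp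
  finally show ?thesis by (simp add: kk_def power2_eq_square)
qed

text \<open>\<open>kk\<close> at \<open>r\<close> is the mean of a function that crosses zero only
  upwards, under laws with monotone likelihood ratio in \<open>r\<close>; such averages cannot pass
  from positive to negative as \<open>r\<close> grows.\<close>

lemma kk_crossing:
  assumes A: assumption_A and n: "1 \<le> n" and R: "R \<ge> 0" and s: "0 < s1" "s1 < s2"
    and r: "0 \<le> r" "r \<le> r'" and pos: "kk n R s1 s2 r > 0"
  shows "kk n R s1 s2 r' \<ge> 0"
proof -
  let ?m = "n + 2"
  have m: "1 \<le> ?m" by simp
  have t: "s2 - s1 > 0" and s20: "s2 > 0" using s by auto
  note Jm [measurable] = J_measurable[OF n R s20 t]
  have g: "gAm n R s1 s2 y = gA n R s1 s2 y" if "y > 0" for y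
    unfolding gAm_def gA_eq[OF n R s that] ..
  have sc: "at_most_one_sign_change (gA n R s1 s2)"
    using A n R s unfolding assumption_A_def by simp
  obtain c where c: "\<And>y. y > c \<Longrightarrow> gA n R s1 s2 y > 0" using gA_eventually_pos[OF n R s] by blast
  have "0 \<le> (\<integral>p. gAm n R s1 s2 (s1 * p) \<partial>kap ?m s1 r')"
  proof (rule kap_single_crossing[OF m s(1) r])
    show "(\<lambda>p. gAm n R s1 s2 (s1 * p)) \<in> borel_measurable borel" unfolding gAm_def by measurable
    show "\<bar>gAm n R s1 s2 (s1 * p)\<bar> \<le> 1 / s2 * (R\<^sup>2 / (s2 * real n) + 1) + 1 / s1 * (R\<^sup>2 / (s1 * real n) + 1)" if "p > 0" for p
      using g[of "s1 * p"] gA_bound[OF n R s, of "s1 * p"] that s by simp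
    show "(\<integral>p. gAm n R s1 s2 (s1 * p) \<partial>kap ?m s1 r) > 0" unfolding integral_gA[OF n R s r(1)] by (rule pos)
    show "gAm n R s1 s2 (s1 * q) \<ge> 0" if pq: "0 < p" "p < q" "gAm n R s1 s2 (s1 * p) > 0" for p q
    proof (rule ccontr)
      assume "\<not> ?thesis"
      then have neg: "gA n R s1 s2 (s1 * q) < 0" using g[of "s1 * q"] pq s by simp
      have pos': "gA n R s1 s2 (s1 * p) > 0" using g[of "s1 * p"] pq s by simp
      \<comment> \<open>A point beyond both \<open>s1 * q\<close> and the threshold of
        \<open>gA_eventually_pos\<close> completes the forbidden pattern plus, minus, plus.\<close>
      let ?z = "max (s1 * q) c + 1"
      have "gA n R s1 s2 ?z > 0" by (rule c) simp
      moreover have "0 < s1 * p" "s1 * p < s1 * q" "s1 * q < ?z" using pq s by auto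
      ultimately show False using sc neg pos' unfolding at_most_one_sign_change_def by blast
    qed
  qed
  then show ?thesis using integral_gA[OF n R s, of r'] r by simp
qed

text \<open>If \<open>Xi\<close> at \<open>r\<close> exceeded the value at \<open>R\<close>, it
  would also exceed the value at 0. Its derivative would then be positive somewhere up to
  \<open>r\<close>, hence nonnegative from \<open>r\<close> to \<open>R\<close>, which contradicts
  the excess.\<close>

lemma Xi_le_endpoint:
  assumes A: assumption_A and n: "1 \<le> n" and R: "R \<ge> 0" and s: "0 < s1" "s1 < s2"
    and X: "Xi n R s1 s2 0 \<le> Xi n R s1 s2 R" and r: "0 \<le> r" "r \<le> R"
  shows "Xi n R s1 s2 r \<le> Xi n R s1 s2 R"
proof (rule ccontr)
  assume not: "\<not> ?thesis"
  have s20: "0 < s2" using s by simp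
  note D = Xi_diff[OF n s(1) s20 R]
  have "\<exists>a. 0 \<le> a \<and> a \<le> r \<and> a * kk n R s1 s2 a > 0"
  proof (rule ccontr)
    assume "\<not> ?thesis"
    then have "a * kk n R s1 s2 a \<le> 0" if "0 \<le> a" "a \<le> r" for a using that by force
    then have "(LINT a:{0..r}|lborel. a * kk n R s1 s2 a) \<le> (LINT a:{0..r}|lborel. 0)"
      by (intro set_integral_mono D(2) r) (auto simp: set_integrable_def)
    then have "Xi n R s1 s2 r - Xi n R s1 s2 0 \<le> 0" using D(1)[OF order_refl r(1)] by simp
    with not X show False by simp
  qed
  then obtain a where a: "0 \<le> a" "a \<le> r" "a * kk n R s1 s2 a > 0" by blast
  then have ka: "kk n R s1 s2 a > 0" by (simp add: zero_less_mult_iff)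
  have "0 \<le> b * kk n R s1 s2 b" if "r \<le> b" "b \<le> R" for b
    using kk_crossing[OF A n R s a(1) _ ka, of b] that a by simp
  then have "(LINT b:{r..R}|lborel. 0) \<le> (LINT b:{r..R}|lborel. b * kk n R s1 s2 b)"
    by (intro set_integral_mono D(2) r) (auto simp: set_integrable_def)
  then have "Xi n R s1 s2 r \<le> Xi n R s1 s2 R" using D(1)[OF r] by simp
  with not show False by simp
qed

section \<open>Output densities, joint laws and mutual information\<close>

text \<open>\<open>fP n s P\<close> is the output density of the input \<open>P\<close>, and \<open>KLq\<close> its divergence from \<open>qd n R s\<close>.\<close>

definition fP :: "nat \<Rightarrow> real \<Rightarrow> (nat \<Rightarrow> real) measure \<Rightarrow> (nat \<Rightarrow> real) \<Rightarrow> real" where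
  "fP n s P y = (\<integral>x. gd n s x y \<partial>P)"

definition KLq :: "nat \<Rightarrow> real \<Rightarrow> real \<Rightarrow> (nat \<Rightarrow> real) measure \<Rightarrow> real" where
  "KLq n R s P = (\<integral>y. ln (fP n s P y / qd n R s y) \<partial>density (Rn n) (\<lambda>y. ennreal (fP n s P y)))"

text \<open>Cauchy-Schwarz by rotation: once \<open>x\<close> lies on the first axis, the inner
  product is its norm times one coordinate of the image of \<open>y\<close>.\<close>

lemma abs_vdot_le:
  assumes n: "1 \<le> n" and x: "x \<in> space (Rn n)" and y: "y \<in> space (Rn n)"
  shows "\<bar>vdot n x y\<bar> \<le> vnorm n x * vnorm n y"
proof -
  obtain T where T: "orth n T" "T x = ve1 n (vnorm n x)" using orth_to_ve1[OF n x] by blast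
  have "vdot n x y = vnorm n x * T y 0"
    using orth_vdot[OF T(1) x y] by (simp add: T(2) vdot_ve1[OF n])
  moreover have "\<bar>T y 0\<bar> \<le> vnorm n y"
    using abs_coord_le_vnorm[of 0 n "T y"] n orth_vnorm[OF T(1) y] by simp
  ultimately show ?thesis by (simp add: abs_mult mult_left_mono)
qed

lemma gd_le: "s > 0 \<Longrightarrow> gd n s x y \<le> (1 / sqrt (2 * pi * s)) ^ n"
proof -
  assume s: "s > 0"
  have "vdot n y y - 2 * vdot n x y + vdot n x x = (\<Sum>i<n. (y i - x i)\<^sup>2)"
    unfolding vdot_def sum_distrib_left sum_subtractf[symmetric] sum.distrib[symmetric]
    by (intro sum.cong refl) (simp add: power2_eq_square algebra_simps)
  then have "0 \<le> vdot n y y - 2 * vdot n x y + vdot n x x" by (simp add: sum_nonneg)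
  then have "exp (- (vdot n y y - 2 * vdot n x y + vdot n x x) / (2 * s)) \<le> 1"
    using s by (simp add: divide_nonpos_pos)
  then show ?thesis unfolding gd_eq[OF s] using s
    by (intro mult_left_le) auto
qed

text \<open>From \<open>|y - x|^2 <= 2 * (|y|^2 + |x|^2)\<close>. Being uniform over inputs in the
  ball, the bound passes to \<open>fP\<close>, so that \<open>ln (fP n s P y)\<close> grows at most
  quadratically; integrability of the log ratios depends on this.\<close>

lemma gd_ge:
  assumes n: "1 \<le> n" and s: "s > 0" and x: "x \<in> space (Rn n)" "vnorm n x \<le> R" and y: "y \<in> space (Rn n)"
  shows "(1 / sqrt (2 * pi * s)) ^ n * exp (- ((vnorm n y)\<^sup>2 + R\<^sup>2) / s) \<le> gd n s x y"
proof -
  have "- (2 * vdot n x y) \<le> 2 * (vnorm n x * vnorm n y)" using abs_vdot_le[OF n x(1) y] by simp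
  also have "\<dots> \<le> (vnorm n x)\<^sup>2 + (vnorm n y)\<^sup>2" using sum_squares_bound[of "vnorm n x" "vnorm n y"] by simp
  finally have "vdot n y y - 2 * vdot n x y + vdot n x x \<le> 2 * ((vnorm n y)\<^sup>2 + (vnorm n x)\<^sup>2)"
    by (simp add: vnorm_power2)
  also have "\<dots> \<le> 2 * ((vnorm n y)\<^sup>2 + R\<^sup>2)" using x(2) by (simp add: power_mono)
  finally have "- (2 * ((vnorm n y)\<^sup>2 + R\<^sup>2)) / (2 * s) \<le> - (vdot n y y - 2 * vdot n x y + vdot n x x) / (2 * s)"
    using s by (intro divide_right_mono) auto
  moreover have "- (2 * v) / (2 * s) = - v / s" for v by simp
  then have "- (2 * ((vnorm n y)\<^sup>2 + R\<^sup>2)) / (2 * s) = - ((vnorm n y)\<^sup>2 + R\<^sup>2) / s" .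
  ultimately show ?thesis unfolding gd_eq[OF s] using s by (intro mult_left_mono) auto
qed

text \<open>The support of the input is left unrestricted, because \<open>KLq_antimono\<close> feeds
  the output law of one channel, which is unbounded, into a second channel.\<close>

locale prob_input =
  fixes n :: nat and s :: real and P :: "(nat \<Rightarrow> real) measure"
  assumes n: "1 \<le> n" and s: "0 < s" and prob_P: "prob_space P" and sets_P [measurable_cong]: "sets P = sets (Rn n)"
begin

sublocale P: prob_space P by (rule prob_P)

lemma space_P: "space P = space (Rn n)"
  by (rule sets_eq_imp_space_eq[OF sets_P])

sublocale L: sigma_finite_measure "Rn n" by simp

sublocale PL: pair_sigma_finite P "Rn n" ..

abbreviation M where "M \<equiv> (1 / sqrt (2 * pi * s)) ^ n"

lemma M_pos: "M > 0" using s by simp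

lemma gd_measurable_P: "y \<in> space (Rn n) \<Longrightarrow> (\<lambda>x. gd n s x y) \<in> borel_measurable P"
  by (rule measurable_gd) (simp_all cong: measurable_cong_sets add: sets_P)

lemma gd_measurable_pair [measurable]: "(\<lambda>z. gd n s (fst z) (snd z)) \<in> borel_measurable (P \<Otimes>\<^sub>M Rn n)"
  by (rule measurable_gd) (simp_all cong: measurable_cong_sets add: sets_P)

lemma integrable_gd_P: "y \<in> space (Rn n) \<Longrightarrow> integrable P (\<lambda>x. gd n s x y)"
  by (rule P.integrable_const_bound[where B = M]) (auto simp: gd_le[OF s] gd_measurable_P)

lemma nn_integral_gd_P: "y \<in> space (Rn n) \<Longrightarrow> (\<integral>\<^sup>+x. ennreal (gd n s x y) \<partial>P) = ennreal (fP n s P y)"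
  unfolding fP_def by (rule nn_integral_eq_integral[OF integrable_gd_P]) auto

lemma fP_le: "y \<in> space (Rn n) \<Longrightarrow> fP n s P y \<le> M"
proof -
  assume y: "y \<in> space (Rn n)"
  have "fP n s P y \<le> (\<integral>x. M \<partial>P)"
    unfolding fP_def by (intro integral_mono integrable_gd_P y) (auto simp: gd_le[OF s])
  then show ?thesis by (simp add: P.prob_space)
qed

lemma fP_measurable [measurable]: "fP n s P \<in> borel_measurable (Rn n)"
proof -
  have "(\<lambda>(y, x). gd n s x y) \<in> borel_measurable (Rn n \<Otimes>\<^sub>M P)"
    unfolding case_prod_beta by (rule measurable_gd) (simp_all cong: measurable_cong_sets add: sets_P)
  from P.borel_measurable_lebesgue_integral[OF this] show ?thesis
    unfolding fP_def[abs_def] by simp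
qed

text \<open>The joint law of input and output, given by its density over \<open>P\<close> times
  Lebesgue measure.\<close>

definition Jm :: "((nat \<Rightarrow> real) \<times> (nat \<Rightarrow> real)) measure" where
  "Jm = density (P \<Otimes>\<^sub>M Rn n) (\<lambda>z. ennreal (gd n s (fst z) (snd z)))"

lemma sets_Jm [measurable_cong]: "sets Jm = sets (P \<Otimes>\<^sub>M Rn n)" by (simp add: Jm_def)

lemma nn_integral_Jm:
  assumes [measurable]: "f \<in> borel_measurable (P \<Otimes>\<^sub>M Rn n)"
  shows "(\<integral>\<^sup>+z. f z \<partial>Jm) = (\<integral>\<^sup>+x. (\<integral>\<^sup>+y. f (x, y) \<partial>density (Rn n) (\<lambda>y. ennreal (gd n s x y))) \<partial>P)"
proof -
  have "(\<integral>\<^sup>+z. f z \<partial>Jm) = (\<integral>\<^sup>+z. ennreal (gd n s (fst z) (snd z)) * f z \<partial>(P \<Otimes>\<^sub>M Rn n))"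
    unfolding Jm_def by (rule nn_integral_density) measurable
  also have "\<dots> = (\<integral>\<^sup>+x. (\<integral>\<^sup>+y. ennreal (gd n s x y) * f (x, y) \<partial>Rn n) \<partial>P)"
    by (subst L.nn_integral_fst[symmetric]) (simp_all, measurable)
  also have "\<dots> = (\<integral>\<^sup>+x. (\<integral>\<^sup>+y. f (x, y) \<partial>density (Rn n) (\<lambda>y. ennreal (gd n s x y))) \<partial>P)"
  proof (intro nn_integral_cong nn_integral_density[symmetric])
    fix x assume x: "x \<in> space P"
    then show "(\<lambda>y. ennreal (gd n s x y)) \<in> borel_measurable (Rn n)" by (simp add: space_P) measurable
    show "(\<lambda>y. f (x, y)) \<in> borel_measurable (Rn n)" using x by measurable
  qed
  finally show ?thesis .
qed

lemma distr_snd_Jm: "distr Jm (Rn n) snd = density (Rn n) (\<lambda>y. ennreal (fP n s P y))"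
proof (rule measure_eqI)
  fix A assume "A \<in> sets (distr Jm (Rn n) snd)"
  then have A [measurable]: "A \<in> sets (Rn n)" by simp
  have sm: "snd \<in> measurable Jm (Rn n)" by measurable
  have "emeasure (distr Jm (Rn n) snd) A = (\<integral>\<^sup>+z. indicator A (snd z) \<partial>Jm)"
    using nn_integral_distr[OF sm, of "indicator A"] by simp
  also have "\<dots> = (\<integral>\<^sup>+z. ennreal (gd n s (fst z) (snd z)) * indicator A (snd z) \<partial>(P \<Otimes>\<^sub>M Rn n))"
    unfolding Jm_def by (rule nn_integral_density) measurable
  also have "\<dots> = (\<integral>\<^sup>+y. (\<integral>\<^sup>+x. ennreal (gd n s x y) * indicator A y \<partial>P) \<partial>Rn n)"
    by (subst PL.nn_integral_snd[symmetric]) (simp_all, measurable)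
  also have "\<dots> = (\<integral>\<^sup>+y. ennreal (fP n s P y) * indicator A y \<partial>Rn n)"
  proof (intro nn_integral_cong)
    fix y assume y: "y \<in> space (Rn n)"
    have "(\<integral>\<^sup>+x. ennreal (gd n s x y) * indicator A y \<partial>P) = (\<integral>\<^sup>+x. ennreal (gd n s x y) \<partial>P) * indicator A y"
      by (intro nn_integral_multc measurable_compose[OF gd_measurable_P[OF y] measurable_ennreal])
    then show "(\<integral>\<^sup>+x. ennreal (gd n s x y) * indicator A y \<partial>P) = ennreal (fP n s P y) * indicator A y"
      by (simp only: nn_integral_gd_P[OF y])
  qed
  also have "\<dots> = emeasure (density (Rn n) (\<lambda>y. ennreal (fP n s P y))) A"
    by (rule emeasure_density[symmetric]) measurable
  finally show "emeasure (distr Jm (Rn n) snd) A = emeasure (density (Rn n) (\<lambda>y. ennreal (fP n s P y))) A" .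
qed simp

lemma prob_space_Jm: "prob_space Jm"
proof
  have "emeasure Jm (space Jm) = (\<integral>\<^sup>+z. 1 \<partial>Jm)" by simp
  also have "\<dots> = (\<integral>\<^sup>+x. (\<integral>\<^sup>+y. 1 \<partial>density (Rn n) (\<lambda>y. ennreal (gd n s x y))) \<partial>P)"
    by (rule nn_integral_Jm) measurable
  also have "\<dots> = (\<integral>\<^sup>+x. 1 \<partial>P)"
  proof (intro nn_integral_cong)
    fix x assume "x \<in> space P"
    then interpret G: prob_space "density (Rn n) (\<lambda>y. ennreal (gd n s x y))" by (intro prob_space_gd s) (simp add: space_P)
    show "(\<integral>\<^sup>+y. 1 \<partial>density (Rn n) (\<lambda>y. ennreal (gd n s x y))) = 1" using G.emeasure_space_1 by simp
  qed
  finally show "emeasure Jm (space Jm) = 1" by (simp add: P.emeasure_space_1)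
qed

lemma prob_space_fP: "prob_space (density (Rn n) (\<lambda>y. ennreal (fP n s P y)))"
  unfolding distr_snd_Jm[symmetric] by (rule prob_space.prob_space_distr[OF prob_space_Jm]) measurable

lemma distr_fst_Jm: "distr Jm (Rn n) fst = P"
proof (rule measure_eqI)
  fix A assume "A \<in> sets (distr Jm (Rn n) fst)"
  then have A [measurable]: "A \<in> sets (Rn n)" by simp
  have fm: "fst \<in> measurable Jm (Rn n)" by measurable
  have "emeasure (distr Jm (Rn n) fst) A = (\<integral>\<^sup>+z. indicator A (fst z) \<partial>Jm)"
    using nn_integral_distr[OF fm, of "indicator A"] by simp
  also have "\<dots> = (\<integral>\<^sup>+x. (\<integral>\<^sup>+y. indicator A x \<partial>density (Rn n) (\<lambda>y. ennreal (gd n s x y))) \<partial>P)"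
    by (subst nn_integral_Jm) (simp_all, measurable)
  also have "\<dots> = (\<integral>\<^sup>+x. indicator A x \<partial>P)"
  proof (intro nn_integral_cong)
    fix x assume "x \<in> space P"
    then interpret G: prob_space "density (Rn n) (\<lambda>y. ennreal (gd n s x y))" by (intro prob_space_gd s) (simp add: space_P)
    show "(\<integral>\<^sup>+y. indicator A x \<partial>density (Rn n) (\<lambda>y. ennreal (gd n s x y))) = indicator A x" using G.emeasure_space_1 by simp
  qed
  also have "\<dots> = emeasure P A" using A by (simp add: sets_P)
  finally show "emeasure (distr Jm (Rn n) fst) A = emeasure P A" .
qed (simp add: sets_P)

end

locale channel_input =
  fixes n :: nat and R s :: real and P :: "(nat \<Rightarrow> real) measure"
  assumes n0: "1 \<le> n" and R: "0 \<le> R" and s0: "0 < s" and adm: "admissible n R P"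
begin

sublocale prob_input n s P
  using n0 s0 adm by (intro prob_input.intro) (simp_all add: admissible_def)

lemma AE_P: "AE x in P. vnorm n x \<le> R"
  using adm by (simp add: admissible_def)

lemma fP_ge:
  assumes y: "y \<in> space (Rn n)"
  shows "M * exp (- ((vnorm n y)\<^sup>2 + R\<^sup>2) / s) \<le> fP n s P y"
proof -
  have "(\<integral>x. M * exp (- ((vnorm n y)\<^sup>2 + R\<^sup>2) / s) \<partial>P) \<le> fP n s P y"
    unfolding fP_def
  proof (intro integral_mono_AE integrable_gd_P y)
    show "AE x in P. M * exp (- ((vnorm n y)\<^sup>2 + R\<^sup>2) / s) \<le> gd n s x y"
      using AE_P AE_space[of P] by eventually_elim (rule gd_ge[OF n s _ _ y], simp_all only: space_P)
  qed simp
  then show ?thesis by (simp add: P.prob_space)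
qed

lemma fP_pos: "y \<in> space (Rn n) \<Longrightarrow> fP n s P y > 0"
  using fP_ge[of y] M_pos by (smt (verit) exp_gt_zero mult_pos_pos)

lemma abs_ln_fP: "y \<in> space (Rn n) \<Longrightarrow> \<bar>ln (fP n s P y) - ln M\<bar> \<le> ((vnorm n y)\<^sup>2 + R\<^sup>2) / s"
proof -
  assume y: "y \<in> space (Rn n)"
  have "ln (M * exp (- ((vnorm n y)\<^sup>2 + R\<^sup>2) / s)) \<le> ln (fP n s P y)"
    using fP_ge[OF y] M_pos fP_pos[OF y] by (subst ln_le_cancel_iff) (auto intro!: mult_pos_pos)
  moreover have "ln (M * exp (- v / s)) = ln M - v / s" for v
    by (subst ln_mult_pos[OF M_pos exp_gt_zero]) simp
  ultimately have "ln M - ((vnorm n y)\<^sup>2 + R\<^sup>2) / s \<le> ln (fP n s P y)" by (simp only:)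
  moreover have "ln (fP n s P y) \<le> ln M" using fP_le[OF y] M_pos fP_pos[OF y] by (subst ln_le_cancel_iff)
  ultimately show ?thesis by linarith
qed

text \<open>Fubini for integrands of quadratic growth in \<open>y\<close>: given an input in the
  ball, the second moment of the output is at most \<open>R^2 + n * s\<close>.\<close>

lemma Jm_integral:
  fixes f :: "_ \<Rightarrow> real"
  assumes f [measurable]: "f \<in> borel_measurable (P \<Otimes>\<^sub>M Rn n)" and a: "0 \<le> a" "0 \<le> b"
    and bd: "\<And>x y. x \<in> space (Rn n) \<Longrightarrow> y \<in> space (Rn n) \<Longrightarrow> vnorm n x \<le> R \<Longrightarrow> \<bar>f (x, y)\<bar> \<le> a + b * (vnorm n y)\<^sup>2"
  shows "integrable Jm f"
    and "(\<integral>z. f z \<partial>Jm) = (\<integral>x. (\<integral>y. f (x, y) \<partial>density (Rn n) (\<lambda>y. ennreal (gd n s x y))) \<partial>P)"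
    and "integrable P (\<lambda>x. \<integral>y. f (x, y) \<partial>density (Rn n) (\<lambda>y. ennreal (gd n s x y)))"
proof -
  have nb: "(\<integral>\<^sup>+y. ennreal (norm (f (x, y))) \<partial>density (Rn n) (\<lambda>y. ennreal (gd n s x y))) \<le> ennreal (a + b * (R\<^sup>2 + real n * s))"
    if x: "x \<in> space (Rn n)" "vnorm n x \<le> R" for x
  proof -
    let ?G = "density (Rn n) (\<lambda>y. ennreal (gd n s x y))"
    interpret G: prob_space ?G by (rule prob_space_gd[OF s x(1)])
    have h: "has_bochner_integral ?G (\<lambda>y. a + b * vdot n y y) (a + b * (vdot n x x + real n * s))"
    proof -
      have "has_bochner_integral ?G (\<lambda>y. a) a"
        using G.prob_space by (simp add: has_bochner_integral_iff)
      then show ?thesis by (intro has_bochner_integral_add has_bochner_integral_mult_right gd_vdot_self_moment[OF s x(1)])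
    qed
    have "(\<integral>\<^sup>+y. ennreal (norm (f (x, y))) \<partial>?G) \<le> (\<integral>\<^sup>+y. ennreal (a + b * vdot n y y) \<partial>?G)"
      by (intro nn_integral_mono ennreal_leI) (use bd[OF x(1) _ x(2)] in \<open>simp add: vnorm_power2\<close>)
    also have "\<dots> = ennreal (a + b * (vdot n x x + real n * s))"
    proof -
      have "(\<integral>\<^sup>+y. ennreal (a + b * vdot n y y) \<partial>?G) = ennreal (\<integral>y. a + b * vdot n y y \<partial>?G)"
        by (rule nn_integral_eq_integral) (use h a in \<open>auto simp: has_bochner_integral_iff\<close>)
      then show ?thesis using h by (simp only: has_bochner_integral_iff)
    qed
    also have "\<dots> \<le> ennreal (a + b * (R\<^sup>2 + real n * s))"
    proof (intro ennreal_leI add_left_mono mult_left_mono add_right_mono)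
      show "vdot n x x \<le> R\<^sup>2" unfolding vnorm_power2[symmetric] using x(2) by (intro power_mono) auto
    qed (rule a)
    finally show ?thesis .
  qed
  show i: "integrable Jm f"
  proof (rule integrableI_bounded)
    show "f \<in> borel_measurable Jm" by measurable
    have "(\<integral>\<^sup>+z. ennreal (norm (f z)) \<partial>Jm) = (\<integral>\<^sup>+x. (\<integral>\<^sup>+y. ennreal (norm (f (x, y))) \<partial>density (Rn n) (\<lambda>y. ennreal (gd n s x y))) \<partial>P)"
      by (rule nn_integral_Jm) measurable
    also have "\<dots> \<le> (\<integral>\<^sup>+x. ennreal (a + b * (R\<^sup>2 + real n * s)) \<partial>P)"
    proof (rule nn_integral_mono_AE)
      show "AE x in P. (\<integral>\<^sup>+y. ennreal (norm (f (x, y))) \<partial>density (Rn n) (\<lambda>y. ennreal (gd n s x y))) \<le> ennreal (a + b * (R\<^sup>2 + real n * s))"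
        using AE_P AE_space[of P] by eventually_elim (rule nb, simp_all add: space_P)
    qed
    also have "\<dots> < \<infinity>" by (simp add: P.emeasure_space_1)
    finally show "(\<integral>\<^sup>+z. ennreal (norm (f z)) \<partial>Jm) < \<infinity>" .
  qed
  have i2: "integrable (P \<Otimes>\<^sub>M Rn n) (\<lambda>z. gd n s (fst z) (snd z) * f z)"
    using i unfolding Jm_def by (subst (asm) integrable_real_density) auto
  have ds: "(\<integral>y. f (x, y) \<partial>density (Rn n) (\<lambda>y. ennreal (gd n s x y))) = (\<integral>y. gd n s x y * f (x, y) \<partial>Rn n)" if x: "x \<in> space P" for x
  proof -
    have "gd n s x \<in> borel_measurable (Rn n)" using x by (simp add: space_P)
    moreover have "(\<lambda>y. f (x, y)) \<in> borel_measurable (Rn n)" using x by measurable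
    ultimately show ?thesis by (intro integral_real_density) auto
  qed
  have "(\<integral>z. f z \<partial>Jm) = (\<integral>z. gd n s (fst z) (snd z) * f z \<partial>(P \<Otimes>\<^sub>M Rn n))"
    unfolding Jm_def by (rule integral_real_density) auto
  also have "\<dots> = (\<integral>x. (\<integral>y. gd n s x y * f (x, y) \<partial>Rn n) \<partial>P)"
    using PL.integral_fst'[OF i2] by simp
  also have "\<dots> = (\<integral>x. (\<integral>y. f (x, y) \<partial>density (Rn n) (\<lambda>y. ennreal (gd n s x y))) \<partial>P)"
    by (intro Bochner_Integration.integral_cong refl ds[symmetric])
  finally show "(\<integral>z. f z \<partial>Jm) = (\<integral>x. (\<integral>y. f (x, y) \<partial>density (Rn n) (\<lambda>y. ennreal (gd n s x y))) \<partial>P)" .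
  have "integrable P (\<lambda>x. \<integral>y. gd n s x y * f (x, y) \<partial>Rn n)"
    using PL.integrable_fst'[OF i2] by simp
  then show "integrable P (\<lambda>x. \<integral>y. f (x, y) \<partial>density (Rn n) (\<lambda>y. ennreal (gd n s x y)))"
    by (subst Bochner_Integration.integrable_cong[OF refl ds])
qed

text \<open>The three laws in the definition of mutual information are identified with
  \<open>P\<close>, the density \<open>fP\<close> and \<open>Jm\<close>. Relative to
  \<open>P\<close> times Lebesgue measure both the joint law and the product law have densities, so
  their divergence is the mean of a log ratio.\<close>

lemma MI_eq_Jm: "MI n P s = (\<integral>z. ln (gd n s (fst z) (snd z) / fP n s P (snd z)) \<partial>Jm)"
proof -
  let ?PG = "P \<Otimes>\<^sub>M gauss n s"
  let ?Y = "\<lambda>(x, z). vadd n x z"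
  interpret G: prob_space "gauss n s" by (rule prob_space_gauss)
  interpret PG: pair_prob_space P "gauss n s" ..
  have Ym [measurable]: "?Y \<in> measurable ?PG (Rn n)"
    unfolding case_prod_beta by (rule measurable_vadd) (simp_all cong: measurable_cong_sets add: sets_P sets_gauss)
  have fm [measurable]: "fst \<in> measurable ?PG (Rn n)"
    by (simp cong: measurable_cong_sets add: sets_P)
  have f1: "distr ?PG (Rn n) fst = P"
  proof (rule measure_eqI)
    fix A assume "A \<in> sets (distr ?PG (Rn n) fst)"
    then have A: "A \<in> sets (Rn n)" by simp
    have pre: "fst -` A \<inter> space ?PG = A \<times> space (gauss n s)"
      using sets.sets_into_space[OF A] by (auto simp: space_pair_measure space_P)
    show "emeasure (distr ?PG (Rn n) fst) A = emeasure P A"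
      by (subst emeasure_distr[OF fm A], subst pre, subst G.emeasure_pair_measure_Times)
         (use A in \<open>simp_all add: sets_P G.emeasure_space_1\<close>)
  qed (simp add: sets_P)
  \<comment> \<open>For a fixed input \<open>x\<close>, translating the noise by \<open>x\<close>
    gives the law with density \<open>gd n s x\<close>.\<close>
  have J1: "distr ?PG (Rn n \<Otimes>\<^sub>M Rn n) (\<lambda>w. (fst w, ?Y w)) = Jm"
  proof (rule measure_eqI)
    show "sets (distr ?PG (Rn n \<Otimes>\<^sub>M Rn n) (\<lambda>w. (fst w, ?Y w))) = sets Jm"
      unfolding sets_distr sets_Jm by (rule sets_pair_measure_cong) (simp_all add: sets_P)
    fix A assume "A \<in> sets (distr ?PG (Rn n \<Otimes>\<^sub>M Rn n) (\<lambda>w. (fst w, ?Y w)))"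
    then have A [measurable]: "A \<in> sets (Rn n \<Otimes>\<^sub>M Rn n)" by simp
    have A2 [measurable]: "A \<in> sets (P \<Otimes>\<^sub>M Rn n)" using A by (simp add: sets_pair_measure_cong[OF sets_P refl])
    have m: "(\<lambda>w. (fst w, ?Y w)) \<in> measurable ?PG (Rn n \<Otimes>\<^sub>M Rn n)" by measurable
    have "emeasure (distr ?PG (Rn n \<Otimes>\<^sub>M Rn n) (\<lambda>w. (fst w, ?Y w))) A = (\<integral>\<^sup>+w. indicator A (fst w, ?Y w) \<partial>?PG)"
      using nn_integral_distr[OF m, of "indicator A"] A by simp
    also have "\<dots> = (\<integral>\<^sup>+x. (\<integral>\<^sup>+z. indicator A (x, vadd n x z) \<partial>gauss n s) \<partial>P)"
      by (subst G.nn_integral_fst[symmetric]) (simp_all add: case_prod_beta, measurable)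
    also have "\<dots> = (\<integral>\<^sup>+x. (\<integral>\<^sup>+y. indicator A (x, y) \<partial>density (Rn n) (\<lambda>y. ennreal (gd n s x y))) \<partial>P)"
    proof (intro nn_integral_cong)
      fix x assume "x \<in> space P"
      then have x [simp]: "x \<in> space (Rn n)" by (simp add: space_P)
      have vm: "vadd n x \<in> measurable (gauss n s) (Rn n)"
        using measurable_vadd1[OF x] by (simp cong: measurable_cong_sets add: sets_gauss)
      have im: "(\<lambda>y. indicator A (x, y) :: ennreal) \<in> borel_measurable (Rn n)" by measurable
      show "(\<integral>\<^sup>+z. indicator A (x, vadd n x z) \<partial>gauss n s) = (\<integral>\<^sup>+y. indicator A (x, y) \<partial>density (Rn n) (\<lambda>y. ennreal (gd n s x y)))"
        unfolding distr_gauss[OF s x, symmetric] using nn_integral_distr[OF vm, of "\<lambda>y. indicator A (x, y)"] im by simp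
    qed
    also have "\<dots> = (\<integral>\<^sup>+z. indicator A z \<partial>Jm)"
      by (rule nn_integral_Jm[symmetric]) measurable
    also have "\<dots> = emeasure Jm A" using A2 by (simp add: sets_Jm)
    finally show "emeasure (distr ?PG (Rn n \<Otimes>\<^sub>M Rn n) (\<lambda>w. (fst w, ?Y w))) A = emeasure Jm A" .
  qed
  have Y1: "distr ?PG (Rn n) ?Y = density (Rn n) (\<lambda>y. ennreal (fP n s P y))"
  proof -
    have "distr ?PG (Rn n) (snd \<circ> (\<lambda>w. (fst w, ?Y w))) = distr Jm (Rn n) snd"
      unfolding J1[symmetric] by (rule distr_distr[symmetric]) measurable
    then show ?thesis by (simp add: comp_def distr_snd_Jm)
  qed
  have prod: "P \<Otimes>\<^sub>M density (Rn n) (\<lambda>y. ennreal (fP n s P y)) = density (P \<Otimes>\<^sub>M Rn n) (\<lambda>z. ennreal (fP n s P (snd z)))"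
  proof -
    interpret F: prob_space "density (Rn n) (\<lambda>y. ennreal (fP n s P y))" by (rule prob_space_fP)
    \<comment> \<open>The constant density 1 brings \<open>P\<close> into the form that
      \<open>pair_measure_density\<close> expects.\<close>
    have "density P (\<lambda>_. 1) \<Otimes>\<^sub>M density (Rn n) (\<lambda>y. ennreal (fP n s P y)) = density (P \<Otimes>\<^sub>M Rn n) (\<lambda>(x, y). 1 * ennreal (fP n s P y))"
      by (rule pair_measure_density) (auto intro: F.sigma_finite_measure_axioms L.sigma_finite_measure_axioms)
    then show ?thesis by (simp add: density_1 split_beta')
  qed
  have sf: "sigma_finite_measure (P \<Otimes>\<^sub>M Rn n)" by (rule PL.sigma_finite_measure_axioms)
  have fsnd: "(\<lambda>z. fP n s P (snd z)) \<in> borel_measurable (P \<Otimes>\<^sub>M Rn n)" by measurable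
  have fp0: "0 < fP n s P (snd z)" if "z \<in> space (P \<Otimes>\<^sub>M Rn n)" for z
    using that fP_pos by (auto simp: space_pair_measure)
  have e: "1 < exp (1::real)" by simp
  have ln: "log (exp 1) v = ln v" for v :: real by (simp add: log_def)
  have "MI n P s = KL_divergence (exp 1) (density (P \<Otimes>\<^sub>M Rn n) (\<lambda>z. ennreal (fP n s P (snd z)))) Jm"
    unfolding MI_def prob_space.mutual_information_def[OF PG.prob_space_axioms] f1 Y1 J1 prod ..
  also have "\<dots> = (\<integral>z. gd n s (fst z) (snd z) * log (exp 1) (gd n s (fst z) (snd z) / fP n s P (snd z)) \<partial>(P \<Otimes>\<^sub>M Rn n))"
    unfolding Jm_def
  proof (rule sigma_finite_measure.KL_density_density[OF sf e fsnd _ gd_measurable_pair])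
    show "AE z in P \<Otimes>\<^sub>M Rn n. 0 \<le> fP n s P (snd z)" by (rule AE_I2) (use fp0 in \<open>auto intro: less_imp_le\<close>)
    show "AE z in P \<Otimes>\<^sub>M Rn n. fP n s P (snd z) = 0 \<longrightarrow> gd n s (fst z) (snd z) = 0"
      by (rule AE_I2) (use fp0 in force)
  qed simp
  also have "\<dots> = (\<integral>z. ln (gd n s (fst z) (snd z) / fP n s P (snd z)) \<partial>Jm)"
    unfolding Jm_def ln by (rule integral_real_density[symmetric]) auto
  finally show ?thesis .
qed

end

text \<open>Both densities contain the same normalisation and the same Gaussian factor in
  \<open>y\<close>. After cancellation only a constant, a linear function of \<open>y\<close> and
  one Bessel term remain.\<close>

lemma ln_gd_qd:
  assumes n: "1 \<le> n" and s: "s > 0"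
  shows "ln (gd n s x y / qd n R s y) = (R\<^sup>2 - (vnorm n x)\<^sup>2) / (2 * s) + vdot n y x / s - ln (Phi n (R * (vnorm n y / s)))"
proof -
  let ?M = "(1 / sqrt (2 * pi * s)) ^ n"
  have M: "?M > 0" using s by simp
  have "gd n s x y / qd n R s y = exp (- ((vnorm n y)\<^sup>2 + (vnorm n x)\<^sup>2) / (2 * s)) * exp (vdot n y x / s)
      / (exp (- ((vnorm n y)\<^sup>2 + R\<^sup>2) / (2 * s)) * Phi n (R * vnorm n y / s))"
  proof -
    have gen: "A * a * b / (A * c * d) = a * b / (c * d)" if "A > 0" for A a b c d :: real
      using that by simp
    show ?thesis unfolding gd_factor[OF s] qd_def by (rule gen[OF M])
  qed
  also have "\<dots> = exp (- ((vnorm n y)\<^sup>2 + (vnorm n x)\<^sup>2) / (2 * s) + vdot n y x / s - - ((vnorm n y)\<^sup>2 + R\<^sup>2) / (2 * s)) / Phi n (R * vnorm n y / s)"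
    by (simp add: exp_diff exp_add)
  also have "- ((vnorm n y)\<^sup>2 + (vnorm n x)\<^sup>2) / (2 * s) + vdot n y x / s - - ((vnorm n y)\<^sup>2 + R\<^sup>2) / (2 * s)
     = (R\<^sup>2 - (vnorm n x)\<^sup>2) / (2 * s) + vdot n y x / s"
    by (simp add: diff_divide_distrib add_divide_distrib)
  finally show ?thesis using Phi_pos[OF n, of "R * vnorm n y / s"] by (simp add: ln_divide_pos)
qed

lemma ln_qd:
  assumes n: "1 \<le> n" and s: "s > 0"
  shows "ln (qd n R s y) = ln ((1 / sqrt (2 * pi * s)) ^ n) - ((vnorm n y)\<^sup>2 + R\<^sup>2) / (2 * s) + ln (Phi n (R * (vnorm n y / s)))"
proof -
  let ?M = "(1 / sqrt (2 * pi * s)) ^ n"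
  have M: "?M > 0" using s by simp
  have "ln (qd n R s y) = ln (?M * exp (- ((vnorm n y)\<^sup>2 + R\<^sup>2) / (2 * s))) + ln (Phi n (R * vnorm n y / s))"
    unfolding qd_def by (rule ln_mult_pos[OF mult_pos_pos[OF M exp_gt_zero] Phi_pos[OF n]])
  also have "ln (?M * exp (- ((vnorm n y)\<^sup>2 + R\<^sup>2) / (2 * s))) = ln ?M + - ((vnorm n y)\<^sup>2 + R\<^sup>2) / (2 * s)"
    unfolding ln_mult_pos[OF M exp_gt_zero] ln_exp ..
  finally show ?thesis by (simp add: minus_divide_left[symmetric] del: minus_add_distrib)
qed

lemma le_one_plus_power2: "(v::real) \<le> 1 + v\<^sup>2"
proof -
  have "0 \<le> (v - 1 / 2)\<^sup>2" by simp
  then show ?thesis by (simp add: power2_eq_square algebra_simps)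
qed

lemma ln_Phi_norm_bound:
  assumes n: "1 \<le> n" and s: "s > 0" and R: "R \<ge> 0"
  shows "0 \<le> ln (Phi n (R * (vnorm n y / s)))" "ln (Phi n (R * (vnorm n y / s))) \<le> R / s * (1 + (vnorm n y)\<^sup>2)"
proof -
  show "0 \<le> ln (Phi n (R * (vnorm n y / s)))" by (rule ln_Phi_nonneg[OF n])
  have "ln (Phi n (R * (vnorm n y / s))) \<le> R * (vnorm n y / s)" using s R by (intro ln_Phi_le n) auto
  also have "\<dots> = R / s * vnorm n y" by simp
  also have "\<dots> \<le> R / s * (1 + (vnorm n y)\<^sup>2)" using R s by (intro mult_left_mono le_one_plus_power2) auto
  finally show "ln (Phi n (R * (vnorm n y / s))) \<le> R / s * (1 + (vnorm n y)\<^sup>2)" .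
qed

text \<open>The inequality \<open>ln (Phi n t) <= t\<close> dominates the integrand by a quadratic
  in the norm of \<open>y\<close>. The mean is \<open>T\<close> because the integrand is
  radial.\<close>

lemma ln_Phi_gd_integral:
  assumes n: "1 \<le> n" and s: "s > 0" and R: "R \<ge> 0" and x: "x \<in> space (Rn n)"
  shows "has_bochner_integral (density (Rn n) (\<lambda>y. ennreal (gd n s x y))) (\<lambda>y. ln (Phi n (R * (vnorm n y / s)))) (T n R (vnorm n x) s)"
    and "T n R (vnorm n x) s \<le> R / s * (1 + ((vnorm n x)\<^sup>2 + real n * s))"
proof -
  let ?G = "density (Rn n) (\<lambda>y. ennreal (gd n s x y))"
  interpret G: prob_space ?G by (rule prob_space_gd[OF s x])
  have h: "has_bochner_integral ?G (\<lambda>y. R / s * (1 + vdot n y y)) (R / s * (1 + (vdot n x x + real n * s)))"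
  proof -
    have "has_bochner_integral ?G (\<lambda>y. 1 :: real) 1"
      using G.prob_space by (simp add: has_bochner_integral_iff)
    then show ?thesis by (intro has_bochner_integral_add has_bochner_integral_mult_right gd_vdot_self_moment[OF s x])
  qed
  have bd: "norm (ln (Phi n (R * (vnorm n y / s)))) \<le> norm (R / s * (1 + vdot n y y))" for y
  proof -
    have "0 \<le> R / s * (1 + vdot n y y)" using R s by simp
    then show ?thesis using ln_Phi_norm_bound[OF n s R, of y] by (simp only: vnorm_power2 real_norm_def abs_of_nonneg)
  qed
  have i: "integrable ?G (\<lambda>y. ln (Phi n (R * (vnorm n y / s))))"
    by (rule Bochner_Integration.integrable_bound[OF has_bochner_integral_iff[THEN iffD1, OF h, THEN conjunct1]])
       (measurable, use bd in simp)
  have T: "(\<integral>y. ln (Phi n (R * (vnorm n y / s))) \<partial>?G) = T n R (vnorm n x) s"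
    unfolding T_def by (rule integral_gd_radial(1)[OF n s x]) measurable
  show "has_bochner_integral ?G (\<lambda>y. ln (Phi n (R * (vnorm n y / s)))) (T n R (vnorm n x) s)"
    using i T by (simp add: has_bochner_integral_iff)
  have "T n R (vnorm n x) s \<le> (\<integral>y. R / s * (1 + vdot n y y) \<partial>?G)"
    unfolding T[symmetric]
  proof (rule integral_mono[OF i])
    show "integrable ?G (\<lambda>y. R / s * (1 + vdot n y y))" using h by (simp only: has_bochner_integral_iff)
    show "ln (Phi n (R * (vnorm n y / s))) \<le> R / s * (1 + vdot n y y)" for y
      using ln_Phi_norm_bound(2)[OF n s R, of y] by (simp only: vnorm_power2)
  qed
  also have "\<dots> = R / s * (1 + (vdot n x x + real n * s))" using h by (simp only: has_bochner_integral_iff)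
  finally show "T n R (vnorm n x) s \<le> R / s * (1 + ((vnorm n x)\<^sup>2 + real n * s))" by (simp only: vnorm_power2)
qed

lemma T_nonneg: "n \<ge> 1 \<Longrightarrow> 0 \<le> T n R r s"
  unfolding T_def by (intro integral_nonneg_AE AE_I2 ln_Phi_nonneg)

lemma T_le:
  assumes n: "1 \<le> n" and s: "s > 0" and R: "R \<ge> 0" and r: "0 \<le> r"
  shows "T n R r s \<le> R / s * (1 + (r\<^sup>2 + real n * s))"
  using ln_Phi_gd_integral(2)[OF n s R ve1_in_space[of n r]] n r by (simp add: vnorm_ve1)

lemma T_measurable:
  assumes n: "1 \<le> n" and s: "s > 0"
  shows "(\<lambda>r. T n R r s) \<in> borel_measurable borel"
proof -
  have "T n R r s = (\<integral>p. indicator {0<..} p * (K n s r p * ln (Phi n (R * p))) \<partial>lborel)" for r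
    unfolding T_eq[OF n s] by (simp add: set_lebesgue_integral_def)
  moreover have "(\<lambda>r. \<integral>p. indicator {0<..} p * (K n s r p * ln (Phi n (R * p))) \<partial>lborel) \<in> borel_measurable borel"
    unfolding K_def by (intro lborel.borel_measurable_lebesgue_integral) measurable
  ultimately show ?thesis by simp
qed

lemma Xi_measurable:
  assumes n: "1 \<le> n" and s: "s1 > 0" "s2 > 0"
  shows "Xi n R s1 s2 \<in> borel_measurable borel"
proof -
  note [measurable] = T_measurable[OF n s(1)] T_measurable[OF n s(2)]
  show ?thesis unfolding Xi_def[abs_def] by measurable
qed

text \<open>A relative entropy: that of the output of the fixed input \<open>x\<close> with respect
  to the sphere output. In \<open>ln_gd_qd\<close> the linear term has mean \<open>|x|^2 / s\<close>
  and the Bessel term has mean \<open>T\<close>.\<close>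

lemma gd_qd_integral:
  assumes n: "1 \<le> n" and s: "s > 0" and R: "R \<ge> 0" and x: "x \<in> space (Rn n)"
  shows "(\<integral>y. ln (gd n s x y / qd n R s y) \<partial>density (Rn n) (\<lambda>y. ennreal (gd n s x y)))
     = ((vnorm n x)\<^sup>2 + R\<^sup>2) / (2 * s) - T n R (vnorm n x) s"
proof -
  let ?G = "density (Rn n) (\<lambda>y. ennreal (gd n s x y))"
  interpret G: prob_space ?G by (rule prob_space_gd[OF s x])
  have c: "has_bochner_integral ?G (\<lambda>y. (R\<^sup>2 - (vnorm n x)\<^sup>2) / (2 * s)) ((R\<^sup>2 - (vnorm n x)\<^sup>2) / (2 * s))"
    using G.prob_space by (simp add: has_bochner_integral_iff)
  have v: "has_bochner_integral ?G (\<lambda>y. vdot n y x / s) (vdot n x x / s)"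
  proof -
    have "(\<lambda>y. vdot n y x / s) = (\<lambda>y. vdot n x y / s)" by (rule ext, subst vdot_commute, rule refl)
    then show ?thesis
      using has_bochner_integral_divide_zero[OF gd_vdot_moment[OF s x, of x], of s] by (simp only:)
  qed
  have "has_bochner_integral ?G (\<lambda>y. ln (gd n s x y / qd n R s y)) ((R\<^sup>2 - (vnorm n x)\<^sup>2) / (2 * s) + vdot n x x / s - T n R (vnorm n x) s)"
    unfolding ln_gd_qd[OF n s]
    by (intro has_bochner_integral_add has_bochner_integral_diff c v ln_Phi_gd_integral(1)[OF n s R x])
  moreover have "(R\<^sup>2 - (vnorm n x)\<^sup>2) / (2 * s) + vdot n x x / s = ((vnorm n x)\<^sup>2 + R\<^sup>2) / (2 * s)"
    unfolding vnorm_power2 using s by (simp add: diff_divide_distrib add_divide_distrib)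
  ultimately show ?thesis by (simp add: has_bochner_integral_iff)
qed

context channel_input
begin

lemma qd_pos': "qd n R s y > 0" by (rule qd_pos[OF n s])

abbreviation F where "F \<equiv> density (Rn n) (\<lambda>y. ennreal (fP n s P y))"

lemma measurable_qd_snd [measurable]: "(\<lambda>z. qd n R s (snd z)) \<in> borel_measurable (P \<Otimes>\<^sub>M Rn n)"
  by (rule measurable_compose[OF _ measurable_qd]) measurable

lemma measurable_fP_snd [measurable]: "(\<lambda>z. fP n s P (snd z)) \<in> borel_measurable (P \<Otimes>\<^sub>M Rn n)"
  by (rule measurable_compose[OF _ fP_measurable]) measurable

lemma abs_ln_fP_qd:
  assumes y: "y \<in> space (Rn n)"
  shows "\<bar>ln (fP n s P y / qd n R s y)\<bar> \<le> (2 * R\<^sup>2 / s + R / s) + (2 / s + R / s) * (vnorm n y)\<^sup>2"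
proof -
  let ?v = "((vnorm n y)\<^sup>2 + R\<^sup>2) / s"
  have v: "0 \<le> ?v" using s by simp
  have h: "((vnorm n y)\<^sup>2 + R\<^sup>2) / (2 * s) = ?v / 2" by simp
  have "ln (fP n s P y / qd n R s y) = (ln (fP n s P y) - ln M) + ?v / 2 - ln (Phi n (R * (vnorm n y / s)))"
    using fP_pos[OF y] qd_pos'[of y] by (simp add: ln_divide_pos ln_qd[OF n s] h)
  moreover have "\<bar>l\<bar> \<le> v \<Longrightarrow> 0 \<le> p \<Longrightarrow> p \<le> b \<Longrightarrow> 0 \<le> v \<Longrightarrow> \<bar>l + v / 2 - p\<bar> \<le> 2 * v + b" for l v p b :: real
    by linarith
  ultimately have "\<bar>ln (fP n s P y / qd n R s y)\<bar> \<le> 2 * ?v + R / s * (1 + (vnorm n y)\<^sup>2)"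
    using abs_ln_fP[OF y] ln_Phi_norm_bound[OF n s R, of y] v by presburger
  also have "\<dots> = (2 * R\<^sup>2 / s + R / s) + (2 / s + R / s) * (vnorm n y)\<^sup>2"
    by (simp add: add_divide_distrib distrib_left distrib_right)
  finally show ?thesis .
qed

lemma KLq_Jm:
  shows "integrable Jm (\<lambda>z. ln (fP n s P (snd z) / qd n R s (snd z)))"
    and "(\<integral>z. ln (fP n s P (snd z) / qd n R s (snd z)) \<partial>Jm) = KLq n R s P"
    and "integrable F (\<lambda>y. ln (fP n s P y / qd n R s y))"
proof -
  have sm: "snd \<in> measurable Jm (Rn n)" by measurable
  have m: "(\<lambda>y. ln (fP n s P y / qd n R s y)) \<in> borel_measurable (Rn n)" by measurable
  show i: "integrable Jm (\<lambda>z. ln (fP n s P (snd z) / qd n R s (snd z)))"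
    by (rule Jm_integral(1)[where a = "2 * R\<^sup>2 / s + R / s" and b = "2 / s + R / s"])
       (measurable, use R s abs_ln_fP_qd in auto)
  show "(\<integral>z. ln (fP n s P (snd z) / qd n R s (snd z)) \<partial>Jm) = KLq n R s P"
    unfolding KLq_def distr_snd_Jm[symmetric] by (rule integral_distr[OF sm m, symmetric])
  show "integrable F (\<lambda>y. ln (fP n s P y / qd n R s y))"
    using i unfolding distr_snd_Jm[symmetric] by (subst integrable_distr_eq[OF sm m])
qed

text \<open>Split \<open>ln (gd / fP)\<close> into \<open>ln (gd / qd) - ln (fP / qd)\<close>. The
  first mean sees the input only through the law of its norm, the second is a divergence between
  outputs; the quadratic bounds make both parts integrable.\<close>

lemma MI_decomp:
  "MI n P s = (\<integral>x. ((vnorm n x)\<^sup>2 + R\<^sup>2) / (2 * s) - T n R (vnorm n x) s \<partial>P) - KLq n R s P"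
  and integrable_D: "integrable P (\<lambda>x. ((vnorm n x)\<^sup>2 + R\<^sup>2) / (2 * s) - T n R (vnorm n x) s)"
proof -
  have bd: "\<bar>ln (gd n s x y / qd n R s y)\<bar> \<le> (R\<^sup>2 / s + 2 * R / s) + (2 * R / s) * (vnorm n y)\<^sup>2"
    if x: "x \<in> space (Rn n)" "vnorm n x \<le> R" and y: "y \<in> space (Rn n)" for x y
  proof -
    have a: "0 \<le> (vnorm n x)\<^sup>2" "(vnorm n x)\<^sup>2 \<le> R\<^sup>2" using x by (auto intro: power_mono)
    have "\<bar>(R\<^sup>2 - (vnorm n x)\<^sup>2) / (2 * s)\<bar> = (R\<^sup>2 - (vnorm n x)\<^sup>2) / (2 * s)" using a s by simp
    also have "\<dots> \<le> R\<^sup>2 / s" using a s by (intro frac_le) auto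
    finally have 1: "\<bar>(R\<^sup>2 - (vnorm n x)\<^sup>2) / (2 * s)\<bar> \<le> R\<^sup>2 / s" .
    have "\<bar>vdot n y x\<bar> \<le> vnorm n y * vnorm n x" by (rule abs_vdot_le[OF n y x(1)])
    also have "\<dots> \<le> (1 + (vnorm n y)\<^sup>2) * R" using x by (intro mult_mono le_one_plus_power2) auto
    finally have 2: "\<bar>vdot n y x / s\<bar> \<le> R / s * (1 + (vnorm n y)\<^sup>2)"
      using s by (simp add: divide_right_mono mult.commute)
    have "\<bar>ln (gd n s x y / qd n R s y)\<bar> \<le> R\<^sup>2 / s + 2 * (R / s * (1 + (vnorm n y)\<^sup>2))"
      unfolding ln_gd_qd[OF n s] using 1 2 ln_Phi_norm_bound[OF n s R, of y] by linarith
    then show ?thesis by (simp add: distrib_left)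
  qed
  define f where "f = (\<lambda>z. ln (gd n s (fst z) (snd z) / qd n R s (snd z)))"
  have fe: "f (x, y) = ln (gd n s x y / qd n R s y)" for x y by (simp add: f_def)
  have m: "f \<in> borel_measurable (P \<Otimes>\<^sub>M Rn n)" unfolding f_def by measurable
  have ab: "0 \<le> R\<^sup>2 / s + 2 * R / s" "0 \<le> 2 * R / s" using R s by auto
  have bd': "\<bar>f (x, y)\<bar> \<le> (R\<^sup>2 / s + 2 * R / s) + (2 * R / s) * (vnorm n y)\<^sup>2"
    if "x \<in> space (Rn n)" "y \<in> space (Rn n)" "vnorm n x \<le> R" for x y
    unfolding fe by (rule bd[OF that(1) that(3) that(2)])
  have J1: "integrable Jm f" by (rule Jm_integral(1)[OF m ab]) (rule bd')
  have J2: "(\<integral>z. f z \<partial>Jm) = (\<integral>x. (\<integral>y. f (x, y) \<partial>density (Rn n) (\<lambda>y. ennreal (gd n s x y))) \<partial>P)"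
    by (rule Jm_integral(2)[OF m ab]) (rule bd')
  have J3: "integrable P (\<lambda>x. \<integral>y. f (x, y) \<partial>density (Rn n) (\<lambda>y. ennreal (gd n s x y)))"
    by (rule Jm_integral(3)[OF m ab]) (rule bd')
  have eq: "(\<integral>y. ln (gd n s x y / qd n R s y) \<partial>density (Rn n) (\<lambda>y. ennreal (gd n s x y)))
     = ((vnorm n x)\<^sup>2 + R\<^sup>2) / (2 * s) - T n R (vnorm n x) s" if "x \<in> space P" for x
    by (rule gd_qd_integral[OF n s R]) (use that in \<open>simp only: space_P\<close>)
  show "integrable P (\<lambda>x. ((vnorm n x)\<^sup>2 + R\<^sup>2) / (2 * s) - T n R (vnorm n x) s)"
    using J3 unfolding fe by (subst (asm) Bochner_Integration.integrable_cong[OF refl eq])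
  have "MI n P s = (\<integral>z. f z - ln (fP n s P (snd z) / qd n R s (snd z)) \<partial>Jm)"
    unfolding MI_eq_Jm
  proof (rule Bochner_Integration.integral_cong[OF refl])
    fix z assume "z \<in> space Jm"
    then have z: "snd z \<in> space (Rn n)" by (auto simp: Jm_def space_pair_measure)
    show "ln (gd n s (fst z) (snd z) / fP n s P (snd z)) = f z - ln (fP n s P (snd z) / qd n R s (snd z))"
      unfolding f_def using fP_pos[OF z] qd_pos'[of "snd z"] gd_pos[OF s, of n "fst z" "snd z"] by (simp add: ln_divide_pos)
  qed
  also have "\<dots> = (\<integral>z. f z \<partial>Jm) - KLq n R s P"
    using J1 KLq_Jm by simp
  also have "(\<integral>z. f z \<partial>Jm) = (\<integral>x. ((vnorm n x)\<^sup>2 + R\<^sup>2) / (2 * s) - T n R (vnorm n x) s \<partial>P)"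
    unfolding J2 fe by (rule Bochner_Integration.integral_cong[OF refl eq])
  finally show "MI n P s = (\<integral>x. ((vnorm n x)\<^sup>2 + R\<^sup>2) / (2 * s) - T n R (vnorm n x) s \<partial>P) - KLq n R s P" .
qed

end

section \<open>Degraded outputs and their divergence from the sphere output\<close>

lemma fP_semigroup:
  assumes P: "prob_input n s P" and t: "t > 0" and y: "y \<in> space (Rn n)"
  shows "(\<integral>\<^sup>+u. ennreal (fP n s P u) * ennreal (gd n t u y) \<partial>Rn n) = ennreal (fP n (s + t) P y)"
proof -
  interpret prob_input n s P by fact
  interpret P2: prob_input n "s + t" P using n s t prob_P sets_P by (intro prob_input.intro) auto
  have [measurable]: "(\<lambda>u. gd n t u y) \<in> borel_measurable (Rn n)" by (rule measurable_gd) (simp_all add: y)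
  have m2: "(\<lambda>(x, u). ennreal (gd n s x u) * ennreal (gd n t u y)) \<in> borel_measurable (P \<Otimes>\<^sub>M Rn n)"
    unfolding case_prod_beta by measurable
  have "(\<integral>\<^sup>+u. ennreal (fP n s P u) * ennreal (gd n t u y) \<partial>Rn n) = (\<integral>\<^sup>+u. (\<integral>\<^sup>+x. ennreal (gd n s x u) * ennreal (gd n t u y) \<partial>P) \<partial>Rn n)"
  proof (intro nn_integral_cong)
    fix u assume u: "u \<in> space (Rn n)"
    show "ennreal (fP n s P u) * ennreal (gd n t u y) = (\<integral>\<^sup>+x. ennreal (gd n s x u) * ennreal (gd n t u y) \<partial>P)"
      unfolding nn_integral_gd_P[OF u, symmetric]
      by (intro nn_integral_multc[symmetric] measurable_compose[OF gd_measurable_P[OF u] measurable_ennreal])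
  qed
  also have "\<dots> = (\<integral>\<^sup>+x. (\<integral>\<^sup>+u. ennreal (gd n s x u) * ennreal (gd n t u y) \<partial>Rn n) \<partial>P)"
    by (rule PL.Fubini'[OF m2])
  also have "\<dots> = (\<integral>\<^sup>+x. ennreal (gd n (s + t) x y) \<partial>P)" by (simp only: conv_gd[OF s t])
  also have "\<dots> = ennreal (fP n (s + t) P y)" by (rule P2.nn_integral_gd_P[OF y])
  finally show ?thesis .
qed

lemma fP_unif_sphere:
  assumes n: "1 \<le> n" and R: "0 \<le> R" and s: "s > 0" and y: "y \<in> space (Rn n)"
  shows "fP n s (unif_sphere n R) y = qd n R s y"
proof -
  interpret prob_input n s "unif_sphere n R"
    using n s by (intro prob_input.intro prob_space_unif_sphere sets_unif_sphere)
  have "ennreal (fP n s (unif_sphere n R) y) = ennreal (qd n R s y)"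
    using nn_integral_gd_P[OF y] nn_integral_gd_unif_sphere[OF n R s y] by simp
  moreover have "0 \<le> fP n s (unif_sphere n R) y" unfolding fP_def by simp
  ultimately show ?thesis using qd_pos[OF n s, of R y] by simp
qed

lemma admissible_unif_sphere:
  assumes n: "1 \<le> n" and R: "0 \<le> R"
  shows "admissible n R (unif_sphere n R)"
  unfolding admissible_def using prob_space_unif_sphere[OF n] sets_unif_sphere AE_unif_sphere[OF n R] by auto

lemma KLq_unif_sphere:
  assumes n: "1 \<le> n" and R: "0 \<le> R" and s: "s > 0"
  shows "KLq n R s (unif_sphere n R) = 0"
proof -
  have "KLq n R s (unif_sphere n R) = (\<integral>y. 0 \<partial>density (Rn n) (\<lambda>y. ennreal (fP n s (unif_sphere n R) y)))"
    unfolding KLq_def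
    by (rule Bochner_Integration.integral_cong[OF refl]) (use qd_pos[OF n s, of R] in \<open>simp add: fP_unif_sphere[OF n R s] less_imp_neq[symmetric]\<close>)
  then show ?thesis by simp
qed

text \<open>Gibbs' inequality: \<open>ln v >= 1 - 1 / v\<close>, and \<open>qd / fP\<close> has mean
  1 under the output law because \<open>qd\<close> is a probability density.\<close>

lemma KLq_nonneg:
  assumes "channel_input n R s P"
  shows "KLq n R s P \<ge> 0"
proof -
  interpret channel_input n R s P by fact
  interpret F: prob_space F by (rule prob_space_fP)
  have r: "ennreal (fP n s P y) * ennreal (qd n R s y / fP n s P y) = ennreal (qd n R s y)" if "y \<in> space (Rn n)" for y
    using fP_pos[OF that] qd_pos'[of y] by (simp add: ennreal_mult[symmetric])
  have "(\<integral>\<^sup>+y. ennreal (qd n R s y / fP n s P y) \<partial>F) = (\<integral>\<^sup>+y. ennreal (fP n s P y) * ennreal (qd n R s y / fP n s P y) \<partial>Rn n)"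
    by (rule nn_integral_density) measurable
  also have "\<dots> = (\<integral>\<^sup>+y. ennreal (qd n R s y) \<partial>Rn n)" by (rule nn_integral_cong) (rule r)
  also have "\<dots> = (\<integral>\<^sup>+y. ennreal (fP n s (unif_sphere n R) y) \<partial>Rn n)"
    by (rule nn_integral_cong) (simp only: fP_unif_sphere[OF n R s])
  also have "\<dots> = 1"
  proof -
    interpret Q: prob_input n s "unif_sphere n R"
      using n s by (intro prob_input.intro prob_space_unif_sphere sets_unif_sphere)
    have m: "(\<lambda>y. ennreal (fP n s (unif_sphere n R) y)) \<in> borel_measurable (Rn n)"
      by (rule measurable_compose[OF Q.fP_measurable measurable_ennreal])
    show ?thesis
      using prob_space.emeasure_space_1[OF Q.prob_space_fP]
      by (simp add: emeasure_density[OF m] cong: nn_integral_cong)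
  qed
  finally have n1: "(\<integral>\<^sup>+y. ennreal (qd n R s y / fP n s P y) \<partial>F) = ennreal 1" by simp
  have nnr: "0 \<le> qd n R s y / fP n s P y" for y
    using qd_pos'[of y] by (simp add: fP_def)
  have hb: "has_bochner_integral F (\<lambda>y. qd n R s y / fP n s P y) 1"
    by (rule has_bochner_integral_nn_integral[OF _ _ _ n1]) (use nnr in auto)
  have "(\<integral>y. 1 - qd n R s y / fP n s P y \<partial>F) \<le> (\<integral>y. ln (fP n s P y / qd n R s y) \<partial>F)"
  proof (rule integral_mono[OF _ KLq_Jm(3)])
    show "integrable F (\<lambda>y. 1 - qd n R s y / fP n s P y)" using hb by (simp add: has_bochner_integral_iff)
    fix y assume "y \<in> space F"
    then have y: "y \<in> space (Rn n)" by simp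
    have "ln (qd n R s y / fP n s P y) \<le> qd n R s y / fP n s P y - 1"
      using fP_pos[OF y] qd_pos'[of y] by (intro ln_le_minus_one) simp
    moreover have "ln (qd n R s y / fP n s P y) = - ln (fP n s P y / qd n R s y)"
      using fP_pos[OF y] qd_pos'[of y] by (simp add: ln_divide_pos)
    ultimately show "1 - qd n R s y / fP n s P y \<le> ln (fP n s P y / qd n R s y)" by simp
  qed
  moreover have "(\<integral>y. 1 - qd n R s y / fP n s P y \<partial>F) = 0"
    using hb F.prob_space by (simp add: has_bochner_integral_iff)
  ultimately show ?thesis by (simp add: KLq_def)
qed

text \<open>Data processing: with \<open>l1 = ln (f1 / q1)\<close> and \<open>l2 = ln (f2 / q2)\<close> on the joint law of the two
  outputs, \<open>exp (l2 - l1)\<close> integrates to 1, and \<open>exp z \<ge> 1 + z\<close>.\<close>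

lemma KLq_antimono:
  assumes C: "channel_input n R s P" and t: "t > 0"
  shows "KLq n R (s + t) P \<le> KLq n R s P"
proof -
  interpret A: channel_input n R s P by fact
  interpret B: channel_input n R "s + t" P
    using A.n A.R A.s A.adm t by (intro channel_input.intro) auto
  interpret F1: prob_space A.F by (rule A.prob_space_fP)
  \<comment> \<open>The output at noise \<open>s\<close> becomes the input of a second channel with
    noise \<open>t\<close>, whose output is the one at noise \<open>s + t\<close>.\<close>
  interpret N: prob_input n t A.F
    using A.n t A.prob_space_fP by (intro prob_input.intro) auto
  interpret NN: prob_space N.Jm by (rule N.prob_space_Jm)
  have Qin: "prob_input n s (unif_sphere n R)"
    using A.n A.s by (intro prob_input.intro prob_space_unif_sphere sets_unif_sphere)
  let ?f1 = "fP n s P" and ?f2 = "fP n (s + t) P" and ?q1 = "qd n R s" and ?q2 = "qd n R (s + t)"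
  have f2: "fP n t A.F y = ?f2 y" if y: "y \<in> space (Rn n)" for y
  proof -
    have m: "(\<lambda>u. ennreal (gd n t u y)) \<in> borel_measurable (Rn n)"
      by (rule measurable_compose[OF measurable_gd measurable_ennreal]) (simp_all add: y)
    have m1: "(\<lambda>u. ennreal (?f1 u)) \<in> borel_measurable (Rn n)" by measurable
    have "ennreal (fP n t A.F y) = (\<integral>\<^sup>+u. ennreal (gd n t u y) \<partial>A.F)" by (rule N.nn_integral_gd_P[OF y, symmetric])
    also have "\<dots> = (\<integral>\<^sup>+u. ennreal (?f1 u) * ennreal (gd n t u y) \<partial>Rn n)" by (rule nn_integral_density[OF m1 m])
    also have "\<dots> = ennreal (?f2 y)" by (rule fP_semigroup[OF A.prob_input_axioms t y])
    finally have "ennreal (fP n t A.F y) = ennreal (?f2 y)" .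
    moreover have "0 \<le> fP n t A.F y" "0 \<le> ?f2 y" unfolding fP_def by simp_all
    ultimately show ?thesis by simp
  qed
  have F2: "distr N.Jm (Rn n) snd = B.F"
    unfolding N.distr_snd_Jm by (rule density_cong) (auto simp: f2)
  have F1: "distr N.Jm (Rn n) fst = A.F" by (rule N.distr_fst_Jm)
  have sm: "snd \<in> measurable N.Jm (Rn n)" and fm: "fst \<in> measurable N.Jm (Rn n)" by measurable
  let ?l1 = "\<lambda>u. ln (?f1 u / ?q1 u)" and ?l2 = "\<lambda>y. ln (?f2 y / ?q2 y)"
  have m1: "?l1 \<in> borel_measurable (Rn n)" and m2: "?l2 \<in> borel_measurable (Rn n)" by measurable
  have i1: "integrable N.Jm (\<lambda>z. ?l1 (fst z))" "(\<integral>z. ?l1 (fst z) \<partial>N.Jm) = KLq n R s P"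
  proof -
    show "integrable N.Jm (\<lambda>z. ?l1 (fst z))"
      by (rule integrable_distr_eq[OF fm m1, THEN iffD1]) (simp only: F1 A.KLq_Jm(3))
    show "(\<integral>z. ?l1 (fst z) \<partial>N.Jm) = KLq n R s P"
      using integral_distr[OF fm m1] unfolding F1 KLq_def by (rule sym)
  qed
  have i2: "integrable N.Jm (\<lambda>z. ?l2 (snd z))" "(\<integral>z. ?l2 (snd z) \<partial>N.Jm) = KLq n R (s + t) P"
  proof -
    show "integrable N.Jm (\<lambda>z. ?l2 (snd z))"
      by (rule integrable_distr_eq[OF sm m2, THEN iffD1]) (simp only: F2 B.KLq_Jm(3))
    show "(\<integral>z. ?l2 (snd z) \<partial>N.Jm) = KLq n R (s + t) P"
      using integral_distr[OF sm m2] unfolding F2 KLq_def by (rule sym)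
  qed
  \<comment> \<open>This is the exponential of \<open>?l2 (snd z) - ?l1 (fst z)\<close>, written as
    a product of density ratios.\<close>
  define W where "W = (\<lambda>z. ?q1 (fst z) / ?f1 (fst z) * (?f2 (snd z) / ?q2 (snd z)))"
  have mW0: "W \<in> borel_measurable (Rn n \<Otimes>\<^sub>M Rn n)" unfolding W_def by measurable
  have W0: "0 \<le> W z" for z
    unfolding W_def using qd_pos[OF A.n A.s, of R] qd_pos[OF A.n B.s, of R]
    by (intro mult_nonneg_nonneg divide_nonneg_nonneg) (auto simp: fP_def less_imp_le)
  \<comment> \<open>The density \<open>?f1\<close> of the first output cancels and leaves
    \<open>?q1\<close>. Passed through the second channel, \<open>?q1\<close> becomes
    \<open>?q2\<close>, which cancels in turn and leaves the total mass of
    \<open>?f2\<close>.\<close>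
  have W1: "(\<integral>\<^sup>+z. ennreal (W z) \<partial>N.Jm) = 1"
  proof -
    have LL: "pair_sigma_finite (Rn n) (Rn n)" by (intro pair_sigma_finite.intro sigma_finite_Rn)
    let ?g = "\<lambda>y. ennreal (?f2 y / ?q2 y)"
    have mg: "?g \<in> borel_measurable (Rn n)" by measurable
    have mf: "(\<lambda>u. ennreal (?f1 u)) \<in> borel_measurable (Rn n)" by measurable
    have mN: "(\<lambda>z. ennreal (W z)) \<in> borel_measurable (A.F \<Otimes>\<^sub>M Rn n)"
      using measurable_compose[OF mW0 measurable_ennreal]
      by (simp cong: measurable_cong_sets add: sets_pair_measure_cong[OF N.sets_P refl])
    have q0: "0 < ?q1 u" "0 < ?q2 u" for u using qd_pos[OF A.n A.s, of R] qd_pos[OF A.n B.s, of R] by auto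
    have f0: "0 \<le> ?f2 u" for u by (simp add: fP_def)
    define I where "I = (\<lambda>u. \<integral>\<^sup>+y. ennreal (gd n t u y) * ?g y \<partial>Rn n)"
    have mgd: "(\<lambda>z. gd n t (fst z) (snd z)) \<in> borel_measurable (Rn n \<Otimes>\<^sub>M Rn n)"
      by (rule measurable_gd) simp_all
    have I: "I \<in> borel_measurable (Rn n)"
    proof -
      have "(\<lambda>z. ennreal (gd n t (fst z) (snd z)) * ?g (snd z)) \<in> borel_measurable (Rn n \<Otimes>\<^sub>M Rn n)"
        by (intro borel_measurable_times_ennreal measurable_compose[OF mgd measurable_ennreal] measurable_compose[OF measurable_snd mg])
      then show ?thesis unfolding I_def by (intro sigma_finite_measure.borel_measurable_nn_integral[OF sigma_finite_Rn]) (simp add: case_prod_beta)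
    qed
    have inner: "(\<integral>\<^sup>+y. ennreal (W (u, y)) \<partial>density (Rn n) (\<lambda>y. ennreal (gd n t u y))) = ennreal (?q1 u / ?f1 u) * I u"
      if u: "u \<in> space (Rn n)" for u
    proof -
      have mu: "(\<lambda>y. ennreal (gd n t u y)) \<in> borel_measurable (Rn n)"
        by (rule measurable_compose[OF measurable_gd1[OF u] measurable_ennreal])
      have Wu: "ennreal (W (u, y)) = ennreal (?q1 u / ?f1 u) * ?g y" for y
        unfolding W_def fst_conv snd_conv using q0[of u] q0[of y] A.fP_pos[OF u] f0[of y]
        by (intro ennreal_mult divide_nonneg_nonneg) auto
      have "(\<integral>\<^sup>+y. ennreal (W (u, y)) \<partial>density (Rn n) (\<lambda>y. ennreal (gd n t u y))) = (\<integral>\<^sup>+y. ennreal (?q1 u / ?f1 u) * ?g y \<partial>density (Rn n) (\<lambda>y. ennreal (gd n t u y)))"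
        by (simp only: Wu)
      also have "\<dots> = ennreal (?q1 u / ?f1 u) * (\<integral>\<^sup>+y. ?g y \<partial>density (Rn n) (\<lambda>y. ennreal (gd n t u y)))"
        by (rule nn_integral_cmult) (use mg in simp)
      also have "(\<integral>\<^sup>+y. ?g y \<partial>density (Rn n) (\<lambda>y. ennreal (gd n t u y))) = I u"
        unfolding I_def by (rule nn_integral_density[OF mu mg])
      finally show ?thesis .
    qed
    have mr: "(\<lambda>u. ennreal (?q1 u / ?f1 u) * I u) \<in> borel_measurable (Rn n)"
      by (rule borel_measurable_times_ennreal[OF _ I]) measurable
    have m3: "(\<lambda>(u, y). ennreal (?q1 u) * (ennreal (gd n t u y) * ?g y)) \<in> borel_measurable (Rn n \<Otimes>\<^sub>M Rn n)"
      unfolding case_prod_beta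
      by (intro borel_measurable_times_ennreal measurable_compose[OF mgd measurable_ennreal] measurable_compose[OF measurable_snd mg]
            measurable_compose[OF measurable_fst measurable_compose[OF measurable_qd measurable_ennreal]])
    have "(\<integral>\<^sup>+z. ennreal (W z) \<partial>N.Jm) = (\<integral>\<^sup>+u. (\<integral>\<^sup>+y. ennreal (W (u, y)) \<partial>density (Rn n) (\<lambda>y. ennreal (gd n t u y))) \<partial>A.F)"
      by (rule N.nn_integral_Jm[OF mN])
    also have "\<dots> = (\<integral>\<^sup>+u. ennreal (?q1 u / ?f1 u) * I u \<partial>A.F)"
      by (intro nn_integral_cong inner) simp
    also have "\<dots> = (\<integral>\<^sup>+u. ennreal (?f1 u) * (ennreal (?q1 u / ?f1 u) * I u) \<partial>Rn n)"
      by (rule nn_integral_density[OF mf mr])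
    also have "\<dots> = (\<integral>\<^sup>+u. (\<integral>\<^sup>+y. ennreal (?q1 u) * (ennreal (gd n t u y) * ?g y) \<partial>Rn n) \<partial>Rn n)"
    proof (intro nn_integral_cong)
      fix u assume u: "u \<in> space (Rn n)"
      have "ennreal (?f1 u) * ennreal (?q1 u / ?f1 u) = ennreal (?f1 u * (?q1 u / ?f1 u))"
        using q0[of u] A.fP_pos[OF u] by (intro ennreal_mult[symmetric]) auto
      also have "?f1 u * (?q1 u / ?f1 u) = ?q1 u" using A.fP_pos[OF u] by simp
      finally have "ennreal (?f1 u) * (ennreal (?q1 u / ?f1 u) * I u) = ennreal (?q1 u) * I u"
        by (simp only: mult.assoc[symmetric])
      also have "\<dots> = (\<integral>\<^sup>+y. ennreal (?q1 u) * (ennreal (gd n t u y) * ?g y) \<partial>Rn n)"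
        unfolding I_def
        by (intro nn_integral_cmult[symmetric] borel_measurable_times_ennreal mg measurable_compose[OF measurable_gd1[OF u] measurable_ennreal])
      finally show "ennreal (?f1 u) * (ennreal (?q1 u / ?f1 u) * I u) = (\<integral>\<^sup>+y. ennreal (?q1 u) * (ennreal (gd n t u y) * ?g y) \<partial>Rn n)" .
    qed
    also have "\<dots> = (\<integral>\<^sup>+y. (\<integral>\<^sup>+u. ennreal (?q1 u) * (ennreal (gd n t u y) * ?g y) \<partial>Rn n) \<partial>Rn n)"
      by (rule pair_sigma_finite.Fubini'[OF LL m3, symmetric])
    also have "\<dots> = (\<integral>\<^sup>+y. ennreal (?f2 y) \<partial>Rn n)"
    proof (intro nn_integral_cong)
      fix y assume y: "y \<in> space (Rn n)"
      have my: "(\<lambda>u. ennreal (gd n t u y)) \<in> borel_measurable (Rn n)"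
        by (rule measurable_compose[OF measurable_gd measurable_ennreal]) (simp_all add: y)
      have "(\<integral>\<^sup>+u. ennreal (?q1 u) * (ennreal (gd n t u y) * ?g y) \<partial>Rn n) = (\<integral>\<^sup>+u. ennreal (?q1 u) * ennreal (gd n t u y) * ?g y \<partial>Rn n)"
        by (simp only: mult.assoc)
      also have "\<dots> = (\<integral>\<^sup>+u. ennreal (?q1 u) * ennreal (gd n t u y) \<partial>Rn n) * ?g y"
        by (intro nn_integral_multc borel_measurable_times_ennreal my measurable_compose[OF measurable_qd measurable_ennreal])
      also have "(\<integral>\<^sup>+u. ennreal (?q1 u) * ennreal (gd n t u y) \<partial>Rn n) = (\<integral>\<^sup>+u. ennreal (fP n s (unif_sphere n R) u) * ennreal (gd n t u y) \<partial>Rn n)"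
        by (rule nn_integral_cong) (simp only: fP_unif_sphere[OF A.n A.R A.s])
      also have "\<dots> = ennreal (fP n (s + t) (unif_sphere n R) y)" by (rule fP_semigroup[OF Qin t y])
      also have "\<dots> = ennreal (?q2 y)" by (simp only: fP_unif_sphere[OF A.n A.R B.s y])
      also have "ennreal (?q2 y) * ?g y = ennreal (?q2 y * (?f2 y / ?q2 y))"
        using q0[of y] f0[of y] by (intro ennreal_mult[symmetric]) auto
      also have "?q2 y * (?f2 y / ?q2 y) = ?f2 y" using q0[of y] by simp
      finally show "(\<integral>\<^sup>+u. ennreal (?q1 u) * (ennreal (gd n t u y) * ?g y) \<partial>Rn n) = ennreal (?f2 y)" .
    qed
    also have "\<dots> = 1"
    proof -
      have m: "(\<lambda>y. ennreal (?f2 y)) \<in> borel_measurable (Rn n)" by measurable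
      show ?thesis
        using prob_space.emeasure_space_1[OF B.prob_space_fP] by (simp add: emeasure_density[OF m] cong: nn_integral_cong)
    qed
    finally show ?thesis .
  qed
  have hW: "has_bochner_integral N.Jm W 1"
  proof (rule has_bochner_integral_nn_integral)
    show "W \<in> borel_measurable N.Jm"
      using mW0 by (simp cong: measurable_cong_sets add: N.sets_Jm sets_pair_measure_cong[OF N.sets_P refl])
  qed (use W0 W1 in auto)
  have "(\<integral>z. 1 - W z \<partial>N.Jm) \<le> (\<integral>z. ?l1 (fst z) - ?l2 (snd z) \<partial>N.Jm)"
  proof (rule integral_mono)
    show "integrable N.Jm (\<lambda>z. 1 - W z)" using hW by (simp add: has_bochner_integral_iff)
    show "integrable N.Jm (\<lambda>z. ?l1 (fst z) - ?l2 (snd z))" using i1 i2 by simp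
    fix z assume "z \<in> space N.Jm"
    then have z: "fst z \<in> space (Rn n)" "snd z \<in> space (Rn n)" by (auto simp: N.Jm_def space_pair_measure)
    have p: "0 < ?f1 (fst z)" "0 < ?f2 (snd z)" "0 < ?q1 (fst z)" "0 < ?q2 (snd z)"
      using A.fP_pos[OF z(1)] B.fP_pos[OF z(2)] A.qd_pos' B.qd_pos' by auto
    have "ln (W z) \<le> W z - 1" using p by (intro ln_le_minus_one) (simp add: W_def)
    moreover have "ln (W z) = - ?l1 (fst z) + ?l2 (snd z)"
      using p by (simp add: W_def ln_mult_pos ln_divide_pos)
    ultimately show "1 - W z \<le> ?l1 (fst z) - ?l2 (snd z)" by simp
  qed
  moreover have "(\<integral>z. 1 - W z \<partial>N.Jm) = 0" using hW NN.prob_space by (simp add: has_bochner_integral_iff)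
  moreover have "(\<integral>z. ?l1 (fst z) - ?l2 (snd z) \<partial>N.Jm) = KLq n R s P - KLq n R (s + t) P" using i1 i2 by simp
  ultimately show ?thesis by simp
qed

section \<open>Secrecy rates and the capacity\<close>

lemma secrecy_rate_eq:
  assumes n: "1 \<le> n" and R: "0 \<le> R" and s: "0 < s1" "s1 < s2" and P: "admissible n R P"
  shows "secrecy_rate n P s1 s2 = (\<integral>x. Xi n R s1 s2 (vnorm n x) \<partial>P) - (KLq n R s1 P - KLq n R s2 P)"
    and "integrable P (\<lambda>x. Xi n R s1 s2 (vnorm n x))"
proof -
  interpret A: channel_input n R s1 P using n R s P by (intro channel_input.intro) auto
  interpret B: channel_input n R s2 P using n R s P by (intro channel_input.intro) auto
  have eq: "Xi n R s1 s2 (vnorm n x) = (((vnorm n x)\<^sup>2 + R\<^sup>2) / (2 * s1) - T n R (vnorm n x) s1) - (((vnorm n x)\<^sup>2 + R\<^sup>2) / (2 * s2) - T n R (vnorm n x) s2)" for x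
    by (simp add: Xi_def right_diff_distrib)
  show "integrable P (\<lambda>x. Xi n R s1 s2 (vnorm n x))"
    unfolding eq by (intro Bochner_Integration.integrable_diff A.integrable_D B.integrable_D)
  show "secrecy_rate n P s1 s2 = (\<integral>x. Xi n R s1 s2 (vnorm n x) \<partial>P) - (KLq n R s1 P - KLq n R s2 P)"
    unfolding secrecy_rate_def A.MI_decomp B.MI_decomp eq
    by (subst Bochner_Integration.integral_diff[OF A.integrable_D B.integrable_D]) simp
qed

lemma secrecy_rate_le:
  assumes n: "1 \<le> n" and R: "0 \<le> R" and s: "0 < s1" "s1 < s2" and P: "admissible n R P"
    and B: "\<And>r. 0 \<le> r \<Longrightarrow> r \<le> R \<Longrightarrow> Xi n R s1 s2 r \<le> B"
  shows "secrecy_rate n P s1 s2 \<le> B"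
proof -
  interpret A: channel_input n R s1 P using n R s P by (intro channel_input.intro) auto
  have "KLq n R s2 P \<le> KLq n R s1 P"
    using KLq_antimono[OF A.channel_input_axioms, of "s2 - s1"] s by simp
  moreover have "(\<integral>x. Xi n R s1 s2 (vnorm n x) \<partial>P) \<le> (\<integral>x. B \<partial>P)"
  proof (rule integral_mono_AE[OF secrecy_rate_eq(2)[OF n R s P]])
    show "AE x in P. Xi n R s1 s2 (vnorm n x) \<le> B"
      using A.AE_P by eventually_elim (rule B, simp_all)
  qed simp
  ultimately show ?thesis unfolding secrecy_rate_eq(1)[OF n R s P] by (simp add: A.P.prob_space)
qed

lemma secrecy_rate_unif_sphere:
  assumes n: "1 \<le> n" and R: "0 \<le> R" and s: "0 < s1" "s1 < s2"
  shows "secrecy_rate n (unif_sphere n R) s1 s2 = Xi n R s1 s2 R"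
proof -
  let ?Q = "unif_sphere n R"
  interpret Q: prob_space ?Q by (rule prob_space_unif_sphere[OF n])
  have i: "integrable ?Q (\<lambda>x. Xi n R s1 s2 (vnorm n x))"
    by (rule secrecy_rate_eq(2)[OF n R s admissible_unif_sphere[OF n R]])
  have "(\<integral>x. Xi n R s1 s2 (vnorm n x) \<partial>?Q) = (\<integral>x. Xi n R s1 s2 R \<partial>?Q)"
  proof (rule integral_cong_AE)
    show "AE x in ?Q. Xi n R s1 s2 (vnorm n x) = Xi n R s1 s2 R"
      using AE_unif_sphere[OF n R] by eventually_elim simp
  qed (use i in auto)
  then show ?thesis
    using secrecy_rate_eq(1)[OF n R s admissible_unif_sphere[OF n R]] KLq_unif_sphere[OF n R] s
    by (simp add: Q.prob_space)
qed

lemma Cs_eq_Xi: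
  assumes n: "1 \<le> n" and R: "0 \<le> R" and s: "0 < s1" "s1 < s2"
    and le: "\<And>r. 0 \<le> r \<Longrightarrow> r \<le> R \<Longrightarrow> Xi n R s1 s2 r \<le> Xi n R s1 s2 R"
  shows "Cs s1 s2 R n = Xi n R s1 s2 R"
  unfolding Cs_def
proof (rule cSup_eq_maximum)
  show "Xi n R s1 s2 R \<in> (\<lambda>P. secrecy_rate n P s1 s2) ` {P. admissible n R P}"
    using secrecy_rate_unif_sphere[OF n R s] admissible_unif_sphere[OF n R] by (intro image_eqI[of _ _ "unif_sphere n R"]) auto
  fix x assume "x \<in> (\<lambda>P. secrecy_rate n P s1 s2) ` {P. admissible n R P}"
  then show "x \<le> Xi n R s1 s2 R" using secrecy_rate_le[OF n R s _ le] by auto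
qed

text \<open>A crude bound that drops the nonnegative \<open>T n R r s1\<close>. It makes the set of
  secrecy rates bounded above, so that the supremum \<open>Cs\<close> dominates each of
  them.\<close>

lemma Xi_bounded:
  assumes n: "1 \<le> n" and R: "0 \<le> R" and s: "0 < s1" "s1 < s2" and r: "0 \<le> r" "r \<le> R"
  shows "Xi n R s1 s2 r \<le> (R\<^sup>2 + R\<^sup>2) / 2 * (1 / s1 - 1 / s2) + R / s2 * (1 + (R\<^sup>2 + real n * s2))"
proof -
  have s20: "s2 > 0" using s by simp
  have d: "0 \<le> 1 / s1 - 1 / s2" using s by (simp add: frac_le)
  have r2: "r\<^sup>2 \<le> R\<^sup>2" using r by (intro power_mono)
  have "(r\<^sup>2 + R\<^sup>2) / 2 * (1 / s1 - 1 / s2) \<le> (R\<^sup>2 + R\<^sup>2) / 2 * (1 / s1 - 1 / s2)"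
    using r2 d by (intro mult_right_mono) auto
  moreover have "T n R r s2 \<le> R / s2 * (1 + (R\<^sup>2 + real n * s2))"
  proof -
    have "T n R r s2 \<le> R / s2 * (1 + (r\<^sup>2 + real n * s2))" by (rule T_le[OF n s20 R r(1)])
    also have "\<dots> \<le> R / s2 * (1 + (R\<^sup>2 + real n * s2))" using r2 R s20 by (intro mult_left_mono) auto
    finally show ?thesis .
  qed
  moreover have "0 \<le> T n R r s1" by (rule T_nonneg[OF n])
  ultimately show ?thesis unfolding Xi_def by linarith
qed

lemma secrecy_rate_le_Cs:
  assumes n: "1 \<le> n" and R: "0 \<le> R" and s: "0 < s1" "s1 < s2" and P: "admissible n R P"
  shows "secrecy_rate n P s1 s2 \<le> Cs s1 s2 R n"
  unfolding Cs_def
proof (rule cSUP_upper)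
  show "bdd_above ((\<lambda>P. secrecy_rate n P s1 s2) ` {P. admissible n R P})"
    by (rule bdd_aboveI2) (rule secrecy_rate_le[OF n R s _ Xi_bounded[OF n R s]], auto)
qed (use P in simp)

subsection \<open>Necessity of the optimality condition\<close>

text \<open>The law \<open>(1 - e) * Q + e * (point mass at 0)\<close> for \<open>e\<close> in
  \<open>[0, 1]\<close>, with \<open>Q\<close> the sphere law: a coin decides whether the sphere
  point is replaced by the origin. As an image measure it is a probability measure at once, and
  Fubini splits its integrals.\<close>

definition mixture :: "nat \<Rightarrow> real \<Rightarrow> real \<Rightarrow> (nat \<Rightarrow> real) measure" where
  "mixture n R e = distr (unif_sphere n R \<Otimes>\<^sub>M measure_pmf (bernoulli_pmf e)) (Rn n) (\<lambda>z. if snd z then ve1 n 0 else fst z)"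

lemma measurable_mixture_map:
  "(\<lambda>z. if snd z then ve1 n 0 else fst z) \<in> measurable (unif_sphere n R \<Otimes>\<^sub>M measure_pmf (bernoulli_pmf e)) (Rn n)"
proof (rule measurable_If)
  show "(\<lambda>z. fst z) \<in> measurable (unif_sphere n R \<Otimes>\<^sub>M measure_pmf (bernoulli_pmf e)) (Rn n)"
    by (rule measurable_fst'') (rule measurable_ident_sets[OF sets_unif_sphere])
  have "snd \<in> measurable (unif_sphere n R \<Otimes>\<^sub>M measure_pmf (bernoulli_pmf e)) (count_space UNIV)"
    by (rule measurable_compose[OF measurable_snd]) simp
  then have "snd -` {True} \<inter> space (unif_sphere n R \<Otimes>\<^sub>M measure_pmf (bernoulli_pmf e)) \<in> sets (unif_sphere n R \<Otimes>\<^sub>M measure_pmf (bernoulli_pmf e))"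
    by (rule measurable_sets) simp
  moreover have "{z \<in> space (unif_sphere n R \<Otimes>\<^sub>M measure_pmf (bernoulli_pmf e)). snd z} = snd -` {True} \<inter> space (unif_sphere n R \<Otimes>\<^sub>M measure_pmf (bernoulli_pmf e))"
    by auto
  ultimately show "{z \<in> space (unif_sphere n R \<Otimes>\<^sub>M measure_pmf (bernoulli_pmf e)). snd z} \<in> sets (unif_sphere n R \<Otimes>\<^sub>M measure_pmf (bernoulli_pmf e))"
    by (simp only:)
qed simp

lemma admissible_mixture:
  assumes n: "1 \<le> n" and R: "0 \<le> R"
  shows "admissible n R (mixture n R e)"
proof -
  let ?Q = "unif_sphere n R" and ?B = "measure_pmf (bernoulli_pmf e)"
  interpret Q: prob_space ?Q by (rule prob_space_unif_sphere[OF n])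
  interpret B: prob_space ?B by (rule measure_pmf.prob_space_axioms)
  interpret QB: pair_prob_space ?Q ?B ..
  note m = measurable_mixture_map[of n R e]
  have meas: "{x \<in> space (Rn n). vnorm n x \<le> R} \<in> sets (Rn n)" by measurable
  have "AE z in ?Q \<Otimes>\<^sub>M ?B. vnorm n (if snd z then ve1 n 0 else fst z) \<le> R"
  proof (rule QB.AE_pair_measure)
    have "(\<lambda>z. vnorm n (if snd z then ve1 n 0 else fst z)) \<in> borel_measurable (?Q \<Otimes>\<^sub>M ?B)"
      by (rule measurable_compose[OF m measurable_vnorm])
    then show "{z \<in> space (?Q \<Otimes>\<^sub>M ?B). vnorm n (if snd z then ve1 n 0 else fst z) \<le> R} \<in> sets (?Q \<Otimes>\<^sub>M ?B)"
      by (rule borel_measurable_le) simp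
    show "AE x in ?Q. AE y in ?B. vnorm n (if snd (x, y) then ve1 n 0 else fst (x, y)) \<le> R"
      using AE_unif_sphere[OF n R] by eventually_elim (auto simp: vnorm_ve1[OF n] R)
  qed
  then have "AE x in mixture n R e. vnorm n x \<le> R"
    unfolding mixture_def by (subst AE_distr_iff[OF m meas])
  moreover have "prob_space (mixture n R e)"
    unfolding mixture_def by (rule QB.prob_space_distr[OF m])
  moreover have "sets (mixture n R e) = sets (Rn n)" by (simp add: mixture_def)
  ultimately show ?thesis by (simp add: admissible_def)
qed

lemma integral_mixture:
  fixes g :: "_ \<Rightarrow> real"
  assumes n: "1 \<le> n" and e: "0 \<le> e" "e \<le> 1" and g: "g \<in> borel_measurable (Rn n)" and i: "integrable (unif_sphere n R) g"
  shows "(\<integral>x. g x \<partial>mixture n R e) = e * g (ve1 n 0) + (1 - e) * (\<integral>x. g x \<partial>unif_sphere n R)"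
proof -
  let ?Q = "unif_sphere n R" and ?B = "measure_pmf (bernoulli_pmf e)"
  interpret Q: prob_space ?Q by (rule prob_space_unif_sphere[OF n])
  interpret B: prob_space ?B by (rule measure_pmf.prob_space_axioms)
  interpret QB: pair_prob_space ?Q ?B ..
  note m = measurable_mixture_map[of n R e]
  define h where "h = (\<lambda>z. g (if snd z then ve1 n 0 else fst z))"
  have h: "h \<in> borel_measurable (?Q \<Otimes>\<^sub>M ?B)" unfolding h_def by (rule measurable_compose[OF m g])
  have hb: "(\<integral>b. h (x, b) \<partial>?B) = e * g (ve1 n 0) + (1 - e) * g x" for x
    using e by (simp add: h_def integral_bernoulli_pmf)
  have "(\<integral>x. g x \<partial>mixture n R e) = (\<integral>z. h z \<partial>(?Q \<Otimes>\<^sub>M ?B))"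
    unfolding mixture_def h_def by (rule integral_distr[OF m g])
  also have "\<dots> = (\<integral>x. (\<integral>b. h (x, b) \<partial>?B) \<partial>?Q)"
  proof (rule QB.integral_fst'[symmetric])
    show "integrable (?Q \<Otimes>\<^sub>M ?B) h"
    proof (rule QB.Fubini_integrable[OF h])
      show "AE x in ?Q. integrable ?B (\<lambda>b. h (x, b))" by (intro AE_I2 integrable_measure_pmf_finite) simp
      have "(\<integral>b. norm (h (x, b)) \<partial>?B) = e * norm (g (ve1 n 0)) + (1 - e) * norm (g x)" for x
        using e by (simp add: h_def integral_bernoulli_pmf)
      then show "integrable ?Q (\<lambda>x. \<integral>b. norm (h (x, b)) \<partial>?B)" using i by simp
    qed
  qed
  also have "\<dots> = e * g (ve1 n 0) + (1 - e) * (\<integral>x. g x \<partial>?Q)"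
    unfolding hb using i by (simp add: Q.prob_space)
  finally show ?thesis .
qed

text \<open>With \<open>w = g / q\<close> one has \<open>f / q - 1 = e * (w - 1)\<close>, so
  \<open>ln v <= v - 1\<close> bounds the divergence by \<open>e\<close> times the mean of
  \<open>w - 1\<close> under \<open>f\<close>. In that mean the part of order 0 in \<open>e\<close>
  vanishes because \<open>g\<close> and \<open>q\<close> have equal mass; this leaves order
  \<open>e^2\<close>. The bound on \<open>w\<close> comes from \<open>Phi >= 1\<close>.\<close>

lemma KLq_mixture_le:
  assumes n: "1 \<le> n" and R: "0 \<le> R" and s: "s > 0" and e: "0 \<le> e" "e \<le> 1"
  shows "KLq n R s (mixture n R e) \<le> e\<^sup>2 * exp (R\<^sup>2 / (2 * s))"
proof -
  interpret A: channel_input n R s "mixture n R e"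
    using n R s admissible_mixture[OF n R] by (intro channel_input.intro) auto
  interpret F: prob_space A.F by (rule A.prob_space_fP)
  let ?f = "fP n s (mixture n R e)" and ?q = "qd n R s" and ?g = "gd n s (ve1 n 0)"
  let ?B = "exp (R\<^sup>2 / (2 * s))"
  have f: "?f y = e * ?g y + (1 - e) * ?q y" if y: "y \<in> space (Rn n)" for y
  proof -
    interpret Q: prob_input n s "unif_sphere n R"
      using n s by (intro prob_input.intro prob_space_unif_sphere sets_unif_sphere)
    have gm: "(\<lambda>x. gd n s x y) \<in> borel_measurable (Rn n)" by (rule measurable_gd) (simp_all add: y)
    have "?f y = e * ?g y + (1 - e) * fP n s (unif_sphere n R) y"
      unfolding fP_def by (rule integral_mixture[OF n e gm Q.integrable_gd_P[OF y]])
    then show ?thesis by (simp only: fP_unif_sphere[OF n R s y])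
  qed
  define w where "w = (\<lambda>y. ?g y / ?q y)"
  have q0: "?q y > 0" for y by (rule qd_pos[OF n s])
  have wq: "w y * ?q y = ?g y" for y using q0[of y] by (simp add: w_def)
  have w0: "0 \<le> w y" for y using q0[of y] by (simp add: w_def)
  have wB: "w y \<le> ?B" for y
  proof -
    have "ln (?g y / ?q y) \<le> R\<^sup>2 / (2 * s)"
      using ln_Phi_nonneg[OF n, of "R * (vnorm n y / s)"]
      unfolding ln_gd_qd[OF n s] by (simp add: vnorm_ve1[OF n] vdot_commute[of n y] vdot_ve1[OF n])
    moreover have "0 < ?g y / ?q y" using q0[of y] gd_pos[OF s, of n "ve1 n 0" y] by simp
    ultimately show ?thesis unfolding w_def by (metis exp_le_cancel_iff exp_ln)
  qed
  have mw: "w \<in> borel_measurable (Rn n)" unfolding w_def by measurable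
  have fnn: "AE y in Rn n. 0 \<le> ?f y" by (simp add: fP_def)
  have iG: "has_bochner_integral (Rn n) ?g 1"
    by (rule has_bochner_integral_nn_integral) (use nn_integral_gd[OF s ve1_in_space] in \<open>auto\<close>)
  have iQ: "has_bochner_integral (Rn n) ?q 1"
  proof (rule has_bochner_integral_nn_integral)
    interpret Q: prob_input n s "unif_sphere n R"
      using n s by (intro prob_input.intro prob_space_unif_sphere sets_unif_sphere)
    have m: "(\<lambda>y. ennreal (fP n s (unif_sphere n R) y)) \<in> borel_measurable (Rn n)"
      by (rule measurable_compose[OF Q.fP_measurable measurable_ennreal])
    have "(\<integral>\<^sup>+y. ennreal (?q y) \<partial>Rn n) = (\<integral>\<^sup>+y. ennreal (fP n s (unif_sphere n R) y) \<partial>Rn n)"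
      by (rule nn_integral_cong) (simp only: fP_unif_sphere[OF n R s])
    also have "\<dots> = 1"
      using prob_space.emeasure_space_1[OF Q.prob_space_fP] by (simp add: emeasure_density[OF m] cong: nn_integral_cong)
    finally show "(\<integral>\<^sup>+y. ennreal (?q y) \<partial>Rn n) = ennreal 1" by simp
  qed (use q0 in \<open>auto intro: less_imp_le\<close>)
  have iwG: "integrable (Rn n) (\<lambda>y. w y * ?g y)"
  proof (rule Bochner_Integration.integrable_bound)
    show "integrable (Rn n) (\<lambda>y. ?B * ?g y)" using iG by (simp add: has_bochner_integral_iff)
    show "(\<lambda>y. w y * ?g y) \<in> borel_measurable (Rn n)" using mw by measurable
    show "AE y in Rn n. norm (w y * ?g y) \<le> norm (?B * ?g y)"
      using w0 wB by (intro AE_I2) (simp add: abs_mult mult_right_mono)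
  qed
  have "KLq n R s (mixture n R e) \<le> (\<integral>y. e * (w y - 1) \<partial>A.F)"
    unfolding KLq_def
  proof (rule integral_mono[OF A.KLq_Jm(3)])
    show "integrable A.F (\<lambda>y. e * (w y - 1))"
    proof (rule F.integrable_const_bound[where B = "e * (?B + 1)"])
      show "AE y in A.F. norm (e * (w y - 1)) \<le> e * (?B + 1)"
      proof (intro AE_I2)
        fix y
        have "\<bar>w y - 1\<bar> \<le> ?B + 1" using w0[of y] wB[of y] by linarith
        then show "norm (e * (w y - 1)) \<le> e * (?B + 1)" using e by (simp add: abs_mult mult_left_mono)
      qed
    qed (use mw in simp)
    fix y assume "y \<in> space A.F"
    then have y: "y \<in> space (Rn n)" by simp
    have "ln (?f y / ?q y) \<le> ?f y / ?q y - 1" using A.fP_pos[OF y] q0[of y] by (intro ln_le_minus_one) simp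
    moreover have "?f y / ?q y = e * w y + (1 - e)" unfolding f[OF y] w_def using q0[of y] by (simp add: add_divide_distrib)
    then have "?f y / ?q y - 1 = e * (w y - 1)" by (simp add: right_diff_distrib)
    ultimately show "ln (?f y / ?q y) \<le> e * (w y - 1)" by (simp only:)
  qed
  also have "\<dots> = (\<integral>y. ?f y * (e * (w y - 1)) \<partial>Rn n)"
    by (rule integral_real_density[OF _ fnn]) (use mw in measurable)
  also have "\<dots> = (\<integral>y. e\<^sup>2 * (w y * ?g y) + (e * (1 - e) - e\<^sup>2) * ?g y - e * (1 - e) * ?q y \<partial>Rn n)"
  proof (rule Bochner_Integration.integral_cong[OF refl])
    fix y assume y: "y \<in> space (Rn n)"
    have "(e * G + (1 - e) * q) * (e * (v - 1)) = e\<^sup>2 * (v * G) + (e * (1 - e) - e\<^sup>2) * G - e * (1 - e) * q" if "v * q = G" for G q v :: real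
      unfolding that[symmetric] by (simp add: power2_eq_square algebra_simps)
    from this[OF wq[of y]] show "?f y * (e * (w y - 1)) = e\<^sup>2 * (w y * ?g y) + (e * (1 - e) - e\<^sup>2) * ?g y - e * (1 - e) * ?q y"
      unfolding f[OF y] .
  qed
  also have "\<dots> = e\<^sup>2 * (\<integral>y. w y * ?g y \<partial>Rn n) + (e * (1 - e) - e\<^sup>2) * 1 - e * (1 - e) * 1"
    using iwG iG iQ by (simp add: has_bochner_integral_iff)
  also have "\<dots> \<le> e\<^sup>2 * (\<integral>y. w y * ?g y \<partial>Rn n)" by simp
  also have "\<dots> \<le> e\<^sup>2 * ?B"
  proof (rule mult_left_mono)
    have "(\<integral>y. w y * ?g y \<partial>Rn n) \<le> (\<integral>y. ?B * ?g y \<partial>Rn n)"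
      by (rule integral_mono[OF iwG]) (use iG wB in \<open>auto simp: has_bochner_integral_iff intro!: mult_right_mono\<close>)
    then show "(\<integral>y. w y * ?g y \<partial>Rn n) \<le> ?B" using iG by (simp add: has_bochner_integral_iff)
  qed simp
  finally show ?thesis .
qed

lemma attains_Cs_imp_Xi:
  assumes n: "1 \<le> n" and R: "0 \<le> R" and s: "0 < s1" "s1 < s2" and att: "attains_Cs s1 s2 R n"
  shows "Xi n R s1 s2 0 \<le> Xi n R s1 s2 R"
proof (rule ccontr)
  assume not: "\<not> ?thesis"
  define d where "d = Xi n R s1 s2 0 - Xi n R s1 s2 R"
  have d: "d > 0" using not by (simp add: d_def)
  have s20: "s2 > 0" using s by simp
  define B where "B = exp (R\<^sup>2 / (2 * s1))"
  have B: "B > 0" by (simp add: B_def)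
  let ?Q = "unif_sphere n R"
  have Cs: "Cs s1 s2 R n = Xi n R s1 s2 R"
    using att secrecy_rate_unif_sphere[OF n R s] by (simp add: attains_Cs_def)
  \<comment> \<open>The gain in the mean of \<open>Xi\<close> is \<open>e * d\<close>, the loss in
    divergence at most \<open>e^2 * B\<close>; with \<open>e * B <= d / 2\<close> the gain wins. The
    cap at 1 keeps \<open>e\<close> a probability.\<close>
  define e where "e = min 1 (d / (2 * B))"
  have e: "0 < e" "e \<le> 1" "e * B \<le> d / 2"
  proof -
    show "0 < e" "e \<le> 1" using d B by (auto simp: e_def)
    have "e * B \<le> d / (2 * B) * B" using B by (intro mult_right_mono) (auto simp: e_def)
    then show "e * B \<le> d / 2" using B by simp
  qed
  let ?P = "mixture n R e"
  have adm: "admissible n R ?P" by (rule admissible_mixture[OF n R])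
  have iQ: "integrable ?Q (\<lambda>x. Xi n R s1 s2 (vnorm n x))"
    by (rule secrecy_rate_eq(2)[OF n R s admissible_unif_sphere[OF n R]])
  have mX: "(\<lambda>x. Xi n R s1 s2 (vnorm n x)) \<in> borel_measurable (Rn n)"
    by (rule measurable_compose[OF measurable_vnorm Xi_measurable[OF n s(1) s20]])
  have "(\<integral>x. Xi n R s1 s2 (vnorm n x) \<partial>?Q) = Xi n R s1 s2 R"
    using secrecy_rate_eq(1)[OF n R s admissible_unif_sphere[OF n R]] secrecy_rate_unif_sphere[OF n R s]
      KLq_unif_sphere[OF n R s(1)] KLq_unif_sphere[OF n R s20] by simp
  then have "(\<integral>x. Xi n R s1 s2 (vnorm n x) \<partial>?P) = Xi n R s1 s2 R + e * d"
    using integral_mixture[OF n less_imp_le[OF e(1)] e(2) mX iQ] by (simp add: vnorm_ve1[OF n] d_def algebra_simps)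
  moreover have "KLq n R s1 ?P \<le> e\<^sup>2 * B"
    unfolding B_def by (rule KLq_mixture_le[OF n R s(1) less_imp_le[OF e(1)] e(2)])
  moreover have "0 \<le> KLq n R s2 ?P"
    using n R s20 adm by (intro KLq_nonneg channel_input.intro)
  moreover have "secrecy_rate n ?P s1 s2 \<le> Xi n R s1 s2 R"
    using secrecy_rate_le_Cs[OF n R s adm] Cs by simp
  ultimately have "e * d \<le> e\<^sup>2 * B" using secrecy_rate_eq(1)[OF n R s adm] by simp
  then have "d \<le> e * B" using e(1) by (simp add: power2_eq_square)
  with e(3) d show False by simp
qed

lemma attains_Cs_iff:
  assumes A: assumption_A and n: "1 \<le> n" and R: "0 \<le> R" and s: "0 < s1" "s1 < s2"
  shows "attains_Cs s1 s2 R n \<longleftrightarrow> Xi n R s1 s2 0 \<le> Xi n R s1 s2 R"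
proof
  assume X: "Xi n R s1 s2 0 \<le> Xi n R s1 s2 R"
  have "Cs s1 s2 R n = Xi n R s1 s2 R"
    by (rule Cs_eq_Xi[OF n R s Xi_le_endpoint[OF A n R s X]])
  then show "attains_Cs s1 s2 R n" by (simp add: attains_Cs_def secrecy_rate_unif_sphere[OF n R s])
qed (rule attains_Cs_imp_Xi[OF n R s])

subsection \<open>Integral representations\<close>

text \<open>At \<open>r = R\<close> this is the expectation in the capacity formula, see
  \<open>mm_eq_std_gauss\<close>; at \<open>r = 0\<close> it is its counterpart for the input at the
  origin.\<close>

definition mm :: "nat \<Rightarrow> real \<Rightarrow> real \<Rightarrow> real \<Rightarrow> real" where
  "mm n R r s = (\<integral>p. (H n (R * p))\<^sup>2 \<partial>kap n s r)"

lemma H_power2_le_1: "n \<ge> 1 \<Longrightarrow> t \<ge> 0 \<Longrightarrow> (H n t)\<^sup>2 \<le> 1"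
  using H_abs_le_1[of n t] by (simp add: abs_square_le_1)

lemma integrable_H_power2:
  assumes n: "1 \<le> n" and s: "s > 0" and R: "0 \<le> R" and r: "0 \<le> r"
  shows "integrable (kap n s r) (\<lambda>p. (H n (R * p))\<^sup>2)"
  by (rule integrable_kap_bounded[OF n s r, where B = 1]) (measurable, use R H_power2_le_1[OF n] in simp)

lemma integral_inverse_square:
  fixes c s1 s2 :: real
  assumes s: "0 < s1" "s1 \<le> s2"
  shows "(LINT s:{s1..s2}|lborel. c * (1 / s\<^sup>2)) = c * (1 / s1 - 1 / s2)"
    and "set_integrable lborel {s1..s2} (\<lambda>s. c * (1 / s\<^sup>2))"
proof -
  show "set_integrable lborel {s1..s2} (\<lambda>s. c * (1 / s\<^sup>2))"
    by (rule borel_integrable_atLeastAtMost') (use s in \<open>auto intro!: continuous_intros\<close>)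
  have "(\<integral>x. c * (1 / x\<^sup>2) * indicator {s1..s2} x \<partial>lborel) = - c / s2 - - c / s1"
    by (rule integral_FTC_Icc_real[OF s(2)]) (use s in \<open>auto intro!: derivative_eq_intros simp: power2_eq_square\<close>)
  moreover have "(LINT s:{s1..s2}|lborel. c * (1 / s\<^sup>2)) = (\<integral>x. c * (1 / x\<^sup>2) * indicator {s1..s2} x \<partial>lborel)"
    unfolding set_lebesgue_integral_def by (intro Bochner_Integration.integral_cong refl) simp
  ultimately show "(LINT s:{s1..s2}|lborel. c * (1 / s\<^sup>2)) = c * (1 / s1 - 1 / s2)"
    by (simp add: right_diff_distrib)
qed

text \<open>Combine \<open>T_diff_s\<close> with the elementary part of \<open>Xi\<close>, written
  as an integral of a multiple of \<open>1 / s^2\<close>. At \<open>r = R\<close> the cross term of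
  \<open>T_diff_s\<close> is \<open>R^2 * H^2\<close> and reverses the sign of the square; at
  \<open>r = 0\<close> it vanishes. Hence \<open>1 - mm\<close> in one integrand and
  \<open>mm\<close> in the other.\<close>

lemma Xi_integral:
  assumes n: "1 \<le> n" and R: "0 \<le> R" and s: "0 < s1" "s1 < s2"
  shows "Xi n R s1 s2 R = (LINT s:{s1..s2}|lborel. R\<^sup>2 / 2 * ((1 - mm n R R s) / s\<^sup>2))"
    and "set_integrable lborel {s1..s2} (\<lambda>s. R\<^sup>2 / 2 * ((1 - mm n R R s) / s\<^sup>2))"
    and "Xi n R s1 s2 0 = (LINT s:{s1..s2}|lborel. R\<^sup>2 / 2 * (mm n R 0 s / s\<^sup>2))"
    and "set_integrable lborel {s1..s2} (\<lambda>s. R\<^sup>2 / 2 * (mm n R 0 s / s\<^sup>2))"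
proof -
  have s12: "s1 \<le> s2" using s by simp
  let ?V = "\<lambda>r s. - 1 / s\<^sup>2 * (\<integral>p. R\<^sup>2 / 2 - R\<^sup>2 / 2 * (H n (R * p))\<^sup>2 + r * R * (H n (r * p) * H n (R * p)) \<partial>kap n s r)"
  note T = T_diff_s[OF n R _ s(1) s12]
  have V1: "R\<^sup>2 * (1 / s\<^sup>2) + ?V R s = R\<^sup>2 / 2 * ((1 - mm n R R s) / s\<^sup>2)" if "s \<in> {s1..s2}" for s
  proof -
    have sp: "s > 0" using that s by simp
    have "(\<lambda>p. R\<^sup>2 / 2 - R\<^sup>2 / 2 * (H n (R * p))\<^sup>2 + R * R * (H n (R * p) * H n (R * p))) = (\<lambda>p. R\<^sup>2 / 2 + R\<^sup>2 / 2 * (H n (R * p))\<^sup>2)"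
      by (simp add: power2_eq_square fun_eq_iff)
    moreover have "(\<integral>p. R\<^sup>2 / 2 + R\<^sup>2 / 2 * (H n (R * p))\<^sup>2 \<partial>kap n s R) = R\<^sup>2 / 2 + R\<^sup>2 / 2 * mm n R R s"
    proof -
      interpret k: prob_space "kap n s R" by (rule prob_space_kap[OF n sp R])
      show ?thesis using integrable_H_power2[OF n sp R R] k.prob_space by (simp add: mm_def)
    qed
    ultimately have "?V R s = - 1 / s\<^sup>2 * (R\<^sup>2 / 2 + R\<^sup>2 / 2 * mm n R R s)" by (simp only:)
    moreover have "c * (1 / v) + - 1 / v * (c / 2 + c / 2 * m) = c / 2 * ((1 - m) / v)" for c v m :: real
    proof -
      have "c * i + - i * (c / 2 + c / 2 * m) = c / 2 * ((1 - m) * i)" for i by (simp add: algebra_simps)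
      from this[of "inverse v"] show ?thesis by (simp only: divide_inverse mult_1_left mult_minus1)
    qed
    ultimately show ?thesis by (simp only:)
  qed
  have V0: "R\<^sup>2 / 2 * (1 / s\<^sup>2) + ?V 0 s = R\<^sup>2 / 2 * (mm n R 0 s / s\<^sup>2)" if "s \<in> {s1..s2}" for s
  proof -
    have sp: "s > 0" using that s by simp
    have "(\<integral>p. R\<^sup>2 / 2 - R\<^sup>2 / 2 * (H n (R * p))\<^sup>2 \<partial>kap n s 0) = R\<^sup>2 / 2 - R\<^sup>2 / 2 * mm n R 0 s"
    proof -
      interpret k: prob_space "kap n s 0" by (rule prob_space_kap[OF n sp order_refl])
      show ?thesis using integrable_H_power2[OF n sp R order_refl] k.prob_space by (simp add: mm_def)
    qed
    then have "?V 0 s = - 1 / s\<^sup>2 * (R\<^sup>2 / 2 - R\<^sup>2 / 2 * mm n R 0 s)" by simp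
    moreover have "c / 2 * (1 / v) + - 1 / v * (c / 2 - c / 2 * m) = c / 2 * (m / v)" for c v m :: real
    proof -
      have "c / 2 * i + - i * (c / 2 - c / 2 * m) = c / 2 * (m * i)" for i by (simp add: algebra_simps)
      from this[of "inverse v"] show ?thesis by (simp only: divide_inverse mult_1_left mult_minus1)
    qed
    ultimately show ?thesis by (simp only:)
  qed
  have i1: "set_integrable lborel {s1..s2} (\<lambda>s. R\<^sup>2 * (1 / s\<^sup>2) + ?V R s)"
    by (intro set_integral_add(1) integral_inverse_square(2)[OF s(1) s12] T(2)[OF R])
  have i0: "set_integrable lborel {s1..s2} (\<lambda>s. R\<^sup>2 / 2 * (1 / s\<^sup>2) + ?V 0 s)"
    by (intro set_integral_add(1) integral_inverse_square(2)[OF s(1) s12] T(2)[OF order_refl])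
  show "set_integrable lborel {s1..s2} (\<lambda>s. R\<^sup>2 / 2 * ((1 - mm n R R s) / s\<^sup>2))"
    by (rule set_integrable_cong[THEN iffD1, OF refl refl V1 i1])
  show "set_integrable lborel {s1..s2} (\<lambda>s. R\<^sup>2 / 2 * (mm n R 0 s / s\<^sup>2))"
    by (rule set_integrable_cong[THEN iffD1, OF refl refl V0 i0])
  have "Xi n R s1 s2 R = R\<^sup>2 * (1 / s1 - 1 / s2) + (T n R R s2 - T n R R s1)"
    by (simp add: Xi_def)
  also have "\<dots> = (LINT s:{s1..s2}|lborel. R\<^sup>2 * (1 / s\<^sup>2) + ?V R s)"
    unfolding T(1)[OF R] integral_inverse_square(1)[OF s(1) s12, symmetric]
    by (rule set_integral_add(2)[symmetric, OF integral_inverse_square(2)[OF s(1) s12] T(2)[OF R]])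
  also have "\<dots> = (LINT s:{s1..s2}|lborel. R\<^sup>2 / 2 * ((1 - mm n R R s) / s\<^sup>2))"
    by (rule set_lebesgue_integral_cong) (simp, intro allI impI V1, assumption)
  finally show "Xi n R s1 s2 R = (LINT s:{s1..s2}|lborel. R\<^sup>2 / 2 * ((1 - mm n R R s) / s\<^sup>2))" .
  have "Xi n R s1 s2 0 = R\<^sup>2 / 2 * (1 / s1 - 1 / s2) + (T n R 0 s2 - T n R 0 s1)"
    by (simp add: Xi_def)
  also have "\<dots> = (LINT s:{s1..s2}|lborel. R\<^sup>2 / 2 * (1 / s\<^sup>2) + ?V 0 s)"
    unfolding T(1)[OF order_refl] integral_inverse_square(1)[OF s(1) s12, symmetric]
    by (rule set_integral_add(2)[symmetric, OF integral_inverse_square(2)[OF s(1) s12] T(2)[OF order_refl]])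
  also have "\<dots> = (LINT s:{s1..s2}|lborel. R\<^sup>2 / 2 * (mm n R 0 s / s\<^sup>2))"
    by (rule set_lebesgue_integral_cong) (simp, intro allI impI V0, assumption)
  finally show "Xi n R s1 s2 0 = (LINT s:{s1..s2}|lborel. R\<^sup>2 / 2 * (mm n R 0 s / s\<^sup>2))" .
qed

section \<open>Downward closure and closedness of the optimality condition\<close>

lemma mm_mono:
  assumes n: "1 \<le> n" and s: "s > 0" and R: "0 \<le> R" "R \<le> R'" and r: "0 \<le> r" "r \<le> r'"
  shows "mm n R r s \<le> mm n R' r' s"
proof -
  have R': "0 \<le> R'" using R by simp
  \<comment> \<open>First \<open>R\<close> grows under a fixed law, where \<open>H n\<close> is
    monotone; then \<open>r\<close> grows, and the law increases stochastically.\<close>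
  have "mm n R r s \<le> mm n R' r s"
    unfolding mm_def
  proof (rule integral_mono_AE[OF integrable_H_power2[OF n s R(1) r(1)] integrable_H_power2[OF n s R' r(1)]])
    show "AE p in kap n s r. (H n (R * p))\<^sup>2 \<le> (H n (R' * p))\<^sup>2"
      using AE_kap_pos[of n s r]
      by eventually_elim (use R in \<open>intro power_mono H_mono[OF n] mult_right_mono H_nonneg[OF n]; simp\<close>)
  qed
  also have "\<dots> \<le> mm n R' r' s"
    unfolding mm_def
  proof (rule kap_stochastic_mono[OF n s r, where B = 1])
    show "(H n (R' * p))\<^sup>2 \<le> 1" if "p > 0" for p using H_power2_le_1[OF n] R' that by simp
    show "(H n (R' * p))\<^sup>2 \<le> (H n (R' * q))\<^sup>2" if "0 < p" "p \<le> q" for p q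
      using R' that by (intro power_mono H_mono[OF n] mult_left_mono H_nonneg[OF n]) auto
  qed simp_all
  finally show ?thesis .
qed

text \<open>Divided by \<open>R^2\<close>, the difference of \<open>Xi\<close> at \<open>R\<close>
  and at 0 is the integral of \<open>(1 - mm n R R s - mm n R 0 s) / (2 * s^2)\<close>, which
  decreases in \<open>R\<close> by \<open>mm_mono\<close>. A nonnegative value at \<open>R'\<close>
  therefore remains nonnegative at the smaller \<open>R\<close>.\<close>

lemma Xi_condition_antimono:
  assumes n: "1 \<le> n" and s: "0 < s1" "s1 < s2" and R: "0 < R" "R \<le> R'"
    and X: "Xi n R' s1 s2 0 \<le> Xi n R' s1 s2 R'"
  shows "Xi n R s1 s2 0 \<le> Xi n R s1 s2 R"
proof -
  have R0: "0 \<le> R" "0 \<le> R'" using R by auto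
  have D: "Xi n \<rho> s1 s2 \<rho> - Xi n \<rho> s1 s2 0 = (LINT s:{s1..s2}|lborel. \<rho>\<^sup>2 / 2 * ((1 - mm n \<rho> \<rho> s) / s\<^sup>2) - \<rho>\<^sup>2 / 2 * (mm n \<rho> 0 s / s\<^sup>2))"
    and i: "set_integrable lborel {s1..s2} (\<lambda>s. \<rho>\<^sup>2 / 2 * ((1 - mm n \<rho> \<rho> s) / s\<^sup>2) - \<rho>\<^sup>2 / 2 * (mm n \<rho> 0 s / s\<^sup>2))"
    if "0 \<le> \<rho>" for \<rho>
    using Xi_integral[OF n that s] by (simp_all add: set_integral_diff)
  \<comment> \<open>Replaces the prefactor \<open>R'^2\<close> of the difference at
    \<open>R'\<close> by \<open>R^2\<close>, so that the integrands can be compared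
    pointwise.\<close>
  define c where "c = R\<^sup>2 / R'\<^sup>2"
  have c: "c \<ge> 0" by (simp add: c_def)
  have cR: "c * R'\<^sup>2 = R\<^sup>2" using R by (simp add: c_def)
  have "0 \<le> c * (Xi n R' s1 s2 R' - Xi n R' s1 s2 0)" using c X by simp
  also have "\<dots> = (LINT s:{s1..s2}|lborel. c * (R'\<^sup>2 / 2 * ((1 - mm n R' R' s) / s\<^sup>2) - R'\<^sup>2 / 2 * (mm n R' 0 s / s\<^sup>2)))"
    unfolding D[OF R0(2)] by (rule set_integral_mult_right[symmetric])
  also have "\<dots> \<le> (LINT s:{s1..s2}|lborel. R\<^sup>2 / 2 * ((1 - mm n R R s) / s\<^sup>2) - R\<^sup>2 / 2 * (mm n R 0 s / s\<^sup>2))"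
  proof (rule set_integral_mono[OF _ i[OF R0(1)]])
    show "set_integrable lborel {s1..s2} (\<lambda>s. c * (R'\<^sup>2 / 2 * ((1 - mm n R' R' s) / s\<^sup>2) - R'\<^sup>2 / 2 * (mm n R' 0 s / s\<^sup>2)))"
      by (rule set_integrable_mult_right) (rule i[OF R0(2)])
    fix u assume "u \<in> {s1..s2}"
    then have u: "u > 0" using s by simp
    have "mm n R R u \<le> mm n R' R' u" "mm n R 0 u \<le> mm n R' 0 u"
      using R R0 by (intro mm_mono n u; simp)+
    then have "R\<^sup>2 / 2 * ((1 - mm n R' R' u - mm n R' 0 u) / u\<^sup>2) \<le> R\<^sup>2 / 2 * ((1 - mm n R R u - mm n R 0 u) / u\<^sup>2)"
      by (intro mult_left_mono divide_right_mono) auto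
    moreover have "c * (R'\<^sup>2 / 2 * ((1 - a) / v) - R'\<^sup>2 / 2 * (b / v)) = R\<^sup>2 / 2 * ((1 - a - b) / v)" for a b v
      unfolding cR[symmetric] by (simp add: diff_divide_distrib add_divide_distrib algebra_simps)
    moreover have "R\<^sup>2 / 2 * ((1 - a) / v) - R\<^sup>2 / 2 * (b / v) = R\<^sup>2 / 2 * ((1 - a - b) / v)" for a b v :: real
      by (simp add: diff_divide_distrib right_diff_distrib)
    ultimately show "c * (R'\<^sup>2 / 2 * ((1 - mm n R' R' u) / u\<^sup>2) - R'\<^sup>2 / 2 * (mm n R' 0 u / u\<^sup>2))
      \<le> R\<^sup>2 / 2 * ((1 - mm n R R u) / u\<^sup>2) - R\<^sup>2 / 2 * (mm n R 0 u / u\<^sup>2)"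
      by (simp only:)
  qed
  also have "\<dots> = Xi n R s1 s2 R - Xi n R s1 s2 0" by (rule D[OF R0(1), symmetric])
  finally show ?thesis by simp
qed

text \<open>Convergent sequences are bounded, so \<open>K_dom\<close> supplies one integrable
  majorant for the whole sequence. Both parameters move at once, as the condition compares
  \<open>Xi\<close> at the radius \<open>R\<close> itself.\<close>

lemma T_continuous:
  assumes n: "1 \<le> n" and s: "s > 0" and X: "X \<longlonglongrightarrow> a" "\<And>k. 0 \<le> X k" and Y: "Y \<longlonglongrightarrow> b" "\<And>k. 0 \<le> Y k"
  shows "(\<lambda>k. T n (X k) (Y k) s) \<longlonglongrightarrow> T n a b s"
proof -
  obtain \<rho> where \<rho>: "\<rho> > 0" "\<And>k. \<bar>X k\<bar> \<le> \<rho>"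
    using convergent_imp_Bseq[OF convergentI[OF X(1)]] by (auto simp: Bseq_def)
  obtain \<sigma> where \<sigma>: "\<sigma> > 0" "\<And>k. \<bar>Y k\<bar> \<le> \<sigma>"
    using convergent_imp_Bseq[OF convergentI[OF Y(1)]] by (auto simp: Bseq_def)
  obtain C where C: "C \<ge> 0"
    "\<And>s' r' p. s \<le> s' \<Longrightarrow> s' \<le> s \<Longrightarrow> 0 \<le> r' \<Longrightarrow> r' \<le> \<sigma> \<Longrightarrow> 0 \<le> p \<Longrightarrow> \<bar>K n s' r' p\<bar> * (1 + p) ^ 1 \<le> C * exp (- p)"
    by (rule K_dom[OF n s less_imp_le[OF \<sigma>(1)], where b = s and m = 1]) (rule that)
  have "(\<lambda>k. \<integral>p. indicator {0<..} p *\<^sub>R (K n s (Y k) p * ln (Phi n (X k * p))) \<partial>lborel)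
     \<longlonglongrightarrow> (\<integral>p. indicator {0<..} p *\<^sub>R (K n s b p * ln (Phi n (a * p))) \<partial>lborel)"
  proof (rule integral_dominated_convergence[where w = "\<lambda>p. indicator {0<..} p *\<^sub>R (\<rho> * C * exp (- p))"])
    show "integrable lborel (\<lambda>p. indicator {0<..} p *\<^sub>R (\<rho> * C * exp (- p)))"
      using set_integrable_exp_minus[of "\<rho> * C"] by (simp only: set_integrable_def)
    show "AE p in lborel. (\<lambda>k. indicator {0<..} p *\<^sub>R (K n s (Y k) p * ln (Phi n (X k * p)))) \<longlonglongrightarrow> indicator {0<..} p *\<^sub>R (K n s b p * ln (Phi n (a * p)))"
    proof (intro AE_I2 tendsto_scaleR tendsto_const tendsto_mult)
      fix p
      have "isCont (\<lambda>r. K n s r p) b" using K_has_deriv_r[OF n s] by (rule DERIV_isCont)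
      then show "(\<lambda>k. K n s (Y k) p) \<longlonglongrightarrow> K n s b p" using Y(1) by (rule isCont_tendsto_compose)
      have "isCont (\<lambda>t. ln (Phi n t)) (a * p)" using ln_Phi_has_deriv[OF n] by (rule DERIV_isCont)
      then show "(\<lambda>k. ln (Phi n (X k * p))) \<longlonglongrightarrow> ln (Phi n (a * p))"
        by (rule isCont_tendsto_compose) (intro tendsto_mult X(1) tendsto_const)
    qed
    show "AE p in lborel. norm (indicator {0<..} p *\<^sub>R (K n s (Y k) p * ln (Phi n (X k * p)))) \<le> indicator {0<..} p *\<^sub>R (\<rho> * C * exp (- p))" for k
    proof (intro AE_I2)
      fix p :: real
      show "norm (indicator {0<..} p *\<^sub>R (K n s (Y k) p * ln (Phi n (X k * p)))) \<le> indicator {0<..} p *\<^sub>R (\<rho> * C * exp (- p))"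
      proof (cases "p > 0")
        case True
        have Xk: "X k \<le> \<rho>" and Yk: "Y k \<le> \<sigma>" using \<rho>(2)[of k] \<sigma>(2)[of k] by auto
        have "\<bar>K n s (Y k) p * ln (Phi n (X k * p))\<bar> \<le> \<rho> * C * exp (- p)"
        proof (rule K_mult_dom[OF C(2)])
          have "ln (Phi n (X k * p)) \<le> X k * p" using X(2)[of k] True by (intro ln_Phi_le n) simp
          also have "\<dots> \<le> \<rho> * (1 + p) ^ 1" using Xk True \<rho>(1) by (intro mult_mono) auto
          finally show "\<bar>ln (Phi n (X k * p))\<bar> \<le> \<rho> * (1 + p) ^ 1" using ln_Phi_nonneg[OF n, of "X k * p"] by simp
        qed (use True Y(2)[of k] Yk \<rho> in auto)
        then show ?thesis using True by simp
      qed simp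
    qed
  qed measurable
  then show ?thesis unfolding T_eq[OF n s] set_lebesgue_integral_def .
qed

lemma closed_Xi_condition:
  assumes n: "1 \<le> n" and s: "0 < s1" "s1 < s2"
  shows "closed {R. 0 \<le> R \<and> Xi n R s1 s2 0 \<le> Xi n R s1 s2 R}"
  unfolding closed_sequential_limits
proof (intro allI impI)
  fix X :: "nat \<Rightarrow> real" and a
  assume "(\<forall>k. X k \<in> {R. 0 \<le> R \<and> Xi n R s1 s2 0 \<le> Xi n R s1 s2 R}) \<and> X \<longlonglongrightarrow> a"
  then have X: "\<And>k. 0 \<le> X k" "\<And>k. Xi n (X k) s1 s2 0 \<le> Xi n (X k) s1 s2 (X k)" "X \<longlonglongrightarrow> a" by auto
  have s20: "s2 > 0" using s by simp
  have a: "0 \<le> a" using X(3) by (rule LIMSEQ_le_const) (use X(1) in auto)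
  have z: "(\<lambda>k. 0 :: real) \<longlonglongrightarrow> 0" by simp
  have 1: "(\<lambda>k. Xi n (X k) s1 s2 (X k)) \<longlonglongrightarrow> Xi n a s1 s2 a"
    unfolding Xi_def by (intro tendsto_intros T_continuous n s(1) s20 X) simp
  have 0: "(\<lambda>k. Xi n (X k) s1 s2 0) \<longlonglongrightarrow> Xi n a s1 s2 0"
    unfolding Xi_def by (intro tendsto_intros T_continuous n s(1) s20 X z) simp_all
  have "Xi n a s1 s2 0 \<le> Xi n a s1 s2 a"
    by (rule LIMSEQ_le[OF 0 1]) (use X(2) in auto)
  with a show "a \<in> {R. 0 \<le> R \<and> Xi n R s1 s2 0 \<le> Xi n R s1 s2 R}" by simp
qed

text \<open>By contradiction: downward closure makes a violating radius \<open>R\<close> an upper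
  bound of \<open>?S\<close>. Being closed, nonempty and bounded, \<open>?S\<close> then has a
  greatest element, which is \<open>Rbar\<close>, and \<open>R <= Rbar\<close> puts \<open>R\<close>
  into \<open>?S\<close> after all.\<close>

lemma le_Rbar_imp_Xi_condition:
  assumes A: assumption_A and n: "1 \<le> n" and s: "0 < s1" "s1 < s2" and R: "0 \<le> R" "R \<le> Rbar n s1 s2"
  shows "Xi n R s1 s2 0 \<le> Xi n R s1 s2 R"
proof (rule ccontr)
  assume not: "\<not> ?thesis"
  let ?S = "{R. 0 \<le> R \<and> Xi n R s1 s2 0 \<le> Xi n R s1 s2 R}"
  have R0: "R > 0" using not R by (cases "R = 0") auto
  have S: "(0 \<le> r \<and> attains_Cs s1 s2 r n) = (r \<in> ?S)" for r
    using attains_Cs_iff[OF A n _ s, of r] by auto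
  have ub: "r \<le> R" if "r \<in> ?S" for r
    using Xi_condition_antimono[OF n s R0, of r] not that by force
  have ne: "0 \<in> ?S" by simp
  have bdd: "bdd_above ?S" using ub by (rule bdd_aboveI)
  have "Sup ?S \<in> ?S"
    by (rule closed_contains_Sup[OF _ bdd closed_Xi_condition[OF n s]]) (use ne in blast)
  moreover have "r \<le> Sup ?S" if "r \<in> ?S" for r by (rule cSup_upper[OF that bdd])
  ultimately have G: "(GREATEST R. 0 \<le> R \<and> attains_Cs s1 s2 R n) = Sup ?S"
    unfolding S by (intro Greatest_equality)
  have "{R. 0 \<le> R \<and> attains_Cs s1 s2 R n} \<noteq> {}" using ne S[of 0] by blast
  then have "Rbar n s1 s2 = Sup ?S" by (simp only: Rbar_def G if_False)
  then have "R \<le> Sup ?S" using R by simp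
  moreover have "Sup ?S \<le> R" using ub ne by (intro cSup_least) auto
  ultimately have "R \<in> ?S" using \<open>Sup ?S \<in> ?S\<close> by simp
  with not show False by simp
qed

section \<open>The capacity formula\<close>

lemma mm_eq_std_gauss:
  assumes n: "1 \<le> n" and s: "s > 0" and R: "0 \<le> R"
  shows "(\<integral>z. (hfun (real n / 2) (vnorm n (vadd n (ve1 n R) (vscale n (sqrt s) z)) * R / s))\<^sup>2 \<partial>std_gauss n) = mm n R R s"
proof -
  have m: "(\<lambda>z. vadd n (ve1 n R) (vscale n (sqrt s) z)) \<in> measurable (std_gauss n) (Rn n)"
    by (rule measurable_compose[OF measurable_vscale_std_gauss measurable_vadd1[OF ve1_in_space]])
  have mg: "(\<lambda>y. (H n (R * (vnorm n y / s)))\<^sup>2) \<in> borel_measurable (Rn n)" by measurable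
  have "(\<integral>z. (hfun (real n / 2) (vnorm n (vadd n (ve1 n R) (vscale n (sqrt s) z)) * R / s))\<^sup>2 \<partial>std_gauss n)
     = (\<integral>z. (H n (R * (vnorm n (vadd n (ve1 n R) (vscale n (sqrt s) z)) / s)))\<^sup>2 \<partial>std_gauss n)"
    by (intro Bochner_Integration.integral_cong refl) (use R s in \<open>simp add: hfun_eq_H[OF n] mult.commute\<close>)
  also have "\<dots> = (\<integral>y. (H n (R * (vnorm n y / s)))\<^sup>2 \<partial>density (Rn n) (\<lambda>y. ennreal (gd n s (ve1 n R) y)))"
    unfolding distr_std_gauss[OF s ve1_in_space, symmetric] by (rule integral_distr[OF m mg, symmetric])
  also have "\<dots> = mm n R (vnorm n (ve1 n R)) s"
    unfolding mm_def by (rule integral_gd_radial(1)[OF n s ve1_in_space]) measurable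
  finally show ?thesis using R by (simp add: vnorm_ve1[OF n])
qed

theorem theorem5:
  fixes n :: nat and s1 s2 R :: real
  assumes "1 \<le> n"
    and "0 < s1" and "s1 < s2"
    and assumption_A
    and "0 \<le> R" and "R \<le> Rbar n s1 s2"
  shows "Cs s1 s2 R n =
    1/2 * (LBINT s=s1..s2.
      (R\<^sup>2 - R\<^sup>2 * (\<integral>z. (hfun (real n / 2)
            (vnorm n (vadd n (ve1 n R) (vscale n (sqrt s) z)) * R / s))\<^sup>2 \<partial>std_gauss n)) / s\<^sup>2)"
proof -
  note n = assms(1) and s = assms(2,3) and R = assms(5)
  let ?m = "\<lambda>s. \<integral>z. (hfun (real n / 2) (vnorm n (vadd n (ve1 n R) (vscale n (sqrt s) z)) * R / s))\<^sup>2 \<partial>std_gauss n"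
  have "Xi n R s1 s2 0 \<le> Xi n R s1 s2 R"
    by (rule le_Rbar_imp_Xi_condition[OF assms(4) n s R assms(6)])
  from Cs_eq_Xi[OF n R s Xi_le_endpoint[OF assms(4) n R s this]]
  have "Cs s1 s2 R n = Xi n R s1 s2 R" by blast
  also have "\<dots> = (LINT s:{s1..s2}|lborel. R\<^sup>2 / 2 * ((1 - mm n R R s) / s\<^sup>2))"
    by (rule Xi_integral(1)[OF n R s])
  also have "\<dots> = (LINT s:{s1..s2}|lborel. 1 / 2 * ((R\<^sup>2 - R\<^sup>2 * ?m s) / s\<^sup>2))"
  proof (rule set_lebesgue_integral_cong)
    have "R\<^sup>2 / 2 * ((1 - mm n R R u) / u\<^sup>2) = 1 / 2 * ((R\<^sup>2 - R\<^sup>2 * ?m u) / u\<^sup>2)" if "u \<in> {s1..s2}" for u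
    proof -
      have "u > 0" using that s by simp
      from mm_eq_std_gauss[OF n this R] have "?m u = mm n R R u" .
      moreover have "R\<^sup>2 / 2 * ((1 - v) / w) = 1 / 2 * ((R\<^sup>2 - R\<^sup>2 * v) / w)" for v w :: real
        by (simp add: right_diff_distrib diff_divide_distrib)
      ultimately show ?thesis by (simp only:)
    qed
    then show "\<forall>u. u \<in> {s1..s2} \<longrightarrow> R\<^sup>2 / 2 * ((1 - mm n R R u) / u\<^sup>2) = 1 / 2 * ((R\<^sup>2 - R\<^sup>2 * ?m u) / u\<^sup>2)"
      by blast
  qed simp
  also have "\<dots> = 1 / 2 * (LINT s:{s1..s2}|lborel. (R\<^sup>2 - R\<^sup>2 * ?m s) / s\<^sup>2)"
    by (rule set_integral_mult_right)
  also have "(LINT s:{s1..s2}|lborel. (R\<^sup>2 - R\<^sup>2 * ?m s) / s\<^sup>2) = (LBINT s=s1..s2. (R\<^sup>2 - R\<^sup>2 * ?m s) / s\<^sup>2)"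
    by (rule interval_integral_Icc[symmetric]) (use s in simp)
  finally show ?thesis .
qed

end
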